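(* Let $X\subseteq\mathbb{P}(V)$ be an embedded projective variety with a Seshadri stratification indexed by $A$, $R=\mathbb{K}[\hat X]$, and let $\mathfrak{C}:p_{\max}=p_r>\dots>p_0$ be a maximal chain in $A$. The map $\mathcal{V}_{\mathfrak{C}}$, extended from $R\setminus\{0\}$ to $\mathbb{K}(\hat X)\setminus\{0\}$ by $\mathcal{V}_{\mathfrak{C}}(f/g)=\mathcal{V}_{\mathfrak{C}}(f)-\mathcal{V}_{\mathfrak{C}}(g)$ for $f,g\in R\setminus\{0\}$, is an $L^{\mathfrak{C}}$-valued valuation on $\mathbb{K}(\hat X)$.
   Context: Let $\mathbb{K}$ be an algebraically closed field; varieties are irreducible; $V$ is a finite-dimensional $\mathbb{K}$-vector space. For a closed subvariety $Y\subseteq\mathbb{P}(V)$, $\hat Y\subseteq V$ is its affine cone, $\mathbb{K}[\hat Y]$ its homogeneous coordinate ring. For homogeneous $f\in\mathrm{Sym}(V^* )$, $\mathcal{H}_f=\{[v]\in\mathbb{P}(V)\mid f(v)=0\}$. Smooth in codimension one means that the singular locus has codimension at least $2$. In a poset $p$ covers $q$ if $q<p$ and there is no $s$ with $q<s<p$. Seshadri stratification of $X\subseteq\mathbb{P}(V)$: projective subvarieties $X_p\subseteq X$ indexed by a finite set $A$, partially ordered by $p\le q\Leftrightarrow X_p\subseteq X_q$, with a unique maximal element $p_{\max}$, $X_{p_{\max}}=X$, and for each $p\in A$ a homogeneous function $f_p$ on $V$ of degree $\ge1$, such that (S1) all $X_p$ are smooth in codimension one and $X_q$ has codimension one in $X_p$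 whenever $p$ covers $q$; (S2) $f_q$ vanishes on $X_p$ whenever $q\not\le p$; (S3) set-theoretically $\mathcal{H}_{f_p}\cap X_p=\bigcup_{q\text{ covered by }p}X_q$. Then $f_p$ does not vanish identically on $X_p$, and all maximal chains in $A$ have length $r=\dim X$. Put $\hat A=A\cup\{p_{-1}\}$ with $p_{-1}$ a new minimum and $\hat X_{p_{-1}}=\{0\}\subseteq V$. If $p$ covers $q$ in $\hat A$, then $\hat X_q$ is a prime divisor in $\hat X_p$ with discrete valuation $\nu_{p,q}:\mathbb{K}(\hat X_p)\setminus\{0\}\to\mathbb{Z}$; the bond is $b_{p,q}=\nu_{p,q}(f_p)\ge 1$. Let $N$ be the least common multiple of all bonds $b_{p,q}$, $p$ covering $q$ in $A$. Write $\nu_j=\nu_{p_j,p_{j-1}}$, $b_j=b_{p_j,p_{j-1}}$, $f_j=f_{p_j}$ for $0\le j\le r$. For $g\in R\setminus\{0\}$ define $g_r=g$ and, for $j=r,\dots,1$, $g_{j-1}=\big(g_j^N f_j^{-N\nu_j(g_j)/b_j}\big)\big|_{\hat X_{p_{j-1}}}$ (a well-defined nonzero rational function on $\hat X_{p_{j-1}}$), and $$\mathcal{V}_{\mathfrak{C}}(g)=\sum_{j=0}^r\frac{\nu_j(g_j)}{N^{r-j}b_j}e_{p_j}\in\mathbb{Q}^{\mathfrak{C}}.$$ $\mathbb{Q}^{\mathfrak{C}}$ (basis $e_{p_r},\dots,e_{p_0}$, vectors written $(a_r,\dots,a_0)$) carries the lexicographic order: $(a_r,\dots,a_0)\ge(c_r,\dots,c_0)$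 iff $a_r>c_r$, or $a_r=c_r$ and $a_{r-1}>c_{r-1}$, etc. (or equality). The lattice is $L^{\mathfrak{C}}=\{(\ell_r,\dots,\ell_0)\in\mathbb{Q}^{\mathfrak{C}}\mid b_rb_{r-1}\cdots b_j\ell_j\in\mathbb{Z},\ 0\le j\le r\}$. A valuation on a $\mathbb{K}$-algebra $\mathcal{R}$ with values in a totally ordered abelian group $G$ is a map $\nu:\mathcal{R}\setminus\{0\}\to G$ with $\nu(x+y)\ge\min\{\nu(x),\nu(y)\}$ if $x,y,x+y\neq0$; $\nu(\lambda x)=\nu(x)$ for $\lambda\in\mathbb{K}^*$, $x\ne0$; $\nu(xy)=\nu(x)+\nu(y)$ if $x,y,xy\ne0$. *)

theory Defs
  imports
    "HOL-Computational_Algebra.Polynomial"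
    "HOL-Library.Extended_Nat"
    "HOL-Library.FuncSet"
    "HOL-Algebra.Ring_Divisibility"
    "HOL-Algebra.Module"
begin

section \<open>Polynomial functions and projective varieties\<close>

text \<open>
  \<open>V\<close> is the whole type \<open>'v\<close>, with scalar multiplication \<open>scale\<close>.  Since the scalar field will
  be algebraically closed, hence infinite, \<open>Sym(V\<^sup>*)\<close> is identified with the algebra of polynomial
  functions on \<open>V\<close>.
\<close>

abbreviation linear_form :: "('k::field \<Rightarrow> 'v::ab_group_add \<Rightarrow> 'v) \<Rightarrow> ('v \<Rightarrow> 'k) \<Rightarrow> bool" where
  "linear_form scale \<equiv> Vector_Spaces.linear scale (*)"

inductive_set poly_fun :: "('k::field \<Rightarrow> 'v::ab_group_add \<Rightarrow> 'v) \<Rightarrow> ('v \<Rightarrow> 'k) set"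
  for scale :: "'k \<Rightarrow> 'v \<Rightarrow> 'v" where
  const: "(\<lambda>_. a) \<in> poly_fun scale"
| linear: "linear_form scale l \<Longrightarrow> l \<in> poly_fun scale"
| add: "g \<in> poly_fun scale \<Longrightarrow> h \<in> poly_fun scale \<Longrightarrow> (\<lambda>v. g v + h v) \<in> poly_fun scale"
| mult: "g \<in> poly_fun scale \<Longrightarrow> h \<in> poly_fun scale \<Longrightarrow> (\<lambda>v. g v * h v) \<in> poly_fun scale"

text \<open>\<open>homog scale d\<close> is the image of \<open>Sym\<^sup>d(V\<^sup>*)\<close>: sums of \<open>d\<close>-fold products of linear forms
  (constants for \<open>d = 0\<close>).  The zero function belongs to every degree.\<close>

inductive_set homog :: "('k::field \<Rightarrow> 'v::ab_group_add \<Rightarrow> 'v) \<Rightarrow> (nat \<times> ('v \<Rightarrow> 'k)) set"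
  for scale :: "'k \<Rightarrow> 'v \<Rightarrow> 'v" where
  const: "(0, \<lambda>_. a) \<in> homog scale"
| zero: "(d, \<lambda>_. 0) \<in> homog scale"
| add: "(d, g) \<in> homog scale \<Longrightarrow> (d, h) \<in> homog scale \<Longrightarrow> (d, \<lambda>v. g v + h v) \<in> homog scale"
| mult: "linear_form scale l \<Longrightarrow> (d, g) \<in> homog scale \<Longrightarrow> (Suc d, \<lambda>v. l v * g v) \<in> homog scale"

definition homogeneous :: "('k::field \<Rightarrow> 'v::ab_group_add \<Rightarrow> 'v) \<Rightarrow> nat \<Rightarrow> ('v \<Rightarrow> 'k) \<Rightarrow> bool" where
  "homogeneous scale d g \<longleftrightarrow> (d, g) \<in> homog scale"

text \<open>A point \<open>[v]\<close> of \<open>\<P>(V)\<close> is the line spanned by \<open>v \<noteq> 0\<close>.\<close>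

definition point :: "('k \<Rightarrow> 'v \<Rightarrow> 'v) \<Rightarrow> 'v \<Rightarrow> 'v set" where
  "point scale v = range (\<lambda>a. scale a v)"

definition proj_space :: "('k \<Rightarrow> 'v::zero \<Rightarrow> 'v) \<Rightarrow> 'v set set" where
  "proj_space scale = {point scale v | v. v \<noteq> 0}"

definition hypersurface :: "('k::zero \<Rightarrow> 'v::zero \<Rightarrow> 'v) \<Rightarrow> ('v \<Rightarrow> 'k) \<Rightarrow> 'v set set" where
  "hypersurface scale g = {point scale v | v. v \<noteq> 0 \<and> g v = 0}"

definition zariski_closed :: "('k::field \<Rightarrow> 'v::ab_group_add \<Rightarrow> 'v) \<Rightarrow> 'v set set \<Rightarrow> bool" where
  "zariski_closed scale Y \<longleftrightarrow>
     (\<exists>F. (\<forall>g\<in>F. \<exists>d. homogeneous scale d g) \<and>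
          Y = {L \<in> proj_space scale. \<forall>g\<in>F. L \<in> hypersurface scale g})"

definition proj_variety :: "('k::field \<Rightarrow> 'v::ab_group_add \<Rightarrow> 'v) \<Rightarrow> 'v set set \<Rightarrow> bool" where
  "proj_variety scale Y \<longleftrightarrow> zariski_closed scale Y \<and> Y \<noteq> {} \<and>
     (\<forall>Y1 Y2. zariski_closed scale Y1 \<longrightarrow> zariski_closed scale Y2 \<longrightarrow> Y = Y1 \<union> Y2 \<longrightarrow> Y = Y1 \<or> Y = Y2)"

definition cone :: "'v::zero set set \<Rightarrow> 'v set" where
  "cone Y = insert 0 (\<Union>Y)"

text \<open>Codimension of an irreducible closed subset, and of an arbitrary subset (the infimum over the
  irreducible closed sets it contains, \<open>\<infinity>\<close> if there are none).\<close>

definition codim_irred :: "('k::field \<Rightarrow> 'v::ab_group_add \<Rightarrow> 'v) \<Rightarrow> 'v set set \<Rightarrow> 'v set set \<Rightarrow> enat" where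
  "codim_irred scale Z Y =
     Sup {enat n | n. \<exists>C. C 0 = Z \<and> C n = Y \<and>
       (\<forall>i\<le>n. proj_variety scale (C i)) \<and> (\<forall>i<n. C i \<subset> C (Suc i))}"

definition codim :: "('k::field \<Rightarrow> 'v::ab_group_add \<Rightarrow> 'v) \<Rightarrow> 'v set set \<Rightarrow> 'v set set \<Rightarrow> enat" where
  "codim scale S Y = (INF Z\<in>{Z. proj_variety scale Z \<and> Z \<subseteq> S}. codim_irred scale Z Y)"

section \<open>Fraction fields, regular local rings, discrete valuations\<close>

text \<open>\<open>fraction R a b\<close> is the class of \<open>a / b\<close>.\<close>

definition fraction :: "('b, 'm) ring_scheme \<Rightarrow> 'b \<Rightarrow> 'b \<Rightarrow> ('b \<times> 'b) set" where
  "fraction R a b = {(c, d). c \<in> carrier R \<and> d \<in> carrier R - {\<zero>\<^bsub>R\<^esub>} \<and> a \<otimes>\<^bsub>R\<^esub> d = c \<otimes>\<^bsub>R\<^esub> b}"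

definition fraction_field :: "('k, 'b) module \<Rightarrow> ('k, ('b \<times> 'b) set) module" where
  "fraction_field R =
    \<lparr>carrier = {fraction R a b | a b. a \<in> carrier R \<and> b \<in> carrier R - {\<zero>\<^bsub>R\<^esub>}},
     mult = (\<lambda>x y. \<Union>(a, b)\<in>x. \<Union>(c, d)\<in>y. fraction R (a \<otimes>\<^bsub>R\<^esub> c) (b \<otimes>\<^bsub>R\<^esub> d)),
     one = fraction R \<one>\<^bsub>R\<^esub> \<one>\<^bsub>R\<^esub>,
     zero = fraction R \<zero>\<^bsub>R\<^esub> \<one>\<^bsub>R\<^esub>,
     add = (\<lambda>x y. \<Union>(a, b)\<in>x. \<Union>(c, d)\<in>y.
              fraction R ((a \<otimes>\<^bsub>R\<^esub> d) \<oplus>\<^bsub>R\<^esub> (c \<otimes>\<^bsub>R\<^esub> b)) (b \<otimes>\<^bsub>R\<^esub> d)),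
     module.smult = (\<lambda>t x. \<Union>(a, b)\<in>x. fraction R (t \<odot>\<^bsub>R\<^esub> a) b)\<rparr>"

definition nonunits :: "('b, 'm) ring_scheme \<Rightarrow> 'b set" where
  "nonunits L = carrier L - Units L"

definition krull_dim :: "('b, 'm) ring_scheme \<Rightarrow> enat" where
  "krull_dim L = Sup {enat n | n. \<exists>P :: nat \<Rightarrow> 'b set.
     (\<forall>i\<le>n. primeideal (P i) L) \<and> (\<forall>i<n. P i \<subset> P (Suc i))}"

text \<open>A noetherian local ring whose maximal ideal (the set of nonunits) has minimal number of
  generators equal to the Krull dimension.\<close>

definition regular_local_ring :: "('b, 'm) ring_scheme \<Rightarrow> bool" where
  "regular_local_ring L \<longleftrightarrow> cring L \<and> noetherian_ring L \<and> ideal (nonunits L) L \<and>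
     (INF S\<in>{S. S \<subseteq> nonunits L \<and> finite S \<and> Idl\<^bsub>L\<^esub> S = nonunits L}. enat (card S)) = krull_dim L"

text \<open>The valuation on the field \<open>F\<close> attached to a discrete valuation ring with carrier
  \<open>B \<subseteq> carrier F\<close>: the exponent \<open>n\<close> in \<open>h = u t\<^sup>n\<close>, \<open>t\<close> a uniformizer and \<open>u\<close> a unit of \<open>B\<close>.\<close>

definition dvr_val :: "('k, 'b) module \<Rightarrow> 'b set \<Rightarrow> 'b \<Rightarrow> int" where
  "dvr_val F B h = (THE n. \<exists>t u. t \<in> B \<and> PIdl\<^bsub>F\<lparr>carrier := B\<rparr>\<^esub> t = nonunits (F\<lparr>carrier := B\<rparr>) \<and>
     u \<in> Units (F\<lparr>carrier := B\<rparr>) \<and> h = u \<otimes>\<^bsub>F\<^esub> (t [^]\<^bsub>F\<^esub> n))"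

definition totally_ordered_group :: "('g, 'm) monoid_scheme \<Rightarrow> ('g \<Rightarrow> 'g \<Rightarrow> bool) \<Rightarrow> bool" where
  "totally_ordered_group G leq \<longleftrightarrow> comm_group G \<and>
     linear_order_on (carrier G) {(a, b). a \<in> carrier G \<and> b \<in> carrier G \<and> leq a b} \<and>
     (\<forall>a\<in>carrier G. \<forall>b\<in>carrier G. \<forall>c\<in>carrier G. leq a b \<longrightarrow> leq (a \<otimes>\<^bsub>G\<^esub> c) (b \<otimes>\<^bsub>G\<^esub> c))"

definition valuation ::
  "('k::zero, 'b) module \<Rightarrow> ('g, 'm) monoid_scheme \<Rightarrow> ('g \<Rightarrow> 'g \<Rightarrow> bool) \<Rightarrow> ('b \<Rightarrow> 'g) \<Rightarrow> bool" where
  "valuation R G leq \<nu> \<longleftrightarrow> totally_ordered_group G leq \<and>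
     (\<forall>x\<in>carrier R - {\<zero>\<^bsub>R\<^esub>}. \<nu> x \<in> carrier G) \<and>
     (\<forall>x\<in>carrier R - {\<zero>\<^bsub>R\<^esub>}. \<forall>y\<in>carrier R - {\<zero>\<^bsub>R\<^esub>}. x \<oplus>\<^bsub>R\<^esub> y \<noteq> \<zero>\<^bsub>R\<^esub> \<longrightarrow>
        leq (if leq (\<nu> x) (\<nu> y) then \<nu> x else \<nu> y) (\<nu> (x \<oplus>\<^bsub>R\<^esub> y))) \<and>
     (\<forall>t. t \<noteq> 0 \<longrightarrow> (\<forall>x\<in>carrier R - {\<zero>\<^bsub>R\<^esub>}. \<nu> (t \<odot>\<^bsub>R\<^esub> x) = \<nu> x)) \<and>
     (\<forall>x\<in>carrier R - {\<zero>\<^bsub>R\<^esub>}. \<forall>y\<in>carrier R - {\<zero>\<^bsub>R\<^esub>}. x \<otimes>\<^bsub>R\<^esub> y \<noteq> \<zero>\<^bsub>R\<^esub> \<longrightarrow>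
        \<nu> (x \<otimes>\<^bsub>R\<^esub> y) = \<nu> x \<otimes>\<^bsub>G\<^esub> \<nu> y)"

section \<open>Coordinate rings, function fields and local rings of cones\<close>

text \<open>In the following, \<open>Y\<close> and \<open>Z\<close> are affine cones in \<open>V\<close>.  \<open>coord_ring scale Y\<close> is
  \<open>\<K>[Y]\<close>, realized as the ring of restrictions to \<open>Y\<close> of polynomial functions.\<close>

definition coord_ring :: "('k::field \<Rightarrow> 'v::ab_group_add \<Rightarrow> 'v) \<Rightarrow> 'v set \<Rightarrow> ('k, 'v \<Rightarrow> 'k) module" where
  "coord_ring scale Y =
    \<lparr>carrier = (\<lambda>g. restrict g Y) ` poly_fun scale,
     mult = (\<lambda>g h. restrict (\<lambda>v. g v * h v) Y),
     one = restrict (\<lambda>_. 1) Y,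
     zero = restrict (\<lambda>_. 0) Y,
     add = (\<lambda>g h. restrict (\<lambda>v. g v + h v) Y),
     module.smult = (\<lambda>t g. restrict (\<lambda>v. t * g v) Y)\<rparr>"

definition fun_field ::
  "('k::field \<Rightarrow> 'v::ab_group_add \<Rightarrow> 'v) \<Rightarrow> 'v set \<Rightarrow> ('k, (('v \<Rightarrow> 'k) \<times> ('v \<Rightarrow> 'k)) set) module" where
  "fun_field scale Y = fraction_field (coord_ring scale Y)"

text \<open>\<open>ratio scale Y a b\<close> is the rational function \<open>a / b\<close> on \<open>Y\<close>, for functions \<open>a\<close>, \<open>b\<close> on \<open>V\<close>
  or on \<open>Y\<close>.\<close>

definition ratio ::
  "('k::field \<Rightarrow> 'v::ab_group_add \<Rightarrow> 'v) \<Rightarrow> 'v set \<Rightarrow> ('v \<Rightarrow> 'k) \<Rightarrow> ('v \<Rightarrow> 'k) \<Rightarrow> (('v \<Rightarrow> 'k) \<times> ('v \<Rightarrow> 'k)) set"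
  where "ratio scale Y a b = fraction (coord_ring scale Y) (restrict a Y) (restrict b Y)"

text \<open>The local ring \<open>\<O>\<^bsub>Y,Z\<^esub>\<close> of an irreducible closed \<open>Z \<subseteq> Y\<close> (as a subset of the function field),
  the associated valuation, and the restriction to \<open>Z\<close> of a rational function in \<open>\<O>\<^bsub>Y,Z\<^esub>\<close>.\<close>

definition local_ring_along ::
  "('k::field \<Rightarrow> 'v::ab_group_add \<Rightarrow> 'v) \<Rightarrow> 'v set \<Rightarrow> 'v set \<Rightarrow> (('v \<Rightarrow> 'k) \<times> ('v \<Rightarrow> 'k)) set set" where
  "local_ring_along scale Y Z =
     {ratio scale Y a s | a s. a \<in> poly_fun scale \<and> s \<in> poly_fun scale \<and> (\<exists>v\<in>Z. s v \<noteq> 0)}"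

definition divisor_val ::
  "('k::field \<Rightarrow> 'v::ab_group_add \<Rightarrow> 'v) \<Rightarrow> 'v set \<Rightarrow> 'v set \<Rightarrow> (('v \<Rightarrow> 'k) \<times> ('v \<Rightarrow> 'k)) set \<Rightarrow> int" where
  "divisor_val scale Y Z = dvr_val (fun_field scale Y) (local_ring_along scale Y Z)"

definition restrict_rat ::
  "('k::field \<Rightarrow> 'v::ab_group_add \<Rightarrow> 'v) \<Rightarrow> 'v set \<Rightarrow> 'v set \<Rightarrow>
   (('v \<Rightarrow> 'k) \<times> ('v \<Rightarrow> 'k)) set \<Rightarrow> (('v \<Rightarrow> 'k) \<times> ('v \<Rightarrow> 'k)) set" where
  "restrict_rat scale Y Z h =
     (THE k. \<exists>a s. a \<in> poly_fun scale \<and> s \<in> poly_fun scale \<and> (\<exists>v\<in>Z. s v \<noteq> 0) \<and>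
        h = ratio scale Y a s \<and> k = ratio scale Z a s)"

text \<open>For a projective variety \<open>Y\<close> and a point \<open>L = [v]\<close> of \<open>Y\<close>: the local ring \<open>\<O>\<^bsub>Y,L\<^esub>\<close>, consisting of the
  fractions of homogeneous elements of equal degree with denominator not vanishing at \<open>L\<close>.\<close>

definition local_ring_at ::
  "('k::field \<Rightarrow> 'v::ab_group_add \<Rightarrow> 'v) \<Rightarrow> 'v set set \<Rightarrow> 'v set \<Rightarrow>
   ('k, (('v \<Rightarrow> 'k) \<times> ('v \<Rightarrow> 'k)) set) module" where
  "local_ring_at scale Y L = (fun_field scale (cone Y))\<lparr>carrier :=
     {ratio scale (cone Y) a s | a s d. homogeneous scale d a \<and> homogeneous scale d s \<and>
        L \<notin> hypersurface scale s}\<rparr>"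

definition singular_locus :: "('k::field \<Rightarrow> 'v::ab_group_add \<Rightarrow> 'v) \<Rightarrow> 'v set set \<Rightarrow> 'v set set" where
  "singular_locus scale Y = {L \<in> Y. \<not> regular_local_ring (local_ring_at scale Y L)}"

definition smooth_in_codim_one :: "('k::field \<Rightarrow> 'v::ab_group_add \<Rightarrow> 'v) \<Rightarrow> 'v set set \<Rightarrow> bool" where
  "smooth_in_codim_one scale Y \<longleftrightarrow> codim scale (singular_locus scale Y) Y \<ge> 2"

section \<open>Seshadri stratifications\<close>

locale seshadri_stratification = finite_dimensional_vector_space scale Basis
  for scale :: "'k::alg_closed_field \<Rightarrow> 'v::ab_group_add \<Rightarrow> 'v"
  and Basis :: "'v set" +
  fixes X :: "'v set set"
    and A :: "'a set"
    and Xs :: "'a \<Rightarrow> 'v set set"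
    and f :: "'a \<Rightarrow> 'v \<Rightarrow> 'k"
  assumes variety_X: "proj_variety scale X"
    and finite_A: "finite A"
    and variety_strata: "p \<in> A \<Longrightarrow> proj_variety scale (Xs p) \<and> Xs p \<subseteq> X"
    \<comment> \<open>\<open>p \<le> q \<longleftrightarrow> Xs p \<subseteq> Xs q\<close> is a partial order on \<open>A\<close>, i.e. antisymmetric\<close>
    and inj_strata: "inj_on Xs A"
    and maximal_stratum: "\<exists>pmax. {p \<in> A. \<forall>q\<in>A. Xs p \<subseteq> Xs q \<longrightarrow> q = p} = {pmax} \<and> Xs pmax = X"
    and homogeneous_f: "p \<in> A \<Longrightarrow> \<exists>d\<ge>1. homogeneous scale d (f p)"
    and S1_smooth: "p \<in> A \<Longrightarrow> smooth_in_codim_one scale (Xs p)"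
    and S1_codim: "\<lbrakk>p \<in> A; q \<in> A; Xs q \<subset> Xs p; \<not> (\<exists>s\<in>A. Xs q \<subset> Xs s \<and> Xs s \<subset> Xs p)\<rbrakk>
          \<Longrightarrow> codim_irred scale (Xs q) (Xs p) = 1"
    and S2: "\<lbrakk>p \<in> A; q \<in> A; \<not> Xs q \<subseteq> Xs p\<rbrakk> \<Longrightarrow> Xs p \<subseteq> hypersurface scale (f q)"
    and S3: "p \<in> A \<Longrightarrow> hypersurface scale (f p) \<inter> Xs p =
          \<Union>{Xs q | q. q \<in> A \<and> Xs q \<subset> Xs p \<and> \<not> (\<exists>s\<in>A. Xs q \<subset> Xs s \<and> Xs s \<subset> Xs p)}"
begin

definition covers :: "'a \<Rightarrow> 'a \<Rightarrow> bool" where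
  "covers p q \<longleftrightarrow> p \<in> A \<and> q \<in> A \<and> Xs q \<subset> Xs p \<and> \<not> (\<exists>s\<in>A. Xs q \<subset> Xs s \<and> Xs s \<subset> Xs p)"

text \<open>The extended poset \<open>\<hat>A\<close> is modelled by \<open>'a option\<close>, with \<open>None\<close> playing the role of the
  additional minimum \<open>p\<^bsub>-1\<^esub>\<close>.\<close>

definition Xhat :: "'a option \<Rightarrow> 'v set" where
  "Xhat p = (case p of None \<Rightarrow> {0} | Some q \<Rightarrow> cone (Xs q))"

definition nu :: "'a \<Rightarrow> 'a option \<Rightarrow> (('v \<Rightarrow> 'k) \<times> ('v \<Rightarrow> 'k)) set \<Rightarrow> int" where
  "nu p q = divisor_val scale (Xhat (Some p)) (Xhat q)"

definition f_rat :: "'a \<Rightarrow> (('v \<Rightarrow> 'k) \<times> ('v \<Rightarrow> 'k)) set" where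
  "f_rat p = ratio scale (Xhat (Some p)) (f p) (\<lambda>_. 1)"

definition bond :: "'a \<Rightarrow> 'a option \<Rightarrow> int" where
  "bond p q = nu p q (f_rat p)"

definition N :: nat where
  "N = Lcm {nat (bond p (Some q)) | p q. covers p q}"

text \<open>A chain \<open>p\<^sub>r > \<dots> > p\<^sub>0\<close> is given by its length \<open>r\<close> and the enumeration \<open>c j = p\<^sub>j\<close>, \<open>j \<le> r\<close>.\<close>

definition maximal_chain :: "nat \<Rightarrow> (nat \<Rightarrow> 'a) \<Rightarrow> bool" where
  "maximal_chain r c \<longleftrightarrow> (\<forall>j<r. Xs (c j) \<subset> Xs (c (Suc j))) \<and>
     pred_on.maxchain A (\<lambda>p q. Xs p \<subset> Xs q) (c ` {..r})"

definition pred_elem :: "(nat \<Rightarrow> 'a) \<Rightarrow> nat \<Rightarrow> 'a option" where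
  "pred_elem c j = (if j = 0 then None else Some (c (j - 1)))"

definition nu_chain :: "(nat \<Rightarrow> 'a) \<Rightarrow> nat \<Rightarrow> (('v \<Rightarrow> 'k) \<times> ('v \<Rightarrow> 'k)) set \<Rightarrow> int" where
  "nu_chain c j = nu (c j) (pred_elem c j)"

definition b_chain :: "(nat \<Rightarrow> 'a) \<Rightarrow> nat \<Rightarrow> int" where
  "b_chain c j = bond (c j) (pred_elem c j)"

text \<open>One step \<open>g\<^sub>j \<mapsto> g\<^bsub>j-1\<^esub>\<close> for \<open>j \<ge> 1\<close>.  The integer division is exact, as \<open>b\<^sub>j\<close> divides \<open>N\<close>.\<close>

definition g_step :: "(nat \<Rightarrow> 'a) \<Rightarrow> nat \<Rightarrow> (('v \<Rightarrow> 'k) \<times> ('v \<Rightarrow> 'k)) set \<Rightarrow> (('v \<Rightarrow> 'k) \<times> ('v \<Rightarrow> 'k)) set" where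
  "g_step c j h = (let F = fun_field scale (Xhat (Some (c j))) in
     restrict_rat scale (Xhat (Some (c j))) (Xhat (pred_elem c j))
       (h [^]\<^bsub>F\<^esub> N \<otimes>\<^bsub>F\<^esub> f_rat (c j) [^]\<^bsub>F\<^esub> (- ((int N * nu_chain c j h) div b_chain c j))))"

text \<open>\<open>g_desc r c g k\<close> is \<open>g\<^bsub>r-k\<^esub>\<close>; the start \<open>g \<in> R\<close> is viewed as an element of \<open>\<K>(Xhat p\<^sub>r)\<close>.\<close>

primrec g_desc :: "nat \<Rightarrow> (nat \<Rightarrow> 'a) \<Rightarrow> ('v \<Rightarrow> 'k) \<Rightarrow> nat \<Rightarrow> (('v \<Rightarrow> 'k) \<times> ('v \<Rightarrow> 'k)) set" where
  "g_desc r c g 0 = ratio scale (Xhat (Some (c r))) g (\<lambda>_. 1)"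
| "g_desc r c g (Suc k) = g_step c (r - k) (g_desc r c g k)"

definition basis_vec :: "'a \<Rightarrow> 'a \<Rightarrow> rat" where
  "basis_vec p = (\<lambda>x. if x = p then 1 else 0)"

definition V_chain :: "nat \<Rightarrow> (nat \<Rightarrow> 'a) \<Rightarrow> ('v \<Rightarrow> 'k) \<Rightarrow> 'a \<Rightarrow> rat" where
  "V_chain r c g = (\<lambda>x. \<Sum>j\<le>r.
     of_int (nu_chain c j (g_desc r c g (r - j))) / (of_nat N ^ (r - j) * of_int (b_chain c j))
       * basis_vec (c j) x)"

text \<open>The extension to the function field by \<open>f/g \<mapsto> V(f) - V(g)\<close>; the theorem states explicitly
  that this does not depend on the chosen representation.\<close>

definition V_ext :: "nat \<Rightarrow> (nat \<Rightarrow> 'a) \<Rightarrow> (('v \<Rightarrow> 'k) \<times> ('v \<Rightarrow> 'k)) set \<Rightarrow> 'a \<Rightarrow> rat" where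
  "V_ext r c h = (THE w. \<exists>g1 g2. let R = coord_ring scale (cone X) in
     g1 \<in> carrier R - {\<zero>\<^bsub>R\<^esub>} \<and> g2 \<in> carrier R - {\<zero>\<^bsub>R\<^esub>} \<and> h = fraction R g1 g2 \<and>
     w = (\<lambda>x. V_chain r c g1 x - V_chain r c g2 x))"

text \<open>\<open>\<rat>\<^sup>\<CC>\<close> is the group of functions \<open>'a \<Rightarrow> rat\<close> vanishing off the chain.\<close>

definition L_lattice :: "nat \<Rightarrow> (nat \<Rightarrow> 'a) \<Rightarrow> ('a \<Rightarrow> rat) monoid" where
  "L_lattice r c =
    \<lparr>carrier = {l. (\<forall>x. x \<notin> c ` {..r} \<longrightarrow> l x = 0) \<and>
                  (\<forall>j\<le>r. (\<Prod>i=j..r. of_int (b_chain c i)) * l (c j) \<in> \<int>)},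
     monoid.mult = (\<lambda>l m x. l x + m x),
     one = (\<lambda>_. 0)\<rparr>"

definition lex_le :: "nat \<Rightarrow> (nat \<Rightarrow> 'a) \<Rightarrow> ('a \<Rightarrow> rat) \<Rightarrow> ('a \<Rightarrow> rat) \<Rightarrow> bool" where
  "lex_le r c l m \<longleftrightarrow> (\<forall>j\<le>r. l (c j) = m (c j)) \<or>
     (\<exists>j\<le>r. l (c j) < m (c j) \<and> (\<forall>i. j < i \<and> i \<le> r \<longrightarrow> l (c i) = m (c i)))"

end

end

theory Submission
  imports Defs "HOL-Library.Function_Algebras"
begin

text \<open>
  Two facts make \<open>V_chain\<close> a valuation. The first is formal. Let \<open>res h\<close> be the restriction to the
  next divisor of the unit \<open>h\<^bsup>b\<^esup> f\<^bsup>-\<nu>(h)\<^esup>\<close>, where \<open>b = \<nu>(f)\<close> is the bond. One step of the descent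
  sends \<open>h\<close> to \<open>(res h)\<^bsup>N/b\<^esup>\<close>, because \<open>b\<close> divides \<open>N\<close>. Both maps are multiplicative, so the vector
  is additive on products. After the division by \<open>N\<close>, every lower entry for \<open>h\<close> is \<open>1/b\<close> times the
  entry for \<open>res h\<close>; hence the denominators are products of bonds and the vector lies in the lattice
  (\<open>W_step\<close>, \<open>W_lattice\<close>). For sums, divide by the smaller summand: it remains to see that
  \<open>1 + h\<close> is lexicographically nonnegative when \<open>h\<close> is, and this follows by descending along the
  chain, since the restriction of \<open>1 + h\<close> is \<open>1\<close> plus the restriction of \<open>h\<close> as long as both units
  survive (\<open>one_add_nonneg\<close>). This part is carried out for any tower of fields with valuations and
  restriction maps (locale \<open>valued_field_tower\<close>).

  The second fact is geometric: for a covering \<open>p > q\<close> the local ring of the cone over \<open>X\<^sub>p\<close> along the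
  cone over \<open>X\<^sub>q\<close> is a discrete valuation ring, so that the \<open>\<nu>\<close> are valuations at all. As \<open>X\<^sub>p\<close> is
  smooth in codimension one, some point \<open>L\<close> of \<open>X\<^sub>q\<close> is regular on \<open>X\<^sub>p\<close>. A regular local ring is normal
  (\<open>regular_local_ring_normal\<close>). Since \<open>f\<^sub>p\<close> cuts out the union of the covered strata, a power of
  each equation of \<open>X\<^sub>q\<close> is, by Hilbert's Nullstellensatz, a multiple of \<open>f\<^sub>p\<close> up to a factor that does
  not vanish on \<open>X\<^sub>q\<close>. So the prime of \<open>X\<^sub>q\<close> in the local ring at \<open>L\<close> is the radical of a principal
  ideal near its generic point. In a normal noetherian domain such a prime is locally generated by one
  element (\<open>normal_local_uniformizer\<close>). This uniformizer is a quotient of homogeneous functions of equal degree; it also serves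
  for the cone, because homogeneous components can be handled separately
  (\<open>homogeneous_decomposition_suffices\<close>). At the bottom of the chain the cone has no zero of
  \<open>f\<close> except the origin; then it is a line (\<open>cone_without_zeros_is_line\<close>), and the
  valuation is the vanishing order of a polynomial at \<open>0\<close>.

  Regular local rings are shown to be normal without unique factorisation or homological algebra.
  Krull's principal ideal theorem turns a minimal generating system of the maximal ideal into a flag of
  primes, each obtained from the previous one by adding one generator (\<open>regular_local_ring_flag\<close>).
  Normality passes from \<open>R/(K + (x))\<close> to \<open>R/K\<close> (\<open>normal_mod_step\<close>), and at the top of the flag the
  quotient is a field. The arguments that usually pass to a localisation or a quotient are carried out
  in the ring itself: localising at \<open>P\<close> is replaced by ideals that are saturated with
  respect to the complement of \<open>P\<close>, and finite generation in Nakayama's lemma by the ascending chain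
  condition.
\<close>

section \<open>Saturated ideals in noetherian rings\<close>

context cring
begin

lemma ideal_closed:
  assumes "ideal I R"
  shows "I \<subseteq> carrier R" "\<zero> \<in> I" "\<And>a b. a \<in> I \<Longrightarrow> b \<in> I \<Longrightarrow> a \<oplus> b \<in> I"
    "\<And>a b. a \<in> I \<Longrightarrow> b \<in> I \<Longrightarrow> a \<ominus> b \<in> I"
    "\<And>a r. a \<in> I \<Longrightarrow> r \<in> carrier R \<Longrightarrow> r \<otimes> a \<in> I"
    "\<And>a r. a \<in> I \<Longrightarrow> r \<in> carrier R \<Longrightarrow> a \<otimes> r \<in> I"
proof -
  interpret I: ideal I R by fact
  show "I \<subseteq> carrier R" "\<zero> \<in> I" "\<And>a b. a \<in> I \<Longrightarrow> b \<in> I \<Longrightarrow> a \<oplus> b \<in> I"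
    "\<And>a b. a \<in> I \<Longrightarrow> b \<in> I \<Longrightarrow> a \<ominus> b \<in> I"
    "\<And>a r. a \<in> I \<Longrightarrow> r \<in> carrier R \<Longrightarrow> r \<otimes> a \<in> I"
    "\<And>a r. a \<in> I \<Longrightarrow> r \<in> carrier R \<Longrightarrow> a \<otimes> r \<in> I"
    by (auto simp: minus_eq I.I_l_closed I.I_r_closed)
qed

lemma idealI_cring:
  assumes "I \<subseteq> carrier R" "\<zero> \<in> I" "\<And>a b. a \<in> I \<Longrightarrow> b \<in> I \<Longrightarrow> a \<oplus> b \<in> I"
    "\<And>a r. a \<in> I \<Longrightarrow> r \<in> carrier R \<Longrightarrow> r \<otimes> a \<in> I"
  shows "ideal I R"
proof (rule idealI)
  show "ring R" by (rule ring_axioms)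
  show "subgroup I (add_monoid R)"
  proof (rule add.subgroupI)
    show "I \<subseteq> carrier R" "I \<noteq> {}" "\<And>a b. a \<in> I \<Longrightarrow> b \<in> I \<Longrightarrow> a \<oplus> b \<in> I" using assms by auto
    fix a assume a: "a \<in> I"
    then have "\<ominus> a = (\<ominus> \<one>) \<otimes> a" using assms(1) by (simp add: l_minus subsetD)
    then show "\<ominus> a \<in> I" using assms(4)[OF a] by simp
  qed
  show "\<And>a x. a \<in> I \<Longrightarrow> x \<in> carrier R \<Longrightarrow> x \<otimes> a \<in> I" by fact
  then show "\<And>a x. a \<in> I \<Longrightarrow> x \<in> carrier R \<Longrightarrow> a \<otimes> x \<in> I"
    using assms(1) m_comm by (metis subsetD)
qed

text \<open>The ideal generated by \<open>I\<close> and \<open>x\<close>. For an ideal \<open>K\<close>, membership in \<open>adjoin K b\<close> says that \<open>b\<close> divides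
modulo \<open>K\<close>; in this way quotient rings are avoided.\<close>

definition adjoin :: "'a set \<Rightarrow> 'a \<Rightarrow> 'a set" where
  "adjoin I x = {k \<oplus> r \<otimes> x | k r. k \<in> I \<and> r \<in> carrier R}"

lemma adjoinI: "k \<in> I \<Longrightarrow> r \<in> carrier R \<Longrightarrow> k \<oplus> r \<otimes> x \<in> adjoin I x"
  by (auto simp: adjoin_def)

lemma adjoinE:
  assumes "a \<in> adjoin I x"
  obtains k r where "k \<in> I" "r \<in> carrier R" "a = k \<oplus> r \<otimes> x"
  using assms by (auto simp: adjoin_def)

lemma adjoin_ideal:
  assumes I: "ideal I R" and x: "x \<in> carrier R"
  shows "ideal (adjoin I x) R" and "I \<subseteq> adjoin I x" and "x \<in> adjoin I x"
proof -
  note c = ideal_closed[OF I]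
  show "ideal (adjoin I x) R"
  proof (rule idealI_cring)
    show "adjoin I x \<subseteq> carrier R" using c(1) x by (auto simp: adjoin_def)
    have "\<zero> \<oplus> \<zero> \<otimes> x \<in> adjoin I x" using c(2) by (intro adjoinI) auto
    then show "\<zero> \<in> adjoin I x" using x by simp
  next
    fix a b assume "a \<in> adjoin I x" "b \<in> adjoin I x"
    then obtain k r k' r' where *: "k \<in> I" "r \<in> carrier R" "a = k \<oplus> r \<otimes> x" "k' \<in> I" "r' \<in> carrier R" "b = k' \<oplus> r' \<otimes> x"
      by (metis adjoinE)
    then have "a \<oplus> b = (k \<oplus> k') \<oplus> (r \<oplus> r') \<otimes> x"
      using c(1) x by (simp add: subsetD l_distr a_ac)
    then show "a \<oplus> b \<in> adjoin I x" using * c by (auto intro: adjoinI)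
  next
    fix a s assume "a \<in> adjoin I x" and s: "s \<in> carrier R"
    then obtain k r where *: "k \<in> I" "r \<in> carrier R" "a = k \<oplus> r \<otimes> x"
      by (metis adjoinE)
    then have "s \<otimes> a = (s \<otimes> k) \<oplus> (s \<otimes> r) \<otimes> x"
      using c(1) x s subsetD[OF c(1)] by (simp add: r_distr m_assoc)
    then show "s \<otimes> a \<in> adjoin I x" using * c s by (auto intro: adjoinI)
  qed
  show "I \<subseteq> adjoin I x"
  proof
    fix k assume k: "k \<in> I"
    have "k \<oplus> \<zero> \<otimes> x \<in> adjoin I x" using k by (intro adjoinI) auto
    then show "k \<in> adjoin I x" using x k c(1) by (simp add: subsetD)
  qed
  have "\<zero> \<oplus> \<one> \<otimes> x \<in> adjoin I x" using c(2) by (intro adjoinI) auto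
  then show "x \<in> adjoin I x" using x by simp
qed

lemma adjoin_minimal:
  assumes "ideal J R" "I \<subseteq> J" "x \<in> J"
  shows "adjoin I x \<subseteq> J"
  using ideal_closed[OF assms(1)] assms by (auto simp: adjoin_def)

lemma primeideal_closed:
  assumes "primeideal P R"
  shows "ideal P R" "\<one> \<notin> P"
    "\<And>a b. a \<in> carrier R \<Longrightarrow> b \<in> carrier R \<Longrightarrow> a \<otimes> b \<in> P \<Longrightarrow> a \<in> P \<or> b \<in> P"
    "\<And>a (n::nat). a \<in> carrier R \<Longrightarrow> a [^] n \<in> P \<Longrightarrow> a \<in> P"
proof -
  interpret P: primeideal P R by fact
  show 1: "ideal P R" by (rule P.is_ideal)
  show 2: "\<one> \<notin> P" using P.I_notcarr P.one_imp_carrier by auto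
  show 3: "\<And>a b. a \<in> carrier R \<Longrightarrow> b \<in> carrier R \<Longrightarrow> a \<otimes> b \<in> P \<Longrightarrow> a \<in> P \<or> b \<in> P" by (rule P.I_prime)
  fix a and n :: nat assume a: "a \<in> carrier R"
  show "a [^] n \<in> P \<Longrightarrow> a \<in> P"
  proof (induction n)
    case (Suc n)
    then show ?case using 3[of "a [^] n" a] a by auto
  qed (use 2 in auto)
qed

lemma primeidealI_cring:
  assumes "ideal P R" "\<one> \<notin> P"
    "\<And>a b. a \<in> carrier R \<Longrightarrow> b \<in> carrier R \<Longrightarrow> a \<otimes> b \<in> P \<Longrightarrow> a \<in> P \<or> b \<in> P"
  shows "primeideal P R"
  by (rule primeidealI) (use assms cring_axioms in auto)

text \<open>Zorn's lemma: an ideal that is maximal among those containing \<open>J\<close> and disjoint from a multiplicative set is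
prime.\<close>

lemma prime_avoiding_multiplicative_set:
  assumes J: "ideal J R" and S: "S \<subseteq> carrier R" "\<one> \<in> S" "\<And>a b. a \<in> S \<Longrightarrow> b \<in> S \<Longrightarrow> a \<otimes> b \<in> S"
    and JS: "J \<inter> S = {}"
  obtains P where "primeideal P R" "J \<subseteq> P" "P \<inter> S = {}"
proof -
  define X where "X = {I. ideal I R \<and> J \<subseteq> I \<and> I \<inter> S = {}}"
  have "\<exists>M\<in>X. \<forall>I\<in>X. M \<subseteq> I \<longrightarrow> I = M"
  proof (rule subset_Zorn)
    fix C assume C: "subset.chain X C"
    show "\<exists>U\<in>X. \<forall>I\<in>C. I \<subseteq> U"
    proof (cases "C = {}")
      case True
      then show ?thesis using J JS by (auto simp: X_def)
    next
      case False
      have "subset.chain {I. ideal I R} C" using C by (auto simp: pred_on.chain_def X_def)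
      then have "ideal (\<Union>C) R" using chain_Union_is_ideal[of C] False by simp
      moreover have "J \<subseteq> \<Union>C" "\<Union>C \<inter> S = {}" using C False unfolding pred_on.chain_def X_def by blast+
      ultimately show ?thesis by (auto simp: X_def)
    qed
  qed
  then obtain P where P: "ideal P R" "J \<subseteq> P" "P \<inter> S = {}"
    and max: "\<And>I. ideal I R \<Longrightarrow> J \<subseteq> I \<Longrightarrow> I \<inter> S = {} \<Longrightarrow> P \<subseteq> I \<Longrightarrow> I = P" by (auto simp: X_def)
  note c = ideal_closed[OF P(1)]
  have *: "\<exists>p r. p \<in> P \<and> r \<in> carrier R \<and> p \<oplus> r \<otimes> a \<in> S" if a: "a \<in> carrier R" "a \<notin> P" for a
  proof (rule ccontr)
    assume n: "\<not> ?thesis"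
    have "adjoin P a = P"
      by (rule max) (use adjoin_ideal[OF P(1) a(1)] P n in \<open>auto simp: adjoin_def\<close>)
    then show False using adjoin_ideal[OF P(1) a(1)] a by auto
  qed
  have "primeideal P R"
  proof (rule primeidealI_cring)
    show "\<one> \<notin> P" using P S by auto
    fix a b assume ab: "a \<in> carrier R" "b \<in> carrier R" "a \<otimes> b \<in> P"
    show "a \<in> P \<or> b \<in> P"
    proof (rule ccontr)
      assume "\<not> ?thesis"
      then obtain p r q s where ps: "p \<in> P" "r \<in> carrier R" "p \<oplus> r \<otimes> a \<in> S" "q \<in> P" "s \<in> carrier R" "q \<oplus> s \<otimes> b \<in> S"
        using *[of a] *[of b] ab by blast
      then have pc: "p \<in> carrier R" "q \<in> carrier R" using c by auto
      have "(p \<oplus> r \<otimes> a) \<otimes> (q \<oplus> s \<otimes> b) = (q \<oplus> s \<otimes> b) \<otimes> p \<oplus> (r \<otimes> a) \<otimes> q \<oplus> (r \<otimes> s) \<otimes> (a \<otimes> b)"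
        using pc ps(2,5) ab by algebra
      also have "\<dots> \<in> P" using c(5)[OF ps(1), of "q \<oplus> s \<otimes> b"] c(5)[OF ps(4), of "r \<otimes> a"] c(5)[OF ab(3), of "r \<otimes> s"] ps ab pc
          by (auto intro!: c(3))
      finally show False using S(3)[OF ps(3,6)] P(3) by auto
    qed
  qed fact
  with P that show thesis by blast
qed

end

locale noetherian_cring = cring R + noetherian_ring R for R (structure)
begin

lemma ideals_maximal_element:
  assumes "\<I> \<noteq> {}" "\<And>I. I \<in> \<I> \<Longrightarrow> ideal I R"
  obtains M where "M \<in> \<I>" "\<And>I. I \<in> \<I> \<Longrightarrow> M \<subseteq> I \<Longrightarrow> I = M"
proof -
  have "\<exists>M\<in>\<I>. \<forall>I\<in>\<I>. M \<subseteq> I \<longrightarrow> I = M"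
  proof (rule subset_Zorn)
    fix C assume C: "subset.chain \<I> C"
    show "\<exists>U\<in>\<I>. \<forall>I\<in>C. I \<subseteq> U"
    proof (cases "C = {}")
      case False
      have "subset.chain {I. ideal I R} C" using C assms(2) by (auto simp: pred_on.chain_def)
      from ideal_chain_is_trivial[OF False this] have "\<Union>C \<in> C" .
      then show ?thesis using C by (auto simp: pred_on.chain_def)
    qed (use assms in auto)
  qed
  then show thesis using that by blast
qed

lemma ideals_induct [consumes 1, case_names ideal]:
  assumes "ideal I R"
    and step: "\<And>I. ideal I R \<Longrightarrow> (\<And>J. ideal J R \<Longrightarrow> I \<subset> J \<Longrightarrow> Q J) \<Longrightarrow> Q I"
  shows "Q I"
proof (rule ccontr)
  assume "\<not> Q I"
  with assms(1) have "{I. ideal I R \<and> \<not> Q I} \<noteq> {}" by auto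
  then obtain M where "ideal M R" "\<not> Q M" "\<And>I. ideal I R \<Longrightarrow> \<not> Q I \<Longrightarrow> M \<subseteq> I \<Longrightarrow> I = M"
  proof (rule ideals_maximal_element)
  qed (blast, blast)
  with step[of M] show False by blast
qed

lemma ascending_ideals_stabilise:
  assumes "\<And>n. ideal (J n) R" "\<And>n::nat. J n \<subseteq> J (Suc n)"
  shows "\<exists>n. \<forall>m\<ge>n. J m = J n"
proof -
  have mono: "J m \<subseteq> J n" if "m \<le> n" for m n using lift_Suc_mono_le[of J m n] assms(2) that by auto
  obtain M where M: "M \<in> range J" "\<And>I. I \<in> range J \<Longrightarrow> M \<subseteq> I \<Longrightarrow> I = M"
  proof (rule ideals_maximal_element[of "range J"])
    show "range J \<noteq> {}" by blast
    show "\<And>I. I \<in> range J \<Longrightarrow> ideal I R" using assms(1) by blast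
  qed blast
  then obtain n where n: "M = J n" by blast
  have "J m = J n" if "m \<ge> n" for m
    using M(2)[of "J m"] mono[OF that] n by blast
  then show ?thesis by blast
qed

text \<open>The ideals that are contracted from the localisation at the prime \<open>P\<close>. Their inclusions are
the inclusions of ideals of the local ring, without leaving \<open>R\<close>.\<close>

definition saturated :: "'a set \<Rightarrow> 'a set \<Rightarrow> bool" where
  "saturated P J \<longleftrightarrow> (\<forall>s\<in>carrier R - P. \<forall>a\<in>carrier R. s \<otimes> a \<in> J \<longrightarrow> a \<in> J)"

lemma saturatedD:
  "saturated P J \<Longrightarrow> s \<otimes> a \<in> J \<Longrightarrow> s \<in> carrier R \<Longrightarrow> s \<notin> P \<Longrightarrow> a \<in> carrier R \<Longrightarrow> a \<in> J"
  by (auto simp: saturated_def)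

definition saturation :: "'a set \<Rightarrow> 'a set \<Rightarrow> 'a set" where
  "saturation P J = {a \<in> carrier R. \<exists>s\<in>carrier R - P. s \<otimes> a \<in> J}"

lemma saturation:
  assumes P: "primeideal P R" and J: "ideal J R"
  shows "ideal (saturation P J) R" "J \<subseteq> saturation P J" "saturated P (saturation P J)"
proof -
  note p = primeideal_closed[OF P] and c = ideal_closed[OF J]
  show "J \<subseteq> saturation P J"
  proof
    fix a assume "a \<in> J"
    then have "a \<in> carrier R" "\<one> \<otimes> a \<in> J" using c(1) by auto
    then show "a \<in> saturation P J" using p(2) by (auto simp: saturation_def intro!: bexI[of _ \<one>])
  qed
  then show "ideal (saturation P J) R"
  proof (intro idealI_cring)
    fix a b assume "a \<in> saturation P J" "b \<in> saturation P J"
    then obtain s t where st: "a \<in> carrier R" "b \<in> carrier R" "s \<in> carrier R" "t \<in> carrier R" "s \<notin> P" "t \<notin> P"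
      "s \<otimes> a \<in> J" "t \<otimes> b \<in> J" by (auto simp: saturation_def)
    have "(s \<otimes> t) \<otimes> (a \<oplus> b) = t \<otimes> (s \<otimes> a) \<oplus> s \<otimes> (t \<otimes> b)" using st by algebra
    also have "\<dots> \<in> J" using st c by auto
    finally show "a \<oplus> b \<in> saturation P J" using st p(3)[of s t]
      by (auto simp: saturation_def intro!: bexI[of _ "s \<otimes> t"])
  next
    fix a r assume "a \<in> saturation P J" and r: "r \<in> carrier R"
    then obtain s where st: "a \<in> carrier R" "s \<in> carrier R" "s \<notin> P" "s \<otimes> a \<in> J" by (auto simp: saturation_def)
    have "s \<otimes> (r \<otimes> a) = r \<otimes> (s \<otimes> a)" using st r by algebra
    also have "\<dots> \<in> J" using st c r by auto
    finally show "r \<otimes> a \<in> saturation P J" using st r by (auto simp: saturation_def)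
  qed (use c in \<open>auto simp: saturation_def\<close>)
  show "saturated P (saturation P J)"
    unfolding saturated_def
  proof safe
    fix s a assume "s \<in> carrier R" "s \<notin> P" "a \<in> carrier R" "s \<otimes> a \<in> saturation P J"
    moreover then obtain t where "t \<in> carrier R" "t \<notin> P" "t \<otimes> (s \<otimes> a) \<in> J" by (auto simp: saturation_def)
    ultimately show "a \<in> saturation P J" using p(3)[of t s]
      by (auto simp: saturation_def m_assoc intro!: bexI[of _ "t \<otimes> s"])
  qed
qed

lemma saturation_mono: "I \<subseteq> J \<Longrightarrow> saturation P I \<subseteq> saturation P J"
  by (auto simp: saturation_def)

text \<open>The localisation at \<open>P\<close> is a local ring: an element outside \<open>P\<close> stays a unit there after a change by an
element of \<open>P\<close>.\<close>

lemma saturated_minus: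
  assumes "primeideal P R" "x \<in> P" "t \<in> carrier R" "t \<notin> P" "r \<in> carrier R"
  shows "t \<ominus> r \<otimes> x \<in> carrier R" "t \<ominus> r \<otimes> x \<notin> P"
proof -
  note p = primeideal_closed[OF assms(1)] and c = ideal_closed[OF primeideal_closed(1)[OF assms(1)]]
  have x: "x \<in> carrier R" using c assms by auto
  show "t \<ominus> r \<otimes> x \<in> carrier R" using assms x by auto
  show "t \<ominus> r \<otimes> x \<notin> P"
  proof
    assume "t \<ominus> r \<otimes> x \<in> P"
    then have "(t \<ominus> r \<otimes> x) \<oplus> r \<otimes> x \<in> P" using c assms by auto
    moreover have "(t \<ominus> r \<otimes> x) \<oplus> r \<otimes> x = t" using assms x by algebra
    ultimately show False using assms by simp
  qed
qed

text \<open>A form of Nakayama's lemma for the localisation at \<open>P\<close>, with \<open>x\<close> in the maximal ideal and \<open>I = J + x I\<close>. The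
set \<open>I\<close> is not assumed to be an ideal: starting at \<open>a\<close>, repeated division by \<open>x\<close> modulo \<open>J\<close> yields a
sequence in \<open>I\<close>, the ideals generated by \<open>J\<close> and the members of the sequence form a locally ascending
chain, and once this chain is stationary a member is a multiple of \<open>x\<close> times itself modulo \<open>J\<close>, hence lies
in \<open>J\<close>. All Krull intersection arguments below are instances, taking for \<open>I\<close> a set of elements that are
divisible too often.\<close>

lemma Nakayama_principal:
  assumes P: "primeideal P R" and J: "ideal J R" "saturated P J" and x: "x \<in> P" and I: "I \<subseteq> carrier R"
    and step: "\<And>a. a \<in> I \<Longrightarrow> \<exists>t j b. t \<in> carrier R - P \<and> j \<in> J \<and> b \<in> I \<and> t \<otimes> a = j \<oplus> x \<otimes> b"
  shows "I \<subseteq> J"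
proof
  fix a assume "a \<in> I"
  note p = primeideal_closed[OF P] and cJ = ideal_closed[OF J(1)]
  have xc: "x \<in> carrier R" using x ideal_closed[OF p(1)] by auto
  obtain T j B where step': "\<And>a. a \<in> I \<Longrightarrow> T a \<in> carrier R \<and> T a \<notin> P \<and> j a \<in> J \<and> B a \<in> I \<and> T a \<otimes> a = j a \<oplus> x \<otimes> B a"
    using step by (metis Diff_iff)
  define s where "s n = (B ^^ n) a" for n
  have s: "s n \<in> I" for n by (induction n) (use \<open>a \<in> I\<close> step' in \<open>auto simp: s_def\<close>)
  have sc: "s n \<in> carrier R" for n using s I by auto
  have s_Suc: "T (s n) \<otimes> s n = j (s n) \<oplus> x \<otimes> s (Suc n)" for n
    using step'[OF s] by (auto simp: s_def)
  define D where "D n = saturation P (adjoin J (s n))" for n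
  note aJ = adjoin_ideal[OF J(1) sc]
  have D: "ideal (D n) R" "J \<subseteq> D n" "s n \<in> D n" "saturated P (D n)" for n
    using saturation[OF P aJ(1)[of n]] aJ(2,3)[of n] by (auto simp: D_def)
  have "adjoin J (s n) \<subseteq> D (Suc n)" for n
  proof (rule adjoin_minimal[OF D(1,2)])
    note d = ideal_closed[OF D(1)[of "Suc n"]]
    have "j (s n) \<in> J" using step'[OF s] by auto
    then have "T (s n) \<otimes> s n \<in> D (Suc n)" unfolding s_Suc using D(2,3)[of "Suc n"] xc
      by (intro d(3) d(5)) auto
    then show "s n \<in> D (Suc n)" using D(4)[of "Suc n"] step'[OF s] sc unfolding saturated_def by blast
  qed
  then have inc: "D n \<subseteq> D (Suc n)" for n
    unfolding D_def[of n] using D(4)[of "Suc n"] by (auto simp: saturation_def saturated_def)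
  obtain n where n: "\<And>m. m \<ge> n \<Longrightarrow> D m = D n" using ascending_ideals_stabilise[of D] D(1) inc by blast
  \<comment> \<open>stationarity gives \<open>u s\<^bsub>n+1\<^esub> \<in> J + R s\<^sub>n\<close>; inserting this into \<open>t s\<^sub>n = j + x s\<^bsub>n+1\<^esub>\<close> with \<open>t = T (s n)\<close> shows \<open>(u t - r x) s\<^sub>n \<in> J\<close>\<close>
  have "s (Suc n) \<in> D n" using D(3)[of "Suc n"] n[of "Suc n"] by auto
  then obtain u k r where u: "u \<in> carrier R" "u \<notin> P" "k \<in> J" "r \<in> carrier R" "u \<otimes> s (Suc n) = k \<oplus> r \<otimes> s n"
    by (auto simp: D_def saturation_def adjoin_def)
  have tj: "T (s n) \<in> carrier R" "T (s n) \<notin> P" "j (s n) \<in> J" "j (s n) \<in> carrier R" using step'[OF s] cJ by auto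
  have kc: "k \<in> carrier R" using u cJ by auto
  have "(u \<otimes> T (s n) \<ominus> r \<otimes> x) \<otimes> s n = u \<otimes> (T (s n) \<otimes> s n) \<ominus> x \<otimes> (r \<otimes> s n)"
    using u(1,4) tj(1,4) sc[of n] sc[of "Suc n"] xc by algebra
  also have "\<dots> = u \<otimes> j (s n) \<oplus> x \<otimes> (u \<otimes> s (Suc n)) \<ominus> x \<otimes> (r \<otimes> s n)"
    unfolding s_Suc using u(1,4) tj(1,4) sc[of n] sc[of "Suc n"] xc by algebra
  also have "\<dots> = u \<otimes> j (s n) \<oplus> x \<otimes> (k \<oplus> r \<otimes> s n) \<ominus> x \<otimes> (r \<otimes> s n)"
    by (simp only: u(5))
  also have "\<dots> = u \<otimes> j (s n) \<oplus> x \<otimes> k"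
    using u(1,4) kc tj(1,4) sc[of n] xc by algebra
  also have "\<dots> \<in> J" using u tj xc cJ by auto
  finally have "(u \<otimes> T (s n) \<ominus> r \<otimes> x) \<otimes> s n \<in> J" .
  moreover have "u \<otimes> T (s n) \<ominus> r \<otimes> x \<in> carrier R" "u \<otimes> T (s n) \<ominus> r \<otimes> x \<notin> P"
    using saturated_minus[OF P x, of "u \<otimes> T (s n)" r] u tj p(3)[of u "T (s n)"] by auto
  ultimately have "s n \<in> J" using J(2) sc[of n] by (auto simp: saturated_def)
  then have "adjoin J (s n) \<subseteq> J" by (rule adjoin_minimal[OF J(1) order_refl])
  then have "D n \<subseteq> J" using J(2) by (auto simp: D_def saturation_def saturated_def)
  moreover have "D 0 \<subseteq> D n" using lift_Suc_mono_le[of D 0 n] inc by auto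
  ultimately show "a \<in> J" using D(3)[of 0] by (auto simp: s_def)
qed

text \<open>When \<open>P\<close> is nilpotent modulo \<open>I\<close> up to factors outside \<open>P\<close>, it is an associated prime of \<open>I\<close>: among the
annihilators modulo \<open>I\<close> of single elements choose a maximal one that is contained in \<open>P\<close>. It is prime by the usual
argument, and it contains \<open>P\<close> by the nilpotency.\<close>

lemma associated_prime:
  assumes P: "primeideal P R" and I: "ideal I R" "I \<subseteq> P"
    and nil: "\<And>z. z \<in> P \<Longrightarrow> \<exists>(n::nat) s. s \<in> carrier R - P \<and> s \<otimes> z [^] n \<in> I"
  obtains y where "y \<in> carrier R" "{z \<in> carrier R. z \<otimes> y \<in> I} = P"
proof -
  note p = primeideal_closed[OF P] and c = ideal_closed[OF I(1)]
  define C where "C y = {z \<in> carrier R. z \<otimes> y \<in> I}" for y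
  have C: "ideal (C y) R" "I \<subseteq> C y" if y: "y \<in> carrier R" for y
  proof -
    show "ideal (C y) R"
      by (rule idealI_cring) (use y c in \<open>auto simp: C_def l_distr m_assoc\<close>)
    show "I \<subseteq> C y" using c y by (auto simp: C_def)
  qed
  define Y where "Y = {C y | y. y \<in> carrier R \<and> C y \<subseteq> P}"
  have "C \<one> \<subseteq> P" using I by (auto simp: C_def)
  then have "Y \<noteq> {}" by (auto simp: Y_def)
  then obtain M where M: "M \<in> Y" "\<And>I. I \<in> Y \<Longrightarrow> M \<subseteq> I \<Longrightarrow> I = M"
  proof (rule ideals_maximal_element)
    show "\<And>I. I \<in> Y \<Longrightarrow> ideal I R" using C(1) unfolding Y_def by blast
  qed blast
  then obtain y where y: "y \<in> carrier R" "C y \<subseteq> P" and My: "M = C y" by (auto simp: Y_def)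
  have max: "C y' = C y" if "y' \<in> carrier R" "C y' \<subseteq> P" "C y \<subseteq> C y'" for y'
    using M(2)[of "C y'"] that unfolding My Y_def by blast
  have sub: "C y \<subseteq> C (b \<otimes> y)" if "b \<in> carrier R" for b
  proof
    fix z assume "z \<in> C y"
    then have z: "z \<in> carrier R" "z \<otimes> y \<in> I" by (auto simp: C_def)
    have "z \<otimes> (b \<otimes> y) = b \<otimes> (z \<otimes> y)" using z y that by algebra
    then show "z \<in> C (b \<otimes> y)" using z c that by (auto simp: C_def)
  qed
  have prime: "a \<in> C y \<or> b \<in> C y" if ab: "a \<in> carrier R" "b \<in> carrier R" "a \<otimes> b \<in> C y" for a b
  proof (cases "C (b \<otimes> y) \<subseteq> P")
    case True
    then have "C (b \<otimes> y) = C y" using max sub ab y by auto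
    moreover have "a \<in> C (b \<otimes> y)" using ab y by (auto simp: C_def m_assoc)
    ultimately show ?thesis by simp
  next
    case False
    then obtain s where s: "s \<in> carrier R" "s \<otimes> (b \<otimes> y) \<in> I" "s \<notin> P" by (auto simp: C_def)
    have eq: "b \<otimes> (s \<otimes> y) = s \<otimes> (b \<otimes> y)" using s y ab by algebra
    \<comment> \<open>here \<open>s\<close> outside \<open>P\<close> annihilates \<open>b y\<close>, so \<open>b\<close> annihilates \<open>s y\<close>, which has the same annihilator as \<open>y\<close>\<close>
    have "C (s \<otimes> y) \<subseteq> P"
    proof
      fix z assume "z \<in> C (s \<otimes> y)"
      then have "z \<otimes> s \<in> C y" "z \<in> carrier R" using s y by (auto simp: C_def m_assoc)
      then show "z \<in> P" using y(2) p(3)[of z s] s by auto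
    qed
    then have "C (s \<otimes> y) = C y" using max sub s y by auto
    moreover have "b \<in> C (s \<otimes> y)" using eq s ab by (auto simp: C_def)
    ultimately show ?thesis by simp
  qed
  have "P \<subseteq> C y"
  proof
    fix z assume z: "z \<in> P"
    then have zc: "z \<in> carrier R" using ideal_closed[OF p(1)] by auto
    obtain n :: nat and s where s: "s \<in> carrier R" "s \<notin> P" "s \<otimes> z [^] n \<in> I" using nil[OF z] by auto
    then have "z [^] n \<in> C y" using prime[of s "z [^] n"] zc C(2)[OF y(1)] y(2) by auto
    moreover have "\<one> \<notin> C y" using y(2) p(2) by auto
    ultimately show "z \<in> C y"
    proof (induction n)
      case (Suc n)
      then show ?case using prime[of "z [^] n" z] zc by auto
    qed auto
  qed
  with y have "C y = P" by auto
  with y(1) that show thesis by (auto simp: C_def)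
qed

text \<open>The quotient of the local ring at \<open>P\<close> by \<open>I\<close> is artinian when its maximal ideal is nil. Noetherian induction
on \<open>I\<close> replaces the length of modules. By \<open>associated_prime\<close> some \<open>y\<close> outside \<open>I\<close> has annihilator \<open>P\<close>, so that locally
\<open>(I + (y)) / I\<close> is a simple module; the statement for \<open>I + (y)\<close> then gives it for \<open>I\<close>.\<close>

lemma descending_saturated_ideals_stabilise:
  assumes P: "primeideal P R" and I: "ideal I R"
    and nil: "\<And>z. z \<in> P \<Longrightarrow> \<exists>(n::nat) s. s \<in> carrier R - P \<and> s \<otimes> z [^] n \<in> I"
    and J: "\<And>n. ideal (J n) R" "\<And>n. saturated P (J n)" "\<And>n. I \<subseteq> J n" "\<And>n::nat. J (Suc n) \<subseteq> J n"
  shows "\<exists>n. J (Suc n) = J n"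
  using I nil J
proof (induction I arbitrary: J rule: ideals_induct)
  case (ideal I)
  note p = primeideal_closed[OF P] and c = ideal_closed[OF ideal(1)]
  note nil = ideal(3) and J = ideal(4-7)
  note cJ = ideal_closed[OF J(1)]
  have dec: "J m \<subseteq> J n" if "n \<le> m" for m n
    using that by (induction rule: dec_induct) (use J(4) in auto)
  have IH: "\<exists>n. K (Suc n) = K n" if "ideal I' R" "I \<subset> I'" "\<And>n. ideal (K n) R" "\<And>n. saturated P (K n)" "\<And>n. I' \<subseteq> K n" "\<And>n. K (Suc n) \<subseteq> K n" for I' K
  proof (rule ideal(2)[of I' K])
    show "\<exists>(n::nat) s. s \<in> carrier R - P \<and> s \<otimes> z [^] n \<in> I'" if "z \<in> P" for z
      using nil[OF that] \<open>I \<subset> I'\<close> by blast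
  qed (use that in auto)
  show ?case
  proof (cases "I \<subseteq> P")
    case False
    then obtain s where s: "s \<in> I" "s \<notin> P" by auto
    have "J n = carrier R" for n
    proof -
      have "a \<in> J n" if "a \<in> carrier R" for a
      proof -
        have "s \<in> carrier R" "s \<otimes> a \<in> J n" using c(1) c(6)[OF s(1) that] s J(3)[of n] by auto
        then show ?thesis using saturatedD[OF J(2)] s(2) that by blast
      qed
      then show ?thesis using cJ(1) by auto
    qed
    then show ?thesis by auto
  next
    case True
    obtain y where y: "y \<in> carrier R" and col: "{z \<in> carrier R. z \<otimes> y \<in> I} = P"
      by (rule associated_prime[OF P ideal(1) True nil]) blast+
    have yI: "y \<notin> I" using col p(2) y by auto
    note aI = adjoin_ideal[OF ideal(1) y]
    have ss: "I \<subset> adjoin I y" using aI yI by auto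
    show ?thesis
    proof (cases "\<forall>k. y \<in> J k")
      case True
      show ?thesis
        by (rule IH[OF aI(1) ss]) (use J adjoin_minimal[OF J(1) J(3)] True in auto)
    next
      case False
      then obtain k0 where k0: "y \<notin> J k0" by auto
      \<comment> \<open>the chain becomes stationary after adjoining \<open>y\<close>, and \<open>r y \<in> J\<close> with \<open>y \<notin> J\<close> forces \<open>r \<in> P\<close>, that is \<open>r y \<in> I\<close>\<close>
      define K where "K k = saturation P (adjoin (J (k0 + k)) y)" for k
      note aJ = adjoin_ideal[OF J(1) y]
      note sJ = saturation[OF P aJ(1)]
      have "\<exists>n. K (Suc n) = K n"
      proof (rule IH[OF aI(1) ss])
        show "ideal (K n) R" "saturated P (K n)" for n unfolding K_def by (intro sJ)+
        show "adjoin I y \<subseteq> K n" for n unfolding K_def using sJ(2) aJ(2,3) J(3)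
          by (intro adjoin_minimal[OF sJ(1)]) blast+
        show "K (Suc n) \<subseteq> K n" for n unfolding K_def
          using J(4)[of "k0 + n"] by (intro saturation_mono) (auto simp: adjoin_def)
      qed
      then obtain n where n: "K (Suc n) = K n" by auto
      have "J (k0 + n) \<subseteq> J (Suc (k0 + n))"
      proof
        fix b assume b: "b \<in> J (k0 + n)"
        then have "b \<in> K n" unfolding K_def using sJ(2) aJ(2) by blast
        then have "b \<in> K (Suc n)" using n by simp
        then obtain t d r where t: "t \<in> carrier R" "t \<notin> P" "b \<in> carrier R" "d \<in> J (Suc (k0 + n))" "r \<in> carrier R"
          "t \<otimes> b = d \<oplus> r \<otimes> y" by (auto simp: K_def saturation_def adjoin_def)
        have dc: "d \<in> carrier R" using t cJ by auto
        have "r \<otimes> y = t \<otimes> b \<ominus> d" unfolding t(6) using t(5) dc y by algebra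
        also have "\<dots> \<in> J (k0 + n)" using t b J(4)[of "k0 + n"] by (intro cJ(4) cJ(5)) auto
        finally have ry: "r \<otimes> y \<in> J (k0 + n)" .
        have "r \<in> P"
        proof (rule ccontr)
          assume "r \<notin> P"
          then have "y \<in> J (k0 + n)" using saturatedD[OF J(2) ry] t(5) y by blast
          then show False using k0 dec[of k0 "k0 + n"] by force
        qed
        then have "r \<otimes> y \<in> I" using col by auto
        then have "t \<otimes> b \<in> J (Suc (k0 + n))" unfolding t(6) using t(4) J(3) by (intro cJ(3)) auto
        then show "b \<in> J (Suc (k0 + n))" using saturatedD[OF J(2)] t(1-3) by blast
      qed
      then show ?thesis using J(4)[of "k0 + n"] by auto
    qed
  qed
qed

end

section \<open>Krull's principal ideal theorem and regular local rings\<close>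

context noetherian_cring
begin

text \<open>If \<open>P\<close> had no smaller prime containing \<open>P0\<close> and \<open>x\<close>, its local ring modulo \<open>P0\<close> and \<open>x\<close> would be artinian. The symbolic powers
of a prime \<open>Q\<close> strictly between would stabilise modulo \<open>x\<close>, hence stabilise by Nakayama's lemma, and
\<open>Q\<close> would be equal to \<open>P0\<close>. Here the symbolic powers are replaced by the saturations of the powers of one
element \<open>y\<close> of \<open>Q\<close>, which are easier to descend.\<close>

lemma Krull_principal_ideal:
  assumes P0: "primeideal P0 R" and Q: "primeideal Q R" and P: "primeideal P R"
    and sub: "P0 \<subset> Q" "Q \<subset> P" and x: "x \<in> P" "x \<notin> Q"
  obtains P' where "primeideal P' R" "P0 \<subseteq> P'" "x \<in> P'" "P' \<subset> P"
proof -
  note p0 = primeideal_closed[OF P0] and q = primeideal_closed[OF Q] and p = primeideal_closed[OF P]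
  note c0 = ideal_closed[OF p0(1)] and cq = ideal_closed[OF q(1)] and cp = ideal_closed[OF p(1)]
  have xc: "x \<in> carrier R" using x cp by auto
  note I = adjoin_ideal[OF p0(1) xc]
  show thesis
  proof (cases "\<forall>z\<in>P. \<exists>(n::nat) s. s \<in> carrier R - P \<and> s \<otimes> z [^] n \<in> adjoin P0 x")
    case False
    then obtain z where z: "z \<in> P" and n: "\<And>(n::nat) s. s \<in> carrier R - P \<Longrightarrow> s \<otimes> z [^] n \<notin> adjoin P0 x" by blast
    have zc: "z \<in> carrier R" using z cp by auto
    \<comment> \<open>a prime disjoint from this set lies inside \<open>P\<close> and misses \<open>z\<close>\<close>
    define S where "S = {s \<otimes> z [^] n | s n. s \<in> carrier R - P \<and> n \<in> (UNIV :: nat set)}"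
    have S_intro: "s \<otimes> z [^] n \<in> S" if "s \<in> carrier R" "s \<notin> P" for s and n :: nat
      using that by (auto simp: S_def)
    obtain P' where P': "primeideal P' R" "adjoin P0 x \<subseteq> P'" "P' \<inter> S = {}"
    proof (rule prime_avoiding_multiplicative_set[OF I(1)])
      show "S \<subseteq> carrier R" using zc by (auto simp: S_def)
      show "\<one> \<in> S" using S_intro[of \<one> 0] p(2) zc by simp
      show "adjoin P0 x \<inter> S = {}" using n by (auto simp: S_def)
      fix a b assume "a \<in> S" "b \<in> S"
      then obtain s t and n m :: nat where st: "s \<in> carrier R" "t \<in> carrier R" "s \<notin> P" "t \<notin> P" "a = s \<otimes> z [^] n" "b = t \<otimes> z [^] m"
        unfolding S_def by blast
      have "a \<otimes> b = (s \<otimes> t) \<otimes> (z [^] n \<otimes> z [^] m)" unfolding st(5,6) using st(1,2) zc by (simp add: m_ac)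
      also have "\<dots> = (s \<otimes> t) \<otimes> z [^] (n + m)" using zc by (simp add: nat_pow_mult)
      also have "\<dots> \<in> S" using st p(3)[of s t] by (intro S_intro) auto
      finally show "a \<otimes> b \<in> S" .
    qed blast
    have "P' \<subseteq> P"
    proof
      fix s assume s: "s \<in> P'"
      then have "s \<in> carrier R" using ideal_closed[OF primeideal_closed(1)[OF P'(1)]] by auto
      moreover then have "s \<notin> P \<Longrightarrow> s \<in> S" using S_intro[of s 0] zc by simp
      ultimately show "s \<in> P" using s P'(3) by auto
    qed
    moreover have "z \<in> S" using S_intro[of \<one> 1] p(2) zc by simp
    then have "z \<notin> P'" using P'(3) by auto
    ultimately show thesis using that[OF P'(1)] P'(2) I(2,3) z by blast
  next
    case True
    obtain y where y: "y \<in> Q" "y \<notin> P0" using sub by auto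
    have yc: "y \<in> carrier R" using y cq by auto
    have I2: "ideal (adjoin P0 (y [^] k)) R" "P0 \<subseteq> adjoin P0 (y [^] k)" "y [^] k \<in> adjoin P0 (y [^] k)" for k :: nat
      using adjoin_ideal[OF p0(1), of "y [^] k"] yc by auto
    define D where "D k = saturation Q (adjoin P0 (y [^] k))" for k :: nat
    have D: "ideal (D k) R" "adjoin P0 (y [^] k) \<subseteq> D k" "saturated Q (D k)" for k
      unfolding D_def by (intro saturation[OF Q] I2)+
    have D_sat: "saturated P (D k)" for k
      using D(3)[of k] sub(2) unfolding saturated_def by blast
    have D_dec: "D (Suc k) \<subseteq> D k" for k
      unfolding D_def
    proof (intro saturation_mono adjoin_minimal I2(1,2))
      have "y \<otimes> y [^] k \<in> adjoin P0 (y [^] k)" using ideal_closed(5)[OF I2(1) I2(3) yc] .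
      then show "y [^] Suc k \<in> adjoin P0 (y [^] k)" using yc by (simp add: m_comm)
    qed
    note cD = ideal_closed[OF D(1)]
    note DX = adjoin_ideal[OF D(1) xc]
    define J where "J k = saturation P (adjoin (D k) x)" for k
    have J: "ideal (J k) R" "adjoin (D k) x \<subseteq> J k" "saturated P (J k)" for k
      unfolding J_def by (intro saturation[OF P] DX)+
    have "\<exists>n. J (Suc n) = J n"
    proof (rule descending_saturated_ideals_stabilise[OF P I(1)])
      show "\<And>z. z \<in> P \<Longrightarrow> \<exists>(n::nat) s. s \<in> carrier R - P \<and> s \<otimes> z [^] n \<in> adjoin P0 x" using True by blast
      show "\<And>n. ideal (J n) R" "\<And>n. saturated P (J n)" by (rule J)+
      have "P0 \<subseteq> J n" for n using I2(2)[of n] D(2)[of n] J(2)[of n] DX(2)[of n] by blast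
      moreover have "x \<in> J n" for n using J(2) DX(3) by blast
      ultimately show "adjoin P0 x \<subseteq> J n" for n by (intro adjoin_minimal J)
      show "J (Suc n) \<subseteq> J n" for n unfolding J_def using D_dec[of n]
        by (intro saturation_mono) (auto simp: adjoin_def)
    qed
    then obtain k where k: "J (Suc k) = J k" by auto
    have "D k \<subseteq> D (Suc k)"
    proof (rule Nakayama_principal[OF P D(1) D_sat x(1)])
      show "D k \<subseteq> carrier R" by (rule cD)
      fix a assume a: "a \<in> D k"
      then have "a \<in> J (Suc k)" unfolding k using DX(2)[of k] J(2)[of k] by blast
      then obtain t where t: "a \<in> carrier R" "t \<in> carrier R" "t \<notin> P" "t \<otimes> a \<in> adjoin (D (Suc k)) x"
        unfolding J_def saturation_def by blast
      from t(4) obtain b r where br: "b \<in> D (Suc k)" "r \<in> carrier R" "t \<otimes> a = b \<oplus> r \<otimes> x" by (rule adjoinE)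
      have bc: "b \<in> carrier R" using br(1) cD(1) by blast
      have "x \<otimes> r = t \<otimes> a \<ominus> b" unfolding br(3) using bc br(2) xc by algebra
      also have "\<dots> \<in> D k" using D_dec[of k] br(1) cD(4)[OF cD(5)[OF a t(2)], of b] by blast
      finally have "r \<in> D k" using saturatedD[OF D(3)] xc x(2) br(2) by blast
      moreover have "t \<otimes> a = b \<oplus> x \<otimes> r" unfolding br(3) using xc br(2) by (simp add: m_comm)
      ultimately show "\<exists>t j b. t \<in> carrier R - P \<and> j \<in> D (Suc k) \<and> b \<in> D k \<and> t \<otimes> a = j \<oplus> x \<otimes> b"
        using t(2,3) br(1) by blast
    qed
    then have "y [^] k \<in> D (Suc k)" using D(2)[of k] I2(3)[of k] by blast
    then obtain s where s: "s \<in> carrier R" "s \<notin> Q" "s \<otimes> y [^] k \<in> adjoin P0 (y [^] Suc k)"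
      unfolding D_def saturation_def by blast
    from s(3) obtain u r where u: "u \<in> P0" "r \<in> carrier R" "s \<otimes> y [^] k = u \<oplus> r \<otimes> y [^] Suc k" by (rule adjoinE)
    have uc: "u \<in> carrier R" "y [^] k \<in> carrier R" "y [^] Suc k \<in> carrier R" using u(1) c0(1) yc by auto
    have "(s \<ominus> r \<otimes> y) \<otimes> y [^] k = s \<otimes> y [^] k \<ominus> r \<otimes> y [^] Suc k"
      unfolding nat_pow_Suc using s(1) u(2) uc(1,2) yc by algebra
    also have "\<dots> = u" unfolding u(3) using u(2) uc(1,3) by algebra
    finally have "(s \<ominus> r \<otimes> y) \<otimes> y [^] k \<in> P0" using u(1) by simp
    moreover have sr: "s \<ominus> r \<otimes> y \<in> carrier R" "s \<ominus> r \<otimes> y \<notin> Q" using saturated_minus[OF Q y(1) s(1,2) u(2)] by auto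
    ultimately have "y [^] k \<in> P0" using p0(3)[OF sr(1) uc(2)] sub(1) by blast
    then show thesis using p0(4)[OF yc] y(2) by blast
  qed
qed

definition prime_chain :: "nat \<Rightarrow> (nat \<Rightarrow> 'a set) \<Rightarrow> bool" where
  "prime_chain n P \<longleftrightarrow> (\<forall>i\<le>n. primeideal (P i) R) \<and> (\<forall>i<n. P i \<subset> P (Suc i))"

text \<open>Krull's theorem, applied to the three topmost primes, moves \<open>x\<close> into the second prime from the top; by
induction it moves down to the lowest position but one.\<close>

lemma prime_chain_through_element:
  assumes "prime_chain (Suc n) P" "x \<in> P (Suc n)"
  shows "\<exists>Q. prime_chain (Suc n) Q \<and> Q 0 = P 0 \<and> Q (Suc n) = P (Suc n) \<and> x \<in> Q 1"
  using assms
proof (induction n arbitrary: P)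
  case 0
  then show ?case by auto
next
  case (Suc n)
  have P: "\<And>i. i \<le> Suc (Suc n) \<Longrightarrow> primeideal (P i) R" "\<And>i. i < Suc (Suc n) \<Longrightarrow> P i \<subset> P (Suc i)"
    using Suc.prems by (auto simp: prime_chain_def)
  obtain P' where P': "primeideal P' R" "P n \<subset> P'" "x \<in> P'" "P' \<subset> P (Suc (Suc n))"
  proof (cases "x \<in> P (Suc n)")
    case True
    then show thesis using that[of "P (Suc n)"] P(1)[of "Suc n"] P(2)[of n] P(2)[of "Suc n"] by auto
  next
    case False
    obtain P' where "primeideal P' R" "P n \<subseteq> P'" "x \<in> P'" "P' \<subset> P (Suc (Suc n))"
    proof (rule Krull_principal_ideal)
      show "primeideal (P n) R" "primeideal (P (Suc n)) R" "primeideal (P (Suc (Suc n))) R" using P(1) by auto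
      show "P n \<subset> P (Suc n)" "P (Suc n) \<subset> P (Suc (Suc n))" using P(2) by auto
      show "x \<in> P (Suc (Suc n))" "x \<notin> P (Suc n)" using Suc.prems False by auto
    qed blast
    moreover have "x \<notin> P n" using False P(2)[of n] by auto
    ultimately show thesis using that[of P'] by blast
  qed
  have "prime_chain (Suc n) (P(Suc n := P'))" using P P' by (auto simp: prime_chain_def less_Suc_eq)
  from Suc.IH[OF this] obtain Q where Q: "prime_chain (Suc n) Q" "Q 0 = P 0" "Q (Suc n) = P'" "x \<in> Q 1"
    using P'(3) by auto
  have "prime_chain (Suc (Suc n)) (Q(Suc (Suc n) := P (Suc (Suc n))))"
    using Q P P' unfolding prime_chain_def by (auto simp: le_Suc_eq less_Suc_eq)
  moreover have "(Q(Suc (Suc n) := P (Suc (Suc n)))) 0 = P 0" "x \<in> (Q(Suc (Suc n) := P (Suc (Suc n)))) 1"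
    "(Q(Suc (Suc n) := P (Suc (Suc n)))) (Suc (Suc n)) = P (Suc (Suc n))"
    using Q by auto
  ultimately show ?case by blast
qed

text \<open>For the maximal ideal of a local ring this is the inequality between the number of generators and the
dimension, in the form that is needed for flags.\<close>

lemma prime_chain_through_elements:
  assumes "prime_chain (length xs) P" "set xs \<subseteq> P (length xs)"
  shows "\<exists>Q. prime_chain (length xs) Q \<and> Q 0 = P 0 \<and> Q (length xs) = P (length xs) \<and>
    (\<forall>i<length xs. xs ! i \<in> Q (Suc i))"
  using assms
proof (induction xs arbitrary: P)
  case Nil
  then show ?case by auto
next
  case (Cons x xs)
  let ?n = "length xs"
  obtain P' where P': "prime_chain (Suc ?n) P'" "P' 0 = P 0" "P' (Suc ?n) = P (Suc ?n)" "x \<in> P' 1"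
    using prime_chain_through_element[of ?n P x] Cons.prems by auto
  have "prime_chain ?n (\<lambda>i. P' (Suc i))" using P'(1) by (auto simp: prime_chain_def)
  from Cons.IH[OF this] obtain Q where Q: "prime_chain ?n Q" "Q 0 = P' 1" "Q ?n = P' (Suc ?n)" "\<forall>i<?n. xs ! i \<in> Q (Suc i)"
    using Cons.prems P'(3) by auto
  let ?Q = "\<lambda>i. case i of 0 \<Rightarrow> P 0 | Suc j \<Rightarrow> Q j"
  have "P' 0 \<subset> P' (Suc 0)" "primeideal (P' 0) R" using P'(1) unfolding prime_chain_def by blast+
  then have "P 0 \<subset> Q 0" "primeideal (P 0) R" using P'(2) Q(2) by auto
  then have "prime_chain (Suc ?n) ?Q" using Q(1) by (auto simp: prime_chain_def split: nat.splits)
  then show ?case using P' Q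
    by (intro exI[of _ ?Q]) (auto simp: nth_Cons split: nat.splits)
qed

text \<open>A regular system of parameters, seen through the primes that its initial segments generate.\<close>

definition regular_flag :: "nat \<Rightarrow> (nat \<Rightarrow> 'a set) \<Rightarrow> (nat \<Rightarrow> 'a) \<Rightarrow> bool" where
  "regular_flag d Q x \<longleftrightarrow> Q 0 = {\<zero>} \<and> (\<forall>i\<le>d. primeideal (Q i) R) \<and>
     (\<forall>i<d. x i \<in> carrier R \<and> x i \<notin> Q i \<and> Q (Suc i) = adjoin (Q i) (x i))"

lemma saturated_local:
  assumes M: "carrier R - M \<subseteq> Units R" and J: "ideal J R"
  shows "saturated M J"
  unfolding saturated_def
proof (intro ballI impI)
  fix s a assume *: "s \<in> carrier R - M" "a \<in> carrier R" "s \<otimes> a \<in> J"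
  then have s: "s \<in> Units R" using M by auto
  then have "a = inv s \<otimes> (s \<otimes> a)" using * by (simp add: m_assoc[symmetric])
  also have "\<dots> \<in> J" using ideal_closed(5)[OF J *(3)] s by auto
  finally show "a \<in> J" .
qed

text \<open>If \<open>d\<close> elements generate the maximal ideal and there is a chain of primes of length \<open>d\<close>, then the ideals generated by
the initial segments are prime. Choose the chain with the \<open>i\<close>-th generator in its \<open>i\<close>-th prime. At the top, prime and
segment ideal coincide, and this descends: if they coincide for \<open>i + 1\<close>, the \<open>i\<close>-th prime \<open>Q\<close> satisfies
\<open>Q = K + x Q\<close> for the segment ideal \<open>K\<close>, and Nakayama's lemma gives \<open>Q = K\<close>.\<close>

lemma regular_local_ring_flag:
  assumes xs: "set xs \<subseteq> carrier R" and M: "Idl (set xs) = M" "primeideal M R" "carrier R - M \<subseteq> Units R"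
    and ch: "prime_chain (length xs) P"
  shows "\<exists>Q. regular_flag (length xs) Q ((!) xs) \<and> Q (length xs) = M"
proof -
  let ?d = "length xs"
  note m = primeideal_closed[OF M(2)]
  have proper: "I \<subseteq> M" if "primeideal I R" for I
  proof
    fix a assume a: "a \<in> I"
    note c = ideal_closed[OF primeideal_closed(1)[OF that]]
    show "a \<in> M"
    proof (rule ccontr)
      assume "a \<notin> M"
      then have "a \<in> Units R" using a c M by auto
      then have "inv a \<otimes> a = \<one>" "inv a \<in> carrier R" by auto
      then show False using c(5)[OF a, of "inv a"] primeideal_closed(2)[OF that] by auto
    qed
  qed
  have xsM: "set xs \<subseteq> M" using genideal_self[OF xs] M(1) by auto
  have "prime_chain ?d (P(?d := M))"
    unfolding prime_chain_def
  proof (intro conjI allI impI)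
    show "primeideal ((P(?d := M)) i) R" if "i \<le> ?d" for i
      using ch M(2) that by (simp add: prime_chain_def)
    fix i assume i: "i < ?d"
    then have "P i \<subset> P (Suc i)" "primeideal (P (Suc i)) R" using ch by (auto simp: prime_chain_def)
    then have "P i \<subset> (P(?d := M)) (Suc i)" using proper[of "P (Suc i)"] by (cases "Suc i = ?d") auto
    then show "(P(?d := M)) i \<subset> (P(?d := M)) (Suc i)" using i by simp
  qed
  from prime_chain_through_elements[OF this] xsM obtain Q where Q: "prime_chain ?d Q" "Q ?d = M" "\<And>i. i < ?d \<Longrightarrow> xs ! i \<in> Q (Suc i)"
    by auto
  have Qp: "primeideal (Q i) R" if "i \<le> ?d" for i using Q(1) that by (auto simp: prime_chain_def)
  have Q_Suc: "Q i \<subset> Q (Suc i)" if "i < ?d" for i using Q(1) that by (auto simp: prime_chain_def)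
  define K where "K i = Idl (set (take i xs))" for i
  have tk: "set (take i xs) \<subseteq> carrier R" for i using xs set_take_subset[of i xs] by auto
  have K: "ideal (K i) R" for i unfolding K_def by (rule genideal_ideal[OF tk])
  have xi: "xs ! i \<in> carrier R" if "i < ?d" for i using xs that by auto
  have K_Suc: "K (Suc i) = adjoin (K i) (xs ! i)" if "i < ?d" for i
  proof
    note a = adjoin_ideal[OF K xi[OF that], of i]
    have ins: "set (take (Suc i) xs) = insert (xs ! i) (set (take i xs))"
      using that by (simp add: take_Suc_conv_app_nth)
    have "set (take i xs) \<subseteq> K i" unfolding K_def by (rule genideal_self[OF tk])
    then have "set (take (Suc i) xs) \<subseteq> adjoin (K i) (xs ! i)" unfolding ins using a(2,3) by blast
    then show "K (Suc i) \<subseteq> adjoin (K i) (xs ! i)"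
      unfolding K_def[of "Suc i"] by (rule genideal_minimal[OF a(1)])
    have s: "set (take (Suc i) xs) \<subseteq> K (Suc i)" unfolding K_def by (rule genideal_self[OF tk])
    have "K i \<subseteq> K (Suc i)" unfolding K_def[of i]
      by (rule genideal_minimal[OF K]) (use s ins in blast)
    then show "adjoin (K i) (xs ! i) \<subseteq> K (Suc i)"
      by (rule adjoin_minimal[OF K]) (use s ins in blast)
  qed
  have KQ: "K i \<subseteq> Q i" if "i \<le> ?d" for i
    using that
  proof (induction i)
    case 0
    have "K 0 = Idl {}" by (simp add: K_def)
    also have "\<dots> \<subseteq> Q 0" by (rule genideal_minimal) (use primeideal_closed(1)[OF Qp[of 0]] in auto)
    finally show ?case .
  next
    case (Suc i)
    then have "K i \<subseteq> Q (Suc i)" using Q_Suc[of i] by auto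
    then show ?case
      using Suc.prems Q(3)[of i] primeideal_closed(1)[OF Qp[of "Suc i"]] K_Suc[of i] adjoin_minimal by auto
  qed
  note sat = saturated_local[OF M(3)]
  have step: "Q i = K i \<and> xs ! i \<notin> Q i" if i: "i < ?d" and eq: "Q (Suc i) = K (Suc i)" for i
  proof -
    note q = primeideal_closed[OF Qp[of i]] and cq = ideal_closed[OF primeideal_closed(1)[OF Qp[of i]]]
    have xn: "xs ! i \<notin> Q i"
    proof
      assume "xs ! i \<in> Q i"
      then have "K (Suc i) \<subseteq> Q i" unfolding K_Suc[OF i] using q(1) KQ[of i] i by (intro adjoin_minimal) auto
      then show False using Q_Suc[OF i] eq by auto
    qed
    have "Q i \<subseteq> K i"
    proof (rule Nakayama_principal[OF M(2) K sat[OF K]])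
      show "xs ! i \<in> M" using xsM i by auto
      show "Q i \<subseteq> carrier R" using cq i by auto
      fix a assume a: "a \<in> Q i"
      then have ac: "a \<in> carrier R" using cq i by auto
      from a have "a \<in> adjoin (K i) (xs ! i)" using Q_Suc[OF i] eq K_Suc[OF i] by auto
      then obtain k r where k: "k \<in> K i" "r \<in> carrier R" "a = k \<oplus> r \<otimes> xs ! i" by (rule adjoinE)
      have kq: "k \<in> Q i" "k \<in> carrier R" using k KQ[of i] i ideal_closed[OF K] by auto
      have "r \<otimes> xs ! i = a \<ominus> k" unfolding k(3) using kq(2) k(2) xi[OF i] by algebra
      also have "\<dots> \<in> Q i" using cq(4) a kq i by auto
      finally have "r \<in> Q i" using q(3)[of r "xs ! i"] xn k(2) xi[OF i] i by auto
      moreover have "\<one> \<otimes> a = k \<oplus> xs ! i \<otimes> r" using k ac kq xi[OF i] by (simp add: m_comm)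
      ultimately show "\<exists>t j b. t \<in> carrier R - M \<and> j \<in> K i \<and> b \<in> Q i \<and> t \<otimes> a = j \<oplus> xs ! i \<otimes> b"
        using m(2) k(1) by blast
    qed
    with KQ[of i] i xn show ?thesis by auto
  qed
  have "Q i = K i" if "i \<le> ?d" for i
    using that
  proof (induction rule: inc_induct)
    case base
    show ?case using Q(2) M(1) by (simp add: K_def)
  next
    case (step n)
    then show ?case using step.hyps \<open>\<And>i. i < ?d \<Longrightarrow> Q (Suc i) = K (Suc i) \<Longrightarrow> Q i = K i \<and> xs ! i \<notin> Q i\<close> by auto
  qed
  then have "regular_flag ?d Q ((!) xs)"
    unfolding regular_flag_def using Qp step K_Suc xi genideal_zero
    by (auto simp: K_def genideal_minimal zeroideal ideal_closed(2)[OF genideal_ideal] subset_antisym)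
  then show ?thesis using Q(2) by blast
qed

end

section \<open>Normality of regular local rings\<close>

context noetherian_cring
begin

lemma adjoin_cong:
  assumes K: "ideal K R" and b: "b \<in> carrier R" "b' \<in> carrier R" "b \<ominus> b' \<in> K"
  shows "adjoin K b = adjoin K b'"
proof -
  have *: "adjoin K b \<subseteq> adjoin K b'" if b: "b \<in> carrier R" "b' \<in> carrier R" "b \<ominus> b' \<in> K" for b b'
  proof (rule adjoin_minimal)
    note a = adjoin_ideal[OF K b(2)]
    show "ideal (adjoin K b') R" "K \<subseteq> adjoin K b'" by (rule a)+
    have "(b \<ominus> b') \<oplus> b' \<in> adjoin K b'" using a b by (intro ideal_closed(3)[OF a(1)]) auto
    then show "b \<in> adjoin K b'" using b by (simp add: minus_eq a_assoc l_neg)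
  qed
  have "b' \<ominus> b = (\<ominus> \<one>) \<otimes> (b \<ominus> b')" using b by algebra
  also have "\<dots> \<in> K" using ideal_closed(5)[OF K b(3)] by auto
  finally show ?thesis using *[OF b] *[OF b(2,1)] by auto
qed

lemma ideal_cong_mem:
  assumes I: "ideal I R" "K \<subseteq> I" and a: "a \<in> carrier R" "a' \<in> carrier R" "a \<ominus> a' \<in> K" "a' \<in> I"
  shows "a \<in> I"
proof -
  have "(a \<ominus> a') \<oplus> a' \<in> I" using I a by (intro ideal_closed(3)[OF I(1)]) auto
  then show ?thesis using a by (simp add: minus_eq a_assoc l_neg)
qed

lemma cong_sym:
  assumes K: "ideal K R" and b: "b \<in> carrier R" "b' \<in> carrier R" "b \<ominus> b' \<in> K"
  shows "b' \<ominus> b \<in> K"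
proof -
  have "b' \<ominus> b = (\<ominus> \<one>) \<otimes> (b \<ominus> b')" using b by algebra
  also have "\<dots> \<in> K" using ideal_closed(5)[OF K b(3)] by auto
  finally show ?thesis .
qed

lemma cong_mult:
  assumes K: "ideal K R" and b: "b \<in> carrier R" "b' \<in> carrier R" "b \<ominus> b' \<in> K"
    and a: "a \<in> carrier R" "a' \<in> carrier R" "a \<ominus> a' \<in> K"
  shows "a \<otimes> b \<ominus> a' \<otimes> b' \<in> K"
proof -
  have "a \<otimes> b \<ominus> a' \<otimes> b' = a \<otimes> (b \<ominus> b') \<oplus> b' \<otimes> (a \<ominus> a')" using a b by algebra
  also have "\<dots> \<in> K" using ideal_closed[OF K] a b by auto
  finally show ?thesis .
qed

lemma cong_refl: "ideal K R \<Longrightarrow> a \<in> carrier R \<Longrightarrow> a \<ominus> a \<in> K"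
  by (simp add: minus_eq r_neg ideal_closed)

lemma cong_pow:
  assumes K: "ideal K R" and b: "b \<in> carrier R" "b' \<in> carrier R" "b \<ominus> b' \<in> K"
  shows "b [^] k \<ominus> b' [^] (k::nat) \<in> K"
proof (induction k)
  case (Suc k)
  then show ?case using cong_mult[OF K b, of "b [^] k" "b' [^] k"] b by simp
qed (use cong_refl[OF K] in simp)

lemma adjoin_mult:
  assumes K: "ideal K R" and b: "b \<in> carrier R" "d \<in> carrier R"
    and a: "a \<in> adjoin K b" "c \<in> adjoin K d"
  shows "a \<otimes> c \<in> adjoin K (b \<otimes> d)"
proof -
  note cK = ideal_closed[OF K]
  from a(1) obtain k r where k: "k \<in> K" "r \<in> carrier R" "a = k \<oplus> r \<otimes> b" by (rule adjoinE)
  from a(2) obtain l s where l: "l \<in> K" "s \<in> carrier R" "c = l \<oplus> s \<otimes> d" by (rule adjoinE)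
  have c: "k \<in> carrier R" "l \<in> carrier R" using k(1) l(1) cK(1) by auto
  have "a \<otimes> c = ((l \<oplus> s \<otimes> d) \<otimes> k \<oplus> (r \<otimes> b) \<otimes> l) \<oplus> (r \<otimes> s) \<otimes> (b \<otimes> d)"
    unfolding k(3) l(3) using c b k(2) l(2) by algebra
  moreover have "(l \<oplus> s \<otimes> d) \<otimes> k \<oplus> (r \<otimes> b) \<otimes> l \<in> K"
    by (rule cK(3); rule cK(5)) (use k(1,2) l(1,2) c b in auto)
  ultimately show ?thesis using k(2) l(2) by (auto intro!: adjoinI)
qed

lemma adjoin_cancel:
  assumes K: "primeideal K R" and c: "y \<in> carrier R" "y \<notin> K" "a \<in> carrier R" "b \<in> carrier R"
    and a: "y \<otimes> a \<in> adjoin K (y \<otimes> b)"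
  shows "a \<in> adjoin K b"
proof -
  note p = primeideal_closed[OF K]
  note cK = ideal_closed[OF p(1)]
  from a obtain k r where k: "k \<in> K" "r \<in> carrier R" "y \<otimes> a = k \<oplus> r \<otimes> (y \<otimes> b)" by (rule adjoinE)
  have kc: "k \<in> carrier R" using k(1) cK(1) by auto
  have "y \<otimes> (a \<ominus> r \<otimes> b) = y \<otimes> a \<ominus> r \<otimes> (y \<otimes> b)" using c(1,3,4) k(2) by algebra
  also have "\<dots> = k" unfolding k(3) using c(1,3,4) k(2) kc by algebra
  finally have "y \<otimes> (a \<ominus> r \<otimes> b) \<in> K" using k(1) by simp
  then have "a \<ominus> r \<otimes> b \<in> K" using p(3)[of y "a \<ominus> r \<otimes> b"] c k(2) by auto
  then have "(a \<ominus> r \<otimes> b) \<oplus> r \<otimes> b \<in> adjoin K b" using k(2) by (rule adjoinI)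
  then show ?thesis using c k(2) by (simp add: minus_eq a_assoc l_neg)
qed

text \<open>When \<open>x\<close> is prime modulo \<open>K\<close> and \<open>b\<close> is not divisible by \<open>x\<close>, the factor \<open>x\<close> of a multiple of \<open>b\<close> must divide the
cofactor.\<close>

lemma adjoin_cancel_regular:
  assumes K: "primeideal K R" and x: "x \<in> carrier R" "x \<notin> K" and K': "primeideal (adjoin K x) R"
    and b: "b \<in> carrier R" "b \<notin> adjoin K x" and y: "y \<in> carrier R" "x [^] (n::nat) \<otimes> y \<in> adjoin K b"
  shows "y \<in> adjoin K b"
proof -
  note p = primeideal_closed[OF K]
  note cK = ideal_closed[OF p(1)]
  note aI = adjoin_ideal[OF p(1) x(1)]
  \<comment> \<open>if \<open>x y = c b\<close> modulo \<open>K\<close>, then \<open>x\<close> divides \<open>c b\<close>, hence \<open>c\<close>, and can be cancelled\<close>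
  have one: "y \<in> adjoin K b" if y: "y \<in> carrier R" "x \<otimes> y \<in> adjoin K b" for y
  proof -
    from y(2) obtain k c where k: "k \<in> K" "c \<in> carrier R" "x \<otimes> y = k \<oplus> c \<otimes> b" by (rule adjoinE)
    have kc: "k \<in> carrier R" using k(1) cK(1) by auto
    have "c \<otimes> b = x \<otimes> y \<ominus> k" unfolding k(3) using k(2) kc b(1) by algebra
    also have "\<dots> \<in> adjoin K x"
      using ideal_closed(4)[OF aI(1) ideal_closed(6)[OF aI(1) aI(3) y(1)]] aI(2) k(1) by blast
    finally have "c \<in> adjoin K x" using primeideal_closed(3)[OF K' k(2) b(1)] b(2) by blast
    then obtain l d where l: "l \<in> K" "d \<in> carrier R" "c = l \<oplus> d \<otimes> x" by (rule adjoinE)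
    have lc: "l \<in> carrier R" using l(1) cK(1) by auto
    have "x \<otimes> y = (k \<oplus> b \<otimes> l) \<oplus> d \<otimes> (x \<otimes> b)"
      unfolding k(3) l(3) using kc lc l(2) b(1) x(1) by algebra
    moreover have "k \<oplus> b \<otimes> l \<in> K" by (rule cK(3)[OF k(1) cK(5)[OF l(1) b(1)]])
    ultimately have "x \<otimes> y \<in> adjoin K (x \<otimes> b)" using l(2) by (auto intro: adjoinI)
    then show ?thesis using adjoin_cancel[OF K x y(1) b(1)] by blast
  qed
  show ?thesis using y(2)
  proof (induction n)
    case (Suc n)
    have "x \<otimes> (x [^] n \<otimes> y) \<in> adjoin K b" using Suc.prems x y by (simp add: m_ac)
    then show ?case using one[of "x [^] n \<otimes> y"] Suc.IH x y by auto
  qed (use y in simp)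
qed

text \<open>Modulo \<open>K\<close>, no nonzero element is divisible by all powers of \<open>x\<close>: the set \<open>I\<close> of elements that
are not of the required form is stable under division by \<open>x\<close>, and Nakayama's lemma applies to it.\<close>

lemma order_along_regular_element:
  assumes M: "primeideal M R" "carrier R - M \<subseteq> Units R" and K: "ideal K R" and x: "x \<in> M"
    and a: "a \<in> carrier R" "a \<notin> K"
  obtains n :: nat and b where "b \<in> carrier R" "b \<notin> adjoin K x" "a \<ominus> x [^] n \<otimes> b \<in> K"
proof -
  have xc: "x \<in> carrier R" using x ideal_closed(1)[OF primeideal_closed(1)[OF M(1)]] by auto
  note cK = ideal_closed[OF K]
  define I where "I = {a \<in> carrier R. \<forall>(n::nat) b. b \<in> carrier R \<longrightarrow> a \<ominus> x [^] n \<otimes> b \<in> K \<longrightarrow> b \<in> adjoin K x}"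
  have "I \<subseteq> K"
  proof (rule Nakayama_principal[OF M(1) K saturated_local[OF M(2) K] x])
    show "I \<subseteq> carrier R" by (auto simp: I_def)
    fix a assume a: "a \<in> I"
    then have ac: "a \<in> carrier R" by (auto simp: I_def)
    have "a \<ominus> x [^] (0::nat) \<otimes> a \<in> K" using ac cK(2) by (simp add: minus_eq r_neg)
    then have "a \<in> adjoin K x" using a ac unfolding I_def by blast
    then obtain k r where k: "k \<in> K" "r \<in> carrier R" "a = k \<oplus> r \<otimes> x" by (rule adjoinE)
    have kc: "k \<in> carrier R" using k(1) cK(1) by auto
    have "r \<in> I"
      unfolding I_def
    proof (intro CollectI conjI allI impI k(2))
      fix n :: nat and b assume b: "b \<in> carrier R" "r \<ominus> x [^] n \<otimes> b \<in> K"
      have "a \<ominus> x [^] Suc n \<otimes> b = k \<oplus> x \<otimes> (r \<ominus> x [^] n \<otimes> b)"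
        unfolding k(3) nat_pow_Suc using kc k(2) xc b(1) nat_pow_closed[OF xc, of n] by algebra
      also have "\<dots> \<in> K" by (rule cK(3)[OF k(1) cK(5)[OF b(2) xc]])
      finally show "b \<in> adjoin K x" using a b(1) unfolding I_def by blast
    qed
    moreover have "\<one> \<otimes> a = k \<oplus> x \<otimes> r" using ac k(2,3) xc m_comm by auto
    ultimately show "\<exists>t j b. t \<in> carrier R - M \<and> j \<in> K \<and> b \<in> I \<and> t \<otimes> a = j \<oplus> x \<otimes> b"
      using k(1) primeideal_closed(2)[OF M(1)] by blast
  qed
  then have "a \<notin> I" using a by auto
  then show thesis using a(1) that unfolding I_def by blast
qed

text \<open>Normality of the domain \<open>R/K\<close> in the form needed for noetherian rings: a fraction \<open>a/b\<close> whose powers have the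
common denominator \<open>f\<close> lies in \<open>R/K\<close> (complete integral closedness). This formulation avoids monic equations and is
stable under the passage from a quotient back to the ring.\<close>

definition normal_mod :: "'a set \<Rightarrow> bool" where
  "normal_mod K \<longleftrightarrow> (\<forall>a\<in>carrier R. \<forall>b\<in>carrier R - K. \<forall>f\<in>carrier R - K.
     (\<forall>k::nat. f \<otimes> a [^] k \<in> adjoin K (b [^] k)) \<longrightarrow> a \<in> adjoin K b)"

lemma normal_modD:
  assumes "normal_mod K" "a \<in> carrier R" "b \<in> carrier R" "b \<notin> K" "f \<in> carrier R" "f \<notin> K"
    "\<And>k::nat. f \<otimes> a [^] k \<in> adjoin K (b [^] k)"
  shows "a \<in> adjoin K b"
  using assms unfolding normal_mod_def by blast

text \<open>The numerators \<open>a\<close> that admit a common denominator \<open>f\<close> prime to \<open>x\<close> form an ideal \<open>I\<close>, by the binomial expansion.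
Normality modulo \<open>x\<close> shows that an element of \<open>I\<close> is a multiple of \<open>b\<close> up to a multiple \<open>x r\<close> of \<open>x\<close>, and \<open>r\<close> again lies in
\<open>I\<close>. Nakayama's lemma finishes the argument.\<close>

lemma normal_mod_regular_denominator:
  assumes M: "primeideal M R" "carrier R - M \<subseteq> Units R"
    and K: "primeideal K R" and x: "x \<in> M" "x \<notin> K" and K': "primeideal (adjoin K x) R"
    and norm: "normal_mod (adjoin K x)"
    and b: "b \<in> carrier R" "b \<notin> adjoin K x" and f: "f \<in> carrier R" "f \<notin> adjoin K x"
    and a: "a \<in> carrier R" "\<And>k::nat. f \<otimes> a [^] k \<in> adjoin K (b [^] k)"
  shows "a \<in> adjoin K b"
proof -
  have xc: "x \<in> carrier R" using x ideal_closed(1)[OF primeideal_closed(1)[OF M(1)]] by auto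
  note p = primeideal_closed[OF K] and p' = primeideal_closed[OF K']
  note cK = ideal_closed[OF p(1)] and aI = adjoin_ideal[OF p(1) xc]
  have bk: "b [^] k \<in> carrier R" "b [^] k \<notin> adjoin K x" for k :: nat using b p'(4)[of b k] by auto
  have bI: "ideal (adjoin K (b [^] k)) R" "K \<subseteq> adjoin K (b [^] k)" "b [^] k \<in> adjoin K (b [^] k)" for k :: nat
    using adjoin_ideal[OF p(1) bk(1)] .
  note cb = ideal_closed[OF bI(1)]
  define I where "I = {a \<in> carrier R. \<exists>f \<in> carrier R - adjoin K x. \<forall>k::nat. f \<otimes> a [^] k \<in> adjoin K (b [^] k)}"
  have I_intro: "a \<in> I" if "a \<in> carrier R" "f \<in> carrier R" "f \<notin> adjoin K x" "\<And>k::nat. f \<otimes> a [^] k \<in> adjoin K (b [^] k)" for a f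
    using that unfolding I_def by blast
  have K_I: "K \<subseteq> I"
  proof
    fix k assume k: "k \<in> K"
    have "\<one> \<otimes> k [^] n \<in> adjoin K (b [^] n)" for n :: nat
    proof (cases n)
      case 0
      then show ?thesis using bI(3)[of 0] by simp
    next
      case (Suc m)
      have kc: "k \<in> carrier R" using k cK(1) by blast
      then have "k [^] n \<in> K" using Suc cK(5)[OF k, of "k [^] m"] by simp
      then have "k [^] n \<in> adjoin K (b [^] n)" using bI(2)[of n] by blast
      then show ?thesis using kc by simp
    qed
    then show "k \<in> I" using I_intro[of k \<one>] p'(2) k cK(1) by auto
  qed
  have b_I: "b \<in> I" using I_intro[of b \<one>] p'(2) b(1) bI(3) by auto
  have I: "ideal I R"
  proof (rule idealI_cring)
    show "I \<subseteq> carrier R" by (auto simp: I_def)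
    show "\<zero> \<in> I" using K_I cK(2) by auto
  next
    fix a r assume "a \<in> I" and r: "r \<in> carrier R"
    then obtain f where f: "a \<in> carrier R" "f \<in> carrier R" "f \<notin> adjoin K x" "\<And>k::nat. f \<otimes> a [^] k \<in> adjoin K (b [^] k)"
      by (auto simp: I_def)
    show "r \<otimes> a \<in> I"
    proof (rule I_intro[OF _ f(2,3)])
      show "r \<otimes> a \<in> carrier R" using r f by auto
      fix k :: nat
      have "f \<otimes> (r \<otimes> a) [^] k = r [^] k \<otimes> (f \<otimes> a [^] k)" using r f(1,2) by (simp add: nat_pow_distrib m_lcomm)
      then show "f \<otimes> (r \<otimes> a) [^] k \<in> adjoin K (b [^] k)" using cb(5)[OF f(4)] r by auto
    qed
  next
    fix a a' assume "a \<in> I" "a' \<in> I"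
    then obtain f f' where f: "a \<in> carrier R" "f \<in> carrier R" "f \<notin> adjoin K x" "\<And>k::nat. f \<otimes> a [^] k \<in> adjoin K (b [^] k)"
      and f': "a' \<in> carrier R" "f' \<in> carrier R" "f' \<notin> adjoin K x" "\<And>k::nat. f' \<otimes> a' [^] k \<in> adjoin K (b [^] k)"
      by (auto simp: I_def)
    \<comment> \<open>the binomial expansion, as an induction over the exponents\<close>
    have *: "((f \<otimes> a [^] i) \<otimes> (f' \<otimes> a' [^] j)) \<otimes> (a \<oplus> a') [^] k \<in> adjoin K (b [^] (i + j + k))" for i j k :: nat
    proof (induction k arbitrary: i j)
      case 0
      have "(f \<otimes> a [^] i) \<otimes> (f' \<otimes> a' [^] j) \<in> adjoin K (b [^] i \<otimes> b [^] j)"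
        by (rule adjoin_mult[OF p(1) bk(1) bk(1) f(4) f'(4)])
      then show ?case using b(1) f(1,2) f'(1,2) by (simp add: nat_pow_mult)
    next
      case (Suc k)
      let ?c = "(a \<oplus> a') [^] k"
      have c: "?c \<in> carrier R" "a [^] i \<in> carrier R" "a' [^] j \<in> carrier R" using f f' by auto
      have "((f \<otimes> a [^] i) \<otimes> (f' \<otimes> a' [^] j)) \<otimes> (a \<oplus> a') [^] Suc k =
        ((f \<otimes> a [^] Suc i) \<otimes> (f' \<otimes> a' [^] j)) \<otimes> ?c \<oplus> ((f \<otimes> a [^] i) \<otimes> (f' \<otimes> a' [^] Suc j)) \<otimes> ?c"
        unfolding nat_pow_Suc using f(1,2) f'(1,2) c by algebra
      also have "\<dots> \<in> adjoin K (b [^] (i + j + Suc k))"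
        by (rule cb(3)) (use Suc.IH[of "Suc i" j] Suc.IH[of i "Suc j"] in simp_all)
      finally show ?case .
    qed
    show "a \<oplus> a' \<in> I"
    proof (rule I_intro[of _ "f \<otimes> f'"])
      show "a \<oplus> a' \<in> carrier R" "f \<otimes> f' \<in> carrier R" using f f' by auto
      show "f \<otimes> f' \<notin> adjoin K x" using p'(3)[OF f(2) f'(2)] f(3) f'(3) by blast
      show "f \<otimes> f' \<otimes> (a \<oplus> a') [^] k \<in> adjoin K (b [^] k)" for k :: nat
        using *[of 0 0 k] f f' by simp
    qed
  qed
  note cI = ideal_closed[OF I]
  have "adjoin K b = adjoin K (b [^] (1::nat))" using b(1) by simp
  then have bI1: "ideal (adjoin K b) R" using bI(1)[of 1] by simp
  have "I \<subseteq> adjoin K b"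
  proof (rule Nakayama_principal[OF M(1) bI1 saturated_local[OF M(2) bI1] x(1)])
    show "I \<subseteq> carrier R" by (rule cI)
    fix a assume aI': "a \<in> I"
    then obtain f where f: "a \<in> carrier R" "f \<in> carrier R" "f \<notin> adjoin K x" "\<And>k::nat. f \<otimes> a [^] k \<in> adjoin K (b [^] k)"
      by (auto simp: I_def)
    have "a \<in> adjoin (adjoin K x) b"
    proof (rule normal_modD[OF norm f(1) b f(2,3)])
      fix k :: nat
      have "adjoin K (b [^] k) \<subseteq> adjoin (adjoin K x) (b [^] k)"
        using aI(2) by (auto simp: adjoin_def)
      then show "f \<otimes> a [^] k \<in> adjoin (adjoin K x) (b [^] k)" using f(4) by blast
    qed
    then obtain k' c where k': "k' \<in> adjoin K x" "c \<in> carrier R" "a = k' \<oplus> c \<otimes> b" by (rule adjoinE)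
    from k'(1) obtain k r where k: "k \<in> K" "r \<in> carrier R" "k' = k \<oplus> r \<otimes> x" by (rule adjoinE)
    have kc: "k \<in> carrier R" using k(1) cK(1) by auto
    have eq: "a = (k \<oplus> c \<otimes> b) \<oplus> x \<otimes> r" unfolding k'(3) k(3) using kc k(2) k'(2) b(1) xc by algebra
    have "x \<otimes> r = a \<ominus> (k \<oplus> c \<otimes> b)" unfolding eq using kc k(2) k'(2) b(1) xc by algebra
    also have "\<dots> \<in> I" using cI(4)[OF aI' cI(3)[OF _ cI(5)[OF b_I k'(2)]]] k(1) K_I by blast
    finally obtain g where g: "g \<in> carrier R" "g \<notin> adjoin K x" "\<And>k::nat. g \<otimes> (x \<otimes> r) [^] k \<in> adjoin K (b [^] k)"
      unfolding I_def by blast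
    have "r \<in> I"
    proof (rule I_intro[OF k(2) g(1,2)])
      fix n :: nat
      have "x [^] n \<otimes> (g \<otimes> r [^] n) = g \<otimes> (x \<otimes> r) [^] n"
        using xc g(1) k(2) by (simp add: nat_pow_distrib m_lcomm)
      then have "x [^] n \<otimes> (g \<otimes> r [^] n) \<in> adjoin K (b [^] n)" using g(3)[of n] by simp
      then show "g \<otimes> r [^] n \<in> adjoin K (b [^] n)"
        using adjoin_cancel_regular[OF K xc x(2) K' bk] g(1) k(2) by blast
    qed
    moreover have "k \<oplus> c \<otimes> b \<in> adjoin K b" using k(1) k'(2) by (rule adjoinI)
    moreover have "\<one> \<otimes> a = (k \<oplus> c \<otimes> b) \<oplus> x \<otimes> r" using eq f(1) by simp
    ultimately show "\<exists>t j b'. t \<in> carrier R - M \<and> j \<in> adjoin K b \<and> b' \<in> I \<and> t \<otimes> a = j \<oplus> x \<otimes> b'"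
      using primeideal_closed(2)[OF M(1)] by blast
  qed
  moreover have "a \<in> I" using I_intro[OF a(1) f a(2)] .
  ultimately show ?thesis by blast
qed

text \<open>Split off the powers of \<open>x\<close> from \<open>a\<close>, \<open>b\<close> and \<open>f\<close>. Comparing the powers of \<open>x\<close> for a large exponent \<open>k\<close> shows that \<open>x\<close> occurs
in \<open>a\<close> at least as often as in \<open>b\<close>; what remains has a denominator that is not divisible by \<open>x\<close>, and
\<open>normal_mod_regular_denominator\<close> applies.\<close>

lemma normal_mod_step:
  assumes M: "primeideal M R" "carrier R - M \<subseteq> Units R"
    and K: "primeideal K R" and x: "x \<in> M" "x \<notin> K" and K': "primeideal (adjoin K x) R"
    and norm: "normal_mod (adjoin K x)"
  shows "normal_mod K"
  unfolding normal_mod_def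
proof (intro ballI impI)
  fix a b f assume a: "a \<in> carrier R" and "b \<in> carrier R - K" "f \<in> carrier R - K"
    and dv: "\<forall>k::nat. f \<otimes> a [^] k \<in> adjoin K (b [^] k)"
  then have b: "b \<in> carrier R" "b \<notin> K" and f: "f \<in> carrier R" "f \<notin> K" by auto
  have xc: "x \<in> carrier R" using x ideal_closed(1)[OF primeideal_closed(1)[OF M(1)]] by auto
  note p = primeideal_closed[OF K] and p' = primeideal_closed[OF K']
  note cK = ideal_closed[OF p(1)] and aI = adjoin_ideal[OF p(1) xc]
  have xn: "x [^] n \<in> carrier R" "x [^] n \<notin> K" for n :: nat using xc x(2) p(4)[OF xc, of n] by auto
  obtain m :: nat and b' where b': "b' \<in> carrier R" "b' \<notin> adjoin K x" "b \<ominus> x [^] m \<otimes> b' \<in> K"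
    by (rule order_along_regular_element[OF M p(1) x(1) b])
  obtain e :: nat and f' where f': "f' \<in> carrier R" "f' \<notin> adjoin K x" "f \<ominus> x [^] e \<otimes> f' \<in> K"
    by (rule order_along_regular_element[OF M p(1) x(1) f])
  note bI = adjoin_ideal[OF p(1) b(1)]
  show "a \<in> adjoin K b"
  proof (cases "a \<in> K")
    case True
    then show ?thesis using bI(2) by blast
  next
    case False
    obtain n :: nat and a' where a': "a' \<in> carrier R" "a' \<notin> adjoin K x" "a \<ominus> x [^] n \<otimes> a' \<in> K"
      by (rule order_along_regular_element[OF M p(1) x(1) a False])
    have eqk: "x [^] (e + n * k) \<otimes> (f' \<otimes> a' [^] k) \<in> adjoin K (x [^] (m * k) \<otimes> b' [^] k)" for k :: nat
    proof -
      have 1: "a [^] k \<ominus> (x [^] n \<otimes> a') [^] k \<in> K" by (rule cong_pow[OF p(1) a _ a'(3)]) (use xc a' in auto)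
      have 2: "b [^] k \<ominus> (x [^] m \<otimes> b') [^] k \<in> K" by (rule cong_pow[OF p(1) b(1) _ b'(3)]) (use xc b' in auto)
      have 3: "f \<otimes> a [^] k \<ominus> (x [^] e \<otimes> f') \<otimes> (x [^] n \<otimes> a') [^] k \<in> K"
        by (rule cong_mult[OF p(1) _ _ 1 _ _ f'(3)]) (use xc a a' f f' in auto)
      have c: "f \<otimes> a [^] k \<in> carrier R" "(x [^] e \<otimes> f') \<otimes> (x [^] n \<otimes> a') [^] k \<in> carrier R"
        "b [^] k \<in> carrier R" "(x [^] m \<otimes> b') [^] k \<in> carrier R" using xc a a' f f' b b' by auto
      have "adjoin K (b [^] k) = adjoin K ((x [^] m \<otimes> b') [^] k)" by (rule adjoin_cong[OF p(1) c(3,4) 2])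
      also have "(x [^] m \<otimes> b') [^] k = x [^] (m * k) \<otimes> b' [^] k" using xc b' by (simp add: nat_pow_distrib nat_pow_pow)
      finally have E: "adjoin K (b [^] k) = adjoin K (x [^] (m * k) \<otimes> b' [^] k)" .
      note I = adjoin_ideal[OF p(1) c(3)]
      have "(x [^] e \<otimes> f') \<otimes> (x [^] n \<otimes> a') [^] k \<in> adjoin K (b [^] k)"
        by (rule ideal_cong_mem[OF I(1,2) c(2,1) cong_sym[OF p(1) c(1,2) 3]]) (use dv in blast)
      also have "(x [^] e \<otimes> f') \<otimes> (x [^] n \<otimes> a') [^] k = (x [^] e \<otimes> x [^] (n * k)) \<otimes> (f' \<otimes> a' [^] k)"
        using xc a' f' by (simp add: nat_pow_distrib nat_pow_pow m_ac)
      also have "x [^] e \<otimes> x [^] (n * k) = x [^] (e + n * k)" using xc by (simp add: nat_pow_mult)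
      finally show ?thesis unfolding E .
    qed
    have "m \<le> n"
    proof (rule ccontr)
      assume "\<not> m \<le> n"
      then obtain d where d: "m = Suc (n + d)" using less_imp_Suc_add[of n m] by (auto simp: not_le)
      \<comment> \<open>for this exponent the factor \<open>x\<^bsup>mk\<^esup>\<close> on the right exceeds \<open>x\<^bsup>e+nk\<^esup>\<close> on the left, so \<open>x\<close> would divide \<open>f' a'\<^bsup>k\<^esup>\<close>\<close>
      define k where "k = Suc e"
      define w where "w = x [^] (d * k) \<otimes> b' [^] k"
      have mk: "m * k = (e + n * k) + (1 + d * k)" unfolding d k_def by (simp add: algebra_simps)
      have wc: "w \<in> carrier R" using xc b' by (auto simp: w_def)
      have "x [^] (m * k) \<otimes> b' [^] k = x [^] (e + n * k) \<otimes> (x \<otimes> w)"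
        unfolding mk w_def using xc b' by (simp add: nat_pow_mult[symmetric] m_ac)
      then have "f' \<otimes> a' [^] k \<in> adjoin K (x \<otimes> w)"
        using eqk[of k] adjoin_cancel[OF K xn] f'(1) a'(1) xc wc by auto
      moreover have "x \<otimes> w \<in> adjoin K x" using ideal_closed(6)[OF aI(1) aI(3) wc] .
      then have "adjoin K (x \<otimes> w) \<subseteq> adjoin K x" by (rule adjoin_minimal[OF aI(1,2)])
      ultimately have "f' \<otimes> a' [^] k \<in> adjoin K x" by blast
      then show False using p'(3)[of f' "a' [^] k"] p'(4)[of a' k] f'(1,2) a'(1,2) by blast
    qed
    then obtain d where d: "n = m + d" using le_Suc_ex by blast
    define a'' where "a'' = x [^] d \<otimes> a'"
    have a''c: "a'' \<in> carrier R" using xc a' by (auto simp: a''_def)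
    have "a'' \<in> adjoin K b'"
    proof (rule normal_mod_regular_denominator[OF M K x K' norm b'(1,2) f'(1,2) a''c])
      fix k :: nat
      have bk: "b' [^] k \<in> carrier R" "b' [^] k \<notin> adjoin K x" using b'(1,2) p'(4)[of b' k] by auto
      have c: "x [^] e \<otimes> (f' \<otimes> a'' [^] k) \<in> carrier R" "f' \<otimes> a'' [^] k \<in> carrier R" using xc f'(1) a''c by auto
      have nk: "e + n * k = m * k + (e + d * k)" unfolding d by (simp add: algebra_simps)
      have "x [^] (e + n * k) \<otimes> (f' \<otimes> a' [^] k) = x [^] (m * k) \<otimes> (x [^] e \<otimes> (f' \<otimes> a'' [^] k))"
        unfolding nk a''_def using xc f'(1) a'(1) by (simp add: nat_pow_mult[symmetric] nat_pow_distrib nat_pow_pow m_ac)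
      then have "x [^] e \<otimes> (f' \<otimes> a'' [^] k) \<in> adjoin K (b' [^] k)"
        using eqk[of k] adjoin_cancel[OF K xn c(1) bk(1)] by auto
      then show "f' \<otimes> a'' [^] k \<in> adjoin K (b' [^] k)"
        using adjoin_cancel_regular[OF K xc x(2) K' bk c(2)] by blast
    qed
    moreover note xm = adjoin_ideal[OF p(1) xn(1)[of m]]
    ultimately have "x [^] m \<otimes> a'' \<in> adjoin K (x [^] m \<otimes> b')"
      using adjoin_mult[OF p(1) xn(1) b'(1) xm(3)] by blast
    also have "adjoin K (x [^] m \<otimes> b') = adjoin K b"
      by (rule adjoin_cong[OF p(1) b(1) _ b'(3), symmetric]) (use xc b' in auto)
    also have "x [^] m \<otimes> a'' = x [^] n \<otimes> a'"
      unfolding a''_def d using xc a' by (simp add: nat_pow_mult[symmetric] m_assoc)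
    finally show ?thesis using ideal_cong_mem[OF bI(1,2) a _ a'(3)] xc a'(1) by auto
  qed
qed

text \<open>Descend along the flag; modulo the maximal ideal every nonzero element is a unit.\<close>

lemma regular_flag_normal:
  assumes flag: "regular_flag d Q x" and M: "Q d = M" "carrier R - M \<subseteq> Units R"
  shows "normal_mod {\<zero>}"
proof -
  have Qp: "primeideal (Q i) R" if "i \<le> d" for i using flag that by (auto simp: regular_flag_def)
  have x: "x i \<in> carrier R" "x i \<notin> Q i" "Q (Suc i) = adjoin (Q i) (x i)" if "i < d" for i
    using flag that by (auto simp: regular_flag_def)
  have Mp: "primeideal M R" using Qp[of d] M by auto
  have Q_Suc: "Q i \<subseteq> Q (Suc i)" "x i \<in> Q (Suc i)" if "i < d" for i
    using adjoin_ideal[OF primeideal_closed(1)[OF Qp[of i]] x(1)[OF that]] x(3)[OF that] that by auto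
  have QM: "Q i \<subseteq> M" if "i \<le> d" for i
    using that by (induction rule: inc_induct) (use M(1) Q_Suc in auto)
  have "normal_mod (Q i)" if "i \<le> d" for i
    using that
  proof (induction rule: inc_induct)
    case base
    show ?case unfolding M(1) normal_mod_def
    proof (intro ballI impI)
      fix a b assume a: "a \<in> carrier R" "b \<in> carrier R - M"
      then have b: "b \<in> Units R" using M by auto
      then have "\<zero> \<oplus> (a \<otimes> inv b) \<otimes> b \<in> adjoin M b"
        using a ideal_closed(2)[OF primeideal_closed(1)[OF Mp]] by (intro adjoinI) auto
      then show "a \<in> adjoin M b" using a b by (simp add: m_assoc)
    qed
  next
    case (step i)
    have "x i \<in> M" using Q_Suc(2)[OF step.hyps(2)] QM[of "Suc i"] step.hyps by auto
    moreover have "primeideal (adjoin (Q i) (x i)) R" "normal_mod (adjoin (Q i) (x i))"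
      using Qp[of "Suc i"] step x(3)[OF step.hyps(2)] by auto
    ultimately show ?case
      using normal_mod_step[OF Mp M(2) Qp[of i]] x(2)[OF step.hyps(2)] step.hyps by auto
  qed
  from this[of 0] show ?thesis using flag by (auto simp: regular_flag_def)
qed

text \<open>Let \<open>y\<close> have annihilator \<open>P\<close> modulo \<open>f\<close>. If \<open>y P \<subseteq> f P\<close>, then \<open>f (y/f)\<^sup>k\<close> lies in \<open>P\<close> for all \<open>k\<close>, so
\<open>y/f\<close> belongs to the ring by normality, and \<open>1\<close> would annihilate \<open>y\<close>. Hence \<open>t y = s f\<close> for some \<open>t\<close> in \<open>P\<close> and some \<open>s\<close> outside
\<open>P\<close>, and this \<open>t\<close> generates \<open>P\<close> locally.\<close>

lemma normal_local_uniformizer: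
  assumes norm: "normal_mod {\<zero>}" and Z: "primeideal {\<zero>} R"
    and P: "primeideal P R" and f: "f \<in> P" "f \<noteq> \<zero>"
    and nil: "\<And>z. z \<in> P \<Longrightarrow> \<exists>(n::nat) s r. s \<in> carrier R - P \<and> r \<in> carrier R \<and> s \<otimes> z [^] n = r \<otimes> f"
  shows "\<exists>t\<in>P. \<forall>z\<in>P. \<exists>s\<in>carrier R - P. \<exists>r\<in>carrier R. s \<otimes> z = r \<otimes> t"
proof -
  note p = primeideal_closed[OF P] and z = primeideal_closed[OF Z]
  note cP = ideal_closed[OF p(1)]
  have fc: "f \<in> carrier R" using f(1) cP(1) by blast
  have adj: "a \<in> adjoin {\<zero>} b \<longleftrightarrow> (\<exists>r\<in>carrier R. a = r \<otimes> b)" if "b \<in> carrier R" for a b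
  proof -
    have "\<zero> \<oplus> r \<otimes> b = r \<otimes> b" if "r \<in> carrier R" for r using that \<open>b \<in> carrier R\<close> by simp
    then show ?thesis using adjoinI[of \<zero> "{\<zero>}" _ b] by (auto elim!: adjoinE)
  qed
  have cancel: "a = b" if "a \<in> carrier R" "b \<in> carrier R" "a \<otimes> f = b \<otimes> f" for a b
  proof -
    have "(a \<ominus> b) \<otimes> f = a \<otimes> f \<ominus> b \<otimes> f" using that(1,2) fc by algebra
    also have "\<dots> = \<zero>" using that fc by (simp add: minus_eq r_neg)
    finally have "a \<ominus> b = \<zero>" using z(3)[of "a \<ominus> b" f] that(1,2) fc f(2) by auto
    then show ?thesis using that(1,2) by (simp add: r_right_minus_eq)
  qed
  note I = adjoin_ideal[OF z(1) fc]
  have I_P: "adjoin {\<zero>} f \<subseteq> P" by (rule adjoin_minimal[OF p(1)]) (use cP(2) f in auto)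
  obtain y where y: "y \<in> carrier R" "{z \<in> carrier R. z \<otimes> y \<in> adjoin {\<zero>} f} = P"
  proof (rule associated_prime[OF P I(1) I_P])
    fix z assume "z \<in> P"
    from nil[OF this] show "\<exists>(n::nat) s. s \<in> carrier R - P \<and> s \<otimes> z [^] n \<in> adjoin {\<zero>} f"
      unfolding adj[OF fc] by blast
  qed blast
  have yP: "\<exists>r\<in>carrier R. z \<otimes> y = r \<otimes> f" if "z \<in> P" for z
  proof -
    have "z \<otimes> y \<in> adjoin {\<zero>} f" using that y(2) by blast
    then show ?thesis by (simp add: adj[OF fc])
  qed
  have "y \<notin> adjoin {\<zero>} f" 
  proof
    assume "y \<in> adjoin {\<zero>} f"
    then have "\<one> \<in> {z \<in> carrier R. z \<otimes> y \<in> adjoin {\<zero>} f}" using y(1) by simp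
    then show False unfolding y(2) using p(2) by blast
  qed
  have "\<exists>t\<in>P. \<exists>s\<in>carrier R - P. t \<otimes> y = s \<otimes> f"
  proof (rule ccontr)
    assume no: "\<not> ?thesis"
    have all: "\<exists>r\<in>P. z \<otimes> y = r \<otimes> f" if "z \<in> P" for z
      using yP[OF that] no that by blast
    have "\<exists>r\<in>P. f \<otimes> y [^] k = r \<otimes> f [^] k" for k :: nat
    proof (induction k)
      case (Suc k)
      then obtain r where r: "r \<in> P" "f \<otimes> y [^] k = r \<otimes> f [^] k" by blast
      then obtain r' where r': "r' \<in> P" "r \<otimes> y = r' \<otimes> f" using all by blast
      have c: "r \<in> carrier R" "r' \<in> carrier R" using r(1) r'(1) cP(1) by auto
      have "f \<otimes> y [^] Suc k = (f \<otimes> y [^] k) \<otimes> y" using y(1) fc by (simp add: m_assoc)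
      also have "\<dots> = (r \<otimes> y) \<otimes> f [^] k" unfolding r(2) using c y(1) fc by (simp add: m_ac)
      also have "\<dots> = r' \<otimes> f [^] Suc k" unfolding r'(2) using c y(1) fc by (simp add: m_ac)
      finally show ?case using r'(1) by blast
    next
      case 0
      show ?case using f(1) fc by (intro bexI[of _ f]) simp_all
    qed
    then have "f \<otimes> y [^] k \<in> adjoin {\<zero>} (f [^] k)" for k :: nat
      using adj[of "f [^] k"] fc cP(1) by (meson nat_pow_closed subsetD)
    then have "y \<in> adjoin {\<zero>} f" using normal_modD[OF norm y(1) fc _ fc] f(2) by blast
    then show False using \<open>y \<notin> adjoin {\<zero>} f\<close> by blast
  qed
  then obtain t s where t: "t \<in> P" "s \<in> carrier R" "s \<notin> P" "t \<otimes> y = s \<otimes> f" by blast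
  have tc: "t \<in> carrier R" using t(1) cP(1) by blast
  have "\<exists>s\<in>carrier R - P. \<exists>r\<in>carrier R. s \<otimes> z = r \<otimes> t" if zP: "z \<in> P" for z
  proof -
    obtain r where r: "r \<in> carrier R" "z \<otimes> y = r \<otimes> f" using yP[OF zP] by blast
    have zc: "z \<in> carrier R" using zP cP(1) by blast
    have "(s \<otimes> z) \<otimes> f = z \<otimes> (t \<otimes> y)" unfolding t(4) using t(2) zc fc by (simp add: m_ac)
    also have "\<dots> = t \<otimes> (z \<otimes> y)" using tc zc y(1) by (simp add: m_ac)
    also have "\<dots> = (r \<otimes> t) \<otimes> f" unfolding r(2) using tc r(1) fc by (simp add: m_ac)
    finally have "s \<otimes> z = r \<otimes> t" using cancel t(2) zc r(1) tc by blast
    then show ?thesis using t(2,3) r(1) by blast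
  qed
  then show ?thesis using t(1) by blast
qed

end

text \<open>The infimum and the supremum in the definition of a regular local ring are attained: some generating
system of the maximal ideal and some chain of primes have the same length, and they give a flag.\<close>

lemma regular_local_ring_normal:
  assumes reg: "regular_local_ring L"
  shows "noetherian_cring L" "noetherian_cring.normal_mod L {\<zero>\<^bsub>L\<^esub>}" "primeideal {\<zero>\<^bsub>L\<^esub>} L"
proof -
  let ?M = "nonunits L"
  have L: "cring L" "noetherian_ring L" "ideal ?M L"
    and dim: "(INF S\<in>{S. S \<subseteq> ?M \<and> finite S \<and> Idl\<^bsub>L\<^esub> S = ?M}. enat (card S)) = krull_dim L"
    using reg by (auto simp: regular_local_ring_def)
  interpret cring L by (rule L)
  interpret noetherian_ring L by (rule L)
  interpret noetherian_cring L ..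
  show "noetherian_cring L" ..
  have MU: "carrier L - ?M \<subseteq> Units L" by (auto simp: nonunits_def)
  have M: "primeideal ?M L"
  proof (rule primeidealI_cring[OF L(3)])
    show "\<one>\<^bsub>L\<^esub> \<notin> ?M" by (auto simp: nonunits_def)
    fix a b assume "a \<in> carrier L" "b \<in> carrier L" "a \<otimes>\<^bsub>L\<^esub> b \<in> ?M"
    then show "a \<in> ?M \<or> b \<in> ?M" by (auto simp: nonunits_def)
  qed
  define C where "C = {S. S \<subseteq> ?M \<and> finite S \<and> Idl\<^bsub>L\<^esub> S = ?M}"
  have "C \<noteq> {}"
  proof -
    obtain S where S: "S \<subseteq> carrier L" "finite S" "?M = Idl\<^bsub>L\<^esub> S" using finetely_gen[OF L(3)] by auto
    then have "S \<in> C" using genideal_self[OF S(1)] by (auto simp: C_def)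
    then show ?thesis by auto
  qed
  then have "(\<lambda>S. enat (card S)) ` C \<noteq> {}" by simp
  then have "Inf ((\<lambda>S. enat (card S)) ` C) \<in> (\<lambda>S. enat (card S)) ` C"
    unfolding Inf_enat_def using LeastI_ex[of "\<lambda>x. x \<in> (\<lambda>S. enat (card S)) ` C"] by (simp only: if_False ex_in_conv simp_thms)
  then obtain S where S: "S \<in> C" "krull_dim L = enat (card S)"
    using dim unfolding C_def[symmetric] by auto
  then have S': "S \<subseteq> ?M" "finite S" "Idl\<^bsub>L\<^esub> S = ?M" by (auto simp: C_def)
  obtain xs where xs: "set xs = S" "length xs = card S"
    using finite_distinct_list[OF S'(2)] distinct_card by metis
  have "\<exists>P. prime_chain (length xs) P"
  proof (cases "length xs = 0")
    case True
    then show ?thesis using M by (intro exI[of _ "\<lambda>_. ?M"]) (simp add: prime_chain_def)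
  next
    case False
    define E where "E = {enat n | n. \<exists>P. prime_chain n P}"
    have E: "Sup E = enat (length xs)" using S(2) xs(2) unfolding krull_dim_def E_def prime_chain_def by simp
    have "finite E"
      by (rule finite_enat_bounded[of E "length xs"]) (use E Sup_upper[of _ E] in auto)
    moreover have "E \<noteq> {}" using E False by (auto simp: bot_enat_def zero_enat_def)
    ultimately have "Sup E \<in> E" by (simp add: Sup_enat_def)
    then show ?thesis unfolding E by (auto simp: E_def)
  qed
  then obtain P where P: "prime_chain (length xs) P" ..
  have xc: "set xs \<subseteq> carrier L" using S'(1) xs(1) by (auto simp: nonunits_def)
  obtain Q where Q: "regular_flag (length xs) Q ((!) xs)" "Q (length xs) = ?M"
    using regular_local_ring_flag[OF xc _ M MU P] xs(1) S'(3) by auto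
  show "normal_mod {\<zero>\<^bsub>L\<^esub>}" by (rule regular_flag_normal[OF Q MU])
  show "primeideal {\<zero>\<^bsub>L\<^esub>} L" using Q(1) by (auto simp: regular_flag_def)
qed

section \<open>Extension of homomorphisms to an algebraically closed field\<close>

hide_const (open) up_ring.coeff up_ring.monom module.smult

definition subring_set :: "'r::comm_ring_1 set \<Rightarrow> bool" where
  "subring_set A \<longleftrightarrow> 0 \<in> A \<and> 1 \<in> A \<and> (\<forall>a\<in>A. \<forall>b\<in>A. a + b \<in> A \<and> a - b \<in> A \<and> a * b \<in> A)"

definition coeffs_in :: "'r::comm_ring_1 set \<Rightarrow> 'r poly \<Rightarrow> bool" where
  "coeffs_in A p \<longleftrightarrow> (\<forall>i. coeff p i \<in> A)"

text \<open>The subring generated by \<open>A\<close> and \<open>x\<close>, when \<open>A\<close> is a subring.\<close>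

definition adjoin_elem :: "'r::comm_ring_1 set \<Rightarrow> 'r \<Rightarrow> 'r set" where
  "adjoin_elem A x = {poly p x | p. coeffs_in A p}"

definition hom_on :: "'r::comm_ring_1 set \<Rightarrow> ('r \<Rightarrow> 'k::field) \<Rightarrow> bool" where
  "hom_on A \<chi> \<longleftrightarrow> \<chi> 0 = 0 \<and> \<chi> 1 = 1 \<and> (\<forall>a\<in>A. \<forall>b\<in>A. \<chi> (a + b) = \<chi> a + \<chi> b \<and> \<chi> (a * b) = \<chi> a * \<chi> b)"

lemma infinite_alg_closed: "infinite (UNIV :: 'k::alg_closed_field set)"
proof
  assume fin: "finite (UNIV :: 'k set)"
  define p where "p = (\<Prod>a\<in>(UNIV::'k set). [:- a, 1:]) + 1"
  have d: "degree (\<Prod>a\<in>(UNIV::'k set). [:- a, 1:]) = card (UNIV::'k set)"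
    by (subst degree_prod_eq_sum_degree) (auto simp: fin)
  have "card (UNIV::'k set) > 0" using fin by (simp add: card_gt_0_iff)
  then have "degree p > 0" unfolding p_def using d by (subst degree_add_eq_left) auto
  then obtain z where "poly p z = 0" using alg_closed_imp_poly_has_root by blast
  moreover have "(\<Prod>a\<in>(UNIV::'k set). z - a) = 0" using fin by (intro prod_zero) auto
  ultimately show False by (simp add: p_def poly_prod)
qed

text \<open>The Nullstellensatz is proved by extending homomorphisms along \<open>A \<subseteq> A[x]\<close> modulo a prime
\<open>Q\<close> of a larger ring \<open>P\<close>. Rings are sets of elements of one type and \<open>Q\<close> stays fixed, so neither quotients nor
fraction fields of domains have to be formed.\<close>

locale prime_over_subring =
  fixes P A :: "'r::comm_ring_1 set" and Q :: "'r set" and x :: 'r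
  assumes P: "subring_set P" and A: "subring_set A" "A \<subseteq> P" and x: "x \<in> P"
    and Q: "Q \<subseteq> P" "0 \<in> Q" "1 \<notin> Q" "\<And>a b. a \<in> Q \<Longrightarrow> b \<in> Q \<Longrightarrow> a + b \<in> Q"
      "\<And>a b. a \<in> P \<Longrightarrow> b \<in> Q \<Longrightarrow> a * b \<in> Q"
      "\<And>a b. a \<in> P \<Longrightarrow> b \<in> P \<Longrightarrow> a * b \<in> Q \<Longrightarrow> a \<in> Q \<or> b \<in> Q"
begin

lemma A_closed: "0 \<in> A" "1 \<in> A" "\<And>a b. a \<in> A \<Longrightarrow> b \<in> A \<Longrightarrow> a + b \<in> A"
   "\<And>a b. a \<in> A \<Longrightarrow> b \<in> A \<Longrightarrow> a - b \<in> A" "\<And>a b. a \<in> A \<Longrightarrow> b \<in> A \<Longrightarrow> a * b \<in> A"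
   "\<And>a n. a \<in> A \<Longrightarrow> a ^ n \<in> A" "\<And>a. a \<in> A \<Longrightarrow> - a \<in> A"
proof -
  show *: "0 \<in> A" "1 \<in> A" "\<And>a b. a \<in> A \<Longrightarrow> b \<in> A \<Longrightarrow> a + b \<in> A"
   "\<And>a b. a \<in> A \<Longrightarrow> b \<in> A \<Longrightarrow> a - b \<in> A" "\<And>a b. a \<in> A \<Longrightarrow> b \<in> A \<Longrightarrow> a * b \<in> A"
    using A(1) by (auto simp: subring_set_def)
  show "a ^ n \<in> A" if "a \<in> A" for a n using that * by (induction n) auto
  show "- a \<in> A" if "a \<in> A" for a using *(4)[OF *(1) that] by simp
qed

lemma P_closed: "0 \<in> P" "1 \<in> P" "\<And>a b. a \<in> P \<Longrightarrow> b \<in> P \<Longrightarrow> a + b \<in> P"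
   "\<And>a b. a \<in> P \<Longrightarrow> b \<in> P \<Longrightarrow> a - b \<in> P" "\<And>a b. a \<in> P \<Longrightarrow> b \<in> P \<Longrightarrow> a * b \<in> P"
   "\<And>a n. a \<in> P \<Longrightarrow> a ^ n \<in> P"
proof -
  show *: "0 \<in> P" "1 \<in> P" "\<And>a b. a \<in> P \<Longrightarrow> b \<in> P \<Longrightarrow> a + b \<in> P"
   "\<And>a b. a \<in> P \<Longrightarrow> b \<in> P \<Longrightarrow> a - b \<in> P" "\<And>a b. a \<in> P \<Longrightarrow> b \<in> P \<Longrightarrow> a * b \<in> P"
    using P by (auto simp: subring_set_def)
  show "a ^ n \<in> P" if "a \<in> P" for a n using that * by (induction n) auto
qed

lemma Q_minus: "a \<in> Q \<Longrightarrow> b \<in> Q \<Longrightarrow> a - b \<in> Q"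
  using Q(4)[of a "- 1 * b"] Q(5)[of "-1" b] P_closed(4)[of 0 1] P_closed by auto

lemma Q_pow: "a \<in> P \<Longrightarrow> a ^ n \<in> Q \<Longrightarrow> a \<in> Q"
  by (induction n) (use Q(3) Q(6) P_closed(6) in auto)

lemma sum_A: "finite I \<Longrightarrow> (\<And>i. i \<in> I \<Longrightarrow> h i \<in> A) \<Longrightarrow> sum h I \<in> A"
  by (induction I rule: finite_induct) (auto intro: A_closed)

lemma sum_Q: "finite I \<Longrightarrow> (\<And>i. i \<in> I \<Longrightarrow> h i \<in> Q) \<Longrightarrow> sum h I \<in> Q"
  by (induction I rule: finite_induct) (auto intro: Q)

lemma coeffs_in_closed:
  "coeffs_in A 0" "a \<in> A \<Longrightarrow> coeffs_in A [:a:]" "a \<in> A \<Longrightarrow> coeffs_in A (monom a n)"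
  "coeffs_in A p \<Longrightarrow> coeffs_in A q \<Longrightarrow> coeffs_in A (p + q)"
  "coeffs_in A p \<Longrightarrow> coeffs_in A q \<Longrightarrow> coeffs_in A (p - q)"
  "coeffs_in A p \<Longrightarrow> coeffs_in A q \<Longrightarrow> coeffs_in A (p * q)"
  "a \<in> A \<Longrightarrow> coeffs_in A p \<Longrightarrow> coeffs_in A (smult a p)"
proof -
  show "coeffs_in A 0" "a \<in> A \<Longrightarrow> coeffs_in A [:a:]" "a \<in> A \<Longrightarrow> coeffs_in A (monom a n)"
    using A_closed(1) by (auto simp: coeffs_in_def coeff_pCons split: nat.splits)
  show "coeffs_in A p \<Longrightarrow> coeffs_in A q \<Longrightarrow> coeffs_in A (p + q)"
    "coeffs_in A p \<Longrightarrow> coeffs_in A q \<Longrightarrow> coeffs_in A (p - q)"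
    "a \<in> A \<Longrightarrow> coeffs_in A p \<Longrightarrow> coeffs_in A (smult a p)"
    using A_closed(3-5) by (auto simp: coeffs_in_def)
  show "coeffs_in A p \<Longrightarrow> coeffs_in A q \<Longrightarrow> coeffs_in A (p * q)"
    unfolding coeffs_in_def coeff_mult by (intro allI sum_A A_closed(5)) auto
qed

lemma coeffs_in_coeff: "coeffs_in A p \<Longrightarrow> coeff p i \<in> A"
  by (simp add: coeffs_in_def)

lemma poly_in_P:
  assumes "coeffs_in A p" shows "poly p x \<in> P"
  using assms
proof (induction p)
  case 0
  then show ?case using P_closed(1) by simp
next
  case (pCons a p)
  have "coeff (pCons a p) 0 \<in> A" "\<And>i. coeff (pCons a p) (Suc i) \<in> A" using pCons.prems unfolding coeffs_in_def by blast+
  then have "a \<in> A" "coeffs_in A p" by (auto simp: coeffs_in_def)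
  then show ?case using pCons.IH A(2) x P_closed(3,5) by auto
qed

lemma adjoin_elem_I: "coeffs_in A p \<Longrightarrow> poly p x \<in> adjoin_elem A x"
  by (auto simp: adjoin_elem_def)

lemma adjoin_elem_subring: "subring_set (adjoin_elem A x)" "adjoin_elem A x \<subseteq> P" "A \<subseteq> adjoin_elem A x" "x \<in> adjoin_elem A x"
proof -
  have c: "poly p x + poly q x \<in> adjoin_elem A x" "poly p x - poly q x \<in> adjoin_elem A x" "poly p x * poly q x \<in> adjoin_elem A x"
    if "coeffs_in A p" "coeffs_in A q" for p q
    using adjoin_elem_I[OF coeffs_in_closed(4)[OF that]] adjoin_elem_I[OF coeffs_in_closed(5)[OF that]]
      adjoin_elem_I[OF coeffs_in_closed(6)[OF that]] by simp_all
  show A': "A \<subseteq> adjoin_elem A x"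
  proof
    fix a assume "a \<in> A"
    then show "a \<in> adjoin_elem A x" using adjoin_elem_I[OF coeffs_in_closed(2)[of a]] by simp
  qed
  show "subring_set (adjoin_elem A x)"
    unfolding subring_set_def
  proof (intro conjI ballI)
    show "0 \<in> adjoin_elem A x" "1 \<in> adjoin_elem A x" using A' A_closed by auto
    fix a b assume "a \<in> adjoin_elem A x" "b \<in> adjoin_elem A x"
    then obtain p q where "coeffs_in A p" "coeffs_in A q" "a = poly p x" "b = poly q x" unfolding adjoin_elem_def by blast
    then show "a + b \<in> adjoin_elem A x" "a - b \<in> adjoin_elem A x" "a * b \<in> adjoin_elem A x" using c by auto
  qed
  show "adjoin_elem A x \<subseteq> P" using poly_in_P by (auto simp: adjoin_elem_def)
  have "coeffs_in A (monom 1 1)" by (rule coeffs_in_closed) (rule A_closed)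
  from adjoin_elem_I[OF this] show "x \<in> adjoin_elem A x" by (simp add: poly_monom)
qed

lemma pseudo_division:
  assumes F: "coeffs_in A F" "degree F = m" and h: "coeffs_in A h"
  shows "\<exists>e q s. coeffs_in A q \<and> coeffs_in A s \<and> smult (lead_coeff F ^ e) h = q * F + s \<and>
    (s = 0 \<or> degree s < m) \<and> degree q \<le> degree h - m"
  using h
proof (induction "degree h" arbitrary: h rule: less_induct)
  case less
  note cc = coeffs_in_closed
  let ?a = "lead_coeff F"
  have aA: "?a \<in> A" using F by (simp add: coeffs_in_coeff)
  show ?case
  proof (cases "degree h < m")
    case True
    then show ?thesis using less.prems cc(1) by (intro exI[of _ 0] exI[of _ 0] exI[of _ h]) auto
  next
    case False
    let ?n = "degree h"
    define q0 where "q0 = monom (lead_coeff h) (?n - m)"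
    define h' where "h' = smult ?a h - q0 * F"
    have q0: "coeffs_in A q0" "degree q0 \<le> ?n - m"
      unfolding q0_def using less.prems by (auto intro: cc coeffs_in_coeff degree_monom_le)
    have h'A: "coeffs_in A h'" unfolding h'_def using less.prems F q0 aA by (intro cc) auto
    have le: "degree h' \<le> ?n"
      unfolding h'_def
    proof (rule degree_diff_le)
      show "degree (smult ?a h) \<le> ?n" by (rule degree_smult_le)
      show "degree (q0 * F) \<le> ?n" using degree_mult_le[of q0 F] q0(2) F(2) False by linarith
    qed
    have "coeff (q0 * F) ?n = lead_coeff h * coeff F m"
      unfolding q0_def using False by (simp add: coeff_monom_mult)
    then have top: "coeff h' ?n = 0" using F(2) by (simp add: h'_def mult.commute)
    have eq: "smult ?a h = q0 * F + h'" by (simp add: h'_def)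
    show ?thesis
    proof (cases "?n = 0")
      case True
      then have "h' = 0" using le top by (metis bot_nat_0.extremum_uniqueI leading_coeff_0_iff)
      then show ?thesis using eq q0 cc(1) by (intro exI[of _ 1] exI[of _ q0] exI[of _ 0]) auto
    next
      case False
      then have "degree h' < ?n" using le top
        by (metis le_neq_implies_less leading_coeff_0_iff degree_0 neq0_conv)
      from less.hyps[OF this h'A] obtain e q s where IH: "coeffs_in A q" "coeffs_in A s" "smult (?a ^ e) h' = q * F + s"
         "s = 0 \<or> degree s < m" "degree q \<le> degree h' - m" by auto
      have "smult (?a ^ Suc e) h = smult (?a ^ e) (smult ?a h)" by (simp add: mult.commute)
      also have "\<dots> = smult (?a ^ e) q0 * F + smult (?a ^ e) h'" unfolding eq by (simp add: smult_add_right)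
      also have "\<dots> = (smult (?a ^ e) q0 + q) * F + s" unfolding IH(3) by (simp add: algebra_simps)
      finally have "smult (?a ^ Suc e) h = (smult (?a ^ e) q0 + q) * F + s" .
      moreover have "coeffs_in A (smult (?a ^ e) q0 + q)" using IH q0 aA by (intro cc A_closed) auto
      moreover have "degree (smult (?a ^ e) q0 + q) \<le> ?n - m"
        using degree_smult_le[of "?a ^ e" q0] q0(2) IH(5) le by (intro degree_add_le) auto
      ultimately show ?thesis using IH(2,4) by blast
    qed
  qed
qed

text \<open>Terms with coefficients in \<open>Q\<close> can be discarded, so the leading coefficient may be assumed nonzero modulo
\<open>Q\<close>.\<close>

lemma drop_leading_terms:
  assumes T: "Q \<subseteq> T" "\<And>a b. a \<in> T \<Longrightarrow> b \<in> Q \<Longrightarrow> a - b \<in> T"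
    and s: "coeffs_in A s" "poly s x \<in> T" "\<exists>i. coeff s i \<notin> Q"
  shows "\<exists>s'. coeffs_in A s' \<and> degree s' \<le> degree s \<and> lead_coeff s' \<notin> Q \<and> poly s' x \<in> T"
  using s
proof (induction "degree s" arbitrary: s rule: less_induct)
  case less
  show ?case
  proof (cases "lead_coeff s \<in> Q")
    case False
    then show ?thesis using less.prems by blast
  next
    case True
    define s' where "s' = s - monom (lead_coeff s) (degree s)"
    obtain i where i: "coeff s i \<notin> Q" using less.prems by auto
    then have "i \<noteq> degree s" using True by auto
    then have i': "coeff s' i \<notin> Q" using i by (simp add: s'_def)
    have "degree s' < degree s"
    proof -
      have "i < degree s" using i \<open>i \<noteq> degree s\<close> Q(2) le_degree[of s i] by fastforce
      moreover have "degree s' \<le> degree s" unfolding s'_def by (intro degree_diff_le degree_monom_le) auto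
      moreover have "coeff s' (degree s) = 0" by (simp add: s'_def)
      ultimately show ?thesis
        by (metis degree_0 le_neq_implies_less leading_coeff_0_iff less_nat_zero_code neq0_conv)
    qed
    moreover have "coeffs_in A s'" unfolding s'_def using less.prems by (intro coeffs_in_closed) (auto intro: coeffs_in_coeff)
    moreover have "poly s' x \<in> T"
    proof -
      have "x ^ degree s * lead_coeff s \<in> Q" using True x by (intro Q(5) P_closed) 
      then show ?thesis using less.prems(2) T(2) by (simp add: s'_def poly_monom mult.commute)
    qed
    ultimately obtain s'' where "coeffs_in A s''" "degree s'' \<le> degree s'" "lead_coeff s'' \<notin> Q" "poly s'' x \<in> T"
      using less.hyps[of s'] i' by blast
    then show ?thesis using \<open>degree s' < degree s\<close> by (intro exI[of _ s'']) auto
  qed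
qed

lemma hom_on_sum:
  assumes \<chi>: "hom_on A \<chi>" and I: "finite I" "\<And>i. i \<in> I \<Longrightarrow> h i \<in> A"
  shows "\<chi> (sum h I) = (\<Sum>i\<in>I. \<chi> (h i))"
  using I by (induction I rule: finite_induct) (use \<chi> in \<open>auto simp: hom_on_def sum_A\<close>)

lemma map_poly_hom:
  assumes \<chi>: "hom_on A \<chi>" and p: "coeffs_in A p" "coeffs_in A q"
  shows "map_poly \<chi> (p + q) = map_poly \<chi> p + map_poly \<chi> q" "map_poly \<chi> (p * q) = map_poly \<chi> p * map_poly \<chi> q"
    "map_poly \<chi> (p - q) = map_poly \<chi> p - map_poly \<chi> q"
proof -
  have 0: "\<chi> 0 = 0" using \<chi> by (simp add: hom_on_def)
  note [simp] = coeff_map_poly[of \<chi>, OF 0]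
  show add: "map_poly \<chi> (p + q) = map_poly \<chi> p + map_poly \<chi> q"
    by (rule poly_eqI) (use \<chi> p in \<open>auto simp: hom_on_def coeffs_in_def\<close>)
  show "map_poly \<chi> (p - q) = map_poly \<chi> p - map_poly \<chi> q"
  proof (rule poly_eqI)
    fix i
    have "coeff p i - coeff q i \<in> A" "coeff q i \<in> A" using p A_closed(4) by (auto simp: coeffs_in_def)
    then have "\<chi> ((coeff p i - coeff q i) + coeff q i) = \<chi> (coeff p i - coeff q i) + \<chi> (coeff q i)"
      using \<chi> unfolding hom_on_def by blast
    then show "coeff (map_poly \<chi> (p - q)) i = coeff (map_poly \<chi> p - map_poly \<chi> q) i" by simp
  qed
  show "map_poly \<chi> (p * q) = map_poly \<chi> p * map_poly \<chi> q"
  proof (rule poly_eqI)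
    fix n
    have "\<chi> (\<Sum>i\<le>n. coeff p i * coeff q (n - i)) = (\<Sum>i\<le>n. \<chi> (coeff p i * coeff q (n - i)))"
      using p by (intro hom_on_sum[OF \<chi>]) (auto simp: coeffs_in_def intro: A_closed)
    also have "\<dots> = (\<Sum>i\<le>n. \<chi> (coeff p i) * \<chi> (coeff q (n - i)))"
      using p \<chi> by (intro sum.cong) (auto simp: hom_on_def coeffs_in_def)
    finally show "coeff (map_poly \<chi> (p * q)) n = coeff (map_poly \<chi> p * map_poly \<chi> q) n"
      by (simp add: coeff_mult)
  qed
qed

text \<open>The map \<open>p(x) \<mapsto> (\<chi> p)(\<eta>)\<close> is well defined on \<open>A[x]\<close>, because polynomials with value in \<open>Q\<close> are sent
to \<open>0\<close>.\<close>

lemma extension_at: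
  fixes \<eta> :: "'k::field"
  assumes \<chi>: "hom_on A \<chi>"
    and kill: "\<And>p. coeffs_in A p \<Longrightarrow> poly p x \<in> Q \<Longrightarrow> poly (map_poly \<chi> p) \<eta> = 0"
  shows "\<exists>\<chi>'. hom_on (adjoin_elem A x) \<chi>' \<and> (\<forall>p. coeffs_in A p \<longrightarrow> \<chi>' (poly p x) = poly (map_poly \<chi> p) \<eta>) \<and>
    (\<forall>a\<in>A. \<chi>' a = \<chi> a) \<and> (\<forall>a\<in>Q \<inter> adjoin_elem A x. \<chi>' a = 0)"
proof -
  define \<chi>' where "\<chi>' y = poly (map_poly \<chi> (SOME p. coeffs_in A p \<and> poly p x = y)) \<eta>" for y
  have *: "\<chi>' (poly p x) = poly (map_poly \<chi> p) \<eta>" if p: "coeffs_in A p" for p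
  proof -
    define q where "q = (SOME q. coeffs_in A q \<and> poly q x = poly p x)"
    have q: "coeffs_in A q" "poly q x = poly p x"
      using someI[of "\<lambda>q. coeffs_in A q \<and> poly q x = poly p x" p] p by (auto simp: q_def)
    have "poly (map_poly \<chi> (q - p)) \<eta> = 0" using p q Q(2) by (intro kill coeffs_in_closed) auto
    then have "poly (map_poly \<chi> q) \<eta> = poly (map_poly \<chi> p) \<eta>" by (simp add: map_poly_hom(3)[OF \<chi> q(1) p])
    then show ?thesis by (simp add: \<chi>'_def q_def)
  qed
  have \<chi>0: "\<chi> 0 = 0" "\<chi> 1 = 1" using \<chi> by (auto simp: hom_on_def)
  have c: "\<chi>' a = \<chi> a" if "a \<in> A" for a
    using *[OF coeffs_in_closed(2)[OF that]] \<chi>0 by (simp add: map_poly_pCons)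
  have "hom_on (adjoin_elem A x) \<chi>'"
    unfolding hom_on_def
  proof (intro conjI ballI)
    show "\<chi>' 0 = 0" "\<chi>' 1 = 1" using c[of 0] c[of 1] A_closed \<chi>0 by auto
    fix a b assume "a \<in> adjoin_elem A x" "b \<in> adjoin_elem A x"
    then obtain p q where pq: "coeffs_in A p" "a = poly p x" "coeffs_in A q" "b = poly q x" by (auto simp: adjoin_elem_def)
    show "\<chi>' (a + b) = \<chi>' a + \<chi>' b"
      using *[OF coeffs_in_closed(4)[OF pq(1,3)]] by (simp add: pq * map_poly_hom(1)[OF \<chi> pq(1,3)])
    show "\<chi>' (a * b) = \<chi>' a * \<chi>' b"
      using *[OF coeffs_in_closed(6)[OF pq(1,3)]] by (simp add: pq * map_poly_hom(2)[OF \<chi> pq(1,3)])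
  qed
  moreover have "\<chi>' a = 0" if "a \<in> Q \<inter> adjoin_elem A x" for a
  proof -
    obtain p where "coeffs_in A p" "a = poly p x" using \<open>a \<in> Q \<inter> adjoin_elem A x\<close> by (auto simp: adjoin_elem_def)
    then show ?thesis using * kill that by auto
  qed
  ultimately show ?thesis using * c by blast
qed

text \<open>The extension theorem for homomorphisms into an algebraically closed field: a homomorphism that does not kill a
suitable \<open>u\<close> extends to \<open>A[x]\<close> without killing \<open>g\<close>. If \<open>x\<close> is transcendental modulo \<open>Q\<close>, its image may be any
element at which the image of \<open>g\<close> does not vanish. If \<open>x\<close> is algebraic, its image is a root of the image of a
relation \<open>F\<close> of minimal degree. In this case \<open>u\<close> is the product of the leading coefficient of \<open>F\<close> with a nonzero
multiple of \<open>g\<close> in \<open>A\<close> modulo \<open>Q\<close>, which exists because \<open>A[x]\<close> is algebraic over \<open>A\<close>: among the polynomials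
with value in the ideal generated by \<open>g\<close> and \<open>Q\<close>, one of minimal degree is constant.\<close>

lemma extend_hom:
  assumes g: "g \<in> adjoin_elem A x" "g \<notin> Q"
  shows "\<exists>u\<in>A - Q. \<forall>\<chi>::'r \<Rightarrow> 'k::alg_closed_field. hom_on A \<chi> \<longrightarrow> (\<forall>a\<in>Q \<inter> A. \<chi> a = 0) \<longrightarrow> \<chi> u \<noteq> 0 \<longrightarrow>
    (\<exists>\<chi>'. hom_on (adjoin_elem A x) \<chi>' \<and> (\<forall>a\<in>A. \<chi>' a = \<chi> a) \<and> (\<forall>a\<in>Q \<inter> adjoin_elem A x. \<chi>' a = 0) \<and> \<chi>' g \<noteq> 0)"
proof -
  note cc = coeffs_in_closed
  obtain G0 where G0: "coeffs_in A G0" "g = poly G0 x" using g by (auto simp: adjoin_elem_def)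
  have gP: "g \<in> P" using g(1) adjoin_elem_subring(2) by auto
  have coeffQ: "poly p x \<in> Q" if "coeffs_in A p" "\<And>i. coeff p i \<in> Q" for p
    unfolding poly_altdef using that x
    by (intro sum_Q) (auto simp: mult.commute[of "coeff p _"] intro: Q(5) P_closed)
  show ?thesis
  proof (cases "\<forall>p. coeffs_in A p \<longrightarrow> poly p x \<in> Q \<longrightarrow> (\<forall>i. coeff p i \<in> Q)")
    case True
    obtain j where j: "coeff G0 j \<notin> Q" using coeffQ[OF G0(1)] G0(2) g(2) by blast
    show ?thesis
    proof (intro bexI[of _ "coeff G0 j"] allI impI)
      show "coeff G0 j \<in> A - Q" using j G0(1) by (simp add: coeffs_in_def)
      fix \<chi> :: "'r \<Rightarrow> 'k"
      assume \<chi>: "hom_on A \<chi>" and k: "\<forall>a\<in>Q \<inter> A. \<chi> a = 0" and n: "\<chi> (coeff G0 j) \<noteq> 0"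
      have \<chi>0: "\<chi> 0 = 0" using \<chi> by (auto simp: hom_on_def)
      have "coeff (map_poly \<chi> G0) j \<noteq> 0" using n \<chi>0 by (simp add: coeff_map_poly)
      then have "map_poly \<chi> G0 \<noteq> 0" by auto
      then have "finite {\<eta>. poly (map_poly \<chi> G0) \<eta> = 0}" by (rule poly_roots_finite)
      then have "{\<eta>. poly (map_poly \<chi> G0) \<eta> = 0} \<noteq> UNIV" using infinite_alg_closed by metis
      then obtain \<eta> where \<eta>: "poly (map_poly \<chi> G0) \<eta> \<noteq> 0" by auto
      have "poly (map_poly \<chi> p) \<eta> = 0" if p: "coeffs_in A p" "poly p x \<in> Q" for p
      proof -
        have "coeff p i \<in> Q \<inter> A" for i using True p by (auto simp: coeffs_in_def)
        then have "map_poly \<chi> p = 0" using k \<chi>0 by (intro poly_eqI) (auto simp: coeff_map_poly)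
        then show ?thesis by simp
      qed
      from extension_at[OF \<chi> this] obtain \<chi>' where "hom_on (adjoin_elem A x) \<chi>'"
        "\<forall>p. coeffs_in A p \<longrightarrow> \<chi>' (poly p x) = poly (map_poly \<chi> p) \<eta>"
        "\<forall>a\<in>A. \<chi>' a = \<chi> a" "\<forall>a\<in>Q \<inter> adjoin_elem A x. \<chi>' a = 0" by blast
      moreover then have "\<chi>' g \<noteq> 0" using \<eta> G0 by simp
      ultimately show "\<exists>\<chi>'. hom_on (adjoin_elem A x) \<chi>' \<and> (\<forall>a\<in>A. \<chi>' a = \<chi> a) \<and> (\<forall>a\<in>Q \<inter> adjoin_elem A x. \<chi>' a = 0) \<and> \<chi>' g \<noteq> 0" by blast
    qed
  next
    case False
    define good where "good T d \<longleftrightarrow> (\<exists>p. coeffs_in A p \<and> degree p = d \<and> lead_coeff p \<notin> Q \<and> poly p x \<in> T)" for T d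
    have drop: "\<exists>d\<le>degree s. good T d" if "Q \<subseteq> T" "\<And>a b. a \<in> T \<Longrightarrow> b \<in> Q \<Longrightarrow> a - b \<in> T" "coeffs_in A s" "poly s x \<in> T" "\<exists>i. coeff s i \<notin> Q" for T s
      using drop_leading_terms[OF that] unfolding good_def by blast
    have dropQ: "\<exists>d\<le>degree s. good Q d" if "coeffs_in A s" "poly s x \<in> Q" "\<exists>i. coeff s i \<notin> Q" for s
      by (rule drop[OF order_refl Q_minus that])
    obtain p where "coeffs_in A p" "poly p x \<in> Q" "\<exists>i. coeff p i \<notin> Q" using False by blast
    then obtain d where "good Q d" using dropQ by blast
    define m where "m = (LEAST d. good Q d)"
    have m: "good Q m" "\<And>d. good Q d \<Longrightarrow> m \<le> d" using LeastI[of "good Q", OF \<open>good Q d\<close>] Least_le[of "good Q"] by (auto simp: m_def)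
    then obtain F where F: "coeffs_in A F" "degree F = m" "lead_coeff F \<notin> Q" "poly F x \<in> Q" by (auto simp: good_def)
    have aA: "lead_coeff F \<in> A" using F by (simp add: coeffs_in_def)
    have m0: "m \<noteq> 0"
    proof
      assume "m = 0"
      then obtain a where "F = [:a:]" using F(2) by (metis degree_eq_zeroE)
      then show False using F(3,4) by simp
    qed
    have lowQ: "coeff s i \<in> Q" if "coeffs_in A s" "poly s x \<in> Q" "s = 0 \<or> degree s < m" for s i
    proof (rule ccontr)
      assume n: "coeff s i \<notin> Q"
      then have "degree s < m" using that(3) Q(2) by auto
      moreover have "\<exists>d\<le>degree s. good Q d" using dropQ[OF that(1,2)] n by blast
      ultimately show False using m(2) by fastforce
    qed
    \<comment> \<open>the elements congruent modulo \<open>Q\<close> to a multiple of \<open>g\<close> in \<open>A[x]\<close>\<close>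
    define T where "T = {g * w + q | w q. w \<in> adjoin_elem A x \<and> q \<in> Q}"
    note A' = adjoin_elem_subring
    have T: "Q \<subseteq> T" "\<And>a b. a \<in> T \<Longrightarrow> b \<in> Q \<Longrightarrow> a - b \<in> T" "\<And>w. w \<in> adjoin_elem A x \<Longrightarrow> g * w \<in> T"
      "\<And>a w. a \<in> T \<Longrightarrow> w \<in> adjoin_elem A x \<Longrightarrow> w * a \<in> T" "\<And>a b. a \<in> T \<Longrightarrow> b \<in> T \<Longrightarrow> a - b \<in> T"
    proof -
      have TI: "g * w + q \<in> T" if "w \<in> adjoin_elem A x" "q \<in> Q" for w q using that by (auto simp: T_def)
      show "Q \<subseteq> T" using TI[of 0] A'(1) by (auto simp: subring_set_def)
      show "g * w \<in> T" if "w \<in> adjoin_elem A x" for w using TI[OF that Q(2)] by simp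
      show "a - b \<in> T" if a: "a \<in> T" and b: "b \<in> T" for a b
      proof -
        obtain w q w' q' where *: "w \<in> adjoin_elem A x" "q \<in> Q" "a = g * w + q" "w' \<in> adjoin_elem A x" "q' \<in> Q" "b = g * w' + q'"
          using a b by (auto simp: T_def)
        have eq: "a - b = g * (w - w') + (q - q')" unfolding *(3,6) by (simp add: algebra_simps)
        show ?thesis unfolding eq using * A'(1) by (intro TI Q_minus) (auto simp: subring_set_def)
      qed
      then show "a - b \<in> T" if "a \<in> T" "b \<in> Q" for a b using that \<open>Q \<subseteq> T\<close> by blast
      show "v * a \<in> T" if a: "a \<in> T" and v: "v \<in> adjoin_elem A x" for a v
      proof -
        obtain w q where *: "w \<in> adjoin_elem A x" "q \<in> Q" "a = g * w + q" using a by (auto simp: T_def)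
        have eq: "v * a = g * (v * w) + v * q" unfolding *(3) by (simp add: algebra_simps)
        show ?thesis unfolding eq using * A'(1,2) v by (intro TI Q(5)) (auto simp: subring_set_def)
      qed
    qed
    \<comment> \<open>the remainder of \<open>g\<close> on division by \<open>F\<close>\<close>
    have "\<exists>d<m. good T d"
    proof -
      obtain k q s where d: "coeffs_in A q" "coeffs_in A s" "smult (lead_coeff F ^ k) G0 = q * F + s" "s = 0 \<or> degree s < m"
        using pseudo_division[OF F(1,2) G0(1)] by blast
      have "poly (smult (lead_coeff F ^ k) G0) x = poly (q * F + s) x" by (simp only: d(3))
      then have e: "poly s x = g * lead_coeff F ^ k - poly q x * poly F x" by (simp add: G0(2) algebra_simps)
      have qF: "poly q x * poly F x \<in> Q" using F(4) poly_in_P[OF d(1)] Q(5) by blast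
      have aP: "lead_coeff F \<in> P" "lead_coeff F ^ k \<in> adjoin_elem A x" "lead_coeff F ^ k \<in> P"
        using aA A(2) A'(3) A_closed(6) by auto
      have "poly s x \<in> T" unfolding e using T(2)[OF T(3)[OF aP(2)] qF] .
      moreover have "poly s x \<notin> Q"
      proof
        assume "poly s x \<in> Q"
        then have "poly s x + poly q x * poly F x \<in> Q" using qF Q(4) by blast
        then have "g * lead_coeff F ^ k \<in> Q" unfolding e by simp
        then show False using Q(6)[OF gP aP(3)] g(2) Q_pow[OF aP(1)] F(3) by blast
      qed
      then have "\<exists>i. coeff s i \<notin> Q" using coeffQ[OF d(2)] by blast
      moreover then have "degree s < m" using d(4) Q(2) by auto
      ultimately show ?thesis using drop[OF T(1,2) d(2)] by (meson le_less_trans)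
    qed
    then obtain d0 where d0: "d0 < m" "good T d0" by blast
    define e where "e = (LEAST d. good T d)"
    have e: "good T e" "\<And>d. good T d \<Longrightarrow> e \<le> d" using LeastI[of "good T", OF d0(2)] Least_le[of "good T"] by (auto simp: e_def)
    have em: "e < m" using e(2)[OF d0(2)] d0(1) by simp
    obtain G where G: "coeffs_in A G" "degree G = e" "lead_coeff G \<notin> Q" "poly G x \<in> T" using e(1) by (auto simp: good_def)
    \<comment> \<open>otherwise dividing \<open>F\<close> by \<open>G\<close> leaves no remainder modulo \<open>Q\<close>, and a product \<open>q G\<close> would vanish at \<open>x\<close> modulo \<open>Q\<close>, with both factors of degree less than \<open>m\<close>\<close>
    have "e = 0"
    proof (rule ccontr)
      assume e0: "e \<noteq> 0"
      obtain k q s where d: "coeffs_in A q" "coeffs_in A s" "smult (lead_coeff G ^ k) F = q * G + s" "s = 0 \<or> degree s < e" "degree q \<le> m - e"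
        using pseudo_division[OF G(1,2) F(1)] F(2) by blast
      have "poly (smult (lead_coeff G ^ k) F) x = poly (q * G + s) x" by (simp only: d(3))
      then have eq: "poly s x = lead_coeff G ^ k * poly F x - poly q x * poly G x" by (simp add: algebra_simps)
      have cA: "lead_coeff G \<in> A" using G(1) by (simp add: coeffs_in_def)
      have cP: "lead_coeff G \<in> P" "lead_coeff G ^ k \<in> P" using cA A(2) P_closed(6) by auto
      have cF: "lead_coeff G ^ k * poly F x \<in> Q" using F(4) cP Q(5) by blast
      have "poly s x \<in> T" unfolding eq
        using T(5)[of "lead_coeff G ^ k * poly F x" "poly q x * poly G x"] cF T(1) T(4)[OF G(4) adjoin_elem_I[OF d(1)]] by blast
      have sQ: "coeff s i \<in> Q" for i
      proof (rule ccontr)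
        assume n: "coeff s i \<notin> Q"
        then have "degree s < e" using d(4) Q(2) by auto
        moreover obtain d' where "d' \<le> degree s" "good T d'" using drop[OF T(1,2) d(2) \<open>poly s x \<in> T\<close>] n by blast
        ultimately show False using e(2)[of d'] by auto
      qed
      then have "poly s x \<in> Q" using coeffQ[OF d(2)] by blast
      then have "lead_coeff G ^ k * poly F x - poly s x \<in> Q" using Q_minus cF by blast
      then have "poly q x * poly G x \<in> Q" unfolding eq by simp
      then consider "poly q x \<in> Q" | "poly G x \<in> Q" using Q(6) poly_in_P d(1) G(1) by blast
      then show False
      proof cases
        case 1
        have "coeff q i \<in> Q" for i by (rule lowQ[OF d(1) 1]) (use d(5) e0 em in linarith)
        then have "coeff (q * G) i \<in> Q" for i
          unfolding coeff_mult using G(1) A(2)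
          by (intro sum_Q) (auto simp: coeffs_in_def mult.commute[of "coeff q _"] intro!: Q(5))
        then have "coeff (q * G + s) m \<in> Q" using sQ Q(4) by simp
        then have "lead_coeff G ^ k * lead_coeff F \<in> Q" unfolding d(3)[symmetric] F(2)[symmetric] by simp
        then show False using Q(6)[OF cP(2), of "lead_coeff F"] aA A(2) F(3) G(3) Q_pow[OF cP(1)] by blast
      next
        case 2
        then have "good Q e" using G by (auto simp: good_def)
        then show False using m(2) em by fastforce
      qed
    qed
    then obtain u0 where u0: "G = [:u0:]" using G(2) by (metis degree_eq_zeroE)
    have u0': "u0 \<in> A" "u0 \<notin> Q" "u0 \<in> T" using G u0 by (auto simp: coeffs_in_def coeff_pCons split: nat.splits)
    then obtain w q where w: "w \<in> adjoin_elem A x" "q \<in> Q" "u0 = g * w + q" by (auto simp: T_def)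
    show ?thesis
    proof (intro bexI[of _ "lead_coeff F * u0"] allI impI)
      show "lead_coeff F * u0 \<in> A - Q" using aA u0' F(3) A_closed(5) Q(6)[of "lead_coeff F" u0] A(2) by blast
      fix \<chi> :: "'r \<Rightarrow> 'k"
      assume \<chi>: "hom_on A \<chi>" and k: "\<forall>a\<in>Q \<inter> A. \<chi> a = 0" and n: "\<chi> (lead_coeff F * u0) \<noteq> 0"
      have \<chi>0: "\<chi> 0 = 0" using \<chi> by (auto simp: hom_on_def)
      have n': "\<chi> (lead_coeff F) \<noteq> 0" "\<chi> u0 \<noteq> 0" using n \<chi> aA u0'(1) by (auto simp: hom_on_def)
      have "coeff (map_poly \<chi> F) m \<noteq> 0" using n' \<chi>0 F(2) by (simp add: coeff_map_poly)
      then have "degree (map_poly \<chi> F) > 0" using m0 le_degree[of "map_poly \<chi> F" m] by linarith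
      then obtain \<eta> where \<eta>: "poly (map_poly \<chi> F) \<eta> = 0" using alg_closed_imp_poly_has_root by blast
      have \<chi>pow: "\<chi> (lead_coeff F ^ i) = \<chi> (lead_coeff F) ^ i" for i
        by (induction i) (use \<chi> aA A_closed(6) in \<open>auto simp: hom_on_def\<close>)
      have "poly (map_poly \<chi> p) \<eta> = 0" if p: "coeffs_in A p" "poly p x \<in> Q" for p
      proof -
        obtain k q s where d: "coeffs_in A q" "coeffs_in A s" "smult (lead_coeff F ^ k) p = q * F + s" "s = 0 \<or> degree s < m"
          using pseudo_division[OF F(1,2) p(1)] by blast
        have "poly (smult (lead_coeff F ^ k) p) x = poly (q * F + s) x" by (simp only: d(3))
        then have eq: "poly s x = lead_coeff F ^ k * poly p x - poly q x * poly F x" by (simp add: algebra_simps)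
        have "lead_coeff F ^ k \<in> P" using aA A(2) P_closed(6) by blast
        then have "poly s x \<in> Q" unfolding eq
          using Q_minus Q(5) p(2) F(4) poly_in_P[OF d(1)] by blast
        then have "coeff s i \<in> Q \<inter> A" for i using lowQ[OF d(2) _ d(4)] d(2) by (auto simp: coeffs_in_def)
        then have s0: "map_poly \<chi> s = 0" using \<open>\<forall>a\<in>Q \<inter> A. \<chi> a = 0\<close> \<chi>0 by (intro poly_eqI) (auto simp: coeff_map_poly)
        have c0: "coeffs_in A [:lead_coeff F ^ k:]" using aA by (intro cc A_closed)
        have "map_poly \<chi> [:lead_coeff F ^ k:] * map_poly \<chi> p = map_poly \<chi> ([:lead_coeff F ^ k:] * p)"
          by (rule map_poly_hom(2)[OF \<chi> c0 p(1), symmetric])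
        also have "[:lead_coeff F ^ k:] * p = q * F + s" using d(3) by simp
        also have "map_poly \<chi> (q * F + s) = map_poly \<chi> q * map_poly \<chi> F"
          using map_poly_hom(1)[OF \<chi> cc(6)[OF d(1) F(1)] d(2)] map_poly_hom(2)[OF \<chi> d(1) F(1)] s0 by simp
        also have "map_poly \<chi> [:lead_coeff F ^ k:] = [:\<chi> (lead_coeff F) ^ k:]" using \<chi>0 \<chi>pow by (simp add: map_poly_pCons)
        finally have "poly ([:\<chi> (lead_coeff F) ^ k:] * map_poly \<chi> p) \<eta> = poly (map_poly \<chi> q * map_poly \<chi> F) \<eta>" by simp
        then have "\<chi> (lead_coeff F) ^ k * poly (map_poly \<chi> p) \<eta> = poly (map_poly \<chi> q * map_poly \<chi> F) \<eta>" by simp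
        then show ?thesis using \<eta> n'(1) by simp
      qed
      from extension_at[OF \<chi> this] obtain \<chi>' where \<chi>': "hom_on (adjoin_elem A x) \<chi>'"
        "\<forall>a\<in>A. \<chi>' a = \<chi> a" "\<forall>a\<in>Q \<inter> adjoin_elem A x. \<chi>' a = 0" by blast
      have gw: "g * w \<in> adjoin_elem A x" using A'(1) g(1) w(1) by (simp add: subring_set_def)
      have "u0 \<in> adjoin_elem A x" using A'(3) u0' by blast
      then have "u0 - g * w \<in> adjoin_elem A x" using gw A'(1) by (simp add: subring_set_def)
      then have q': "q \<in> adjoin_elem A x" using w(3) by simp
      have "\<chi>' u0 = \<chi>' g * \<chi>' w + \<chi>' q"
        unfolding w(3) using \<chi>'(1) gw g(1) w(1) q' by (simp add: hom_on_def)
      also have "\<chi>' q = 0" using \<chi>'(3) q' w(2) by blast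
      finally have "\<chi>' g \<noteq> 0" using n'(2) \<chi>'(2) u0'(1) by auto
      then show "\<exists>\<chi>'. hom_on (adjoin_elem A x) \<chi>' \<and> (\<forall>a\<in>A. \<chi>' a = \<chi> a) \<and> (\<forall>a\<in>Q \<inter> adjoin_elem A x. \<chi>' a = 0) \<and> \<chi>' g \<noteq> 0"
        using \<chi>' by blast
    qed
  qed
qed

end

section \<open>Polynomial functions and the Nullstellensatz\<close>

locale closed_field_space = finite_dimensional_vector_space scale Basis
  for scale :: "'k::alg_closed_field \<Rightarrow> 'v::ab_group_add \<Rightarrow> 'v" and Basis :: "'v set"
begin

abbreviation "Pol \<equiv> poly_fun scale"

lemma poly_fun_diff: "g \<in> Pol \<Longrightarrow> h \<in> Pol \<Longrightarrow> (\<lambda>v. g v - h v) \<in> Pol"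
  using poly_fun.add[of g scale "\<lambda>v. (- 1) * h v"] poly_fun.mult[of "\<lambda>_. - 1" scale h] poly_fun.const[of "-1" scale]
  by simp

lemma poly_fun_power: "g \<in> Pol \<Longrightarrow> (\<lambda>v. g v ^ n) \<in> Pol"
  by (induction n) (auto intro: poly_fun.intros)

lemma poly_fun_sum: "finite I \<Longrightarrow> (\<And>i. i \<in> I \<Longrightarrow> h i \<in> Pol) \<Longrightarrow> (\<lambda>v. \<Sum>i\<in>I. h i v) \<in> Pol"
  by (induction I rule: finite_induct) (auto intro: poly_fun.intros)

lemma poly_fun_prod: "finite I \<Longrightarrow> (\<And>i. i \<in> I \<Longrightarrow> h i \<in> Pol) \<Longrightarrow> (\<lambda>v. \<Prod>i\<in>I. h i v) \<in> Pol"
  by (induction I rule: finite_induct) (auto intro: poly_fun.intros)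

lemmas poly_fun_intros = poly_fun.const poly_fun.add poly_fun.mult poly_fun_diff poly_fun_power poly_fun_sum poly_fun_prod

lemma linear_formI:
  assumes "\<And>v w. l (v + w) = l v + l w" "\<And>a v. l (scale a v) = a * l v"
  shows "linear_form scale l"
proof -
  interpret K: vector_space "(*) :: 'k \<Rightarrow> 'k \<Rightarrow> 'k" by unfold_locales (auto simp: algebra_simps)
  show ?thesis by unfold_locales (use assms in auto)
qed

lemma linear_formD:
  assumes "linear_form scale l"
  shows "l (v + w) = l v + l w" "l (scale a v) = a * l v" "l 0 = 0" "finite I \<Longrightarrow> l (\<Sum>i\<in>I. h i) = (\<Sum>i\<in>I. l (h i))"
proof -
  interpret Vector_Spaces.linear scale "(*) :: 'k \<Rightarrow> 'k \<Rightarrow> 'k" l by fact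
  show "l (v + w) = l v + l w" "l (scale a v) = a * l v" "l 0 = 0" "finite I \<Longrightarrow> l (\<Sum>i\<in>I. h i) = (\<Sum>i\<in>I. l (h i))"
    by (auto simp: add scale sum zero)
qed

definition coord :: "'v \<Rightarrow> 'v \<Rightarrow> 'k" where
  "coord b v = representation Basis v b"

lemma linear_coord: "linear_form scale (coord b)"
  by (rule linear_formI)
    (simp_all add: coord_def representation_add[OF independent_Basis] representation_scale[OF independent_Basis] span_Basis)

lemma sum_coord: "(\<Sum>b\<in>Basis. scale (coord b v) b) = v"
  unfolding coord_def
  by (rule sum_representation_eq[OF independent_Basis]) (auto simp: span_Basis finite_Basis)

lemma linear_form_coord:
  assumes "linear_form scale l"
  shows "l v = (\<Sum>b\<in>Basis. l b * coord b v)"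
proof -
  have "l v = l (\<Sum>b\<in>Basis. scale (coord b v) b)" by (simp add: sum_coord)
  also have "\<dots> = (\<Sum>b\<in>Basis. l b * coord b v)"
    by (simp add: linear_formD[OF assms] finite_Basis mult.commute)
  finally show ?thesis .
qed

lemma exists_linear_form_nonzero:
  assumes "v \<noteq> 0" obtains l where "linear_form scale l" "l v \<noteq> 0"
proof -
  have "\<exists>b\<in>Basis. coord b v \<noteq> 0"
  proof (rule ccontr)
    assume "\<not> ?thesis"
    then have "(\<Sum>b\<in>Basis. scale (coord b v) b) = 0" by (intro sum.neutral) auto
    then show False using assms sum_coord by auto
  qed
  then show thesis using that linear_coord by blast
qed

text \<open>The variables are adjoined one after the other; a list records their order for the induction.\<close>

fun generated_by :: "('v \<Rightarrow> 'k) list \<Rightarrow> ('v \<Rightarrow> 'k) set" where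
  "generated_by [] = range (\<lambda>a _. a)"
| "generated_by (x # xs) = adjoin_elem (generated_by xs) x"

lemma subring_Pol: "subring_set Pol"
  unfolding subring_set_def zero_fun_def one_fun_def plus_fun_def times_fun_def fun_diff_def
  by (auto intro: poly_fun_intros)

text \<open>Starting with the constants, \<open>extend_hom\<close> adjoins the coordinates one by one and yields a homomorphism \<open>\<chi>\<close> from the
polynomial functions to the field that kills \<open>Q\<close> but not \<open>g\<close>. Such a homomorphism is the evaluation at the point with
coordinates \<open>\<chi> (coord b)\<close>.\<close>

lemma Nullstellensatz_prime:
  assumes Q: "Q \<subseteq> Pol" "(\<lambda>_. 0) \<in> Q" "(\<lambda>_. 1) \<notin> Q"
    "\<And>a b. a \<in> Q \<Longrightarrow> b \<in> Q \<Longrightarrow> (\<lambda>v. a v + b v) \<in> Q"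
    "\<And>a b. a \<in> Pol \<Longrightarrow> b \<in> Q \<Longrightarrow> (\<lambda>v. a v * b v) \<in> Q"
    "\<And>a b. a \<in> Pol \<Longrightarrow> b \<in> Pol \<Longrightarrow> (\<lambda>v. a v * b v) \<in> Q \<Longrightarrow> a \<in> Q \<or> b \<in> Q"
    and g: "g \<in> Pol" "g \<notin> Q"
  obtains v where "\<And>h. h \<in> Q \<Longrightarrow> h v = 0" "g v \<noteq> 0"
proof -
  have loc: "prime_over_subring Pol A Q x" if "subring_set A" "A \<subseteq> Pol" "x \<in> Pol" for A x
    using that subring_Pol Q
    by unfold_locales (auto simp: zero_fun_def one_fun_def plus_fun_def times_fun_def)
  have gen: "subring_set (generated_by xs) \<and> generated_by xs \<subseteq> Pol \<and> range (\<lambda>a _. a) \<subseteq> generated_by xs \<and> set xs \<subseteq> generated_by xs"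
    if "set xs \<subseteq> Pol" for xs
    using that
  proof (induction xs)
    case Nil
    have "subring_set (range (\<lambda>a (_::'v). a :: 'k))"
      unfolding subring_set_def zero_fun_def one_fun_def plus_fun_def times_fun_def fun_diff_def by auto
    then show ?case by (auto intro: poly_fun_intros)
  next
    case (Cons x xs)
    then have *: "subring_set (generated_by xs)" "generated_by xs \<subseteq> Pol" "x \<in> Pol" by auto
    note a = prime_over_subring.adjoin_elem_subring[OF loc[OF *]]
    show ?case using a Cons by auto
  qed
  have hom_exists: "\<exists>\<chi>::('v \<Rightarrow> 'k) \<Rightarrow> 'k. hom_on (generated_by xs) \<chi> \<and> (\<forall>a. \<chi> (\<lambda>_. a) = a) \<and>
      (\<forall>a\<in>Q \<inter> generated_by xs. \<chi> a = 0) \<and> \<chi> g \<noteq> 0"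
    if "set xs \<subseteq> Pol" "g \<in> generated_by xs" "g \<notin> Q" for xs g
    using that
  proof (induction xs arbitrary: g)
    case Nil
    have "hom_on (generated_by []) (\<lambda>h. h 0)"
      by (auto simp: hom_on_def zero_fun_def one_fun_def plus_fun_def times_fun_def)
    moreover have "a = 0" if a: "(\<lambda>_. a) \<in> Q" for a
    proof (rule ccontr)
      assume "a \<noteq> 0"
      then have "(\<lambda>v::'v. inverse a * a) = (\<lambda>_. 1)" by auto
      moreover have "(\<lambda>v. inverse a * a) \<in> Q" using Q(5)[OF poly_fun.const a] .
      ultimately show False using Q(3) by simp
    qed
    moreover obtain a where "g = (\<lambda>_. a)" using Nil by auto
    moreover have "g 0 \<noteq> 0" using Nil(3) Q(2) \<open>g = (\<lambda>_. a)\<close> by auto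
    ultimately show ?case by (intro exI[of _ "\<lambda>h. h 0"]) auto
  next
    case (Cons x xs)
    have xs: "set xs \<subseteq> Pol" "x \<in> Pol" using Cons.prems by auto
    then have *: "subring_set (generated_by xs)" "generated_by xs \<subseteq> Pol" "x \<in> Pol" "range (\<lambda>a _. a) \<subseteq> generated_by xs"
      using gen[of xs] by auto
    obtain u where u: "u \<in> generated_by xs - Q" and e: "\<And>\<chi>::('v \<Rightarrow> 'k) \<Rightarrow> 'k. hom_on (generated_by xs) \<chi> \<Longrightarrow>
       \<forall>a\<in>Q \<inter> generated_by xs. \<chi> a = 0 \<Longrightarrow> \<chi> u \<noteq> 0 \<Longrightarrow>
      (\<exists>\<chi>'. hom_on (adjoin_elem (generated_by xs) x) \<chi>' \<and> (\<forall>a\<in>generated_by xs. \<chi>' a = \<chi> a) \<and>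
        (\<forall>a\<in>Q \<inter> adjoin_elem (generated_by xs) x. \<chi>' a = 0) \<and> \<chi>' g \<noteq> 0)"
      using prime_over_subring.extend_hom[OF loc[OF *(1-3)], of g] Cons.prems(2,3) unfolding generated_by.simps by blast
    obtain \<chi> :: "('v \<Rightarrow> 'k) \<Rightarrow> 'k" where \<chi>: "hom_on (generated_by xs) \<chi>" "\<And>a. \<chi> (\<lambda>_. a) = a"
      "\<forall>a\<in>Q \<inter> generated_by xs. \<chi> a = 0" "\<chi> u \<noteq> 0"
      using Cons.IH[OF xs(1), of u] u by blast
    from e[OF \<chi>(1,3,4)] obtain \<chi>' where \<chi>': "hom_on (adjoin_elem (generated_by xs) x) \<chi>'" "\<forall>a\<in>generated_by xs. \<chi>' a = \<chi> a"
        "\<forall>a\<in>Q \<inter> adjoin_elem (generated_by xs) x. \<chi>' a = 0" "\<chi>' g \<noteq> 0" by blast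
    have "\<chi>' (\<lambda>_. a) = a" for a using \<chi>'(2) \<chi>(2)[of a] *(4) by (metis range_subsetD)
    then show ?case using \<chi>' unfolding generated_by.simps by blast
  qed
  obtain bs where bs: "set bs = Basis" using finite_list[OF finite_Basis] by blast
  let ?xs = "map coord bs"
  let ?A = "generated_by ?xs"
  have xs: "set ?xs \<subseteq> Pol" using linear_coord by (auto intro: poly_fun.linear)
  note A = gen[OF xs]
  have cl: "(\<lambda>v. a v + b v) \<in> ?A" "(\<lambda>v. a v * b v) \<in> ?A" if "a \<in> ?A" "b \<in> ?A" for a b
    using A that unfolding subring_set_def plus_fun_def times_fun_def by blast+
  have cA: "(\<lambda>_. a) \<in> ?A" for a using A by (meson range_subsetD)
  have lA: "coord b \<in> ?A" if "b \<in> Basis" for b using A bs that by auto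
  have sumA: "(\<lambda>v. \<Sum>i\<in>I. h i v) \<in> ?A" if "finite I" "\<And>i. i \<in> I \<Longrightarrow> h i \<in> ?A" for I and h :: "'v \<Rightarrow> _"
    using that by (induction I rule: finite_induct) (use cA[of 0] cl in auto)
  have lin: "l = (\<lambda>v. \<Sum>b\<in>Basis. l b * coord b v)" if "linear_form scale l" for l
    by (rule ext) (rule linear_form_coord[OF that])
  have linA: "l \<in> ?A" if "linear_form scale l" for l
  proof -
    have "(\<lambda>v. \<Sum>b\<in>Basis. l b * coord b v) \<in> ?A" by (intro sumA finite_Basis cl cA lA)
    then show ?thesis by (subst lin[OF that])
  qed
  have PA: "h \<in> ?A" if "h \<in> Pol" for h
    using that by induction (auto intro: cl cA linA)
  obtain \<chi> :: "('v \<Rightarrow> 'k) \<Rightarrow> 'k" where \<chi>: "hom_on ?A \<chi>" "\<And>a. \<chi> (\<lambda>_. a) = a" "\<And>a. a \<in> Q \<Longrightarrow> \<chi> a = 0" "\<chi> g \<noteq> 0"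
    using hom_exists[OF xs PA[OF g(1)] g(2)] PA Q(1) by blast
  have h: "\<chi> (\<lambda>v. a v + b v) = \<chi> a + \<chi> b" "\<chi> (\<lambda>v. a v * b v) = \<chi> a * \<chi> b" if "a \<in> ?A" "b \<in> ?A" for a b
    using \<chi>(1) that unfolding hom_on_def plus_fun_def times_fun_def by blast+
  have hsum: "\<chi> (\<lambda>v. \<Sum>i\<in>I. h i v) = (\<Sum>i\<in>I. \<chi> (h i))" if "finite I" "\<And>i. i \<in> I \<Longrightarrow> h i \<in> ?A" for I and h :: "'v \<Rightarrow> _"
    using that by (induction I rule: finite_induct) (auto simp: \<chi>(2) h sumA)
  define w where "w = (\<Sum>b\<in>Basis. scale (\<chi> (coord b)) b)"
  have lw: "\<chi> l = l w" if l: "linear_form scale l" for l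
  proof -
    have "\<chi> l = \<chi> (\<lambda>v. \<Sum>b\<in>Basis. l b * coord b v)" by (rule arg_cong[OF lin[OF l]])
    also have "\<dots> = (\<Sum>b\<in>Basis. \<chi> (\<lambda>v. l b * coord b v))"
      by (rule hsum[OF finite_Basis]) (intro cl cA lA)
    also have "\<dots> = (\<Sum>b\<in>Basis. l b * \<chi> (coord b))"
      by (intro sum.cong) (auto simp: h cA lA \<chi>(2))
    also have "\<dots> = l w" unfolding w_def by (simp add: linear_formD[OF l] finite_Basis mult.commute)
    finally show ?thesis .
  qed
  have "\<chi> h = h w" if "h \<in> Pol" for h
    using that by induction (auto simp: \<chi>(2) lw h PA)
  with \<chi>(3,4) Q(1) g(1) that show thesis by (metis subsetD)
qed

end

context closed_field_space
begin

section \<open>Homogeneous functions and cones\<close>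

lemma homog_poly: "homogeneous scale d g \<Longrightarrow> g \<in> Pol"
  unfolding homogeneous_def
  by (induction d g rule: homog.induct) (auto intro: poly_fun_intros poly_fun.linear)

lemma homogeneous_scale: "homogeneous scale d g \<Longrightarrow> g (scale t v) = t ^ d * g v"
  unfolding homogeneous_def
  by (induction d g rule: homog.induct) (auto simp: algebra_simps linear_formD)

lemma homogeneous_0: "homogeneous scale d g \<Longrightarrow> d > 0 \<Longrightarrow> g 0 = 0"
  using homogeneous_scale[of d g 0 0] by (simp add: zero_power)

lemma homogeneous_intros:
  "homogeneous scale 0 (\<lambda>_. a)" "homogeneous scale d (\<lambda>_. 0)"
  "homogeneous scale d g \<Longrightarrow> homogeneous scale d h \<Longrightarrow> homogeneous scale d (\<lambda>v. g v + h v)"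
  "linear_form scale l \<Longrightarrow> homogeneous scale 1 l"
  unfolding homogeneous_def using homog.mult[of scale l 0 "\<lambda>_. 1"]
  by (auto intro: homog.intros)

lemma homogeneous_mult:
  assumes "homogeneous scale d g" "homogeneous scale e h"
  shows "homogeneous scale (d + e) (\<lambda>v. g v * h v)"
proof -
  have c: "(e, \<lambda>v. a * h v) \<in> homog scale" if "(e, h) \<in> homog scale" for a e h
    using that
  proof (induction e h rule: homog.induct)
    case (const b)
    then show ?case using homog.const[of "a * b" scale] by simp
  next
    case (mult l d g)
    then show ?case using homog.mult[of scale l d "\<lambda>v. a * g v"] by (simp add: algebra_simps)
  next
    case (add d g h)
    then show ?case using homog.add[of d "\<lambda>v. a * g v" scale "\<lambda>v. a * h v"] by (simp add: algebra_simps)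
  qed (auto intro: homog.intros)
  show ?thesis using assms(1) unfolding homogeneous_def
  proof (induction d g rule: homog.induct)
    case (const a)
    then show ?case using c[of e h a] assms(2) by (simp add: homogeneous_def)
  next
    case (add d g g')
    then show ?case using homog.add[of "d + e" "\<lambda>v. g v * h v" scale "\<lambda>v. g' v * h v"] by (simp add: algebra_simps)
  next
    case (mult l d g)
    then show ?case using homog.mult[of scale l "d + e" "\<lambda>v. g v * h v"] by (simp add: algebra_simps)
  qed (auto intro: homog.intros)
qed

lemma homogeneous_power: "homogeneous scale d g \<Longrightarrow> homogeneous scale (n * d) (\<lambda>v. g v ^ n)"
  by (induction n) (auto intro: homogeneous_intros homogeneous_mult)

lemma homogeneous_sum:
  "finite I \<Longrightarrow> (\<And>i. i \<in> I \<Longrightarrow> homogeneous scale d (h i)) \<Longrightarrow> homogeneous scale d (\<lambda>v. \<Sum>i\<in>I. h i v)"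
  by (induction I rule: finite_induct) (auto intro: homogeneous_intros)

lemma homogeneous_prod:
  "finite I \<Longrightarrow> (\<And>i. i \<in> I \<Longrightarrow> homogeneous scale (d i) (h i)) \<Longrightarrow> homogeneous scale (\<Sum>i\<in>I. d i) (\<lambda>v. \<Prod>i\<in>I. h i v)"
  by (induction I rule: finite_induct) (auto intro: homogeneous_intros homogeneous_mult)

text \<open>The decomposition into homogeneous components, written as the polynomial \<open>G v\<close> in one
variable \<open>t\<close> with \<open>G v (t) = g (t v)\<close>; the component of degree \<open>d\<close> is the coefficient at \<open>d\<close>. Since the field is infinite, identities
between functions on a cone can be compared coefficientwise along each ray.\<close>

definition graded :: "('v \<Rightarrow> 'k) \<Rightarrow> ('v \<Rightarrow> 'k poly) \<Rightarrow> nat \<Rightarrow> bool" where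
  "graded g G n \<longleftrightarrow> (\<forall>d. homogeneous scale d (\<lambda>v. coeff (G v) d)) \<and> (\<forall>v. degree (G v) \<le> n) \<and> (\<forall>v. g v = poly (G v) 1)"

lemma graded_exists:
  assumes "g \<in> Pol" shows "\<exists>G n. graded g G n"
  using assms
proof induction
  case (const a)
  have "graded (\<lambda>_. a) (\<lambda>_. [:a:]) 0"
    by (auto simp: graded_def coeff_pCons split: nat.splits intro: homogeneous_intros)
  then show ?case by blast
next
  case (linear l)
  have "homogeneous scale d (\<lambda>v. coeff (monom (l v) 1) d)" for d
    by (cases "d = 1") (auto intro: homogeneous_intros linear homogeneous_intros(4)[simplified])
  then have "graded l (\<lambda>v. monom (l v) 1) 1" by (auto simp: graded_def degree_monom_le poly_monom)
  then show ?case by blast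
next
  case (add g h)
  then obtain G n H m where "graded g G n" "graded h H m" by blast
  then have "graded (\<lambda>v. g v + h v) (\<lambda>v. G v + H v) (max n m)"
    by (auto simp: graded_def intro!: homogeneous_intros degree_add_le) (meson le_max_iff_disj)+
  then show ?case by blast
next
  case (mult g h)
  then obtain G n H m where GH: "graded g G n" "graded h H m" by blast
  have "graded (\<lambda>v. g v * h v) (\<lambda>v. G v * H v) (n + m)"
    unfolding graded_def
  proof (intro conjI allI)
    show "g v * h v = poly (G v * H v) 1" for v using GH by (auto simp: graded_def)
    show "degree (G v * H v) \<le> n + m" for v using GH degree_mult_le[of "G v" "H v"] by (meson add_mono graded_def le_trans)
    have "homogeneous scale d (\<lambda>v. coeff (G v) i * coeff (H v) (d - i))" if "i \<le> d" for d i
      using homogeneous_mult[of i "\<lambda>v. coeff (G v) i" "d - i" "\<lambda>v. coeff (H v) (d - i)"] GH that by (auto simp: graded_def)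
    then show "homogeneous scale d (\<lambda>v. coeff (G v * H v) d)" for d
      unfolding coeff_mult by (intro homogeneous_sum) auto
  qed
  then show ?case by blast
qed

lemma poly_as_sum:
  assumes "degree p \<le> n" shows "poly p (z::'k) = (\<Sum>i\<le>n. coeff p i * z ^ i)"
proof -
  have "(\<Sum>i\<le>n. coeff p i * z ^ i) = (\<Sum>i\<le>degree p. coeff p i * z ^ i)"
    using assms by (intro sum.mono_neutral_right) (auto simp: coeff_eq_0)
  then show ?thesis by (simp add: poly_altdef)
qed

lemma graded_scale:
  assumes "graded g G n" shows "g (scale t v) = poly (G v) t"
proof -
  have d: "degree (G w) \<le> n" for w using assms by (simp add: graded_def)
  have P: "poly (G w) z = (\<Sum>i\<le>n. coeff (G w) i * z ^ i)" for w z
    by (rule poly_as_sum) (rule d)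
  have h: "coeff (G (scale t v)) i = t ^ i * coeff (G v) i" for i
    using homogeneous_scale[of i "\<lambda>v. coeff (G v) i"] assms by (auto simp: graded_def)
  have "g (scale t v) = poly (G (scale t v)) 1" using assms by (simp add: graded_def)
  then show ?thesis unfolding P by (simp add: h mult.commute)
qed

lemma graded_sum:
  assumes "graded g G n" shows "g v = (\<Sum>d\<le>n. coeff (G v) d)"
proof -
  have "degree (G v) \<le> n" "g v = poly (G v) 1" using assms by (auto simp: graded_def)
  then show ?thesis by (simp add: poly_as_sum[of "G v" n])
qed

lemma poly_eq_0_infinite: "(\<And>t. poly p t = 0) \<Longrightarrow> p = (0 :: 'k poly)"
  using poly_roots_finite[of p] infinite_alg_closed by fastforce

definition conical :: "'v set \<Rightarrow> bool" where
  "conical C \<longleftrightarrow> (\<forall>v\<in>C. \<forall>t. scale t v \<in> C)"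

text \<open>Irreducibility tested on polynomial functions: the vanishing ideal of \<open>C\<close> is prime.\<close>

definition irred :: "'v set \<Rightarrow> bool" where
  "irred C \<longleftrightarrow> C \<noteq> {} \<and> (\<forall>g\<in>Pol. \<forall>h\<in>Pol. (\<forall>v\<in>C. g v * h v = 0) \<longrightarrow> (\<forall>v\<in>C. g v = 0) \<or> (\<forall>v\<in>C. h v = 0))"

definition zero_locus :: "('v \<Rightarrow> 'k) set \<Rightarrow> 'v set" where
  "zero_locus J = {v. \<forall>h\<in>J. h v = 0}"

definition nonvanishing :: "'v set \<Rightarrow> ('v \<Rightarrow> 'k) \<Rightarrow> bool" where
  "nonvanishing C g \<longleftrightarrow> (\<exists>v\<in>C. g v \<noteq> 0)"

lemma irredD:
  assumes "irred C" "g \<in> Pol" "h \<in> Pol" "nonvanishing C g" "nonvanishing C h"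
  shows "nonvanishing C (\<lambda>v. g v * h v)"
proof (rule ccontr)
  assume "\<not> ?thesis"
  then have "\<forall>v\<in>C. g v * h v = 0" by (auto simp: nonvanishing_def)
  moreover have "(\<forall>v\<in>C. g v * h v = 0) \<longrightarrow> (\<forall>v\<in>C. g v = 0) \<or> (\<forall>v\<in>C. h v = 0)"
    using assms(1-3) unfolding irred_def by blast
  ultimately show False using assms(4,5) by (auto simp: nonvanishing_def)
qed

lemma irred_nonempty: "irred C \<Longrightarrow> C \<noteq> {}" by (simp add: irred_def)

lemma irred_one: "irred C \<Longrightarrow> nonvanishing C (\<lambda>_. 1)" by (auto simp: irred_def nonvanishing_def)

lemma nonvanishing_power: "nonvanishing C g \<Longrightarrow> nonvanishing C (\<lambda>v. g v ^ n)"
  by (auto simp: nonvanishing_def)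

lemma irred_prod:
  assumes "irred C" "finite I" "\<And>i. i \<in> I \<Longrightarrow> h i \<in> Pol" "\<And>i. i \<in> I \<Longrightarrow> nonvanishing C (h i)"
  shows "nonvanishing C (\<lambda>v. \<Prod>i\<in>I. h i v)"
  using assms(2-4)
proof (induction I rule: finite_induct)
  case (insert i I)
  then have "nonvanishing C (\<lambda>v. h i v * (\<Prod>i\<in>I. h i v))"
    by (intro irredD[OF assms(1)] poly_fun_prod) auto
  then show ?case using insert by simp
qed (use irred_one[OF assms(1)] in auto)

text \<open>On a cone, components of different degrees vanish separately.\<close>

lemma conical_homogeneous_sum:
  assumes C: "conical C" and I: "finite I" "inj_on e I" and h: "\<And>i. i \<in> I \<Longrightarrow> homogeneous scale (e i) (h i)"
    and z: "\<And>v. v \<in> C \<Longrightarrow> (\<Sum>i\<in>I. h i v) = 0" and iv: "i \<in> I" "v \<in> C"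
  shows "h i v = 0"
proof -
  define p where "p = (\<Sum>i\<in>I. monom (h i v) (e i))"
  have "poly p t = 0" for t
  proof -
    have "poly p t = (\<Sum>i\<in>I. h i (scale t v))"
      unfolding p_def by (simp add: poly_sum poly_monom homogeneous_scale[OF h] mult.commute)
    then show ?thesis using z[of "scale t v"] C iv by (simp add: conical_def)
  qed
  then have "p = 0" by (rule poly_eq_0_infinite)
  then have "coeff p (e i) = 0" by simp
  moreover have "coeff p (e i) = (\<Sum>j\<in>I. if j = i then h j v else 0)"
    unfolding p_def coeff_sum using I(2) iv(1) by (intro sum.cong) (auto simp: inj_on_def)
  ultimately show ?thesis using I(1) iv(1) by simp
qed

lemma point_eq_iff:
  assumes "v \<noteq> 0" "w \<noteq> 0"
  shows "point scale v = point scale w \<longleftrightarrow> (\<exists>t. t \<noteq> 0 \<and> v = scale t w)"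
proof
  assume "point scale v = point scale w"
  moreover have "v \<in> point scale v" unfolding point_def by (metis rangeI scale_one)
  ultimately obtain t where "v = scale t w" by (auto simp: point_def)
  then show "\<exists>t. t \<noteq> 0 \<and> v = scale t w" using assms by (auto intro!: exI[of _ t])
next
  assume "\<exists>t. t \<noteq> 0 \<and> v = scale t w"
  then obtain t where t: "t \<noteq> 0" "v = scale t w" by blast
  have "scale a v = scale (a * t) w" "scale a w = scale (a * inverse t) v" for a using t by simp_all
  then show "point scale v = point scale w" unfolding point_def by (metis (mono_tags, lifting) rangeI subsetI subset_antisym image_subsetI)
qed

lemma point_in_hypersurface:
  assumes "homogeneous scale d g" "v \<noteq> 0"
  shows "point scale v \<in> hypersurface scale g \<longleftrightarrow> g v = 0"
proof
  assume "point scale v \<in> hypersurface scale g"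
  then obtain w where w: "w \<noteq> 0" "g w = 0" "point scale v = point scale w" by (auto simp: hypersurface_def)
  then obtain t where "v = scale t w" using point_eq_iff[OF assms(2) w(1)] by auto
  then show "g v = 0" using homogeneous_scale[OF assms(1)] w by simp
qed (use assms in \<open>auto simp: hypersurface_def\<close>)

lemma closed_points:
  assumes "zariski_closed scale Y" "L \<in> Y" obtains v where "v \<noteq> 0" "L = point scale v"
  using assms by (auto simp: zariski_closed_def proj_space_def)

lemma cone_mem:
  assumes "zariski_closed scale Y" "v \<noteq> 0"
  shows "v \<in> cone Y \<longleftrightarrow> point scale v \<in> Y"
proof
  assume "v \<in> cone Y"
  then obtain L where L: "L \<in> Y" "v \<in> L" using assms by (auto simp: cone_def)
  obtain w where w: "w \<noteq> 0" "L = point scale w" using closed_points[OF assms(1) L(1)] .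
  then obtain t where "v = scale t w" using L by (auto simp: point_def)
  then have "point scale v = L" using point_eq_iff[OF assms(2) w(1)] w assms(2) by auto
  then show "point scale v \<in> Y" using L by simp
next
  have "v \<in> point scale v" unfolding point_def by (metis rangeI scale_one)
  then show "point scale v \<in> Y \<Longrightarrow> v \<in> cone Y" by (auto simp: cone_def)
qed

lemma zero_in_cone: "0 \<in> cone Y" by (simp add: cone_def)

lemma conical_cone:
  assumes "zariski_closed scale Y" shows "conical (cone Y)"
  unfolding conical_def
proof (intro ballI allI)
  fix v t assume v: "v \<in> cone Y"
  show "scale t v \<in> cone Y"
  proof (cases "t = 0 \<or> v = 0")
    case False
    then have "scale t v \<noteq> 0" by simp
    moreover have "point scale (scale t v) = point scale v" using False point_eq_iff[of "scale t v" v] by auto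
    ultimately show ?thesis using cone_mem[OF assms] v False by auto
  qed (auto simp: zero_in_cone)
qed

lemma cone_zero_locus:
  assumes Y: "zariski_closed scale Y" "Y \<noteq> {}"
  obtains J where "\<And>h. h \<in> J \<Longrightarrow> \<exists>d. homogeneous scale d h" "cone Y = zero_locus J"
proof -
  obtain J where J: "\<forall>g\<in>J. \<exists>d. homogeneous scale d g" "Y = {L \<in> proj_space scale. \<forall>g\<in>J. L \<in> hypersurface scale g}"
    using Y by (auto simp: zariski_closed_def)
  have mem: "v \<in> cone Y \<longleftrightarrow> v \<in> zero_locus J" if "v \<noteq> 0" for v
  proof -
    have "point scale v \<in> Y \<longleftrightarrow> (\<forall>g\<in>J. point scale v \<in> hypersurface scale g)"
      using J(2) that by (auto simp: proj_space_def)
    also have "\<dots> \<longleftrightarrow> v \<in> zero_locus J" using point_in_hypersurface[OF _ that] J(1) by (fastforce simp: zero_locus_def)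
    finally show ?thesis using cone_mem[OF Y(1) that] by simp
  qed
  obtain L where "L \<in> Y" using Y(2) by auto
  then obtain w where w: "w \<noteq> 0" "L = point scale w" using closed_points[OF Y(1)] by blast
  then have wJ: "w \<in> zero_locus J" using mem[OF w(1)] cone_mem[OF Y(1) w(1)] \<open>L \<in> Y\<close> by simp
  have "0 \<in> zero_locus J"
    unfolding zero_locus_def
  proof (intro CollectI ballI)
    fix h assume h: "h \<in> J"
    then obtain d where d: "homogeneous scale d h" using J(1) by blast
    have "h 0 = 0 ^ d * h w" using homogeneous_scale[OF d, of 0 w] by simp
    then show "h 0 = 0" using wJ h by (simp add: zero_locus_def)
  qed
  then have "v \<in> cone Y \<longleftrightarrow> v \<in> zero_locus J" for v
    using mem[of v] zero_in_cone[of Y] by (cases "v = 0") auto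
  then have eq: "cone Y = zero_locus J" by (simp add: set_eq_iff)
  show thesis by (rule that[OF _ eq]) (use J(1) in blast)
qed

lemma closed_inter_hypersurface:
  assumes "zariski_closed scale Y" "homogeneous scale d g"
  shows "zariski_closed scale (Y \<inter> hypersurface scale g)"
proof -
  obtain J where J: "\<forall>g\<in>J. \<exists>d. homogeneous scale d g" "Y = {L \<in> proj_space scale. \<forall>g\<in>J. L \<in> hypersurface scale g}"
    using assms by (auto simp: zariski_closed_def)
  show ?thesis unfolding zariski_closed_def
    by (rule exI[of _ "insert g J"]) (use J assms in auto)
qed

text \<open>Only homogeneous functions define closed subsets of \<open>Y\<close>. If \<open>g h\<close> vanishes on the cone, then so does the product
of the polynomials of components at each point; hence at each point all components of \<open>g\<close> or
all components of \<open>h\<close> vanish, and any two components lead to a covering of \<open>Y\<close> by two closed sets.\<close>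

lemma irred_cone:
  assumes Y: "proj_variety scale Y" shows "irred (cone Y)"
proof -
  have Y': "zariski_closed scale Y" "Y \<noteq> {}" using Y by (auto simp: proj_variety_def)
  note con = conical_cone[OF Y'(1)]
  show ?thesis unfolding irred_def
  proof (intro conjI ballI impI)
    show "cone Y \<noteq> {}" by (auto simp: cone_def)
    fix g h assume gh: "g \<in> Pol" "h \<in> Pol" "\<forall>v\<in>cone Y. g v * h v = 0"
    obtain G n where G: "graded g G n" using graded_exists[OF gh(1)] by blast
    obtain H m where H: "graded h H m" using graded_exists[OF gh(2)] by blast
    have GH0: "G v * H v = 0" if "v \<in> cone Y" for v
    proof (rule poly_eq_0_infinite)
      fix t
      have "scale t v \<in> cone Y" using con that by (simp add: conical_def)
      then show "poly (G v * H v) t = 0" using gh(3) graded_scale[OF G, of t v] graded_scale[OF H, of t v] by auto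
    qed
    have van: "\<forall>v\<in>cone Y. a v = 0" if a: "homogeneous scale d a" "Y = Y \<inter> hypersurface scale a" for a d
    proof
      have *: "a v = 0" if "v \<in> cone Y" "v \<noteq> 0" for v
        using that a point_in_hypersurface[OF a(1), of v] cone_mem[OF Y'(1), of v] by auto
      obtain w where "w \<noteq> 0" "w \<in> cone Y" using Y' closed_points[OF Y'(1)] cone_mem[OF Y'(1)] by (metis ex_in_conv)
      then have "a w = 0" using * by blast
      then have "a 0 = 0" using homogeneous_scale[OF a(1), of 0 w] by simp
      then show "a v = 0" if "v \<in> cone Y" for v using * that by blast
    qed
    show "(\<forall>v\<in>cone Y. g v = 0) \<or> (\<forall>v\<in>cone Y. h v = 0)"
    proof (rule ccontr)
      assume "\<not> ?thesis"
      then obtain v w where vw: "v \<in> cone Y" "g v \<noteq> 0" "w \<in> cone Y" "h w \<noteq> 0" by auto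
      obtain d where d: "coeff (G v) d \<noteq> 0" using vw(2) graded_sum[OF G, of v] by (metis sum.neutral)
      obtain e where e: "coeff (H w) e \<noteq> 0" using vw(4) graded_sum[OF H, of w] by (metis sum.neutral)
      let ?a = "\<lambda>v. coeff (G v) d" and ?b = "\<lambda>v. coeff (H v) e"
      have ab: "homogeneous scale d ?a" "homogeneous scale e ?b" using G H by (auto simp: graded_def)
      have "Y = (Y \<inter> hypersurface scale ?a) \<union> (Y \<inter> hypersurface scale ?b)"
      proof -
        have "L \<in> hypersurface scale ?a \<or> L \<in> hypersurface scale ?b" if L: "L \<in> Y" for L
        proof -
          obtain u where u: "u \<noteq> 0" "L = point scale u" using closed_points[OF Y'(1) L] .
          then have "u \<in> cone Y" using cone_mem[OF Y'(1)] L by simp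
          then have "G u = 0 \<or> H u = 0" using GH0 by auto
          then show ?thesis using point_in_hypersurface[OF ab(1) u(1)] point_in_hypersurface[OF ab(2) u(1)] u(2) by auto
        qed
        then show ?thesis by blast
      qed
      then have "Y = Y \<inter> hypersurface scale ?a \<or> Y = Y \<inter> hypersurface scale ?b"
        using Y closed_inter_hypersurface[OF Y'(1)] ab unfolding proj_variety_def by blast
      then show False using van[OF ab(1)] van[OF ab(2)] d e vw by blast
    qed
  qed
qed

end

section \<open>Coordinate rings and function fields\<close>

context closed_field_space
begin

lemma coord_ring_simps:
  "carrier (coord_ring scale C) = (\<lambda>g. restrict g C) ` Pol"
  "g \<otimes>\<^bsub>coord_ring scale C\<^esub> h = restrict (\<lambda>v. g v * h v) C"
  "g \<oplus>\<^bsub>coord_ring scale C\<^esub> h = restrict (\<lambda>v. g v + h v) C"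
  "\<one>\<^bsub>coord_ring scale C\<^esub> = restrict (\<lambda>_. 1) C"
  "\<zero>\<^bsub>coord_ring scale C\<^esub> = restrict (\<lambda>_. 0) C"
  by (simp_all add: coord_ring_def)

lemma restrict_eq_iff: "restrict g C = restrict h C \<longleftrightarrow> (\<forall>v\<in>C. g v = h v)"
  by (auto simp: restrict_def fun_eq_iff)

lemma restrict_mult: "restrict (\<lambda>v. restrict g C v * restrict h C v) C = restrict (\<lambda>v. g v * h v) C"
  and restrict_add: "restrict (\<lambda>v. restrict g C v + restrict h C v) C = restrict (\<lambda>v. g v + h v) C"
  by (auto simp: restrict_eq_iff)

lemma coord_ring_closed:
  assumes "x \<in> carrier (coord_ring scale C)" "y \<in> carrier (coord_ring scale C)"
  shows "x \<oplus>\<^bsub>coord_ring scale C\<^esub> y \<in> carrier (coord_ring scale C)"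
    "x \<otimes>\<^bsub>coord_ring scale C\<^esub> y \<in> carrier (coord_ring scale C)"
proof -
  obtain g h where gh: "g \<in> Pol" "x = restrict g C" "h \<in> Pol" "y = restrict h C"
    using assms by (auto simp: coord_ring_simps)
  have "(\<lambda>v. g v + h v) \<in> Pol" "(\<lambda>v. g v * h v) \<in> Pol" using gh by (auto intro: poly_fun_intros)
  then show "x \<oplus>\<^bsub>coord_ring scale C\<^esub> y \<in> carrier (coord_ring scale C)"
    "x \<otimes>\<^bsub>coord_ring scale C\<^esub> y \<in> carrier (coord_ring scale C)"
    by (simp_all add: coord_ring_simps gh restrict_mult restrict_add del: restrict_apply)
qed

lemma coord_ring_cring: "cring (coord_ring scale C)"
proof (rule cringI)
  let ?R = "coord_ring scale C"
  show "abelian_group ?R"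
  proof (rule abelian_groupI)
    fix x assume "x \<in> carrier ?R"
    then obtain g where g: "g \<in> Pol" "x = restrict g C" by (auto simp: coord_ring_simps)
    have "(\<lambda>v. - 1 * g v) \<in> Pol" using g by (intro poly_fun_intros)
    then show "\<exists>y\<in>carrier ?R. y \<oplus>\<^bsub>?R\<^esub> x = \<zero>\<^bsub>?R\<^esub>"
      unfolding coord_ring_simps by (intro bexI[of _ "restrict (\<lambda>v. - 1 * g v) C"]) (auto simp: g restrict_eq_iff)
  next
    show "\<zero>\<^bsub>?R\<^esub> \<in> carrier ?R" by (auto simp: coord_ring_simps intro: poly_fun_intros)
  qed (auto simp: coord_ring_closed, auto simp: coord_ring_simps restrict_eq_iff)
  show "Group.comm_monoid ?R"
  proof (rule comm_monoidI)
    show "\<one>\<^bsub>?R\<^esub> \<in> carrier ?R" by (auto simp: coord_ring_simps intro: poly_fun_intros)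
  qed (auto simp: coord_ring_closed, auto simp: coord_ring_simps restrict_eq_iff)
  show "\<And>x y z. x \<in> carrier ?R \<Longrightarrow> y \<in> carrier ?R \<Longrightarrow> z \<in> carrier ?R \<Longrightarrow>
      (x \<oplus>\<^bsub>?R\<^esub> y) \<otimes>\<^bsub>?R\<^esub> z = x \<otimes>\<^bsub>?R\<^esub> z \<oplus>\<^bsub>?R\<^esub> y \<otimes>\<^bsub>?R\<^esub> z"
    by (auto simp: coord_ring_simps restrict_eq_iff algebra_simps)
qed

text \<open>If no power of \<open>g\<close> were a multiple of \<open>f\<close> on \<open>C\<close>, some prime ideal would contain \<open>f\<close> and no power of \<open>g\<close>, and
\<open>Nullstellensatz_prime\<close> would give a point of \<open>C\<close> that is a zero of \<open>f\<close> but not of \<open>g\<close>.\<close>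

lemma Nullstellensatz_hypersurface:
  assumes C: "C = zero_locus J" "J \<subseteq> Pol" and fg: "f \<in> Pol" "g \<in> Pol" "\<And>v. v \<in> C \<Longrightarrow> f v = 0 \<Longrightarrow> g v = 0"
  obtains n :: nat and h where "h \<in> Pol" "\<And>v. v \<in> C \<Longrightarrow> g v ^ n = h v * f v"
proof -
  let ?R = "coord_ring scale C"
  interpret R: cring ?R by (rule coord_ring_cring)
  define r where "r g = restrict g C" for g :: "'v \<Rightarrow> 'k"
  have r: "r g \<in> carrier ?R" if "g \<in> Pol" for g using that by (auto simp: coord_ring_simps r_def)
  have r_mult: "r g \<otimes>\<^bsub>?R\<^esub> r h = r (\<lambda>v. g v * h v)" for g h by (auto simp: coord_ring_simps r_def restrict_eq_iff)
  have r_add: "r g \<oplus>\<^bsub>?R\<^esub> r h = r (\<lambda>v. g v + h v)" for g h by (auto simp: coord_ring_simps r_def restrict_eq_iff)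
  define S where "S = {r (\<lambda>v. g v ^ n) | n. n \<in> (UNIV :: nat set)}"
  have "\<not> (PIdl\<^bsub>?R\<^esub> r f) \<inter> S = {}"
  proof
    assume dis: "PIdl\<^bsub>?R\<^esub> r f \<inter> S = {}"
    obtain P where P: "primeideal P ?R" "PIdl\<^bsub>?R\<^esub> r f \<subseteq> P" "P \<inter> S = {}"
    proof (rule R.prime_avoiding_multiplicative_set[OF R.cgenideal_ideal[OF r[OF fg(1)]]])
      show "S \<subseteq> carrier ?R" using r poly_fun_power[OF fg(2)] by (auto simp: S_def)
      show "\<one>\<^bsub>?R\<^esub> \<in> S" unfolding S_def coord_ring_simps r_def by (auto intro!: exI[of _ 0])
      fix a b assume "a \<in> S" "b \<in> S"
      then obtain n m :: nat where "a = r (\<lambda>v. g v ^ n)" "b = r (\<lambda>v. g v ^ m)" by (auto simp: S_def)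
      then have "a \<otimes>\<^bsub>?R\<^esub> b = r (\<lambda>v. g v ^ (n + m))" by (simp add: r_mult power_add)
      then show "a \<otimes>\<^bsub>?R\<^esub> b \<in> S" by (auto simp: S_def)
    qed (use dis in auto)
    note p = R.primeideal_closed[OF P(1)]
    note c = R.ideal_closed[OF p(1)]
    define Q where "Q = {h \<in> Pol. r h \<in> P}"
    have "\<exists>v. (\<forall>h\<in>Q. h v = 0) \<and> g v \<noteq> 0"
    proof (rule Nullstellensatz_prime[of Q g])
      show "Q \<subseteq> Pol" by (auto simp: Q_def)
      show "(\<lambda>_. 0) \<in> Q" using c(2) by (auto simp: Q_def coord_ring_simps r_def intro: poly_fun_intros)
      show "(\<lambda>_. 1) \<notin> Q" using p(2) by (auto simp: Q_def coord_ring_simps r_def)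
      show "(\<lambda>v. a v + b v) \<in> Q" if "a \<in> Q" "b \<in> Q" for a b
        using that c(3)[of "r a" "r b"] by (auto simp: Q_def r_add intro: poly_fun_intros)
      show "(\<lambda>v. a v * b v) \<in> Q" if "a \<in> Pol" "b \<in> Q" for a b
        using that c(5)[of "r b" "r a"] r by (auto simp: Q_def r_mult intro: poly_fun_intros)
      show "a \<in> Q \<or> b \<in> Q" if "a \<in> Pol" "b \<in> Pol" "(\<lambda>v. a v * b v) \<in> Q" for a b
        using that p(3)[OF r[OF that(1)] r[OF that(2)]] by (auto simp: Q_def r_mult)
      show "g \<in> Pol" by fact
      have "r g \<in> S" unfolding S_def by (intro CollectI exI[of _ 1]) simp
      then show "g \<notin> Q" using P(3) by (auto simp: Q_def)
    qed blast
    then obtain v where v: "\<And>h. h \<in> Q \<Longrightarrow> h v = 0" "g v \<noteq> 0" by blast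
    have "v \<in> C"
      unfolding C(1) zero_locus_def
    proof (intro CollectI ballI v(1))
      fix h assume h: "h \<in> J"
      have "r h = \<zero>\<^bsub>?R\<^esub>" using h by (auto simp: C(1) zero_locus_def r_def coord_ring_simps restrict_eq_iff)
      then show "h \<in> Q" using c(2) h C(2) by (auto simp: Q_def)
    qed
    moreover have "r f \<in> P" using P(2) R.cgenideal_self[OF r[OF fg(1)]] by blast
    then have "f v = 0" using v(1) fg(1) by (auto simp: Q_def)
    ultimately show False using fg(3) v(2) by blast
  qed
  then obtain n :: nat where "r (\<lambda>v. g v ^ n) \<in> PIdl\<^bsub>?R\<^esub> r f" by (auto simp: S_def)
  then obtain h where h: "h \<in> Pol" "r (\<lambda>v. g v ^ n) = r (\<lambda>v. h v * f v)"
    by (auto simp: cgenideal_def coord_ring_simps(1) r_def[symmetric] r_mult)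
  have "g v ^ n = h v * f v" if "v \<in> C" for v using h(2) that by (auto simp: r_def restrict_eq_iff)
  with h(1) that show thesis by blast
qed

end

locale function_field = closed_field_space scale Basis
  for scale :: "'k::alg_closed_field \<Rightarrow> 'v::ab_group_add \<Rightarrow> 'v" and Basis +
  fixes C :: "'v set"
  assumes irred_C: "irred C"
begin

abbreviation "R \<equiv> coord_ring scale C"
abbreviation "K \<equiv> fun_field scale C"
abbreviation "nz \<equiv> nonvanishing C"
abbreviation "rat \<equiv> ratio scale C"

lemma nz_mult: "g \<in> Pol \<Longrightarrow> h \<in> Pol \<Longrightarrow> nz g \<Longrightarrow> nz h \<Longrightarrow> nz (\<lambda>v. g v * h v)"
  using irredD[OF irred_C] .

lemma nz_one: "nz (\<lambda>_. 1)" by (rule irred_one[OF irred_C])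

lemma restrict_nz: "restrict g C \<noteq> \<zero>\<^bsub>R\<^esub> \<longleftrightarrow> nz g"
  by (auto simp: coord_ring_simps restrict_eq_iff nonvanishing_def)

lemma cancel:
  assumes "g \<in> Pol" "h \<in> Pol" "nz g" "\<And>v. v \<in> C \<Longrightarrow> g v * h v = 0" "v \<in> C"
  shows "h v = 0"
  using nz_mult[OF assms(1,2,3)] assms(4,5) by (auto simp: nonvanishing_def)

lemma rat_mem:
  "(c, d) \<in> rat a b \<longleftrightarrow> (\<exists>c'\<in>Pol. \<exists>d'\<in>Pol. c = restrict c' C \<and> d = restrict d' C \<and> nz d' \<and> (\<forall>v\<in>C. a v * d' v = c' v * b v))"
  unfolding ratio_def fraction_def
  by (auto simp: restrict_nz[symmetric]) (auto simp: coord_ring_simps restrict_eq_iff image_iff, blast+)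

lemma rat_self:
  assumes "a \<in> Pol" "b \<in> Pol" "nz b" shows "(restrict a C, restrict b C) \<in> rat a b"
  unfolding rat_mem using assms by (intro bexI[of _ a] bexI[of _ b]) auto

lemma rat_eqI:
  assumes P: "a \<in> Pol" "b \<in> Pol" "c \<in> Pol" "d \<in> Pol" and nz: "nz b" "nz d"
    and eq: "\<And>v. v \<in> C \<Longrightarrow> a v * d v = c v * b v"
  shows "rat a b = rat c d"
proof -
  have sub: "rat a b \<subseteq> rat c d" if P: "a \<in> Pol" "b \<in> Pol" "c \<in> Pol" "d \<in> Pol" and nz: "nz b" "nz d"
    and eq: "\<And>v. v \<in> C \<Longrightarrow> a v * d v = c v * b v" for a b c d
  proof (rule subrelI)
    fix x y assume "(x, y) \<in> rat a b"
    then obtain x' y' where xy: "x' \<in> Pol" "y' \<in> Pol" "x = restrict x' C" "y = restrict y' C" "nz y'"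
      "\<forall>v\<in>C. a v * y' v = x' v * b v" unfolding rat_mem by blast
    have "c v * y' v - x' v * d v = 0" if v: "v \<in> C" for v
    proof (rule cancel[OF P(2) _ nz(1) _ v])
      show "(\<lambda>v. c v * y' v - x' v * d v) \<in> Pol" using P xy by (intro poly_fun_intros)
      fix v assume v: "v \<in> C"
      have "b v * (c v * y' v - x' v * d v) = (c v * b v) * y' v - (x' v * b v) * d v" by (simp add: algebra_simps)
      also have "\<dots> = 0" using eq[OF v] xy(6) v by (simp flip: eq) 
      finally show "b v * (c v * y' v - x' v * d v) = 0" .
    qed
    then have "\<forall>v\<in>C. c v * y' v = x' v * d v" by simp
    then show "(x, y) \<in> rat c d" unfolding rat_mem using xy by blast
  qed
  show ?thesis using sub[OF assms] sub[OF P(3,4,1,2) nz(2,1) eq[symmetric]] by blast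
qed

lemma rat_eq_iff:
  assumes P: "a \<in> Pol" "b \<in> Pol" "c \<in> Pol" "d \<in> Pol" and nz: "nz b" "nz d"
  shows "rat a b = rat c d \<longleftrightarrow> (\<forall>v\<in>C. a v * d v = c v * b v)"
proof
  assume "rat a b = rat c d"
  then have "(restrict a C, restrict b C) \<in> rat c d" using rat_self P nz by metis
  then obtain a' b' where "restrict a C = restrict a' C" "restrict b C = restrict b' C" "\<forall>v\<in>C. c v * b' v = a' v * d v"
    unfolding rat_mem by blast
  then show "\<forall>v\<in>C. a v * d v = c v * b v" by (simp add: restrict_eq_iff)
qed (use rat_eqI[OF assms] in blast)

lemma carrier_K: "carrier K = {rat a b | a b. a \<in> Pol \<and> b \<in> Pol \<and> nz b}"
proof -
  have "carrier K = {fraction R a b | a b. a \<in> carrier R \<and> b \<in> carrier R - {\<zero>\<^bsub>R\<^esub>}}"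
    by (simp add: fun_field_def fraction_field_def)
  also have "\<dots> = {rat a b | a b. a \<in> Pol \<and> b \<in> Pol \<and> nz b}"
    unfolding coord_ring_simps(1) ratio_def restrict_nz[symmetric] by blast
  finally show ?thesis .
qed

lemma K_cases:
  assumes "x \<in> carrier K" obtains a b where "a \<in> Pol" "b \<in> Pol" "nz b" "x = rat a b"
  using assms unfolding carrier_K by blast

lemma rat_in_K: "a \<in> Pol \<Longrightarrow> b \<in> Pol \<Longrightarrow> nz b \<Longrightarrow> rat a b \<in> carrier K"
  unfolding carrier_K by blast

lemma UN_pairs_const:
  assumes "x \<noteq> {}" "y \<noteq> {}" "\<And>a b c d. (a, b) \<in> x \<Longrightarrow> (c, d) \<in> y \<Longrightarrow> f a b c d = z"
  shows "(\<Union>(a, b)\<in>x. \<Union>(c, d)\<in>y. f a b c d) = z"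
  using assms by fastforce

lemma rat_mult:
  assumes P: "a \<in> Pol" "b \<in> Pol" "c \<in> Pol" "d \<in> Pol" and nz: "nz b" "nz d"
  shows "rat a b \<otimes>\<^bsub>K\<^esub> rat c d = rat (\<lambda>v. a v * c v) (\<lambda>v. b v * d v)"
proof -
  have "rat a b \<otimes>\<^bsub>K\<^esub> rat c d = (\<Union>(a, b)\<in>rat a b. \<Union>(c, d)\<in>rat c d. fraction R (a \<otimes>\<^bsub>R\<^esub> c) (b \<otimes>\<^bsub>R\<^esub> d))"
    by (simp add: fun_field_def fraction_field_def)
  also have "\<dots> = rat (\<lambda>v. a v * c v) (\<lambda>v. b v * d v)"
  proof (rule UN_pairs_const)
    show "rat a b \<noteq> {}" "rat c d \<noteq> {}" using rat_self P nz by blast+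
    fix a' b' c' d' assume "(a', b') \<in> rat a b" "(c', d') \<in> rat c d"
    then obtain x y z w where *: "x \<in> Pol" "y \<in> Pol" "a' = restrict x C" "b' = restrict y C" "nz y" "\<forall>v\<in>C. a v * y v = x v * b v"
      "z \<in> Pol" "w \<in> Pol" "c' = restrict z C" "d' = restrict w C" "nz w" "\<forall>v\<in>C. c v * w v = z v * d v"
      unfolding rat_mem by blast
    have "fraction R (a' \<otimes>\<^bsub>R\<^esub> c') (b' \<otimes>\<^bsub>R\<^esub> d') = rat (\<lambda>v. x v * z v) (\<lambda>v. y v * w v)"
      by (simp only: * coord_ring_simps restrict_mult ratio_def)
    also have "\<dots> = rat (\<lambda>v. a v * c v) (\<lambda>v. b v * d v)"
    proof (rule rat_eqI)
      show "nz (\<lambda>v. y v * w v)" "nz (\<lambda>v. b v * d v)" using * P nz by (auto intro!: nz_mult)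
      fix v assume v: "v \<in> C"
      have "x v * z v * (b v * d v) = (x v * b v) * (z v * d v)" by (simp add: ac_simps)
      also have "\<dots> = (a v * y v) * (c v * w v)" using *(6,12) v by simp
      finally show "x v * z v * (b v * d v) = a v * c v * (y v * w v)" by (simp add: ac_simps)
    qed (use * P in \<open>auto intro!: poly_fun_intros\<close>)
    finally show "fraction R (a' \<otimes>\<^bsub>R\<^esub> c') (b' \<otimes>\<^bsub>R\<^esub> d') = rat (\<lambda>v. a v * c v) (\<lambda>v. b v * d v)" .
  qed
  finally show ?thesis .
qed

lemma rat_add:
  assumes P: "a \<in> Pol" "b \<in> Pol" "c \<in> Pol" "d \<in> Pol" and nz: "nz b" "nz d"
  shows "rat a b \<oplus>\<^bsub>K\<^esub> rat c d = rat (\<lambda>v. a v * d v + c v * b v) (\<lambda>v. b v * d v)"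
proof -
  have "rat a b \<oplus>\<^bsub>K\<^esub> rat c d = (\<Union>(a, b)\<in>rat a b. \<Union>(c, d)\<in>rat c d. fraction R ((a \<otimes>\<^bsub>R\<^esub> d) \<oplus>\<^bsub>R\<^esub> (c \<otimes>\<^bsub>R\<^esub> b)) (b \<otimes>\<^bsub>R\<^esub> d))"
    by (simp add: fun_field_def fraction_field_def)
  also have "\<dots> = rat (\<lambda>v. a v * d v + c v * b v) (\<lambda>v. b v * d v)"
  proof (rule UN_pairs_const)
    show "rat a b \<noteq> {}" "rat c d \<noteq> {}" using rat_self P nz by blast+
    fix a' b' c' d' assume "(a', b') \<in> rat a b" "(c', d') \<in> rat c d"
    then obtain x y z w where *: "x \<in> Pol" "y \<in> Pol" "a' = restrict x C" "b' = restrict y C" "nz y" "\<forall>v\<in>C. a v * y v = x v * b v"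
      "z \<in> Pol" "w \<in> Pol" "c' = restrict z C" "d' = restrict w C" "nz w" "\<forall>v\<in>C. c v * w v = z v * d v"
      unfolding rat_mem by blast
    have "fraction R ((a' \<otimes>\<^bsub>R\<^esub> d') \<oplus>\<^bsub>R\<^esub> (c' \<otimes>\<^bsub>R\<^esub> b')) (b' \<otimes>\<^bsub>R\<^esub> d') = rat (\<lambda>v. x v * w v + z v * y v) (\<lambda>v. y v * w v)"
      by (simp only: * coord_ring_simps restrict_mult restrict_add ratio_def)
    also have "\<dots> = rat (\<lambda>v. a v * d v + c v * b v) (\<lambda>v. b v * d v)"
    proof (rule rat_eqI)
      show "nz (\<lambda>v. y v * w v)" "nz (\<lambda>v. b v * d v)" using * P nz by (auto intro!: nz_mult)
      fix v assume v: "v \<in> C"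
      have "(x v * w v + z v * y v) * (b v * d v) = (x v * b v) * (w v * d v) + (z v * d v) * (y v * b v)" by (simp add: algebra_simps)
      also have "\<dots> = (a v * y v) * (w v * d v) + (c v * w v) * (y v * b v)" using *(6,12) v by simp
      finally show "(x v * w v + z v * y v) * (b v * d v) = (a v * d v + c v * b v) * (y v * w v)" by (simp add: algebra_simps)
    qed (use * P in \<open>auto intro!: poly_fun_intros\<close>)
    finally show "fraction R ((a' \<otimes>\<^bsub>R\<^esub> d') \<oplus>\<^bsub>R\<^esub> (c' \<otimes>\<^bsub>R\<^esub> b')) (b' \<otimes>\<^bsub>R\<^esub> d') = rat (\<lambda>v. a v * d v + c v * b v) (\<lambda>v. b v * d v)" .
  qed
  finally show ?thesis .
qed

lemma rat_smult:
  assumes P: "a \<in> Pol" "b \<in> Pol" and nz: "nz b"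
  shows "t \<odot>\<^bsub>K\<^esub> rat a b = rat (\<lambda>v. t * a v) b"
proof -
  have "t \<odot>\<^bsub>K\<^esub> rat a b = (\<Union>(a, b)\<in>rat a b. fraction R (t \<odot>\<^bsub>R\<^esub> a) b)"
    by (simp add: fun_field_def fraction_field_def)
  also have "\<dots> = rat (\<lambda>v. t * a v) b"
  proof -
    have "fraction R (t \<odot>\<^bsub>R\<^esub> a') b' = rat (\<lambda>v. t * a v) b" if m: "(a', b') \<in> rat a b" for a' b'
    proof -
      obtain x y where *: "x \<in> Pol" "y \<in> Pol" "a' = restrict x C" "b' = restrict y C" "nz y" "\<forall>v\<in>C. a v * y v = x v * b v"
        using m unfolding rat_mem by blast
      have "t \<odot>\<^bsub>R\<^esub> a' = restrict (\<lambda>v. t * x v) C" unfolding * coord_ring_def by (auto simp: restrict_eq_iff)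
      then have "fraction R (t \<odot>\<^bsub>R\<^esub> a') b' = rat (\<lambda>v. t * x v) y" by (simp add: * ratio_def)
      also have "\<dots> = rat (\<lambda>v. t * a v) b"
        by (rule rat_eqI) (use * P nz in \<open>auto intro!: poly_fun_intros\<close>)
      finally show ?thesis .
    qed
    moreover have "rat a b \<noteq> {}" using rat_self P nz by blast
    ultimately show ?thesis by fastforce
  qed
  finally show ?thesis .
qed

lemma K_one: "\<one>\<^bsub>K\<^esub> = rat (\<lambda>_. 1) (\<lambda>_. 1)"
  and K_zero: "\<zero>\<^bsub>K\<^esub> = rat (\<lambda>_. 0) (\<lambda>_. 1)"
  by (simp_all add: fun_field_def fraction_field_def ratio_def coord_ring_simps)

lemma rat_eq_zero_iff: "a \<in> Pol \<Longrightarrow> b \<in> Pol \<Longrightarrow> nz b \<Longrightarrow> rat a b = \<zero>\<^bsub>K\<^esub> \<longleftrightarrow> \<not> nz a"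
  unfolding K_zero by (subst rat_eq_iff) (auto intro: poly_fun_intros nz_one simp: nonvanishing_def)

lemma field_K: "field K"
proof -
  note pi = poly_fun_intros
  have ab: "abelian_group K"
  proof (rule abelian_groupI)
    fix x y assume "x \<in> carrier K" "y \<in> carrier K"
    then obtain a b c d where *: "a \<in> Pol" "b \<in> Pol" "nz b" "x = rat a b" "c \<in> Pol" "d \<in> Pol" "nz d" "y = rat c d"
      by (metis K_cases)
    have n: "nz (\<lambda>v. b v * d v)" using * by (intro nz_mult)
    show "x \<oplus>\<^bsub>K\<^esub> y \<in> carrier K" unfolding *(4,8) using *(1-3,5-7) n by (subst rat_add) (auto intro!: rat_in_K pi)
    show "x \<oplus>\<^bsub>K\<^esub> y = y \<oplus>\<^bsub>K\<^esub> x" unfolding *(4,8) using *(1-3,5-7)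
      by (simp add: rat_add mult.commute[of "d _"] add.commute[of "c _ * _"])
    fix z assume "z \<in> carrier K"
    then obtain e g where z: "e \<in> Pol" "g \<in> Pol" "nz g" "z = rat e g" by (metis K_cases)
    have n2: "nz (\<lambda>v. d v * g v)" "nz (\<lambda>v. b v * d v * g v)" "nz (\<lambda>v. b v * (d v * g v))"
      using * z n by (auto intro!: nz_mult pi)
    show "x \<oplus>\<^bsub>K\<^esub> y \<oplus>\<^bsub>K\<^esub> z = x \<oplus>\<^bsub>K\<^esub> (y \<oplus>\<^bsub>K\<^esub> z)" unfolding *(4,8) z(4)
      using *(1-3,5-7) z(1-3) n n2 by (simp add: rat_add pi) (simp add: algebra_simps)
  next
    show "\<zero>\<^bsub>K\<^esub> \<in> carrier K" unfolding K_zero by (intro rat_in_K pi nz_one)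
    fix x assume "x \<in> carrier K"
    then obtain a b where *: "a \<in> Pol" "b \<in> Pol" "nz b" "x = rat a b" by (metis K_cases)
    show "\<zero>\<^bsub>K\<^esub> \<oplus>\<^bsub>K\<^esub> x = x" unfolding K_zero *(4) using *(1-3) nz_one by (simp add: rat_add pi)
    have m: "(\<lambda>v. - 1 * a v) \<in> Pol" using * by (intro pi)
    have "rat (\<lambda>v. - 1 * a v) b \<oplus>\<^bsub>K\<^esub> x = \<zero>\<^bsub>K\<^esub>" unfolding *(4) rat_add[OF m *(2) *(1,2,3,3)]
      using poly_fun.add[OF poly_fun.mult[OF m *(2)] poly_fun.mult[OF *(1,2)]] poly_fun.mult[OF *(2,2)] nz_mult[OF *(2,2,3,3)]
      by (subst rat_eq_zero_iff) (auto simp: nonvanishing_def)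
    then show "\<exists>y\<in>carrier K. y \<oplus>\<^bsub>K\<^esub> x = \<zero>\<^bsub>K\<^esub>" using rat_in_K[OF m *(2,3)] by blast
  qed
  have mon: "Group.comm_monoid K"
  proof (rule comm_monoidI)
    fix x y assume "x \<in> carrier K" "y \<in> carrier K"
    then obtain a b c d where *: "a \<in> Pol" "b \<in> Pol" "nz b" "x = rat a b" "c \<in> Pol" "d \<in> Pol" "nz d" "y = rat c d"
      by (metis K_cases)
    have n: "nz (\<lambda>v. b v * d v)" using * by (intro nz_mult)
    show "x \<otimes>\<^bsub>K\<^esub> y \<in> carrier K" unfolding *(4,8) using *(1-3,5-7) n by (subst rat_mult) (auto intro!: rat_in_K pi)
    show "x \<otimes>\<^bsub>K\<^esub> y = y \<otimes>\<^bsub>K\<^esub> x" unfolding *(4,8) using *(1-3,5-7)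
      by (simp add: rat_mult mult.commute)
    fix z assume "z \<in> carrier K"
    then obtain e g where z: "e \<in> Pol" "g \<in> Pol" "nz g" "z = rat e g" by (metis K_cases)
    have n2: "nz (\<lambda>v. d v * g v)"
      using * z by (intro nz_mult)
    show "x \<otimes>\<^bsub>K\<^esub> y \<otimes>\<^bsub>K\<^esub> z = x \<otimes>\<^bsub>K\<^esub> (y \<otimes>\<^bsub>K\<^esub> z)" unfolding *(4,8) z(4)
      using *(1-3,5-7) z(1-3) n n2 by (simp add: rat_mult pi) (simp add: mult.assoc)
  next
    show "\<one>\<^bsub>K\<^esub> \<in> carrier K" unfolding K_one by (intro rat_in_K pi nz_one)
    fix x assume "x \<in> carrier K"
    then obtain a b where *: "a \<in> Pol" "b \<in> Pol" "nz b" "x = rat a b" by (metis K_cases)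
    show "\<one>\<^bsub>K\<^esub> \<otimes>\<^bsub>K\<^esub> x = x" unfolding K_one *(4) using *(1-3) nz_one by (simp add: rat_mult pi)
  qed
  have cr: "cring K"
  proof (rule cringI[OF ab mon])
    fix x y z assume "x \<in> carrier K" "y \<in> carrier K" "z \<in> carrier K"
    then obtain a b c d e g where *: "a \<in> Pol" "b \<in> Pol" "nz b" "x = rat a b" "c \<in> Pol" "d \<in> Pol" "nz d" "y = rat c d"
      and z: "e \<in> Pol" "g \<in> Pol" "nz g" "z = rat e g"
      by (metis K_cases)
    have n: "nz (\<lambda>v. b v * d v)" "nz (\<lambda>v. b v * g v)" "nz (\<lambda>v. d v * g v)" using * z by (auto intro!: nz_mult)
    have n2: "nz (\<lambda>v. b v * d v * g v)" "nz (\<lambda>v. b v * g v * (d v * g v))" using n * z by (auto intro!: nz_mult pi)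
    show "(x \<oplus>\<^bsub>K\<^esub> y) \<otimes>\<^bsub>K\<^esub> z = x \<otimes>\<^bsub>K\<^esub> z \<oplus>\<^bsub>K\<^esub> y \<otimes>\<^bsub>K\<^esub> z"
      unfolding *(4,8) z(4) using *(1-3,5-7) z(1-3) n n2
      by (simp add: rat_add rat_mult pi) (intro rat_eqI; auto intro!: pi simp: algebra_simps)
  qed
  show ?thesis
  proof (rule cring.cring_fieldI2[OF cr])
    show "\<zero>\<^bsub>K\<^esub> \<noteq> \<one>\<^bsub>K\<^esub>" unfolding K_one using rat_eq_zero_iff[of "\<lambda>_. 1" "\<lambda>_. 1"] nz_one pi(1)[of 1] by force
    fix x assume x: "x \<in> carrier K" "x \<noteq> \<zero>\<^bsub>K\<^esub>"
    then obtain a b where *: "a \<in> Pol" "b \<in> Pol" "nz b" "x = rat a b" by (metis K_cases)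
    then have a: "nz a" using x(2) rat_eq_zero_iff[of a b] by simp
    have "x \<otimes>\<^bsub>K\<^esub> rat b a = \<one>\<^bsub>K\<^esub>"
      unfolding *(4) K_one rat_mult[OF *(1,2,2,1,3) a]
      by (rule rat_eqI) (use * a nz_one nz_mult in \<open>auto intro!: pi\<close>)
    then show "\<exists>y\<in>carrier K. x \<otimes>\<^bsub>K\<^esub> y = \<one>\<^bsub>K\<^esub>" using rat_in_K[OF *(2,1) a] by blast
  qed
qed

sublocale K: field K by (rule field_K)

lemma rat_inv:
  assumes "a \<in> Pol" "b \<in> Pol" "nz a" "nz b"
  shows "inv\<^bsub>K\<^esub> (rat a b) = rat b a"
proof (rule K.comm_inv_char)
  show "rat a b \<otimes>\<^bsub>K\<^esub> rat b a = \<one>\<^bsub>K\<^esub>"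
    unfolding K_one rat_mult[OF assms(1,2,2,1,4,3)]
    by (rule rat_eqI) (use assms nz_one nz_mult in \<open>auto intro!: poly_fun_intros\<close>)
qed (use assms rat_in_K in auto)

lemma rat_pow:
  assumes "a \<in> Pol" "b \<in> Pol" "nz b"
  shows "rat a b [^]\<^bsub>K\<^esub> (n::nat) = rat (\<lambda>v. a v ^ n) (\<lambda>v. b v ^ n)"
proof (induction n)
  case (Suc n)
  have "nz (\<lambda>v. b v ^ n)" using assms nonvanishing_power by auto
  then show ?case using Suc assms by (simp add: rat_mult poly_fun_intros mult.commute)
qed (simp add: K_one)

end

section \<open>Discrete valuations of a field\<close>

context field
begin

lemma int_pow_units_of:
  assumes "x \<in> carrier R" "x \<noteq> \<zero>" shows "x [^] (n::int) = x [^]\<^bsub>units_of R\<^esub> n"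
proof -
  have xU: "x \<in> Units R" using assms field_Units by auto
  show ?thesis
    using units_of_pow[OF xU] units_of_inv[OF Units_pow_closed[OF xU]] by (simp only: int_pow_def2)
qed

lemma int_pow_nonzero:
  assumes x: "x \<in> carrier R" "x \<noteq> \<zero>"
  shows "x [^] (n::int) \<in> carrier R" "x [^] (n::int) \<noteq> \<zero>"
    and int_pow_add: "x [^] (n + m) = x [^] n \<otimes> x [^] (m::int)"
    and int_pow_uminus: "x [^] (- n) = inv (x [^] n)"
    and int_pow_int_pow: "(x [^] n) [^] m = x [^] (n * m)"
proof -
  interpret U: comm_group "units_of R" by (rule units_comm_group)
  have xU: "x \<in> carrier (units_of R)" using x field_Units by (simp add: units_of_carrier)
  have c: "x [^] (n::int) \<in> Units R" for n
    using U.int_pow_closed[OF xU, of n] by (simp only: int_pow_units_of[OF x, symmetric] units_of_carrier)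
  then show c': "x [^] (n::int) \<in> carrier R" "x [^] (n::int) \<noteq> \<zero>" for n using field_Units by auto
  note io = int_pow_units_of[OF x, symmetric] int_pow_units_of[OF c', symmetric]
  show "x [^] (n + m) = x [^] n \<otimes> x [^] m"
    using U.int_pow_mult[OF xU, of n m] by (simp only: io units_of_mult)
  show "x [^] (- n) = inv (x [^] n)"
    using U.int_pow_neg[OF xU, of n] units_of_inv[OF c[of n]] by (simp only: io)
  show "(x [^] n) [^] m = x [^] (n * m)"
    using U.int_pow_pow[OF xU, of n m] by (simp only: io)
qed

lemma int_pow_distrib:
  assumes x: "x \<in> carrier R" "x \<noteq> \<zero>" and y: "y \<in> carrier R" "y \<noteq> \<zero>"
  shows "(x \<otimes> y) [^] (n::int) = x [^] n \<otimes> y [^] n"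
proof -
  interpret U: comm_group "units_of R" by (rule units_comm_group)
  have xU: "x \<in> carrier (units_of R)" "y \<in> carrier (units_of R)" using x y field_Units by (auto simp: units_of_carrier)
  have xy: "x \<otimes> y \<in> carrier R" "x \<otimes> y \<noteq> \<zero>" using x y integral_iff by auto
  show ?thesis
    using U.int_pow_distrib[OF xU, of n]
    by (simp only: int_pow_units_of[OF x, symmetric] int_pow_units_of[OF y, symmetric] int_pow_units_of[OF xy, symmetric] units_of_mult)
qed

lemma inv_nonzero: "x \<in> carrier R \<Longrightarrow> x \<noteq> \<zero> \<Longrightarrow> inv x \<in> carrier R \<and> inv x \<noteq> \<zero> \<and> x \<otimes> inv x = \<one> \<and> inv x \<otimes> x = \<one>"
  using field_Units Units_inv_Units[of x] by auto

end

text \<open>A discrete valuation ring \<open>B\<close> with uniformizer \<open>t\<close>, described by the factorisation of field elements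
into a unit and a power of \<open>t\<close>.\<close>

locale discrete_valuation = field R for R :: "('k, 'b) module" (structure) +
  fixes B :: "'b set" and t :: 'b
  assumes B_sub: "B \<subseteq> carrier R" and B_one: "\<one> \<in> B" and B_zero: "\<zero> \<in> B"
    and B_mult: "x \<in> B \<Longrightarrow> y \<in> B \<Longrightarrow> x \<otimes> y \<in> B" and B_add: "x \<in> B \<Longrightarrow> y \<in> B \<Longrightarrow> x \<oplus> y \<in> B"
    and t_B: "t \<in> B" and t_nonzero: "t \<noteq> \<zero>" and t_nonunit: "inv t \<notin> B"
    and decomposition: "x \<in> carrier R \<Longrightarrow> x \<noteq> \<zero> \<Longrightarrow> \<exists>u n. u \<in> B \<and> u \<noteq> \<zero> \<and> inv u \<in> B \<and> x = u \<otimes> t [^] (n::int)"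
begin

definition "UB = {u \<in> B. u \<noteq> \<zero> \<and> inv u \<in> B}"

lemma UB: "u \<in> UB \<Longrightarrow> u \<in> B" "u \<in> UB \<Longrightarrow> u \<in> carrier R" "u \<in> UB \<Longrightarrow> u \<noteq> \<zero>" "u \<in> UB \<Longrightarrow> inv u \<in> UB"
  "u \<in> UB \<Longrightarrow> w \<in> UB \<Longrightarrow> u \<otimes> w \<in> UB" "\<one> \<in> UB"
proof -
  show 1: "u \<in> UB \<Longrightarrow> u \<in> B" "u \<in> UB \<Longrightarrow> u \<in> carrier R" "u \<in> UB \<Longrightarrow> u \<noteq> \<zero>" for u using B_sub by (auto simp: UB_def)
  have nz: "u \<in> carrier R" "u \<noteq> \<zero>" "u \<in> Units R" if "u \<in> UB" for u using 1[OF that] field_Units by auto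
  show 2: "inv u \<in> UB" if u: "u \<in> UB" for u
  proof -
    have "inv (inv u) = u" by (rule Units_inv_inv[OF nz(3)[OF u]])
    then show ?thesis using u inv_nonzero[OF nz(1,2)[OF u]] unfolding UB_def by simp
  qed
  show "\<one> \<in> UB" using B_one by (auto simp: UB_def)
  show "u \<otimes> w \<in> UB" if u: "u \<in> UB" and w: "w \<in> UB"
  proof -
    have i: "inv u \<in> carrier R" "u \<otimes> inv u = \<one>" "inv w \<in> carrier R" "w \<otimes> inv w = \<one>"
      using inv_nonzero[OF nz(1,2)[OF u]] inv_nonzero[OF nz(1,2)[OF w]] by auto
    have "(u \<otimes> w) \<otimes> (inv w \<otimes> inv u) = (u \<otimes> inv u) \<otimes> (w \<otimes> inv w)"
      using i(1,3) nz(1)[OF u] nz(1)[OF w] by (simp only: m_ac m_closed)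
    then have "inv (u \<otimes> w) = inv w \<otimes> inv u"
      using i nz(1)[OF u] nz(1)[OF w] by (intro comm_inv_char) auto
    moreover have "inv w \<otimes> inv u \<in> B" using B_mult 1(1)[OF 2[OF w]] 1(1)[OF 2[OF u]] by blast
    moreover have "u \<otimes> w \<noteq> \<zero>" using integral_iff[OF nz(1)[OF u] nz(1)[OF w]] nz(2)[OF u] nz(2)[OF w] by blast
    ultimately show ?thesis using B_mult[OF 1(1)[OF u] 1(1)[OF w]] unfolding UB_def by simp
  qed
qed

lemma tc: "t \<in> carrier R" using t_B B_sub by auto

lemma zpow_t: "t [^] (n::int) \<in> carrier R" "t [^] (n::int) \<noteq> \<zero>" using int_pow_nonzero[OF tc t_nonzero] by auto

lemma UB_int_pow: "u \<in> UB \<Longrightarrow> u [^] (n::int) \<in> UB"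
proof -
  assume u: "u \<in> UB"
  have nat: "u [^] (k::nat) \<in> UB" for k by (induction k) (use UB u in auto)
  show ?thesis
  proof (cases "n \<ge> 0")
    case True
    then obtain k where "n = int k" by (metis nonneg_int_cases)
    then show ?thesis using nat by (simp add: int_pow_int)
  next
    case False
    then obtain k where k: "n = - int k" by (metis nle_le nonpos_int_cases)
    have "u [^] n = inv (u [^] k)"
      unfolding k int_pow_uminus[OF UB(2,3)[OF u]] by (simp add: int_pow_int)
    then show ?thesis using UB(4)[OF nat] by simp
  qed
qed

lemma t_pow_in_B: "t [^] (n::int) \<in> B \<longleftrightarrow> n \<ge> 0"
proof
  assume "n \<ge> 0"
  then obtain k where k: "n = int k" by (metis nonneg_int_cases)
  have "t [^] (k::nat) \<in> B" for k by (induction k) (use B_one B_mult t_B in auto)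
  then show "t [^] n \<in> B" by (simp add: k int_pow_int)
next
  have nat: "t [^] (k::nat) \<in> B" for k by (induction k) (use B_one B_mult t_B in auto)
  assume n: "t [^] n \<in> B"
  show "n \<ge> 0"
  proof (rule ccontr)
    assume "\<not> n \<ge> 0"
    define k where "k = nat (- n - 1)"
    have k: "- n - 1 = int k" using \<open>\<not> n \<ge> 0\<close> by (simp add: k_def)
    have "t [^] (- 1 :: int) = t [^] (n + int k)" using k by (intro arg_cong[of _ _ "\<lambda>m. t [^] m"]) linarith
    also have "\<dots> = t [^] n \<otimes> t [^] k" by (simp add: int_pow_add[OF tc t_nonzero] int_pow_int)
    also have "\<dots> \<in> B" using n nat B_mult by blast
    finally have "inv (t [^] (1::int)) \<in> B" using int_pow_uminus[OF tc t_nonzero, of 1] by simp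
    moreover have "t [^] (1::int) = t" using int_pow_int[of R t 1] tc by simp
    ultimately show False using t_nonunit by simp
  qed
qed

lemma UB_t_pow_in_B: assumes "u \<in> UB" shows "u \<otimes> t [^] (n::int) \<in> B \<longleftrightarrow> n \<ge> 0"
proof
  assume "u \<otimes> t [^] n \<in> B"
  then have "inv u \<otimes> (u \<otimes> t [^] n) \<in> B" using B_mult UB(1)[OF UB(4)[OF assms]] by blast
  moreover have "inv u \<otimes> (u \<otimes> t [^] n) = t [^] n"
    using UB(2,3)[OF assms] inv_nonzero zpow_t by (simp add: m_assoc[symmetric])
  ultimately show "n \<ge> 0" using t_pow_in_B by simp
qed (use t_pow_in_B B_mult UB(1)[OF assms] in auto)

lemma decompose:
  assumes "x \<in> carrier R" "x \<noteq> \<zero>"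
  obtains u n where "u \<in> UB" "x = u \<otimes> t [^] (n::int)"
  using decomposition[OF assms] by (auto simp: UB_def)

lemma exponent_unique:
  assumes u: "u \<in> UB" "w \<in> UB" and eq: "u \<otimes> t [^] n = w \<otimes> t [^] (m::int)"
  shows "n = m"
proof -
  have le: "m \<le> n" if u: "u \<in> UB" "w \<in> UB" and eq: "u \<otimes> t [^] n = w \<otimes> t [^] (m::int)" for u w n m
  proof -
    have "u \<otimes> t [^] (n - m) = (u \<otimes> t [^] n) \<otimes> t [^] (- m)"
      using UB(2)[OF u(1)] zpow_t int_pow_add[OF tc t_nonzero, of n "- m"] by (simp add: m_assoc)
    also have "\<dots> = w \<otimes> (t [^] m \<otimes> t [^] (- m))"
      unfolding eq using UB(2)[OF u(2)] zpow_t by (simp add: m_assoc)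
    also have "t [^] m \<otimes> t [^] (- m) = \<one>" using int_pow_add[OF tc t_nonzero, of m "- m"] by simp
    also have "w \<otimes> \<one> = w" using UB(2)[OF u(2)] by simp
    finally have "u \<otimes> t [^] (n - m) \<in> B" using UB(1)[OF u(2)] by simp
    then show ?thesis using UB_t_pow_in_B[OF u(1)] by simp
  qed
  show ?thesis using le[OF u eq] le[OF u(2,1) eq[symmetric]] by simp
qed

lemma Units_B: "Units (R\<lparr>carrier := B\<rparr>) = UB"
proof (rule Set.set_eqI)
  fix u
  show "u \<in> Units (R\<lparr>carrier := B\<rparr>) \<longleftrightarrow> u \<in> UB"
  proof
    assume "u \<in> Units (R\<lparr>carrier := B\<rparr>)"
    then obtain w where w: "u \<in> B" "w \<in> B" "w \<otimes> u = \<one>" "u \<otimes> w = \<one>" by (auto simp: Units_def)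
    then have c: "u \<in> carrier R" "w \<in> carrier R" using B_sub by auto
    then have "inv u = w" "u \<noteq> \<zero>" using comm_inv_char[OF c w(4)] w(3) by auto
    then show "u \<in> UB" using w by (simp add: UB_def)
  next
    assume u: "u \<in> UB"
    have "inv u \<otimes> u = \<one>" "u \<otimes> inv u = \<one>" using inv_nonzero[OF UB(2)[OF u] UB(3)[OF u]] by auto
    then show "u \<in> Units (R\<lparr>carrier := B\<rparr>)"
      using UB(1)[OF u] UB(1)[OF UB(4)[OF u]] unfolding Units_def by auto
  qed
qed

lemma PIdl_B: "PIdl\<^bsub>R\<lparr>carrier := B\<rparr>\<^esub> a = {x \<otimes> a | x. x \<in> B}"
  by (simp add: cgenideal_def)

text \<open>The elements of \<open>B\<close> that are not units are those with positive exponent.\<close>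

lemma nonunits_B: "nonunits (R\<lparr>carrier := B\<rparr>) = {x \<otimes> t | x. x \<in> B}"
  unfolding nonunits_def Units_B
proof (intro Set.set_eqI iffI)
  fix x assume "x \<in> carrier (R\<lparr>carrier := B\<rparr>) - UB"
  then have x: "x \<in> B" "x \<notin> UB" by auto
  show "x \<in> {x \<otimes> t | x. x \<in> B}"
  proof (cases "x = \<zero>")
    case True
    then show ?thesis using B_zero tc by (auto intro!: exI[of _ \<zero>])
  next
    case False
    then obtain u n where u: "u \<in> UB" "x = u \<otimes> t [^] (n::int)" using decompose x B_sub by blast
    have n: "n \<ge> 0" using x u UB_t_pow_in_B by simp
    moreover have "n \<noteq> 0" using u x UB(2) by auto
    ultimately have "u \<otimes> t [^] (n - 1) \<in> B" using UB_t_pow_in_B[OF u(1)] by simp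
    moreover have "x = (u \<otimes> t [^] (n - 1)) \<otimes> t [^] (1::int)"
      using int_pow_add[OF tc t_nonzero, of "n - 1" 1] UB(2)[OF u(1)] zpow_t by (simp add: m_assoc u(2))
    moreover have "t [^] (1::int) = t" using int_pow_int[of R t 1] tc by simp
    ultimately show ?thesis by auto
  qed
next
  fix x assume "x \<in> {x \<otimes> t | x. x \<in> B}"
  then obtain y where y: "y \<in> B" "x = y \<otimes> t" by auto
  have "x \<notin> UB"
  proof
    assume U: "x \<in> UB"
    have yc: "y \<in> carrier R" "y \<noteq> \<zero>" using y B_sub UB(3)[OF U] tc by auto
    have "inv t = y \<otimes> inv x"
    proof (rule comm_inv_char[OF tc])
      show "y \<otimes> inv x \<in> carrier R" using yc UB(2)[OF UB(4)[OF U]] by auto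
      have "t \<otimes> (y \<otimes> inv x) = (y \<otimes> t) \<otimes> inv x" using yc(1) tc UB(2)[OF UB(4)[OF U]] by (simp only: m_ac m_closed)
      then have "t \<otimes> (y \<otimes> inv x) = x \<otimes> inv x" using y(2) by simp
      then show "t \<otimes> (y \<otimes> inv x) = \<one>" using inv_nonzero[OF UB(2)[OF U] UB(3)[OF U]] by simp
    qed
    then show False using t_nonunit B_mult[OF y(1)] UB(1)[OF UB(4)[OF U]] by simp
  qed
  then show "x \<in> carrier (R\<lparr>carrier := B\<rparr>) - UB" using y B_mult t_B by auto
qed

text \<open>The exponent is independent of the generator of the maximal ideal, since two generators differ
by a unit.\<close>

lemma dvr_val_eqI:
  assumes u: "u \<in> UB" and h: "h = u \<otimes> t [^] (n::int)"
  shows "dvr_val R B h = n"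
  unfolding dvr_val_def nonunits_B PIdl_B Units_B
proof (rule the_equality)
  show "\<exists>t' u. t' \<in> B \<and> {x \<otimes> t' | x. x \<in> B} = {x \<otimes> t | x. x \<in> B} \<and> u \<in> UB \<and> h = u \<otimes> t' [^] n"
    using t_B u h by blast
  fix m :: int assume "\<exists>t' u. t' \<in> B \<and> {x \<otimes> t' | x. x \<in> B} = {x \<otimes> t | x. x \<in> B} \<and> u \<in> UB \<and> h = u \<otimes> t' [^] m"
  then obtain t' w where t': "t' \<in> B" "{x \<otimes> t' | x. x \<in> B} = {x \<otimes> t | x. x \<in> B}" "w \<in> UB" "h = w \<otimes> t' [^] m" by blast
  have t'c: "t' \<in> carrier R" using t' B_sub by auto
  have "\<one> \<otimes> t' \<in> {x \<otimes> t | x. x \<in> B}" using t'(2) B_one by blast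
  then obtain a where a: "a \<in> B" "t' = a \<otimes> t" using t'c by auto
  have "\<one> \<otimes> t \<in> {x \<otimes> t' | x. x \<in> B}" using t'(2) B_one by blast
  then obtain b where b: "b \<in> B" "t = b \<otimes> t'" using tc by auto
  have ab: "a \<in> carrier R" "b \<in> carrier R" using a b B_sub by auto
  have "t' \<noteq> \<zero>"
  proof
    assume "t' = \<zero>"
    then have "b \<otimes> t' = \<zero>" using ab by simp
    then show False using b(2) t_nonzero by metis
  qed
  have nz: "a \<noteq> \<zero>"
  proof
    assume "a = \<zero>"
    then have "a \<otimes> t = \<zero>" using tc by simp
    then show False using a(2) \<open>t' \<noteq> \<zero>\<close> by metis
  qed
  have "(b \<otimes> a) \<otimes> t = b \<otimes> (a \<otimes> t)" using ab tc by (simp add: m_assoc)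
  also have "\<dots> = b \<otimes> t'" by (rule arg_cong[OF a(2)[symmetric]])
  also have "\<dots> = t" by (rule b(2)[symmetric])
  finally have "(b \<otimes> a) \<otimes> t = \<one> \<otimes> t" using tc by simp
  then have "b \<otimes> a = \<one>" by (rule iffD1[OF m_rcancel[OF t_nonzero tc m_closed[OF ab(2,1)] one_closed]])
  then have "inv a = b" using ab m_comm[OF ab] by (intro comm_inv_char) auto
  then have aU: "a \<in> UB" using a(1) b(1) nz by (simp add: UB_def)
  have "h = w \<otimes> (a \<otimes> t) [^] m" using t'(4) a(2) by metis
  also have "(a \<otimes> t) [^] m = a [^] m \<otimes> t [^] m" by (rule int_pow_distrib[OF ab(1) nz tc t_nonzero])
  also have "w \<otimes> (a [^] m \<otimes> t [^] m) = (w \<otimes> a [^] m) \<otimes> t [^] m"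
    by (rule m_assoc[OF UB(2)[OF t'(3)] int_pow_nonzero(1)[OF ab(1) nz] zpow_t(1), symmetric])
  finally have "h = (w \<otimes> a [^] m) \<otimes> t [^] m" .
  then have "u \<otimes> t [^] n = (w \<otimes> a [^] m) \<otimes> t [^] m" using h by metis
  from exponent_unique[OF u UB(5)[OF t'(3) UB_int_pow[OF aU]] this] show "m = n" by simp
qed

abbreviation "ord \<equiv> dvr_val R B"

lemma ord_decompose:
  assumes "x \<in> carrier R" "x \<noteq> \<zero>"
  obtains u where "u \<in> UB" "x = u \<otimes> t [^] ord x"
  using decompose[OF assms] dvr_val_eqI by metis

lemma ord_mult:
  assumes x: "x \<in> carrier R" "x \<noteq> \<zero>" and y: "y \<in> carrier R" "y \<noteq> \<zero>"
  shows "ord (x \<otimes> y) = ord x + ord y"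
proof -
  obtain u where u: "u \<in> UB" "x = u \<otimes> t [^] ord x" using ord_decompose[OF x] .
  obtain w where w: "w \<in> UB" "y = w \<otimes> t [^] ord y" using ord_decompose[OF y] .
  have "x \<otimes> y = (u \<otimes> t [^] ord x) \<otimes> (w \<otimes> t [^] ord y)" using u(2) w(2) by simp
  also have "\<dots> = (u \<otimes> w) \<otimes> t [^] (ord x + ord y)"
    using UB(2)[OF u(1)] UB(2)[OF w(1)] zpow_t int_pow_add[OF tc t_nonzero] by (simp add: m_ac)
  finally show ?thesis using dvr_val_eqI[OF UB(5)[OF u(1) w(1)]] by blast
qed

lemma in_B_iff: "x \<in> carrier R \<Longrightarrow> x \<noteq> \<zero> \<Longrightarrow> x \<in> B \<longleftrightarrow> ord x \<ge> 0"
  using ord_decompose UB_t_pow_in_B by metis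

lemma in_UB_iff:
  assumes "x \<in> carrier R" "x \<noteq> \<zero>" shows "x \<in> UB \<longleftrightarrow> ord x = 0"
proof
  assume "x \<in> UB"
  then show "ord x = 0" using dvr_val_eqI[of x x 0] assms by simp
next
  obtain u where u: "u \<in> UB" "x = u \<otimes> t [^] ord x" using ord_decompose[OF assms] .
  assume "ord x = 0"
  then show "x \<in> UB" using u UB(2)[OF u(1)] by simp
qed

lemma ord_add:
  assumes x: "x \<in> carrier R" "x \<noteq> \<zero>" and y: "y \<in> carrier R" "y \<noteq> \<zero>" and xy: "x \<oplus> y \<noteq> \<zero>"
  shows "min (ord x) (ord y) \<le> ord (x \<oplus> y)"
proof -
  define m where "m = min (ord x) (ord y)"
  obtain u where u: "u \<in> UB" "x = u \<otimes> t [^] ord x" using ord_decompose[OF x] .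
  obtain w where w: "w \<in> UB" "y = w \<otimes> t [^] ord y" using ord_decompose[OF y] .
  define a where "a = u \<otimes> t [^] (ord x - m)"
  define b where "b = w \<otimes> t [^] (ord y - m)"
  have ab: "a \<in> B" "b \<in> B" unfolding a_def b_def using UB_t_pow_in_B u w by (auto simp: m_def)
  have "x = a \<otimes> t [^] m" "y = b \<otimes> t [^] m"
    using u(2) w(2) UB(2)[OF u(1)] UB(2)[OF w(1)] zpow_t int_pow_add[OF tc t_nonzero, of "ord x - m" m]
      int_pow_add[OF tc t_nonzero, of "ord y - m" m] by (auto simp: a_def b_def m_assoc)
  then have eq: "x \<oplus> y = (a \<oplus> b) \<otimes> t [^] m" using subsetD[OF B_sub ab(1)] subsetD[OF B_sub ab(2)] zpow_t by (simp add: l_distr)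
  have abn: "a \<oplus> b \<in> B" "a \<oplus> b \<in> carrier R" "a \<oplus> b \<noteq> \<zero>" using ab B_add B_sub xy eq zpow_t by auto
  have "ord (x \<oplus> y) = ord (a \<oplus> b) + ord (t [^] m)" unfolding eq by (rule ord_mult[OF abn(2,3) zpow_t])
  moreover have "ord (t [^] m) = m" using dvr_val_eqI[OF UB(6), of "t [^] m" m] zpow_t by simp
  ultimately show ?thesis using in_B_iff[OF abn(2,3)] abn(1) by (simp add: m_def)
qed

end

section \<open>Uniformizers and divisors on cones\<close>

text \<open>An element outside \<open>P\<close> is of the required form with exponent \<open>0\<close>, and one in \<open>P\<close> can be divided by \<open>t\<close>
locally. By Nakayama's lemma this stops for every nonzero element.\<close>

lemma (in noetherian_cring) uniformizer_powers:
  assumes Z: "primeideal {\<zero>} R" and P: "primeideal P R" and t: "t \<in> P"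
    and unif: "\<And>z. z \<in> P \<Longrightarrow> \<exists>s\<in>carrier R - P. \<exists>r\<in>carrier R. s \<otimes> z = r \<otimes> t"
    and z: "z \<in> carrier R" "z \<noteq> \<zero>"
  shows "\<exists>(n::nat) s r. s \<in> carrier R - P \<and> r \<in> carrier R - P \<and> s \<otimes> z = r \<otimes> t [^] n"
proof -
  note p = primeideal_closed[OF P] and z0 = primeideal_closed[OF Z]
  have tc: "t \<in> carrier R" using t ideal_closed(1)[OF p(1)] by blast
  have "\<zero> \<in> P" using ideal_closed(2)[OF p(1)] .
  then have sat: "saturated P {\<zero>}"
    unfolding saturated_def using z0(3) by blast
  define I where "I = {z \<in> carrier R. \<not> (\<exists>(n::nat) s r. s \<in> carrier R - P \<and> r \<in> carrier R - P \<and> s \<otimes> z = r \<otimes> t [^] n)}"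
  have "I \<subseteq> {\<zero>}"
  proof (rule Nakayama_principal[OF P z0(1) sat t])
    show "I \<subseteq> carrier R" by (auto simp: I_def)
    fix a assume a: "a \<in> I"
    then have ac: "a \<in> carrier R" by (auto simp: I_def)
    have no: "s \<otimes> a \<noteq> r \<otimes> t [^] n" if "s \<in> carrier R - P" "r \<in> carrier R - P" for s r and n :: nat
      using a that unfolding I_def by blast
    have "a \<in> P"
    proof (rule ccontr)
      assume "a \<notin> P"
      then have "\<one> \<otimes> a \<noteq> a \<otimes> t [^] (0::nat)" using ac p(2) by (intro no) auto
      then show False using ac by simp
    qed
    then obtain s r where sr: "s \<in> carrier R - P" "r \<in> carrier R" "s \<otimes> a = r \<otimes> t" using unif by blast
    have "r \<in> I"
      unfolding I_def
    proof (intro CollectI conjI sr(2) notI)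
      assume "\<exists>(n::nat) s r'. s \<in> carrier R - P \<and> r' \<in> carrier R - P \<and> s \<otimes> r = r' \<otimes> t [^] n"
      then obtain n :: nat and s' r' where *: "s' \<in> carrier R - P" "r' \<in> carrier R - P" "s' \<otimes> r = r' \<otimes> t [^] n" by blast
      have "(s' \<otimes> s) \<otimes> a = s' \<otimes> (s \<otimes> a)" using *(1) sr(1) ac by (simp add: m_assoc)
      also have "\<dots> = (s' \<otimes> r) \<otimes> t" unfolding sr(3) using *(1) sr(2) tc by (simp add: m_assoc)
      also have "\<dots> = r' \<otimes> t [^] Suc n" unfolding *(3) using *(2) tc by (simp add: m_assoc)
      finally have "(s' \<otimes> s) \<otimes> a = r' \<otimes> t [^] Suc n" .
      moreover have "s' \<otimes> s \<in> carrier R - P" using *(1) sr(1) p(3)[of s' s] by auto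
      ultimately show False using no *(2) by blast
    qed
    moreover have "s \<otimes> a = \<zero> \<oplus> t \<otimes> r" using sr tc by (simp add: m_comm)
    ultimately show "\<exists>s j b. s \<in> carrier R - P \<and> j \<in> {\<zero>} \<and> b \<in> I \<and> s \<otimes> a = j \<oplus> t \<otimes> b"
      using sr(1) by blast
  qed
  then show ?thesis using z unfolding I_def by blast
qed

locale divisor = function_field scale Basis C
  for scale :: "'k::alg_closed_field \<Rightarrow> 'v::ab_group_add \<Rightarrow> 'v" and Basis C +
  fixes D :: "'v set"
  assumes irred_D: "irred D" and D_sub: "D \<subseteq> C"
begin

abbreviation "nzD \<equiv> nonvanishing D"
abbreviation "B \<equiv> local_ring_along scale C D"

lemma nzD_nz: "nzD g \<Longrightarrow> nz g" using D_sub by (auto simp: nonvanishing_def)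

lemma nzD_mult: "g \<in> Pol \<Longrightarrow> h \<in> Pol \<Longrightarrow> nzD g \<Longrightarrow> nzD h \<Longrightarrow> nzD (\<lambda>v. g v * h v)"
  using irredD[OF irred_D] .

lemma nzD_one: "nzD (\<lambda>_. 1)" by (rule irred_one[OF irred_D])

lemma B_def': "B = {rat a s | a s. a \<in> Pol \<and> s \<in> Pol \<and> nzD s}"
  by (auto simp: local_ring_along_def nonvanishing_def)

lemma B_I: "a \<in> Pol \<Longrightarrow> s \<in> Pol \<Longrightarrow> nzD s \<Longrightarrow> rat a s \<in> B" unfolding B_def' by blast

lemma B_E:
  assumes "x \<in> B" obtains a s where "a \<in> Pol" "s \<in> Pol" "nzD s" "nz s" "x = rat a s"
  using assms nzD_nz unfolding B_def' by blast

text \<open>Whether the numerator vanishes on \<open>D\<close> does not depend on the representation, provided that the denominators do not vanish on \<open>D\<close>.\<close>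

lemma numerator_nzD:
  assumes P: "a \<in> Pol" "s \<in> Pol" "a' \<in> Pol" "s' \<in> Pol" and nz: "nzD s" "nzD s'" and eq: "rat a s = rat a' s'" and a: "nzD a"
  shows "nzD a'"
proof -
  have "\<forall>v\<in>C. a v * s' v = a' v * s v" using eq rat_eq_iff[OF P nzD_nz[OF nz(1)] nzD_nz[OF nz(2)]] by simp
  moreover have "nzD (\<lambda>v. a v * s' v)" using nzD_mult P nz a by blast
  ultimately show ?thesis using D_sub unfolding nonvanishing_def by fastforce
qed

lemma rat_unit_iff:
  assumes P: "a \<in> Pol" "s \<in> Pol" and s: "nzD s" and a: "nz a"
  shows "inv\<^bsub>K\<^esub> (rat a s) \<in> B \<longleftrightarrow> nzD a"
proof
  have i: "inv\<^bsub>K\<^esub> (rat a s) = rat s a" by (rule rat_inv[OF P a nzD_nz[OF s]])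
  assume "inv\<^bsub>K\<^esub> (rat a s) \<in> B"
  then obtain a' s' where a': "a' \<in> Pol" "s' \<in> Pol" "nzD s'" "nz s'" "rat s a = rat a' s'" unfolding i by (rule B_E)
  then have "\<forall>v\<in>C. s v * s' v = a' v * a v" using rat_eq_iff[OF P(2,1) a'(1,2) a a'(4)] by simp
  moreover have "nzD (\<lambda>v. s v * s' v)" using nzD_mult P a' s by blast
  ultimately show "nzD a" using D_sub unfolding nonvanishing_def by fastforce
next
  assume "nzD a"
  then show "inv\<^bsub>K\<^esub> (rat a s) \<in> B" using rat_inv[OF P a nzD_nz[OF s]] B_I P by simp
qed

text \<open>It suffices to factor polynomial functions: the factorisations of numerator and denominator combine to one
of the fraction, and the local ring contains every fraction whose denominator does not vanish on \<open>D\<close>.\<close>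

lemma discrete_valuationI:
  assumes \<tau>: "\<tau> \<in> Pol" "\<sigma> \<in> Pol" "nzD \<sigma>" "nz \<tau>" "\<not> nzD \<tau>"
    and dec: "\<And>g. g \<in> Pol \<Longrightarrow> nz g \<Longrightarrow> \<exists>(m::nat) \<alpha> \<beta>. \<alpha> \<in> Pol \<and> \<beta> \<in> Pol \<and> nzD \<alpha> \<and> nzD \<beta> \<and> (\<forall>v\<in>C. g v * \<beta> v * \<sigma> v ^ m = \<alpha> v * \<tau> v ^ m)"
  shows "discrete_valuation K B (rat \<tau> \<sigma>)"
proof unfold_locales
  note pi = poly_fun_intros
  let ?t = "rat \<tau> \<sigma>"
  show "B \<subseteq> carrier K" by (auto elim!: B_E intro: rat_in_K)
  show "\<one>\<^bsub>K\<^esub> \<in> B" "\<zero>\<^bsub>K\<^esub> \<in> B" unfolding K_one K_zero by (intro B_I pi nzD_one)+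
  show "x \<otimes>\<^bsub>K\<^esub> y \<in> B" if x: "x \<in> B" and y: "y \<in> B" for x y
  proof -
    obtain a s where a: "a \<in> Pol" "s \<in> Pol" "nzD s" "nz s" "x = rat a s" using x by (rule B_E)
    obtain c d where c: "c \<in> Pol" "d \<in> Pol" "nzD d" "nz d" "y = rat c d" using y by (rule B_E)
    show ?thesis unfolding a(5) c(5) rat_mult[OF a(1,2) c(1,2) a(4) c(4)] using a c by (intro B_I pi nzD_mult)
  qed
  show "x \<oplus>\<^bsub>K\<^esub> y \<in> B" if x: "x \<in> B" and y: "y \<in> B" for x y
  proof -
    obtain a s where a: "a \<in> Pol" "s \<in> Pol" "nzD s" "nz s" "x = rat a s" using x by (rule B_E)
    obtain c d where c: "c \<in> Pol" "d \<in> Pol" "nzD d" "nz d" "y = rat c d" using y by (rule B_E)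
    show ?thesis unfolding a(5) c(5) rat_add[OF a(1,2) c(1,2) a(4) c(4)] using a c by (intro B_I pi nzD_mult)
  qed
  show "?t \<in> B" by (rule B_I[OF \<tau>(1-3)])
  show t0: "?t \<noteq> \<zero>\<^bsub>K\<^esub>" using rat_eq_zero_iff[OF \<tau>(1,2) nzD_nz[OF \<tau>(3)]] \<tau>(4) by simp
  show "inv\<^bsub>K\<^esub> ?t \<notin> B" using rat_unit_iff[OF \<tau>(1-4)] \<tau>(5) by simp
  have tc: "?t \<in> carrier K" using rat_in_K[OF \<tau>(1,2) nzD_nz[OF \<tau>(3)]] .
  fix x assume x: "x \<in> carrier K" "x \<noteq> \<zero>\<^bsub>K\<^esub>"
  obtain g h where gh: "g \<in> Pol" "h \<in> Pol" "nz h" "x = rat g h" using x(1) by (rule K_cases)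
  then have g0: "nz g" using x(2) rat_eq_zero_iff by simp
  obtain m :: nat and \<alpha> \<beta> where 1: "\<alpha> \<in> Pol" "\<beta> \<in> Pol" "nzD \<alpha>" "nzD \<beta>" "\<And>v. v \<in> C \<Longrightarrow> g v * \<beta> v * \<sigma> v ^ m = \<alpha> v * \<tau> v ^ m"
    using dec[OF gh(1) g0] by blast
  obtain n :: nat and \<gamma> \<delta> where 2: "\<gamma> \<in> Pol" "\<delta> \<in> Pol" "nzD \<gamma>" "nzD \<delta>" "\<And>v. v \<in> C \<Longrightarrow> h v * \<delta> v * \<sigma> v ^ n = \<gamma> v * \<tau> v ^ n"
    using dec[OF gh(2,3)] by blast
  define u where "u = rat (\<lambda>v. \<alpha> v * \<delta> v) (\<lambda>v. \<beta> v * \<gamma> v)"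
  have n1: "nzD (\<lambda>v. \<alpha> v * \<delta> v)" "nzD (\<lambda>v. \<beta> v * \<gamma> v)" using 1 2 by (auto intro: nzD_mult)
  have p1: "(\<lambda>v. \<alpha> v * \<delta> v) \<in> Pol" "(\<lambda>v. \<beta> v * \<gamma> v) \<in> Pol" using 1 2 by (auto intro: pi)
  have u: "u \<in> B" "u \<noteq> \<zero>\<^bsub>K\<^esub>" "inv\<^bsub>K\<^esub> u \<in> B"
    unfolding u_def using B_I[OF p1 n1(2)] rat_unit_iff[OF p1 n1(2) nzD_nz[OF n1(1)]] n1 rat_eq_zero_iff[OF p1 nzD_nz[OF n1(2)]] nzD_nz by auto
  have pw: "(\<lambda>v. \<tau> v ^ k) \<in> Pol" "(\<lambda>v. \<sigma> v ^ k) \<in> Pol" "nz (\<lambda>v. \<tau> v ^ k)" "nz (\<lambda>v. \<sigma> v ^ k)" for k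
    using \<tau> nzD_nz by (auto intro: pi nonvanishing_power)
  have "?t [^]\<^bsub>K\<^esub> (int m - int n) = ?t [^]\<^bsub>K\<^esub> int m \<otimes>\<^bsub>K\<^esub> ?t [^]\<^bsub>K\<^esub> (- int n)"
    using K.int_pow_add[OF tc t0, of "int m" "- int n"] by simp
  also have "?t [^]\<^bsub>K\<^esub> (- int n) = inv\<^bsub>K\<^esub> (?t [^]\<^bsub>K\<^esub> int n)" by (rule K.int_pow_uminus[OF tc t0])
  also have "?t [^]\<^bsub>K\<^esub> int n = rat (\<lambda>v. \<tau> v ^ n) (\<lambda>v. \<sigma> v ^ n)" unfolding int_pow_int by (rule rat_pow[OF \<tau>(1,2) nzD_nz[OF \<tau>(3)]])
  also have "inv\<^bsub>K\<^esub> (rat (\<lambda>v. \<tau> v ^ n) (\<lambda>v. \<sigma> v ^ n)) = rat (\<lambda>v. \<sigma> v ^ n) (\<lambda>v. \<tau> v ^ n)" by (rule rat_inv[OF pw])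
  also have "?t [^]\<^bsub>K\<^esub> int m = rat (\<lambda>v. \<tau> v ^ m) (\<lambda>v. \<sigma> v ^ m)" unfolding int_pow_int by (rule rat_pow[OF \<tau>(1,2) nzD_nz[OF \<tau>(3)]])
  also have "rat (\<lambda>v. \<tau> v ^ m) (\<lambda>v. \<sigma> v ^ m) \<otimes>\<^bsub>K\<^esub> rat (\<lambda>v. \<sigma> v ^ n) (\<lambda>v. \<tau> v ^ n)
     = rat (\<lambda>v. \<tau> v ^ m * \<sigma> v ^ n) (\<lambda>v. \<sigma> v ^ m * \<tau> v ^ n)" by (rule rat_mult[OF pw(1,2,2,1,4,3)])
  finally have T: "?t [^]\<^bsub>K\<^esub> (int m - int n) = rat (\<lambda>v. \<tau> v ^ m * \<sigma> v ^ n) (\<lambda>v. \<sigma> v ^ m * \<tau> v ^ n)" .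
  have p2: "(\<lambda>v. \<tau> v ^ m * \<sigma> v ^ n) \<in> Pol" "(\<lambda>v. \<sigma> v ^ m * \<tau> v ^ n) \<in> Pol" using pw by (auto intro: pi)
  have n2: "nz (\<lambda>v. \<sigma> v ^ m * \<tau> v ^ n)" using pw by (intro nz_mult)
  have "x = u \<otimes>\<^bsub>K\<^esub> ?t [^]\<^bsub>K\<^esub> (int m - int n)"
    unfolding T u_def gh(4) rat_mult[OF p1 p2 nzD_nz[OF n1(2)] n2]
  proof (rule rat_eqI[OF gh(1,2) _ _ gh(3)])
    show "nz (\<lambda>v. \<beta> v * \<gamma> v * (\<sigma> v ^ m * \<tau> v ^ n))" by (rule nz_mult[OF p1(2) p2(2) nzD_nz[OF n1(2)] n2])
    fix v assume v: "v \<in> C"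
    have "g v * (\<beta> v * \<gamma> v * (\<sigma> v ^ m * \<tau> v ^ n)) = (g v * \<beta> v * \<sigma> v ^ m) * (\<gamma> v * \<tau> v ^ n)" by (simp add: ac_simps)
    also have "\<dots> = (\<alpha> v * \<tau> v ^ m) * (h v * \<delta> v * \<sigma> v ^ n)" unfolding 1(5)[OF v] 2(5)[OF v] ..
    finally show "g v * (\<beta> v * \<gamma> v * (\<sigma> v ^ m * \<tau> v ^ n)) = \<alpha> v * \<delta> v * (\<tau> v ^ m * \<sigma> v ^ n) * h v" by (simp add: ac_simps)
  qed (use p1 p2 in \<open>auto intro!: pi\<close>)
  then show "\<exists>u n. u \<in> B \<and> u \<noteq> \<zero>\<^bsub>K\<^esub> \<and> inv\<^bsub>K\<^esub> u \<in> B \<and> x = u \<otimes>\<^bsub>K\<^esub> ?t [^]\<^bsub>K\<^esub> (n::int)" using u by blast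
qed

text \<open>After a common denominator is chosen, each component of \<open>g\<close> is a unit times a power of \<open>\<tau>/\<sigma>\<close>. The smallest exponent
\<open>m\<close> can be factored out. The remaining sum does not vanish on \<open>D\<close>, since its summands are homogeneous of
different degrees and one of them, with exponent \<open>m\<close>, does not vanish on the cone \<open>D\<close>. The degrees stay different because \<open>\<tau>\<close> and \<open>\<sigma>\<close> have equal degree and multiplication with the units
shifts all components alike.\<close>

lemma homogeneous_decomposition_suffices:
  assumes D: "conical D" and \<tau>: "homogeneous scale e0 \<tau>" "homogeneous scale e0 \<sigma>" "nzD \<sigma>" "nz \<tau>" "\<not> nzD \<tau>"
    and dec: "\<And>d g. homogeneous scale d g \<Longrightarrow> nz g \<Longrightarrow> \<exists>(n::nat) \<alpha> \<beta> e. homogeneous scale (e + d) \<alpha> \<and> homogeneous scale e \<beta> \<and>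
       nzD \<alpha> \<and> nzD \<beta> \<and> (\<forall>v\<in>C. g v * \<beta> v * \<sigma> v ^ n = \<alpha> v * \<tau> v ^ n)"
  shows "discrete_valuation K B (rat \<tau> \<sigma>)"
proof (rule discrete_valuationI[OF homog_poly[OF \<tau>(1)] homog_poly[OF \<tau>(2)] \<tau>(3-5)])
  fix g assume g: "g \<in> Pol" "nz g"
  obtain G n where G: "graded g G n" using graded_exists[OF g(1)] by blast
  define c where "c d v = coeff (G v) d" for d v
  have c: "homogeneous scale d (c d)" for d using G by (simp add: graded_def c_def[abs_def])
  define E where "E = {d. d \<le> n \<and> nz (c d)}"
  have E: "finite E" by (simp add: E_def)
  have "\<forall>d\<in>E. \<exists>x. case x of (k::nat, \<alpha>, \<beta>, e) \<Rightarrow> homogeneous scale (e + d) \<alpha> \<and> homogeneous scale e \<beta> \<and>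
       nzD \<alpha> \<and> nzD \<beta> \<and> (\<forall>v\<in>C. c d v * \<beta> v * \<sigma> v ^ k = \<alpha> v * \<tau> v ^ k)"
    using dec[OF c] by (simp add: E_def)
  from bchoice[OF this] obtain X where X: "\<forall>d\<in>E. case X d of (k::nat, \<alpha>, \<beta>, e) \<Rightarrow> homogeneous scale (e + d) \<alpha> \<and> homogeneous scale e \<beta> \<and>
       nzD \<alpha> \<and> nzD \<beta> \<and> (\<forall>v\<in>C. c d v * \<beta> v * \<sigma> v ^ k = \<alpha> v * \<tau> v ^ k)" ..
  define k where "k d = fst (X d)" for d
  define \<alpha> where "\<alpha> d = fst (snd (X d))" for d
  define \<beta> where "\<beta> d = fst (snd (snd (X d)))" for d
  define e where "e d = snd (snd (snd (X d)))" for d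
  have X': "homogeneous scale (e d + d) (\<alpha> d)" "homogeneous scale (e d) (\<beta> d)" "nzD (\<alpha> d)" "nzD (\<beta> d)"
     "\<And>v. v \<in> C \<Longrightarrow> c d v * \<beta> d v * \<sigma> v ^ k d = \<alpha> d v * \<tau> v ^ k d" if "d \<in> E" for d
    using X that by (auto simp: k_def \<alpha>_def \<beta>_def e_def case_prod_beta)
  have "E \<noteq> {}"
  proof
    assume "E = {}"
    then have "c d v = 0" if "v \<in> C" "d \<le> n" for d v using that by (auto simp: E_def nonvanishing_def)
    then have "g v = 0" if "v \<in> C" for v using graded_sum[OF G, of v] that by (simp add: c_def)
    then show False using g(2) by (auto simp: nonvanishing_def)
  qed
  define M where "M = (\<Sum>d\<in>E. k d)"
  have kM: "k d \<le> M" if "d \<in> E" for d unfolding M_def using E that by (intro member_le_sum) auto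
  define m where "m = Min (k ` E)"
  have m: "m \<le> k d" if "d \<in> E" for d unfolding m_def using E that by auto
  have "m \<in> k ` E" unfolding m_def using E \<open>E \<noteq> {}\<close> by (intro Min_in) auto
  then obtain d0 where d0: "d0 \<in> E" "k d0 = m" by auto
  have mM: "m \<le> M" using kM[OF d0(1)] d0(2) by simp
  define b where "b v = (\<Prod>d\<in>E. \<beta> d v)" for v
  define a where "a d v = \<alpha> d v * (\<Prod>i\<in>E - {d}. \<beta> i v) * \<sigma> v ^ (M - k d)" for d v
  define T where "T d v = a d v * \<tau> v ^ (k d - m)" for d v
  have ha: "homogeneous scale ((e d + d) + (\<Sum>i\<in>E - {d}. e i) + (M - k d) * e0) (a d)" if "d \<in> E" for d
    unfolding a_def[abs_def] using X' that E \<tau> by (intro homogeneous_mult homogeneous_power homogeneous_prod) auto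
  have hT: "homogeneous scale (d + ((\<Sum>i\<in>E. e i) + (M - m) * e0)) (T d)" if d: "d \<in> E" for d
  proof -
    have "(\<Sum>i\<in>E. e i) = e d + (\<Sum>i\<in>E - {d}. e i)" using E d by (simp add: sum.remove)
    moreover have "M - m = (M - k d) + (k d - m)" using m[OF d] kM[OF d] by simp
    then have "(M - m) * e0 = (M - k d) * e0 + (k d - m) * e0" by (simp add: add_mult_distrib)
    ultimately have deg: "d + ((\<Sum>i\<in>E. e i) + (M - m) * e0) = ((e d + d) + (\<Sum>i\<in>E - {d}. e i) + (M - k d) * e0) + (k d - m) * e0" by simp
    show ?thesis unfolding T_def[abs_def] deg by (rule homogeneous_mult[OF ha[OF d] homogeneous_power[OF \<tau>(1)]])
  qed
  define N where "N v = (\<Sum>d\<in>E. T d v)" for v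
  have N: "N \<in> Pol" unfolding N_def[abs_def] using E homog_poly[OF hT] by (intro poly_fun_sum) auto
  have bP: "b \<in> Pol" unfolding b_def[abs_def] using E homog_poly[OF X'(2)] by (intro poly_fun_prod) auto
  have bn: "nzD b" unfolding b_def[abs_def] using E homog_poly[OF X'(2)] X'(4) by (intro irred_prod[OF irred_D]) auto
  have an: "nzD (a d)" if d: "d \<in> E" for d
    unfolding a_def[abs_def] using d X'(3,4) homog_poly[OF X'(1)] homog_poly[OF X'(2)] E \<tau>(3) homog_poly[OF \<tau>(2)]
    by (intro nzD_mult irred_prod[OF irred_D] nonvanishing_power poly_fun_intros) auto
  have nN: "nzD N"
  proof (rule ccontr)
    assume "\<not> nzD N"
    then have "(\<Sum>d\<in>E. T d v) = 0" if "v \<in> D" for v using that by (auto simp: nonvanishing_def N_def)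
    then have "T d0 v = 0" if "v \<in> D" for v
      using conical_homogeneous_sum[OF D E, of "\<lambda>d. d + ((\<Sum>i\<in>E. e i) + (M - m) * e0)" T d0 v] hT d0(1) that
      by (auto simp: inj_on_def)
    then show False using an[OF d0(1)] d0(2) by (auto simp: nonvanishing_def T_def)
  qed
  have "\<forall>v\<in>C. g v * (b v * \<sigma> v ^ (M - m)) * \<sigma> v ^ m = N v * \<tau> v ^ m"
  proof
    fix v assume v: "v \<in> C"
    have "g v = (\<Sum>d\<le>n. c d v)" using graded_sum[OF G] by (simp add: c_def)
    also have "\<dots> = (\<Sum>d\<in>E. c d v)" using v by (intro sum.mono_neutral_right) (auto simp: E_def nonvanishing_def)
    finally have gs: "g v = (\<Sum>d\<in>E. c d v)" .
    have "c d v * b v * \<sigma> v ^ M = T d v * \<tau> v ^ m" if d: "d \<in> E" for d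
    proof -
      have b': "b v = \<beta> d v * (\<Prod>i\<in>E - {d}. \<beta> i v)" unfolding b_def using E d by (simp add: prod.remove)
      have "\<sigma> v ^ M = \<sigma> v ^ k d * \<sigma> v ^ (M - k d)" using kM[OF d] by (simp flip: power_add)
      then have "c d v * b v * \<sigma> v ^ M = (c d v * \<beta> d v * \<sigma> v ^ k d) * ((\<Prod>i\<in>E - {d}. \<beta> i v) * \<sigma> v ^ (M - k d))"
        unfolding b' by (simp add: ac_simps)
      also have "\<dots> = a d v * \<tau> v ^ k d" unfolding X'(5)[OF d v] a_def by (simp add: ac_simps)
      also have "\<tau> v ^ k d = \<tau> v ^ (k d - m) * \<tau> v ^ m" using m[OF d] by (simp flip: power_add)
      finally show ?thesis by (simp add: T_def ac_simps)
    qed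
    then have "g v * b v * \<sigma> v ^ M = N v * \<tau> v ^ m"
      unfolding gs N_def by (simp add: sum_distrib_right)
    moreover have "\<sigma> v ^ M = \<sigma> v ^ (M - m) * \<sigma> v ^ m" using mM by (simp flip: power_add)
    ultimately show "g v * (b v * \<sigma> v ^ (M - m)) * \<sigma> v ^ m = N v * \<tau> v ^ m" by (simp add: ac_simps)
  qed
  moreover have "(\<lambda>v. b v * \<sigma> v ^ (M - m)) \<in> Pol" "nzD (\<lambda>v. b v * \<sigma> v ^ (M - m))"
    using bP bn homog_poly[OF \<tau>(2)] \<tau>(3) by (auto intro!: poly_fun_intros nzD_mult nonvanishing_power)
  ultimately show "\<exists>(m::nat) \<alpha> \<beta>. \<alpha> \<in> Pol \<and> \<beta> \<in> Pol \<and> nzD \<alpha> \<and> nzD \<beta> \<and> (\<forall>v\<in>C. g v * \<beta> v * \<sigma> v ^ m = \<alpha> v * \<tau> v ^ m)"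
    using N nN by (intro exI[of _ m] exI[of _ N] exI[of _ "\<lambda>v. b v * \<sigma> v ^ (M - m)"]) blast
qed

end

section \<open>Towers of valued fields\<close>

text \<open>The valuation-theoretic content of a chain of divisors: \<open>\<rho> j\<close> is the restriction of \<open>\<nu> j\<close>-units to the
next divisor, and \<open>\<kappa> j\<close> embeds the nonzero constants. The rules for
\<open>\<rho> j (1 + x)\<close> concern the cases where \<open>1 + x\<close> is a unit, since only units restrict to nonzero elements.\<close>

locale valued_field_tower =
  fixes F :: "nat \<Rightarrow> ('k::field, 'b) module" and \<nu> :: "nat \<Rightarrow> 'b \<Rightarrow> int" and f :: "nat \<Rightarrow> 'b"
    and \<rho> :: "nat \<Rightarrow> 'b \<Rightarrow> 'b" and N :: nat and r :: nat and \<kappa> :: "nat \<Rightarrow> 'k \<Rightarrow> 'b"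
  assumes field: "j \<le> r \<Longrightarrow> field (F j)"
    and val_mult: "\<lbrakk>j \<le> r; x \<in> carrier (F j); x \<noteq> \<zero>\<^bsub>F j\<^esub>; y \<in> carrier (F j); y \<noteq> \<zero>\<^bsub>F j\<^esub>\<rbrakk> \<Longrightarrow> \<nu> j (x \<otimes>\<^bsub>F j\<^esub> y) = \<nu> j x + \<nu> j y"
    and val_add: "\<lbrakk>j \<le> r; x \<in> carrier (F j); x \<noteq> \<zero>\<^bsub>F j\<^esub>; y \<in> carrier (F j); y \<noteq> \<zero>\<^bsub>F j\<^esub>; x \<oplus>\<^bsub>F j\<^esub> y \<noteq> \<zero>\<^bsub>F j\<^esub>\<rbrakk>
        \<Longrightarrow> min (\<nu> j x) (\<nu> j y) \<le> \<nu> j (x \<oplus>\<^bsub>F j\<^esub> y)"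
    and f: "j \<le> r \<Longrightarrow> f j \<in> carrier (F j)" "j \<le> r \<Longrightarrow> f j \<noteq> \<zero>\<^bsub>F j\<^esub>" "j \<le> r \<Longrightarrow> \<nu> j (f j) > 0"
    and N: "N > 0" "0 < j \<Longrightarrow> j \<le> r \<Longrightarrow> \<nu> j (f j) dvd int N"
    and res_unit: "\<lbrakk>0 < j; j \<le> r; x \<in> carrier (F j); x \<noteq> \<zero>\<^bsub>F j\<^esub>; \<nu> j x = 0\<rbrakk> \<Longrightarrow> \<rho> j x \<in> carrier (F (j - 1)) \<and> \<rho> j x \<noteq> \<zero>\<^bsub>F (j - 1)\<^esub>"
    and res_mult: "\<lbrakk>0 < j; j \<le> r; x \<in> carrier (F j); x \<noteq> \<zero>\<^bsub>F j\<^esub>; \<nu> j x = 0; y \<in> carrier (F j); y \<noteq> \<zero>\<^bsub>F j\<^esub>; \<nu> j y = 0\<rbrakk>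
        \<Longrightarrow> \<rho> j (x \<otimes>\<^bsub>F j\<^esub> y) = \<rho> j x \<otimes>\<^bsub>F (j - 1)\<^esub> \<rho> j y"
    and res_one_add: "\<lbrakk>0 < j; j \<le> r; x \<in> carrier (F j); x \<noteq> \<zero>\<^bsub>F j\<^esub>; \<nu> j x = 0; \<one>\<^bsub>F j\<^esub> \<oplus>\<^bsub>F j\<^esub> x \<noteq> \<zero>\<^bsub>F j\<^esub>; \<nu> j (\<one>\<^bsub>F j\<^esub> \<oplus>\<^bsub>F j\<^esub> x) = 0\<rbrakk>
        \<Longrightarrow> \<rho> j (\<one>\<^bsub>F j\<^esub> \<oplus>\<^bsub>F j\<^esub> x) = \<one>\<^bsub>F (j - 1)\<^esub> \<oplus>\<^bsub>F (j - 1)\<^esub> \<rho> j x"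
    and res_one_add_small: "\<lbrakk>0 < j; j \<le> r; x \<in> carrier (F j); x \<noteq> \<zero>\<^bsub>F j\<^esub>; \<nu> j x > 0\<rbrakk>
        \<Longrightarrow> \<rho> j (\<one>\<^bsub>F j\<^esub> \<oplus>\<^bsub>F j\<^esub> x) = \<one>\<^bsub>F (j - 1)\<^esub>"
    and const: "\<lbrakk>j \<le> r; a \<noteq> 0\<rbrakk> \<Longrightarrow> \<kappa> j a \<in> carrier (F j) \<and> \<kappa> j a \<noteq> \<zero>\<^bsub>F j\<^esub> \<and> \<nu> j (\<kappa> j a) = 0"
    and const_pow: "\<lbrakk>j \<le> r; a \<noteq> 0\<rbrakk> \<Longrightarrow> \<kappa> j a [^]\<^bsub>F j\<^esub> n = \<kappa> j (a ^ n)"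
    and const_res: "\<lbrakk>0 < j; j \<le> r; a \<noteq> 0\<rbrakk> \<Longrightarrow> \<rho> j (\<kappa> j a) = \<kappa> (j - 1) a"
begin

definition b :: "nat \<Rightarrow> int" where "b j = \<nu> j (f j)"

definition nonzero :: "nat \<Rightarrow> 'b set" where "nonzero j = carrier (F j) - {\<zero>\<^bsub>F j\<^esub>}"

definition step :: "nat \<Rightarrow> 'b \<Rightarrow> 'b" where
  "step j h = \<rho> j (h [^]\<^bsub>F j\<^esub> N \<otimes>\<^bsub>F j\<^esub> f j [^]\<^bsub>F j\<^esub> (- ((int N * \<nu> j h) div b j)))"

text \<open>The vector of the descent that starts at level \<open>j\<close>, computed by recursion on \<open>j\<close>. Dividing by \<open>N\<close> at each level produces the
powers of \<open>N\<close> in the denominators.\<close>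

primrec W :: "nat \<Rightarrow> 'b \<Rightarrow> nat \<Rightarrow> rat" where
  "W 0 h = (\<lambda>i. if i = 0 then of_int (\<nu> 0 h) / of_int (b 0) else 0)"
| "W (Suc j) h = (\<lambda>i. if i = Suc j then of_int (\<nu> (Suc j) h) / of_int (b (Suc j)) else W j (step (Suc j) h) i / of_nat N)"

lemma b_pos: "j \<le> r \<Longrightarrow> b j > 0" using f(3) by (simp add: b_def)

lemma nonzero_mult: assumes "j \<le> r" "x \<in> nonzero j" "y \<in> nonzero j" shows "x \<otimes>\<^bsub>F j\<^esub> y \<in> nonzero j"
proof -
  interpret field "F j" using field assms by simp
  show ?thesis using assms integral_iff by (auto simp: nonzero_def)
qed

lemma one_nonzero: assumes "j \<le> r" shows "\<one>\<^bsub>F j\<^esub> \<in> nonzero j"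
proof -
  interpret field "F j" using field assms by simp
  show ?thesis by (auto simp: nonzero_def)
qed

lemma nonzero_int_pow: assumes "j \<le> r" "x \<in> nonzero j" shows "x [^]\<^bsub>F j\<^esub> (n::int) \<in> nonzero j"
proof -
  interpret field "F j" using field assms by simp
  show ?thesis using assms int_pow_nonzero(1,2)[of x n] by (auto simp: nonzero_def)
qed

lemma nonzero_pow: assumes "j \<le> r" "x \<in> nonzero j" shows "x [^]\<^bsub>F j\<^esub> (n::nat) \<in> nonzero j"
  using nonzero_int_pow[OF assms, of "int n"] by (simp add: int_pow_int)

lemma val_mult': "j \<le> r \<Longrightarrow> x \<in> nonzero j \<Longrightarrow> y \<in> nonzero j \<Longrightarrow> \<nu> j (x \<otimes>\<^bsub>F j\<^esub> y) = \<nu> j x + \<nu> j y"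
  using val_mult by (auto simp: nonzero_def)

lemma val_one: assumes "j \<le> r" shows "\<nu> j \<one>\<^bsub>F j\<^esub> = 0"
proof -
  interpret field "F j" using field assms by simp
  show ?thesis using val_mult'[OF assms one_nonzero[OF assms] one_nonzero[OF assms]] by simp
qed

lemma val_pow: assumes "j \<le> r" "x \<in> nonzero j" shows "\<nu> j (x [^]\<^bsub>F j\<^esub> (n::nat)) = int n * \<nu> j x"
proof (induction n)
  case 0
  interpret field "F j" using field assms by simp
  show ?case using val_one assms by simp
next
  case (Suc n)
  interpret field "F j" using field assms by simp
  show ?case using val_mult'[OF assms(1) nonzero_pow[OF assms, of n] assms(2)] Suc by (simp add: algebra_simps)
qed

lemma val_int_pow: assumes "j \<le> r" "x \<in> nonzero j" shows "\<nu> j (x [^]\<^bsub>F j\<^esub> (n::int)) = n * \<nu> j x"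
proof (cases "n \<ge> 0")
  case True
  then obtain k where k: "n = int k" by (metis nonneg_int_cases)
  show ?thesis unfolding k int_pow_int using val_pow[OF assms] by simp
next
  case False
  interpret field "F j" using field assms by simp
  have x: "x \<in> carrier (F j)" "x \<noteq> \<zero>\<^bsub>F j\<^esub>" using assms by (auto simp: nonzero_def)
  define k where "k = nat (- n)"
  have k: "n = - int k" using False by (simp add: k_def)
  have "x [^]\<^bsub>F j\<^esub> n \<otimes>\<^bsub>F j\<^esub> x [^]\<^bsub>F j\<^esub> int k = \<one>\<^bsub>F j\<^esub>"
    unfolding int_pow_add[OF x, symmetric] k by simp
  then have "\<nu> j (x [^]\<^bsub>F j\<^esub> n) + \<nu> j (x [^]\<^bsub>F j\<^esub> int k) = 0"
    using val_mult'[OF assms(1) nonzero_int_pow[OF assms] nonzero_int_pow[OF assms]] val_one[OF assms(1)] by metis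
  then show ?thesis unfolding int_pow_int val_pow[OF assms] k by simp
qed

text \<open>The descent with the exponent \<open>b j\<close> in place of \<open>N\<close>, the smallest exponent that uniformly produces
units.\<close>

definition res :: "nat \<Rightarrow> 'b \<Rightarrow> 'b" where
  "res j h = \<rho> j (h [^]\<^bsub>F j\<^esub> (nat (b j)) \<otimes>\<^bsub>F j\<^esub> f j [^]\<^bsub>F j\<^esub> (- \<nu> j h))"

lemma f_nonzero: "j \<le> r \<Longrightarrow> f j \<in> nonzero j" using f by (auto simp: nonzero_def)

lemma normalised:
  assumes j: "j \<le> r" and h: "h \<in> nonzero j"
  shows "h [^]\<^bsub>F j\<^esub> (nat (b j)) \<otimes>\<^bsub>F j\<^esub> f j [^]\<^bsub>F j\<^esub> (- \<nu> j h) \<in> nonzero j"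
    and "\<nu> j (h [^]\<^bsub>F j\<^esub> (nat (b j)) \<otimes>\<^bsub>F j\<^esub> f j [^]\<^bsub>F j\<^esub> (- \<nu> j h)) = 0"
proof -
  note nz = nonzero_pow[OF j h, of "nat (b j)"] nonzero_int_pow[OF j f_nonzero[OF j], of "- \<nu> j h"]
  show "h [^]\<^bsub>F j\<^esub> (nat (b j)) \<otimes>\<^bsub>F j\<^esub> f j [^]\<^bsub>F j\<^esub> (- \<nu> j h) \<in> nonzero j" by (rule nonzero_mult[OF j nz])
  show "\<nu> j (h [^]\<^bsub>F j\<^esub> (nat (b j)) \<otimes>\<^bsub>F j\<^esub> f j [^]\<^bsub>F j\<^esub> (- \<nu> j h)) = 0"
    unfolding val_mult'[OF j nz] val_pow[OF j h] val_int_pow[OF j f_nonzero[OF j]]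
    using b_pos[OF j] by (simp add: b_def)
qed

lemma res_nonzero:
  assumes "0 < j" "j \<le> r" "h \<in> nonzero j" shows "res j h \<in> nonzero (j - 1)"
  using res_unit[OF assms(1,2)] normalised[OF assms(2,3)] unfolding res_def nonzero_def by auto

lemma res_mult':
  assumes "0 < j" "j \<le> r" "x \<in> nonzero j" "\<nu> j x = 0" "y \<in> nonzero j" "\<nu> j y = 0"
  shows "\<rho> j (x \<otimes>\<^bsub>F j\<^esub> y) = \<rho> j x \<otimes>\<^bsub>F (j - 1)\<^esub> \<rho> j y"
  using res_mult[OF assms(1,2)] assms by (auto simp: nonzero_def)

lemma res_unit':
  assumes "0 < j" "j \<le> r" "x \<in> nonzero j" "\<nu> j x = 0" shows "\<rho> j x \<in> nonzero (j - 1)"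
  using res_unit[OF assms(1,2)] assms by (auto simp: nonzero_def)

lemma res_one:
  assumes "0 < j" "j \<le> r" shows "\<rho> j \<one>\<^bsub>F j\<^esub> = \<one>\<^bsub>F (j - 1)\<^esub>"
proof -
  interpret A: field "F j" using field assms by simp
  interpret B: field "F (j - 1)" using field assms by simp
  note o = one_nonzero[OF assms(2)] val_one[OF assms(2)]
  have 1: "\<rho> j \<one>\<^bsub>F j\<^esub> = \<rho> j \<one>\<^bsub>F j\<^esub> \<otimes>\<^bsub>F (j - 1)\<^esub> \<rho> j \<one>\<^bsub>F j\<^esub>" using res_mult'[OF assms o o] by simp
  have 2: "\<rho> j \<one>\<^bsub>F j\<^esub> \<in> carrier (F (j - 1))" "\<rho> j \<one>\<^bsub>F j\<^esub> \<noteq> \<zero>\<^bsub>F (j - 1)\<^esub>" using res_unit'[OF assms o] by (auto simp: nonzero_def)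
  then have "\<rho> j \<one>\<^bsub>F j\<^esub> \<otimes>\<^bsub>F (j - 1)\<^esub> \<one>\<^bsub>F (j - 1)\<^esub> = \<rho> j \<one>\<^bsub>F j\<^esub> \<otimes>\<^bsub>F (j - 1)\<^esub> \<rho> j \<one>\<^bsub>F j\<^esub>" using 1 B.r_one[OF 2(1)] by metis
  then show ?thesis using B.m_lcancel[OF 2(2,1) B.one_closed 2(1)] by simp
qed

lemma res_pow:
  assumes "0 < j" "j \<le> r" "x \<in> nonzero j" "\<nu> j x = 0"
  shows "\<rho> j (x [^]\<^bsub>F j\<^esub> (n::nat)) = \<rho> j x [^]\<^bsub>F (j - 1)\<^esub> n"
proof (induction n)
  case 0
  show ?case using res_one[OF assms(1,2)] by simp
next
  case (Suc n)
  have "\<nu> j (x [^]\<^bsub>F j\<^esub> n) = 0" using val_pow[OF assms(2,3)] assms by simp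
  then show ?case using res_mult'[OF assms(1,2) nonzero_pow[OF assms(2,3)] _ assms(3,4)] Suc by simp
qed

lemma res_mult_hom:
  assumes "0 < j" "j \<le> r" "x \<in> nonzero j" "y \<in> nonzero j"
  shows "res j (x \<otimes>\<^bsub>F j\<^esub> y) = res j x \<otimes>\<^bsub>F (j - 1)\<^esub> res j y"
proof -
  interpret field "F j" using field assms by simp
  have c: "x \<in> carrier (F j)" "y \<in> carrier (F j)" "f j \<in> carrier (F j)" "f j \<noteq> \<zero>\<^bsub>F j\<^esub>" using assms f by (auto simp: nonzero_def)
  have z: "f j [^]\<^bsub>F j\<^esub> n \<in> carrier (F j)" for n :: int using int_pow_nonzero(1)[OF c(3,4)] .
  have "(x \<otimes>\<^bsub>F j\<^esub> y) [^]\<^bsub>F j\<^esub> (nat (b j)) \<otimes>\<^bsub>F j\<^esub> f j [^]\<^bsub>F j\<^esub> (- \<nu> j (x \<otimes>\<^bsub>F j\<^esub> y)) =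
    (x [^]\<^bsub>F j\<^esub> (nat (b j)) \<otimes>\<^bsub>F j\<^esub> y [^]\<^bsub>F j\<^esub> (nat (b j))) \<otimes>\<^bsub>F j\<^esub> (f j [^]\<^bsub>F j\<^esub> (- \<nu> j x) \<otimes>\<^bsub>F j\<^esub> f j [^]\<^bsub>F j\<^esub> (- \<nu> j y))"
    using c int_pow_add[OF c(3,4), of "- \<nu> j x" "- \<nu> j y"] val_mult'[OF assms(2-4)] by (simp add: nat_pow_distrib)
  also have "\<dots> = (x [^]\<^bsub>F j\<^esub> (nat (b j)) \<otimes>\<^bsub>F j\<^esub> f j [^]\<^bsub>F j\<^esub> (- \<nu> j x)) \<otimes>\<^bsub>F j\<^esub> (y [^]\<^bsub>F j\<^esub> (nat (b j)) \<otimes>\<^bsub>F j\<^esub> f j [^]\<^bsub>F j\<^esub> (- \<nu> j y))"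
    using c z by (simp add: m_ac)
  finally show ?thesis
    unfolding res_def using res_mult'[OF assms(1,2) normalised[OF assms(2,3)] normalised[OF assms(2,4)]] by simp
qed

text \<open>The bond divides \<open>N\<close>, so the unit used in \<open>step\<close> is a power of the unit used in \<open>res\<close>.\<close>

lemma step_eq_res_pow:
  assumes "0 < j" "j \<le> r" "h \<in> nonzero j"
  shows "step j h = res j h [^]\<^bsub>F (j - 1)\<^esub> (N div nat (b j))"
proof -
  interpret field "F j" using field assms by simp
  have c: "h \<in> carrier (F j)" "h \<noteq> \<zero>\<^bsub>F j\<^esub>" "f j \<in> carrier (F j)" "f j \<noteq> \<zero>\<^bsub>F j\<^esub>" using assms f by (auto simp: nonzero_def)
  have z: "f j [^]\<^bsub>F j\<^esub> n \<in> carrier (F j)" for n :: int using int_pow_nonzero(1)[OF c(3,4)] .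
  define q where "q = N div nat (b j)"
  have bj: "b j > 0" "b j dvd int N" using b_pos N(2) assms by (auto simp: b_def)
  then have "nat (b j) dvd N" by (metis int_dvd_int_iff int_nat_eq less_imp_le)
  then have Nq: "N = nat (b j) * q" by (simp add: q_def)
  have "int N = b j * int q" using Nq bj by simp
  then have e: "(int N * \<nu> j h) div b j = \<nu> j h * int q" using bj by simp
  have "h [^]\<^bsub>F j\<^esub> N \<otimes>\<^bsub>F j\<^esub> f j [^]\<^bsub>F j\<^esub> (- ((int N * \<nu> j h) div b j)) =
    (h [^]\<^bsub>F j\<^esub> (nat (b j)) \<otimes>\<^bsub>F j\<^esub> f j [^]\<^bsub>F j\<^esub> (- \<nu> j h)) [^]\<^bsub>F j\<^esub> q"
  proof -
    have "(h [^]\<^bsub>F j\<^esub> (nat (b j)) \<otimes>\<^bsub>F j\<^esub> f j [^]\<^bsub>F j\<^esub> (- \<nu> j h)) [^]\<^bsub>F j\<^esub> q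
      = (h [^]\<^bsub>F j\<^esub> (nat (b j))) [^]\<^bsub>F j\<^esub> q \<otimes>\<^bsub>F j\<^esub> (f j [^]\<^bsub>F j\<^esub> (- \<nu> j h)) [^]\<^bsub>F j\<^esub> q"
      by (rule nat_pow_distrib[OF nat_pow_closed[OF c(1)] z])
    also have "(h [^]\<^bsub>F j\<^esub> (nat (b j))) [^]\<^bsub>F j\<^esub> q = h [^]\<^bsub>F j\<^esub> N" using nat_pow_pow[OF c(1)] Nq by simp
    also have "(f j [^]\<^bsub>F j\<^esub> (- \<nu> j h)) [^]\<^bsub>F j\<^esub> q = f j [^]\<^bsub>F j\<^esub> (- \<nu> j h * int q)"
      using int_pow_int_pow[OF c(3,4), of "- \<nu> j h" "int q"] by (simp only: int_pow_int)
    finally show ?thesis unfolding e by simp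
  qed
  then show ?thesis unfolding step_def res_def q_def[symmetric] using res_pow[OF assms(1,2) normalised[OF assms(2,3)]] by simp
qed

lemma step_nonzero: "0 < j \<Longrightarrow> j \<le> r \<Longrightarrow> h \<in> nonzero j \<Longrightarrow> step j h \<in> nonzero (j - 1)"
  using step_eq_res_pow res_nonzero nonzero_pow[of "j - 1"] by simp

lemma step_mult:
  assumes "0 < j" "j \<le> r" "x \<in> nonzero j" "y \<in> nonzero j"
  shows "step j (x \<otimes>\<^bsub>F j\<^esub> y) = step j x \<otimes>\<^bsub>F (j - 1)\<^esub> step j y"
proof -
  interpret B: field "F (j - 1)" using field assms by simp
  have "res j x \<in> carrier (F (j - 1))" "res j y \<in> carrier (F (j - 1))" using res_nonzero[OF assms(1,2)] assms by (auto simp: nonzero_def)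
  then show ?thesis
    using step_eq_res_pow[OF assms(1,2)] nonzero_mult[OF assms(2-4)] assms res_mult_hom[OF assms] by (simp add: B.nat_pow_distrib del: One_nat_def)
qed

lemma W_mult:
  assumes "j \<le> r" "x \<in> nonzero j" "y \<in> nonzero j"
  shows "W j (x \<otimes>\<^bsub>F j\<^esub> y) i = W j x i + W j y i"
  using assms
proof (induction j arbitrary: x y)
  case 0
  then show ?case using val_mult'[of 0 x y] by (simp add: add_divide_distrib)
next
  case (Suc j)
  have "step (Suc j) (x \<otimes>\<^bsub>F (Suc j)\<^esub> y) = step (Suc j) x \<otimes>\<^bsub>F j\<^esub> step (Suc j) y"
    using step_mult[of "Suc j" x y] Suc.prems by simp
  moreover have "step (Suc j) x \<in> nonzero j" "step (Suc j) y \<in> nonzero j" using step_nonzero[of "Suc j"] Suc.prems by auto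
  ultimately show ?case using val_mult'[OF Suc.prems] Suc.IH[of "step (Suc j) x" "step (Suc j) y"] Suc.prems by (simp add: add_divide_distrib)
qed

lemma W_one: "j \<le> r \<Longrightarrow> W j \<one>\<^bsub>F j\<^esub> i = 0"
proof -
  assume j: "j \<le> r"
  interpret field "F j" using field j by simp
  show ?thesis using W_mult[OF j one_nonzero[OF j] one_nonzero[OF j], of i] by simp
qed

lemma W_pow: "j \<le> r \<Longrightarrow> x \<in> nonzero j \<Longrightarrow> W j (x [^]\<^bsub>F j\<^esub> (n::nat)) i = of_nat n * W j x i"
proof (induction n)
  case 0
  then show ?case by (simp add: W_one)
next
  case (Suc n)
  then show ?case using W_mult[OF Suc.prems(1) nonzero_pow[OF Suc.prems] Suc.prems(2), of n i] by (simp add: algebra_simps)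
qed

text \<open>By \<open>step_eq_res_pow\<close> the factor \<open>N\<close> cancels to the bond: \<open>W\<close> does not depend on the choice of \<open>N\<close>.\<close>

lemma W_step:
  assumes "Suc j \<le> r" "h \<in> nonzero (Suc j)" "i \<le> j"
  shows "of_int (b (Suc j)) * W (Suc j) h i = W j (res (Suc j) h) i"
proof -
  have bj: "b (Suc j) > 0" "b (Suc j) dvd int N" using b_pos N(2)[of "Suc j"] assms by (auto simp: b_def)
  define q where "q = N div nat (b (Suc j))"
  have "nat (b (Suc j)) dvd N" using bj by (metis int_dvd_int_iff int_nat_eq less_imp_le)
  then have Nq: "N = nat (b (Suc j)) * q" by (simp add: q_def)
  have q0: "q \<noteq> 0" using Nq N(1) by auto
  have "W (Suc j) h i = W j (step (Suc j) h) i / of_nat N" using assms by simp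
  also have "W j (step (Suc j) h) i = of_nat q * W j (res (Suc j) h) i"
    using step_eq_res_pow[of "Suc j" h] res_nonzero[of "Suc j" h] W_pow[of j "res (Suc j) h" q i] assms by (simp add: q_def)
  finally have "W (Suc j) h i = of_nat q * W j (res (Suc j) h) i / of_nat N" .
  moreover have "(of_nat N :: rat) = of_int (b (Suc j)) * of_nat q" using Nq bj by (metis of_nat_mult of_nat_nat less_imp_le)
  ultimately show ?thesis using q0 bj by simp
qed

lemma W_lattice:
  assumes "j \<le> r" "h \<in> nonzero j" "i \<le> j"
  shows "(\<Prod>k=i..j. of_int (b k)) * W j h i \<in> \<int>"
  using assms
proof (induction j arbitrary: h)
  case 0
  then show ?case using b_pos[of 0] by simp
next
  case (Suc j)
  show ?case
  proof (cases "i = Suc j")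
    case True
    then show ?thesis using b_pos[of "Suc j"] Suc.prems by simp
  next
    case False
    then have i: "i \<le> j" using Suc.prems by simp
    then have "(\<Prod>k=i..Suc j. rat_of_int (b k)) * W (Suc j) h i = (\<Prod>k=i..j. of_int (b k)) * (of_int (b (Suc j)) * W (Suc j) h i)"
      by (simp add: mult.assoc del: W.simps)
    also have "\<dots> = (\<Prod>k=i..j. of_int (b k)) * W j (res (Suc j) h) i" using W_step[OF Suc.prems(1,2) i] by simp
    also have "\<dots> \<in> \<int>" using Suc.IH[of "res (Suc j) h"] res_nonzero[of "Suc j" h] Suc.prems i by simp
    finally show ?thesis .
  qed
qed

lemma W_const: "j \<le> r \<Longrightarrow> a \<noteq> 0 \<Longrightarrow> W j (\<kappa> j a) i = 0"
proof (induction j arbitrary: a)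
  case 0
  then show ?case using const[of 0 a] by simp
next
  case (Suc j)
  interpret field "F (Suc j)" using field Suc.prems by simp
  have fc: "f (Suc j) [^]\<^bsub>F (Suc j)\<^esub> (0::int) = \<one>\<^bsub>F (Suc j)\<^esub>" by simp
  have "step (Suc j) (\<kappa> (Suc j) a) = \<kappa> j (a ^ N)"
    unfolding step_def using const[of "Suc j" a] const[of "Suc j" "a ^ N"] const_pow[of "Suc j" a N] const_res[of "Suc j" "a ^ N"] Suc.prems by simp
  then show ?case using Suc.IH[of "a ^ N"] Suc.prems const[of "Suc j" a] by simp
qed

text \<open>Lexicographic nonnegativity, with the entry of highest index compared first.\<close>

definition lexpos :: "nat \<Rightarrow> (nat \<Rightarrow> rat) \<Rightarrow> bool" where
  "lexpos j w \<longleftrightarrow> (\<forall>i\<le>j. w i = 0) \<or> (\<exists>i\<le>j. w i > 0 \<and> (\<forall>k. i < k \<and> k \<le> j \<longrightarrow> w k = 0))"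

lemma lexpos_Suc: "lexpos (Suc j) w \<longleftrightarrow> w (Suc j) > 0 \<or> w (Suc j) = 0 \<and> lexpos j w"
proof
  assume "lexpos (Suc j) w"
  then consider "\<forall>i\<le>Suc j. w i = 0" | i where "i \<le> Suc j" "w i > 0" "\<forall>k. i < k \<and> k \<le> Suc j \<longrightarrow> w k = 0"
    unfolding lexpos_def by blast
  then show "w (Suc j) > 0 \<or> w (Suc j) = 0 \<and> lexpos j w"
  proof cases
    case (2 i)
    then show ?thesis by (cases "i = Suc j") (auto simp: lexpos_def le_Suc_eq)
  qed (auto simp: lexpos_def)
next
  assume "w (Suc j) > 0 \<or> w (Suc j) = 0 \<and> lexpos j w"
  then show "lexpos (Suc j) w"
  proof
    assume "w (Suc j) > 0"
    then show ?thesis unfolding lexpos_def by (intro disjI2 exI[of _ "Suc j"]) auto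
  next
    assume a: "w (Suc j) = 0 \<and> lexpos j w"
    then consider "\<forall>i\<le>j. w i = 0" | i where "i \<le> j" "w i > 0" "\<forall>k. i < k \<and> k \<le> j \<longrightarrow> w k = 0"
      unfolding lexpos_def by blast
    then show ?thesis
    proof cases
      case 1
      then show ?thesis using a by (auto simp: lexpos_def le_Suc_eq)
    next
      case (2 i)
      then show ?thesis using a unfolding lexpos_def by (intro disjI2 exI[of _ i]) (auto simp: le_Suc_eq)
    qed
  qed
qed

lemma lexpos_scale: "c > 0 \<Longrightarrow> (\<And>i. i \<le> j \<Longrightarrow> w i = c * w' i) \<Longrightarrow> lexpos j w \<longleftrightarrow> lexpos j w'"
proof (induction j)
  case 0
  then show ?case by (auto simp: lexpos_def zero_less_mult_iff)
next
  case (Suc j)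
  then show ?case unfolding lexpos_Suc by (simp add: zero_less_mult_iff)
qed

text \<open>The triangle inequality after division by one summand. If \<open>\<nu>(1 + h) > 0\<close> the first entry decides. If \<open>\<nu>(1 + h) = 0\<close>, the
question is passed to the restriction, which is \<open>1\<close> for \<open>\<nu>(h) > 0\<close>, and \<open>1\<close> plus the restriction of \<open>h\<close> for
\<open>\<nu>(h) = 0\<close>; in the latter case the induction hypothesis applies.\<close>

lemma one_add_nonneg:
  assumes "j \<le> r" "h \<in> nonzero j" "\<one>\<^bsub>F j\<^esub> \<oplus>\<^bsub>F j\<^esub> h \<in> nonzero j" "lexpos j (W j h)"
  shows "lexpos j (W j (\<one>\<^bsub>F j\<^esub> \<oplus>\<^bsub>F j\<^esub> h))"
  using assms
proof (induction j arbitrary: h)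
  case 0
  let ?x = "\<one>\<^bsub>F 0\<^esub> \<oplus>\<^bsub>F 0\<^esub> h"
  have b: "b 0 > 0" using b_pos by simp
  have "\<nu> 0 h \<ge> 0" using 0 b by (auto simp: lexpos_def zero_less_divide_iff)
  then have "\<nu> 0 ?x \<ge> 0"
    using val_add[of 0 "\<one>\<^bsub>F 0\<^esub>" h] 0 one_nonzero[of 0] val_one[of 0] by (auto simp: nonzero_def)
  then show ?case using b by (cases "\<nu> 0 ?x = 0") (auto simp: lexpos_def)
next
  case (Suc j)
  let ?x = "\<one>\<^bsub>F (Suc j)\<^esub> \<oplus>\<^bsub>F (Suc j)\<^esub> h"
  interpret A: field "F (Suc j)" using field Suc.prems by simp
  interpret B: field "F j" using field Suc.prems by simp
  have j: "0 < Suc j" "Suc j \<le> r" using Suc.prems by auto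
  have b: "b (Suc j) > 0" using b_pos j by simp
  note h = Suc.prems(2) and x = Suc.prems(3)
  have hc: "h \<in> carrier (F (Suc j))" "h \<noteq> \<zero>\<^bsub>F (Suc j)\<^esub>" and xc: "?x \<in> carrier (F (Suc j))" "?x \<noteq> \<zero>\<^bsub>F (Suc j)\<^esub>"
    using h x by (auto simp: nonzero_def)
  have h0: "\<nu> (Suc j) h \<ge> 0" using Suc.prems(4) b by (auto simp: lexpos_Suc zero_less_divide_iff)
  then have x0: "\<nu> (Suc j) ?x \<ge> 0"
    using val_add[OF j(2) _ _ hc xc(2)] one_nonzero[OF j(2)] val_one[OF j(2)] by (auto simp: nonzero_def)
  have main: "lexpos (Suc j) (W (Suc j) y) \<longleftrightarrow> \<nu> (Suc j) y > 0 \<or> \<nu> (Suc j) y = 0 \<and> lexpos j (W j (\<rho> (Suc j) y))"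
    if y: "y \<in> nonzero (Suc j)" for y
  proof -
    have "lexpos j (W (Suc j) y) \<longleftrightarrow> lexpos j (W j (\<rho> (Suc j) y))" if y0: "\<nu> (Suc j) y = 0"
    proof (rule lexpos_scale[of "1"])
      fix i assume i: "i \<le> j"
      have "step (Suc j) y = \<rho> (Suc j) (y [^]\<^bsub>F (Suc j)\<^esub> N)"
        unfolding step_def y0 using y by (simp add: nonzero_def)
      also have "\<dots> = \<rho> (Suc j) y [^]\<^bsub>F j\<^esub> N" using res_pow[OF j y y0] by simp
      finally have "W (Suc j) y i = W j (\<rho> (Suc j) y [^]\<^bsub>F j\<^esub> N) i / of_nat N" using i by simp
      also have "\<dots> = W j (\<rho> (Suc j) y) i"
        using W_pow[of j "\<rho> (Suc j) y" N i] res_unit'[OF j y y0] j N(1) by simp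
      finally show "W (Suc j) y i = 1 * W j (\<rho> (Suc j) y) i" by simp
    qed simp
    then show ?thesis unfolding lexpos_Suc using b by (auto simp: zero_less_divide_iff)
  qed
  show ?case
  proof (cases "\<nu> (Suc j) ?x > 0")
    case True
    then show ?thesis using main[OF x] by simp
  next
    case False
    then have x00: "\<nu> (Suc j) ?x = 0" using x0 by simp
    show ?thesis
    proof (cases "\<nu> (Suc j) h > 0")
      case True
      have "\<rho> (Suc j) ?x = \<one>\<^bsub>F j\<^esub>" using res_one_add_small[OF j hc True] by simp
      then have "lexpos j (W j (\<rho> (Suc j) ?x))" using W_one j by (simp add: lexpos_def)
      then show ?thesis using main[OF x] x00 by simp
    next
      case False
      then have h00: "\<nu> (Suc j) h = 0" using h0 by simp
      have eq: "\<rho> (Suc j) ?x = \<one>\<^bsub>F j\<^esub> \<oplus>\<^bsub>F j\<^esub> \<rho> (Suc j) h" using res_one_add[OF j hc h00 xc(2) x00] by simp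
      have "\<rho> (Suc j) h \<in> nonzero j" "\<rho> (Suc j) ?x \<in> nonzero j" using res_unit'[OF j h h00] res_unit'[OF j x x00] by auto
      moreover have "lexpos j (W j (\<rho> (Suc j) h))" using main[OF h] Suc.prems(4) h00 by simp
      ultimately have "lexpos j (W j (\<rho> (Suc j) ?x))" using Suc.IH[of "\<rho> (Suc j) h"] eq j by simp
      then show ?thesis using main[OF x] x00 by simp
    qed
  qed
qed

end

section \<open>The valuation of a divisor through a regular point\<close>

lemma nat_pow_carrier_update: "x [^]\<^bsub>F\<lparr>carrier := S\<rparr>\<^esub> (n::nat) = x [^]\<^bsub>F\<^esub> n"
  by (simp add: nat_pow_def)

context divisor
begin

text \<open>Work in the regular, hence normal, local ring at the point \<open>[v0]\<close>, where \<open>D\<close> defines a prime \<open>P\<close>. The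
form \<open>f\<close>, divided by a power of a linear form \<open>w\<close> with \<open>w v0 \<noteq> 0\<close>, is a nonzero element of \<open>P\<close>. A form \<open>a\<close> that
vanishes on \<open>D\<close> becomes, after multiplication with \<open>b\<close>, zero on all of \<open>C \<inter> {f = 0}\<close>; by the Nullstellensatz a
power of \<open>a b\<close> is a multiple of \<open>f\<close> on \<open>C\<close>, and \<open>b\<close> is invertible along \<open>D\<close>. So \<open>normal_local_uniformizer\<close> gives
a quotient of forms that generates \<open>P\<close> locally, and it is a uniformizer for the cone as
well.\<close>

lemma discrete_valuation_at_regular_point:
  assumes C: "C = cone Y" "zariski_closed scale Y" "C = zero_locus J" "J \<subseteq> Pol" and D: "conical D"
    and f: "homogeneous scale \<delta> f" "\<not> nzD f" "nz f"
    and b: "homogeneous scale \<epsilon> b" "nzD b" "\<And>v. v \<in> C \<Longrightarrow> f v = 0 \<Longrightarrow> v \<in> D \<or> b v = 0"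
    and v0: "v0 \<noteq> 0" "v0 \<in> D"
    and reg: "regular_local_ring (local_ring_at scale Y (point scale v0))"
  shows "\<exists>t. discrete_valuation K B t"
proof -
  note pi = poly_fun_intros
  define Oc where "Oc = {rat a s | a s d. homogeneous scale d a \<and> homogeneous scale d s \<and> s v0 \<noteq> 0}"
  define Ol where "Ol = K\<lparr>carrier := Oc\<rparr>"
  have "{rat a s | a s d. homogeneous scale d a \<and> homogeneous scale d s \<and> point scale v0 \<notin> hypersurface scale s} = Oc"
    unfolding Oc_def using point_in_hypersurface[OF _ v0(1)] by blast
  then have Ol: "local_ring_at scale Y (point scale v0) = Ol"
    unfolding local_ring_at_def Ol_def C(1)[symmetric] by simp
  note reg' = regular_local_ring_normal[OF reg, unfolded Ol]
  interpret L: noetherian_cring Ol by (rule reg'(1))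
  have ops: "carrier Ol = Oc" "\<And>x y. x \<otimes>\<^bsub>Ol\<^esub> y = x \<otimes>\<^bsub>K\<^esub> y" "\<And>x y. x \<oplus>\<^bsub>Ol\<^esub> y = x \<oplus>\<^bsub>K\<^esub> y"
    "\<one>\<^bsub>Ol\<^esub> = \<one>\<^bsub>K\<^esub>" "\<zero>\<^bsub>Ol\<^esub> = \<zero>\<^bsub>K\<^esub>" "\<And>x n. x [^]\<^bsub>Ol\<^esub> (n::nat) = x [^]\<^bsub>K\<^esub> n"
    by (simp_all add: Ol_def nat_pow_carrier_update)
  have v0D: "nzD s" if "s v0 \<noteq> 0" for s using that v0(2) by (auto simp: nonvanishing_def)
  have Oc_I: "rat a s \<in> Oc" if "homogeneous scale d a" "homogeneous scale d s" "s v0 \<noteq> 0" for a s d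
    using that unfolding Oc_def by blast
  have Oc_E: "\<exists>a s d. homogeneous scale d a \<and> homogeneous scale d s \<and> s v0 \<noteq> 0 \<and> a \<in> Pol \<and> s \<in> Pol \<and> nzD s \<and> nz s \<and> x = rat a s" if x: "x \<in> Oc" for x
  proof -
    obtain a s d where *: "homogeneous scale d a" "homogeneous scale d s" "s v0 \<noteq> 0" "x = rat a s" using x unfolding Oc_def by blast
    have n: "nzD s" by (rule v0D) (rule *(3))
    show ?thesis using homog_poly[OF *(1)] homog_poly[OF *(2)] n nzD_nz[OF n] * by blast
  qed
  define P where "P = {rat a s | a s d. homogeneous scale d a \<and> homogeneous scale d s \<and> s v0 \<noteq> 0 \<and> \<not> nzD a}"
  have P_Oc: "P \<subseteq> Oc" unfolding P_def Oc_def by blast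
  have P_iff: "rat a s \<in> P \<longleftrightarrow> \<not> nzD a" if as: "homogeneous scale d a" "homogeneous scale d s" "s v0 \<noteq> 0" for a s d
  proof
    assume "rat a s \<in> P"
    then obtain a' s' d' where *: "homogeneous scale d' a'" "homogeneous scale d' s'" "s' v0 \<noteq> 0" "\<not> nzD a'" "rat a s = rat a' s'" unfolding P_def by blast
    have n: "nzD s" "nzD s'" by (rule v0D, rule as(3), rule v0D, rule *(3))
    show "\<not> nzD a"
      using numerator_nzD[OF homog_poly[OF as(1)] homog_poly[OF as(2)] homog_poly[OF *(1)] homog_poly[OF *(2)] n *(5)] *(4) by blast
  qed (use as in \<open>auto simp: P_def\<close>)
  have P: "primeideal P Ol"
  proof (rule L.primeidealI_cring[OF L.idealI_cring])
    show "P \<subseteq> carrier Ol" using P_Oc ops by simp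
    have h01: "homogeneous scale 0 (\<lambda>_. 0)" "homogeneous scale 0 (\<lambda>_. 1)" by (rule homogeneous_intros)+
    show "\<zero>\<^bsub>Ol\<^esub> \<in> P" unfolding ops K_zero using P_iff[OF h01] by (simp add: nonvanishing_def)
    show "\<one>\<^bsub>Ol\<^esub> \<notin> P" unfolding ops K_one using P_iff[OF h01(2,2)] nzD_one by simp
  next
    fix x y assume x: "x \<in> P" and y: "y \<in> P"
    obtain a s d where a: "homogeneous scale d a" "homogeneous scale d s" "s v0 \<noteq> 0" "\<not> nzD a" "x = rat a s" using x unfolding P_def by blast
    obtain a' s' d' where a': "homogeneous scale d' a'" "homogeneous scale d' s'" "s' v0 \<noteq> 0" "\<not> nzD a'" "y = rat a' s'" using y unfolding P_def by blast
    have n: "nz s" "nz s'" by (rule nzD_nz, rule v0D, rule a(3), rule nzD_nz, rule v0D, rule a'(3))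
    have "x \<oplus>\<^bsub>Ol\<^esub> y = rat (\<lambda>v. a v * s' v + a' v * s v) (\<lambda>v. s v * s' v)"
      unfolding ops a(5) a'(5) by (rule rat_add[OF homog_poly[OF a(1)] homog_poly[OF a(2)] homog_poly[OF a'(1)] homog_poly[OF a'(2)] n])
    moreover have "homogeneous scale (d + d') (\<lambda>v. a v * s' v + a' v * s v)"
      using homogeneous_intros(3)[OF homogeneous_mult[OF a(1) a'(2)]] homogeneous_mult[OF a'(1) a(2)] by (simp add: add.commute)
    moreover have "homogeneous scale (d + d') (\<lambda>v. s v * s' v)" using homogeneous_mult a a' by blast
    moreover have "\<not> nzD (\<lambda>v. a v * s' v + a' v * s v)" using a(4) a'(4) by (auto simp: nonvanishing_def)
    ultimately show "x \<oplus>\<^bsub>Ol\<^esub> y \<in> P" using P_iff[of "d + d'"] a(3) a'(3) by simp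
  next
    fix x y assume x: "x \<in> P" and "y \<in> carrier Ol"
    then have y: "y \<in> Oc" using ops by simp
    obtain a s d where a: "homogeneous scale d a" "homogeneous scale d s" "s v0 \<noteq> 0" "\<not> nzD a" "x = rat a s" using x unfolding P_def by blast
    obtain a' s' d' where a': "homogeneous scale d' a'" "homogeneous scale d' s'" "s' v0 \<noteq> 0" "y = rat a' s'" using y unfolding Oc_def by blast
    have n: "nz s" "nz s'" by (rule nzD_nz, rule v0D, rule a(3), rule nzD_nz, rule v0D, rule a'(3))
    have "y \<otimes>\<^bsub>Ol\<^esub> x = rat (\<lambda>v. a' v * a v) (\<lambda>v. s' v * s v)"
      unfolding ops a(5) a'(4) by (rule rat_mult[OF homog_poly[OF a'(1)] homog_poly[OF a'(2)] homog_poly[OF a(1)] homog_poly[OF a(2)] n(2,1)])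
    moreover have "homogeneous scale (d' + d) (\<lambda>v. a' v * a v)" "homogeneous scale (d' + d) (\<lambda>v. s' v * s v)"
      using homogeneous_mult a a' by blast+
    moreover have "\<not> nzD (\<lambda>v. a' v * a v)" using a(4) by (auto simp: nonvanishing_def)
    ultimately show "y \<otimes>\<^bsub>Ol\<^esub> x \<in> P" using P_iff[of "d' + d"] a(3) a'(3) by simp
  next
    fix x y assume "x \<in> carrier Ol" "y \<in> carrier Ol" and xy: "x \<otimes>\<^bsub>Ol\<^esub> y \<in> P"
    then have x: "x \<in> Oc" and y: "y \<in> Oc" using ops by auto
    obtain a s d where a: "homogeneous scale d a" "homogeneous scale d s" "s v0 \<noteq> 0" "x = rat a s" using x unfolding Oc_def by blast
    obtain a' s' d' where a': "homogeneous scale d' a'" "homogeneous scale d' s'" "s' v0 \<noteq> 0" "y = rat a' s'" using y unfolding Oc_def by blast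
    have n: "nz s" "nz s'" by (rule nzD_nz, rule v0D, rule a(3), rule nzD_nz, rule v0D, rule a'(3))
    have "x \<otimes>\<^bsub>Ol\<^esub> y = rat (\<lambda>v. a v * a' v) (\<lambda>v. s v * s' v)"
      unfolding ops a(4) a'(4) by (rule rat_mult[OF homog_poly[OF a(1)] homog_poly[OF a(2)] homog_poly[OF a'(1)] homog_poly[OF a'(2)] n])
    moreover have "homogeneous scale (d + d') (\<lambda>v. a v * a' v)" "homogeneous scale (d + d') (\<lambda>v. s v * s' v)"
      using homogeneous_mult a a' by blast+
    ultimately have "\<not> nzD (\<lambda>v. a v * a' v)" using P_iff[of "d + d'"] a(3) a'(3) xy by simp
    then have "\<not> nzD a \<or> \<not> nzD a'" using nzD_mult[OF homog_poly[OF a(1)] homog_poly[OF a'(1)]] by blast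
    then show "x \<in> P \<or> y \<in> P" using P_iff[OF a(1-3)] P_iff[OF a'(1-3)] a(4) a'(4) by blast
  qed
  obtain w where w: "linear_form scale w" "w v0 \<noteq> 0" using exists_linear_form_nonzero[OF v0(1)] .
  have hw: "homogeneous scale n (\<lambda>v. w v ^ n)" for n using homogeneous_power[OF homogeneous_intros(4)[OF w(1)], of n] by simp
  have w0: "w v0 ^ n \<noteq> 0" for n using w(2) by simp
  have wP: "w \<in> Pol" "(\<lambda>v. w v ^ n) \<in> Pol" for n using poly_fun.linear[OF w(1)] by (auto intro: pi)
  have wD: "nzD (\<lambda>v. w v ^ n)" for n by (rule v0D) (rule w0)
  have wC: "nz (\<lambda>v. w v ^ n)" for n by (rule nzD_nz[OF wD])
  have fP: "f \<in> Pol" and bP: "b \<in> Pol" using homog_poly f(1) b(1) by blast+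
  define \<phi> where "\<phi> = rat f (\<lambda>v. w v ^ \<delta>)"
  have \<phi>: "\<phi> \<in> P" "\<phi> \<noteq> \<zero>\<^bsub>Ol\<^esub>"
    unfolding \<phi>_def ops using P_iff[OF f(1) hw w0] f(2) rat_eq_zero_iff[OF fP wP(2) wC] f(3) by simp_all
  have nil: "\<exists>(n::nat) s r. s \<in> carrier Ol - P \<and> r \<in> carrier Ol \<and> s \<otimes>\<^bsub>Ol\<^esub> z [^]\<^bsub>Ol\<^esub> n = r \<otimes>\<^bsub>Ol\<^esub> \<phi>" if z: "z \<in> P" for z
  proof -
    obtain a s e where a: "homogeneous scale e a" "homogeneous scale e s" "s v0 \<noteq> 0" "\<not> nzD a" "z = rat a s" using z unfolding P_def by blast
    have aP: "a \<in> Pol" "s \<in> Pol" using a homog_poly by blast+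
    \<comment> \<open>the factor \<open>w\<close> makes the degree of \<open>g\<close> positive, so that the degree of \<open>g\<^sup>n\<close> grows with \<open>n\<close>\<close>
    define g where "g v = a v * b v * w v" for v
    have hg: "homogeneous scale (e + \<epsilon> + 1) g"
      unfolding g_def[abs_def] by (intro homogeneous_mult a b homogeneous_intros(4) w)
    have gz: "g v = 0" if "v \<in> C" "f v = 0" for v
      using b(3)[OF that] a(4) by (auto simp: g_def nonvanishing_def)
    obtain n0 :: nat and h where h: "h \<in> Pol" "\<And>v. v \<in> C \<Longrightarrow> g v ^ n0 = h v * f v"
      by (rule Nullstellensatz_hypersurface[OF C(3,4) fP homog_poly[OF hg] gz]) (assumption | rule that)+
    define n where "n = n0 + \<delta>"
    \<comment> \<open>the additional factor makes the degree of \<open>g\<^sup>n\<close> at least \<open>\<delta>\<close>, so the cofactor has a component of the complementary degree\<close>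
    define h1 where "h1 v = h v * g v ^ \<delta>" for v
    have h1: "h1 \<in> Pol" "\<And>v. v \<in> C \<Longrightarrow> g v ^ n = h1 v * f v"
      using h homog_poly[OF hg] unfolding h1_def[abs_def] n_def by (auto intro: pi simp: power_add)
    obtain H k where H: "graded h1 H k" using graded_exists[OF h1(1)] by blast
    define m where "m = n * (e + \<epsilon> + 1) - \<delta>"
    have m: "n * (e + \<epsilon> + 1) = m + \<delta>"
      unfolding m_def n_def by (simp add: algebra_simps)
    define c where "c v = coeff (H v) m" for v
    have hc: "homogeneous scale m c" using H by (simp add: graded_def c_def[abs_def])
    have con: "conical C" unfolding C(1) by (rule conical_cone[OF C(2)])
    have key: "g v ^ n = c v * f v" if v: "v \<in> C" for v
    proof -
      have "H v * monom (f v) \<delta> - monom (g v ^ n) (m + \<delta>) = 0"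
      proof (rule poly_eq_0_infinite)
        fix t
        have "scale t v \<in> C" using con v by (simp add: conical_def)
        then have "g (scale t v) ^ n = h1 (scale t v) * f (scale t v)" by (rule h1(2))
        then have "(t ^ (e + \<epsilon> + 1) * g v) ^ n = poly (H v) t * (t ^ \<delta> * f v)"
          by (simp only: graded_scale[OF H] homogeneous_scale[OF hg] homogeneous_scale[OF f(1)])
        then have "t ^ (m + \<delta>) * g v ^ n = poly (H v) t * (t ^ \<delta> * f v)"
          by (simp only: power_mult_distrib m[symmetric] mult.commute[of n] power_mult)
        then show "poly (H v * monom (f v) \<delta> - monom (g v ^ n) (m + \<delta>)) t = 0" by (simp add: poly_monom ac_simps)
      qed
      then have "coeff (H v * monom (f v) \<delta>) (m + \<delta>) = g v ^ n" by simp
      then show ?thesis using coeff_monom_mult[of "f v" \<delta> "H v" "m + \<delta>"] by (simp add: c_def mult.commute)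
    qed
    define s1 where "s1 = rat (\<lambda>v. b v ^ n) (\<lambda>v. w v ^ (n * \<epsilon>))"
    define r1 where "r1 = rat (\<lambda>v. c v * w v ^ \<delta>) (\<lambda>v. s v ^ n * w v ^ (n * \<epsilon> + n))"
    have hb: "homogeneous scale (n * \<epsilon>) (\<lambda>v. b v ^ n)" by (rule homogeneous_power[OF b(1)])
    have "s1 \<in> Oc - P" unfolding s1_def using Oc_I[OF hb hw w0] P_iff[OF hb hw w0] nonvanishing_power[OF b(2)] by blast
    moreover have hr: "homogeneous scale (m + \<delta>) (\<lambda>v. c v * w v ^ \<delta>)" by (rule homogeneous_mult[OF hc hw])
    have hs: "homogeneous scale (n * e + (n * \<epsilon> + n)) (\<lambda>v. s v ^ n * w v ^ (n * \<epsilon> + n))"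
      by (rule homogeneous_mult[OF homogeneous_power[OF a(2)] hw])
    have deg: "n * e + (n * \<epsilon> + n) = m + \<delta>" using m by (simp add: algebra_simps)
    have d0: "s v0 ^ n * w v0 ^ (n * \<epsilon> + n) \<noteq> 0" using a(3) w(2) by simp
    have "r1 \<in> Oc" unfolding r1_def using Oc_I[OF hr hs[unfolded deg] d0] .
    moreover have "s1 \<otimes>\<^bsub>K\<^esub> z [^]\<^bsub>K\<^esub> n = r1 \<otimes>\<^bsub>K\<^esub> \<phi>"
    proof -
      have nzs: "nz s" "nz (\<lambda>v. s v ^ n)" "nz (\<lambda>v. w v ^ i)" "nz (\<lambda>v. s v ^ n * w v ^ (n * \<epsilon> + n))" for i
      proof -
        show s: "nz s" by (rule nzD_nz, rule v0D, rule a(3))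
        show "nz (\<lambda>v. s v ^ n)" by (rule nonvanishing_power[OF s])
        show "nz (\<lambda>v. w v ^ i)" by (rule wC)
        show "nz (\<lambda>v. s v ^ n * w v ^ (n * \<epsilon> + n))" by (rule nzD_nz, rule v0D, rule d0)
      qed
      have pw: "(\<lambda>v. b v ^ n) \<in> Pol" "(\<lambda>v. a v ^ n) \<in> Pol" "(\<lambda>v. s v ^ n) \<in> Pol" "c \<in> Pol" "(\<lambda>v. c v * w v ^ \<delta>) \<in> Pol"
        "(\<lambda>v. s v ^ n * w v ^ (n * \<epsilon> + n)) \<in> Pol"
        using aP bP wP homog_poly[OF hc] by (auto intro!: pi)
      have "s1 \<otimes>\<^bsub>K\<^esub> z [^]\<^bsub>K\<^esub> n = rat (\<lambda>v. b v ^ n * a v ^ n) (\<lambda>v. w v ^ (n * \<epsilon>) * s v ^ n)"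
        unfolding s1_def a(5) rat_pow[OF aP nzs(1)] by (rule rat_mult[OF pw(1) wP(2) pw(2,3) nzs(3,2)])
      also have "\<dots> = rat (\<lambda>v. (c v * w v ^ \<delta>) * f v) (\<lambda>v. (s v ^ n * w v ^ (n * \<epsilon> + n)) * w v ^ \<delta>)"
      proof (rule rat_eqI)
        show "nz (\<lambda>v. w v ^ (n * \<epsilon>) * s v ^ n)" by (rule nz_mult[OF wP(2) pw(3) nzs(3,2)])
        show "nz (\<lambda>v. (s v ^ n * w v ^ (n * \<epsilon> + n)) * w v ^ \<delta>)" by (rule nz_mult[OF pw(6) wP(2) nzs(4,3)])
        fix v assume v: "v \<in> C"
        have "b v ^ n * a v ^ n * (s v ^ n * w v ^ (n * \<epsilon> + n) * w v ^ \<delta>) = g v ^ n * (s v ^ n * w v ^ (n * \<epsilon>) * w v ^ \<delta>)"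
          by (simp add: g_def power_mult_distrib power_add ac_simps)
        also have "\<dots> = c v * w v ^ \<delta> * f v * (w v ^ (n * \<epsilon>) * s v ^ n)" unfolding key[OF v] by (simp add: ac_simps)
        finally show "b v ^ n * a v ^ n * (s v ^ n * w v ^ (n * \<epsilon> + n) * w v ^ \<delta>) = c v * w v ^ \<delta> * f v * (w v ^ (n * \<epsilon>) * s v ^ n)" .
      qed (use pw wP fP in \<open>auto intro!: pi\<close>)
      also have "\<dots> = r1 \<otimes>\<^bsub>K\<^esub> \<phi>"
        unfolding r1_def \<phi>_def by (rule rat_mult[OF pw(5,6) fP wP(2) nzs(4,3), symmetric])
      finally show ?thesis .
    qed
    ultimately show ?thesis unfolding ops by blast
  qed
  obtain t where t: "t \<in> P" "\<And>z. z \<in> P \<Longrightarrow> \<exists>s\<in>carrier Ol - P. \<exists>r\<in>carrier Ol. s \<otimes>\<^bsub>Ol\<^esub> z = r \<otimes>\<^bsub>Ol\<^esub> t"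
    using L.normal_local_uniformizer[OF reg'(2,3) P \<phi> nil] by blast
  obtain \<tau> \<sigma> e0 where \<tau>: "homogeneous scale e0 \<tau>" "homogeneous scale e0 \<sigma>" "\<sigma> v0 \<noteq> 0" "\<not> nzD \<tau>" "t = rat \<tau> \<sigma>" using t(1) unfolding P_def by blast
  have \<tau>P: "\<tau> \<in> Pol" "\<sigma> \<in> Pol" using \<tau> homog_poly by blast+
  have \<sigma>n: "nzD \<sigma>" "nz \<sigma>" by (rule v0D, rule \<tau>(3), rule nzD_nz, rule v0D, rule \<tau>(3))
  have "nz \<tau>"
  proof (rule ccontr)
    assume "\<not> nz \<tau>"
    then have t0: "t = \<zero>\<^bsub>Ol\<^esub>" unfolding \<tau>(5) ops using rat_eq_zero_iff[OF \<tau>P \<sigma>n(2)] by simp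
    obtain s r where sr: "s \<in> carrier Ol - P" "r \<in> carrier Ol" "s \<otimes>\<^bsub>Ol\<^esub> \<phi> = r \<otimes>\<^bsub>Ol\<^esub> t" using t(2)[OF \<phi>(1)] by blast
    then have "s \<otimes>\<^bsub>Ol\<^esub> \<phi> \<in> {\<zero>\<^bsub>Ol\<^esub>}" using t0 by simp
    moreover have "\<phi> \<in> carrier Ol" using \<phi>(1) P_Oc ops by auto
    ultimately have "s = \<zero>\<^bsub>Ol\<^esub>" using L.primeideal_closed(3)[OF reg'(3), of s \<phi>] sr(1) \<phi>(2) by blast
    then show False using sr(1) L.ideal_closed(2)[OF L.primeideal_closed(1)[OF P]] by blast
  qed
  have "discrete_valuation K B (rat \<tau> \<sigma>)"
  proof (rule homogeneous_decomposition_suffices[OF D \<tau>(1,2) \<sigma>n(1) \<open>nz \<tau>\<close> \<tau>(4)])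
    fix d g assume g: "homogeneous scale d g" "nz g"
    have gP: "g \<in> Pol" using homog_poly[OF g(1)] .
    define z where "z = rat g (\<lambda>v. w v ^ d)"
    have nzw: "nz (\<lambda>v. w v ^ d)" by (rule wC)
    have z: "z \<in> carrier Ol" "z \<noteq> \<zero>\<^bsub>Ol\<^esub>"
      unfolding z_def ops using Oc_I[OF g(1) hw w0] rat_eq_zero_iff[OF gP wP(2) nzw] g(2) by simp_all
    obtain n :: nat and s r where sr: "s \<in> carrier Ol - P" "r \<in> carrier Ol - P" "s \<otimes>\<^bsub>Ol\<^esub> z = r \<otimes>\<^bsub>Ol\<^esub> t [^]\<^bsub>Ol\<^esub> n"
      using L.uniformizer_powers[OF reg'(3) P t z] by blast
    obtain a1 b1 e1 where 1: "homogeneous scale e1 a1" "homogeneous scale e1 b1" "b1 v0 \<noteq> 0" "a1 \<in> Pol" "b1 \<in> Pol" "nzD b1" "nz b1" "s = rat a1 b1"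
      using Oc_E sr(1) ops(1) by blast
    obtain a2 b2 e2 where 2: "homogeneous scale e2 a2" "homogeneous scale e2 b2" "b2 v0 \<noteq> 0" "a2 \<in> Pol" "b2 \<in> Pol" "nzD b2" "nz b2" "r = rat a2 b2"
      using Oc_E sr(2) ops(1) by blast
    have a12: "nzD a1" "nzD a2" using P_iff[OF 1(1-3)] P_iff[OF 2(1-3)] 1(8) 2(8) sr(1,2) by auto
    have pw: "(\<lambda>v. \<tau> v ^ n) \<in> Pol" "(\<lambda>v. \<sigma> v ^ n) \<in> Pol" "nz (\<lambda>v. \<sigma> v ^ n)" using \<tau>P \<sigma>n by (auto intro: pi nonvanishing_power)
    have "rat (\<lambda>v. a1 v * g v) (\<lambda>v. b1 v * w v ^ d) = s \<otimes>\<^bsub>K\<^esub> z"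
      unfolding 1(8) z_def by (rule rat_mult[OF 1(4,5) gP wP(2) 1(7) nzw, symmetric])
    also have "\<dots> = r \<otimes>\<^bsub>K\<^esub> t [^]\<^bsub>K\<^esub> n" using sr(3) unfolding ops .
    also have "\<dots> = rat (\<lambda>v. a2 v * \<tau> v ^ n) (\<lambda>v. b2 v * \<sigma> v ^ n)"
      unfolding 2(8) \<tau>(5) rat_pow[OF \<tau>P \<sigma>n(2)] by (rule rat_mult[OF 2(4,5) pw(1,2) 2(7) pw(3)])
    finally have eq: "\<forall>v\<in>C. (a1 v * g v) * (b2 v * \<sigma> v ^ n) = (a2 v * \<tau> v ^ n) * (b1 v * w v ^ d)"
      using 1 2 pw gP wP nzw by (subst (asm) rat_eq_iff) (auto intro!: pi nz_mult)
    have "homogeneous scale ((e1 + e2) + d) (\<lambda>v. b1 v * a2 v * w v ^ d)" by (intro homogeneous_mult 1 2 hw)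
    moreover have "homogeneous scale (e1 + e2) (\<lambda>v. a1 v * b2 v)" by (intro homogeneous_mult 1 2)
    moreover have "nzD (\<lambda>v. a1 v * b2 v)" by (rule nzD_mult[OF 1(4) 2(5) a12(1) 2(6)])
    moreover have "nzD (\<lambda>v. b1 v * a2 v * w v ^ d)"
      using nzD_mult[OF poly_fun.mult[OF 1(5) 2(4)] wP(2) nzD_mult[OF 1(5) 2(4) 1(6) a12(2)] wD] .
    moreover have "\<forall>v\<in>C. g v * (a1 v * b2 v) * \<sigma> v ^ n = (b1 v * a2 v * w v ^ d) * \<tau> v ^ n"
      using eq by (auto simp: ac_simps)
    ultimately show "\<exists>(n::nat) \<alpha> \<beta> e. homogeneous scale (e + d) \<alpha> \<and> homogeneous scale e \<beta> \<and>
       nzD \<alpha> \<and> nzD \<beta> \<and> (\<forall>v\<in>C. g v * \<beta> v * \<sigma> v ^ n = \<alpha> v * \<tau> v ^ n)" by blast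
  qed
  then show ?thesis by blast
qed

lemma poly_of_poly_fun: "l \<in> Pol \<Longrightarrow> (\<lambda>v. poly q (l v)) \<in> Pol"
  unfolding poly_altdef by (intro poly_fun_intros) auto

text \<open>On a line the polynomial functions are the polynomials in one variable, and the valuation at the origin is the
order of vanishing.\<close>

lemma discrete_valuation_line:
  assumes C: "C = range (\<lambda>a. scale a v0)" "v0 \<noteq> 0" and D: "D = {0}"
  shows "\<exists>t. discrete_valuation K B t"
proof -
  note pi = poly_fun_intros
  obtain w where w: "linear_form scale w" "w v0 \<noteq> 0" using exists_linear_form_nonzero[OF C(2)] .
  have wP: "w \<in> Pol" by (rule poly_fun.linear[OF w(1)])
  have ws: "w (scale a v0) = a * w v0" for a by (rule linear_formD(2)[OF w(1)])
  have v0C: "v0 \<in> C" unfolding C(1) by (metis rangeI scale_one)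
  have "discrete_valuation K B (rat w (\<lambda>_. 1))"
  proof (rule discrete_valuationI)
    show "w \<in> Pol" "(\<lambda>_. 1) \<in> Pol" "nzD (\<lambda>_. 1)" using wP nzD_one by (auto intro: pi)
    show "nz w" using w(2) v0C by (auto simp: nonvanishing_def)
    show "\<not> nzD w" using linear_formD(3)[OF w(1)] by (auto simp: nonvanishing_def D)
    fix g assume g: "g \<in> Pol" "nz g"
    obtain G n where G: "graded g G n" using graded_exists[OF g(1)] by blast
    have gG: "g (scale a v0) = poly (G v0) a" for a by (rule graded_scale[OF G])
    have "G v0 \<noteq> 0"
    proof
      assume "G v0 = 0"
      then have "g v = 0" if "v \<in> C" for v using that gG unfolding C(1) by auto
      then show False using g(2) by (auto simp: nonvanishing_def)
    qed
    then obtain q where q: "G v0 = [:- 0, 1:] ^ Polynomial.order 0 (G v0) * q" "\<not> [:- 0, 1:] dvd q" using order_decomp by blast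
    define m where "m = Polynomial.order 0 (G v0)"
    have q0: "poly q 0 \<noteq> 0" using q(2) poly_eq_0_iff_dvd[of q 0] by simp
    define \<alpha> where "\<alpha> v = poly q (inverse (w v0) * w v)" for v
    have "\<alpha> \<in> Pol" unfolding \<alpha>_def[abs_def] by (rule poly_of_poly_fun) (intro pi wP)
    moreover have "nzD \<alpha>" using q0 linear_formD(3)[OF w(1)] by (simp add: nonvanishing_def D \<alpha>_def)
    moreover have "(\<lambda>_. w v0 ^ m) \<in> Pol" "nzD (\<lambda>_. w v0 ^ m)" using w(2) by (auto intro: pi simp: nonvanishing_def D)
    moreover have "\<forall>v\<in>C. g v * w v0 ^ m * 1 ^ m = \<alpha> v * w v ^ m"
    proof
      fix v assume "v \<in> C"
      then obtain a where v: "v = scale a v0" unfolding C(1) by blast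
      have "poly (G v0) a = a ^ m * poly q a" by (subst q(1)) (simp add: m_def)
      then have "g v = a ^ m * poly q a" unfolding v gG .
      moreover have "inverse (w v0) * (a * w v0) = a" using w(2) by (simp add: field_simps)
      then have "\<alpha> v = poly q a" unfolding \<alpha>_def v ws by (rule arg_cong)
      ultimately show "g v * w v0 ^ m * 1 ^ m = \<alpha> v * w v ^ m" unfolding v ws by (simp add: power_mult_distrib)
    qed
    ultimately show "\<exists>(m::nat) \<alpha> \<beta>. \<alpha> \<in> Pol \<and> \<beta> \<in> Pol \<and> nzD \<alpha> \<and> nzD \<beta> \<and> (\<forall>v\<in>C. g v * \<beta> v * 1 ^ m = \<alpha> v * w v ^ m)"
      by (intro exI[of _ m] exI[of _ \<alpha>] exI[of _ "\<lambda>_. w v0 ^ m"]) blast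
  qed
  then show ?thesis by blast
qed

end

section \<open>Cones on which a form has no zero\<close>

context closed_field_space
begin

definition monomial :: "'v list \<Rightarrow> 'v \<Rightarrow> 'k" where
  "monomial bs v = prod_list (map (\<lambda>b. coord b v) bs)"

lemma homogeneous_monomial: "homogeneous scale (length bs) (monomial bs)"
proof (induction bs)
  case Nil
  then show ?case by (simp add: monomial_def[abs_def] homogeneous_intros)
next
  case (Cons b bs)
  then show ?case using homogeneous_mult[OF homogeneous_intros(4)[OF linear_coord[of b]] Cons] by (simp add: monomial_def[abs_def])
qed

lemma monomial_remove: "monomial bs v = coord b v ^ count_list bs b * monomial (removeAll b bs) v"
  by (induction bs) (auto simp: monomial_def ac_simps)

text \<open>If on \<open>E\<close> a power of every coordinate agrees with a form of smaller degree, then the monomials of bounded degree span all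
forms restricted to \<open>E\<close>: in a monomial of large degree some coordinate occurs often enough to be
replaced, which lowers the degree.\<close>

lemma finite_dimensional_restriction:
  assumes E: "\<And>b. b \<in> Basis \<Longrightarrow> \<exists>h m. m < n b \<and> homogeneous scale m h \<and> (\<forall>v\<in>E. coord b v ^ n b = h v)"
  shows "\<exists>T :: ('v \<Rightarrow> 'k) set. finite T \<and> (\<forall>d g. homogeneous scale d g \<longrightarrow>
    (\<exists>g'. g' \<in> module.span (\<lambda>a g v. a * g v) T \<and> (\<forall>v\<in>E. g v = g' v)))"
proof -
  interpret FV: vector_space "\<lambda>a (g :: 'v \<Rightarrow> 'k) v. a * g v"
    by unfold_locales (auto simp: plus_fun_def algebra_simps)
  define k where "k = (\<Sum>b\<in>Basis. n b)"
  define T where "T = monomial ` {bs. set bs \<subseteq> Basis \<and> length bs \<le> k}"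
  have finT: "finite T" unfolding T_def by (intro finite_imageI finite_lists_length_le finite_Basis)
  define OK where "OK g \<longleftrightarrow> (\<exists>g'. g' \<in> FV.span T \<and> (\<forall>v\<in>E. g v = g' v))" for g
  have OK0: "OK (\<lambda>_. 0)" unfolding OK_def using FV.span_zero by (intro exI[of _ 0]) (auto simp: zero_fun_def)
  have OK_add: "OK (\<lambda>v. g v + h v)" if g: "OK g" and h: "OK h" for g h
  proof -
    obtain g' h' where "g' \<in> FV.span T" "\<forall>v\<in>E. g v = g' v" "h' \<in> FV.span T" "\<forall>v\<in>E. h v = h' v"
      using g h unfolding OK_def by blast
    then show ?thesis unfolding OK_def using FV.span_add[of g' T h'] by (intro exI[of _ "g' + h'"]) auto
  qed
  have OK_scale: "OK (\<lambda>v. a * g v)" if g: "OK g" for a g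
  proof -
    obtain g' where "g' \<in> FV.span T" "\<forall>v\<in>E. g v = g' v" using g unfolding OK_def by blast
    then show ?thesis unfolding OK_def using FV.span_scale[of g' T a] by (intro exI[of _ "\<lambda>v. a * g' v"]) auto
  qed
  have OK_sum: "OK (\<lambda>v. \<Sum>i\<in>I. h i v)" if "finite I" "\<And>i. i \<in> I \<Longrightarrow> OK (h i)" for I and h :: "'v \<Rightarrow> _"
    using that by (induction I rule: finite_induct) (auto intro: OK0 OK_add)
  have OK_cong: "OK g" if "OK h" "\<And>v. v \<in> E \<Longrightarrow> g v = h v" for g h
    using that unfolding OK_def by auto
  have expand: "OK g" if mon: "\<And>bs. set bs \<subseteq> Basis \<Longrightarrow> length bs = d \<Longrightarrow> OK (monomial bs)" and g: "homogeneous scale d g" for d g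
  proof -
    have "OK (\<lambda>v. monomial bs v * g v)" if "(e, g) \<in> homog scale" "set bs \<subseteq> Basis" "length bs + e = d" for e g bs
      using that
    proof (induction e g arbitrary: bs rule: homog.induct)
      case (const a)
      then show ?case using OK_scale[OF mon[of bs], of a] by (simp add: mult.commute)
    next
      case (add e g h)
      then show ?case using OK_add[of "\<lambda>v. monomial bs v * g v" "\<lambda>v. monomial bs v * h v"] by (simp add: algebra_simps)
    next
      case (mult l e g)
      have *: "OK (\<lambda>v. l b * (monomial (b # bs) v * g v))" if "b \<in> Basis" for b
        using mult.IH[of "b # bs"] mult.prems that by (intro OK_scale) auto
      have "OK (\<lambda>v. \<Sum>b\<in>Basis. l b * (monomial (b # bs) v * g v))" by (intro OK_sum finite_Basis *)
      moreover have "monomial bs v * (l v * g v) = (\<Sum>b\<in>Basis. l b * (monomial (b # bs) v * g v))" for v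
        by (subst linear_form_coord[OF mult.hyps(1)]) (simp add: monomial_def sum_distrib_left sum_distrib_right ac_simps)
      ultimately show ?case by (rule OK_cong)
    qed (simp add: OK0)
    from this[of d g "[]"] g show ?thesis by (simp add: homogeneous_def monomial_def)
  qed
  have main: "OK g" if "homogeneous scale d g" for d g
    using that
  proof (induction d arbitrary: g rule: less_induct)
    case (less d)
    show ?case
    proof (rule expand[OF _ less.prems])
      fix bs assume bs: "set bs \<subseteq> Basis" "length bs = d"
      show "OK (monomial bs)"
      proof (cases "d \<le> k")
        case True
        then have "monomial bs \<in> FV.span T" using bs by (intro FV.span_base) (auto simp: T_def)
        then show ?thesis unfolding OK_def by blast
      next
        case False
        have "\<exists>b\<in>Basis. n b \<le> count_list bs b"
        proof (rule ccontr)
          assume "\<not> ?thesis"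
          then have "(\<Sum>b\<in>Basis. count_list bs b) \<le> k" unfolding k_def by (intro sum_mono) (auto simp: not_le intro: less_imp_le)
          moreover have "(\<Sum>b\<in>Basis. count_list bs b) = length bs" by (rule sum_count_set[OF bs(1) finite_Basis])
          ultimately show False using False bs by simp
        qed
        then obtain b where b: "b \<in> Basis" "n b \<le> count_list bs b" by blast
        obtain h m where h: "m < n b" "homogeneous scale m h" "\<forall>v\<in>E. coord b v ^ n b = h v" using E[OF b(1)] by blast
        define q where "q = replicate (count_list bs b - n b) b @ removeAll b bs"
        have q: "monomial q v = coord b v ^ (count_list bs b - n b) * monomial (removeAll b bs) v" for v
          by (simp add: q_def monomial_def prod_list_replicate map_replicate)
        have len: "length (removeAll b bs) + count_list bs b = length bs" by (induction bs) auto
        have "m + length q < d" using len h(1) b(2) bs(2) by (simp add: q_def)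
        moreover have "homogeneous scale (m + length q) (\<lambda>v. h v * monomial q v)"
          by (rule homogeneous_mult[OF h(2) homogeneous_monomial])
        ultimately have "OK (\<lambda>v. h v * monomial q v)" by (rule less.IH)
        moreover have "monomial bs v = h v * monomial q v" if "v \<in> E" for v
        proof -
          have "monomial bs v = (coord b v ^ n b * coord b v ^ (count_list bs b - n b)) * monomial (removeAll b bs) v"
            using monomial_remove[of bs v b] b(2) by (simp flip: power_add)
          then show ?thesis using h(3) that by (simp add: q)
        qed
        ultimately show ?thesis by (rule OK_cong)
      qed
    qed
  qed
  show ?thesis by (rule exI[of _ T]) (use finT main in \<open>auto simp: OK_def\<close>)
qed

text \<open>If the powers of \<open>x\<close> span a finite-dimensional space of functions on \<open>E\<close>, they are linearly dependent, and the
values of \<open>x\<close> are roots of one nonzero polynomial.\<close>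

lemma finite_values:
  assumes T: "finite T" "\<And>i. \<exists>g'. g' \<in> module.span (\<lambda>a g v. a * g v) T \<and> (\<forall>v\<in>E. x v ^ i = g' v)"
  shows "finite (x ` (E :: 'v set) :: 'k set)"
proof -
  interpret FV: vector_space "\<lambda>a (g :: 'v \<Rightarrow> 'k) v. a * g v"
    by unfold_locales (auto simp: plus_fun_def algebra_simps)
  have "\<forall>i. \<exists>g'. g' \<in> FV.span T \<and> (\<forall>v\<in>E. x v ^ i = g' v)" using T(2) by blast
  from choice[OF this] obtain y where y: "\<And>i. y i \<in> FV.span T" "\<And>i v. v \<in> E \<Longrightarrow> x v ^ i = y i v" by blast
  have apply_sum: "(\<Sum>w\<in>I. h w) v = (\<Sum>w\<in>I. h w v)" for I and h :: "('v \<Rightarrow> 'k) \<Rightarrow> 'v \<Rightarrow> 'k" and v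
    by (induction I rule: infinite_finite_induct) auto
  define m where "m = card T"
  have "\<exists>p. p \<noteq> 0 \<and> (\<forall>v\<in>E. poly p (x v) = 0)"
  proof (cases "inj_on y {..m}")
    case False
    then obtain i j where ij: "i \<noteq> j" "y i = y j" by (auto simp: inj_on_def)
    have "coeff (monom 1 i - monom (1::'k) j) i \<noteq> 0" using ij(1) by simp
    then have "monom 1 i - monom (1::'k) j \<noteq> 0" by (metis coeff_0)
    moreover have "poly (monom 1 i - monom 1 j) (x v) = 0" if "v \<in> E" for v
      using y(2)[OF that, of i] y(2)[OF that, of j] ij(2) by (simp add: poly_monom)
    ultimately show ?thesis by blast
  next
    case True
    have "FV.dependent (y ` {..m})"
    proof (rule ccontr)
      assume "\<not> FV.dependent (y ` {..m})"
      then have "card (y ` {..m}) \<le> card T" using FV.independent_span_bound[OF T(1), of "y ` {..m}"] y(1) by auto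
      then show False using card_image[OF True] by (simp add: m_def)
    qed
    then obtain u where u: "\<exists>w\<in>y ` {..m}. u w \<noteq> 0" "(\<Sum>w\<in>y ` {..m}. (\<lambda>v. u w * w v)) = 0"
      using FV.dependent_finite[of "y ` {..m}"] by auto
    define p where "p = (\<Sum>i\<le>m. monom (u (y i)) i)"
    obtain i where i: "i \<le> m" "u (y i) \<noteq> 0" using u(1) by auto
    have "coeff p i = (\<Sum>j\<le>m. if j = i then u (y j) else 0)" by (simp add: p_def coeff_sum)
    then have "coeff p i \<noteq> 0" using i by simp
    then have "p \<noteq> 0" by auto
    moreover have "poly p (x v) = 0" if v: "v \<in> E" for v
    proof -
      have "poly p (x v) = (\<Sum>i\<le>m. u (y i) * y i v)" unfolding p_def by (simp add: poly_sum poly_monom y(2)[OF v])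
      also have "\<dots> = (\<Sum>w\<in>y ` {..m}. u w * w v)" by (simp add: sum.reindex[OF True])
      also have "\<dots> = (\<Sum>w\<in>y ` {..m}. (\<lambda>v. u w * w v)) v"
        by (rule apply_sum[symmetric])
      also have "\<dots> = 0" unfolding u(2) by simp
      finally show ?thesis .
    qed
    ultimately show ?thesis by blast
  qed
  then obtain p where p: "p \<noteq> 0" "\<And>v. v \<in> E \<Longrightarrow> poly p (x v) = 0" by blast
  have "x ` E \<subseteq> {a. poly p a = 0}" using p(2) by auto
  then show ?thesis using poly_roots_finite[OF p(1)] by (rule finite_subset)
qed

lemma separating_linear_form:
  assumes u: "u \<noteq> 0" and v: "\<And>a. v \<noteq> scale a u"
  obtains l where "linear_form scale l" "l u = 0" "l v \<noteq> 0"
proof -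
  obtain b where b: "linear_form scale b" "b u \<noteq> 0" using exists_linear_form_nonzero[OF u] .
  define l where "l c w = b u * coord c w - coord c u * b w" for c w
  have l: "linear_form scale (l c)" for c
    unfolding l_def using linear_formD[OF b(1)] linear_formD[OF linear_coord[of c]]
    by (intro linear_formI) (auto simp: algebra_simps)
  have "\<exists>c\<in>Basis. l c v \<noteq> 0"
  proof (rule ccontr)
    assume "\<not> ?thesis"
    then have "coord c v = (b v / b u) * coord c u" if "c \<in> Basis" for c using that b(2) by (auto simp: l_def field_simps)
    then have "(\<Sum>c\<in>Basis. scale (coord c v) c) = (\<Sum>c\<in>Basis. scale (b v / b u) (scale (coord c u) c))"
      by (intro sum.cong) auto
    also have "\<dots> = scale (b v / b u) u" by (simp only: scale_sum_right[symmetric] sum_coord)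
    finally have "v = scale (b v / b u) u" by (simp add: sum_coord)
    then show False using v by blast
  qed
  then obtain c where "l c v \<noteq> 0" by blast
  moreover have "l c u = 0" by (simp add: l_def)
  ultimately show thesis using that l by blast
qed

text \<open>Consider the section \<open>E\<close> of the cone by \<open>f = 1\<close>, which meets every line of the cone. By the Nullstellensatz a power of each
coordinate is a multiple of \<open>f\<close> on \<open>C\<close>, hence on \<open>E\<close> agrees with a form of smaller degree. Therefore \<open>E\<close> is finite, \<open>C\<close>
consists of finitely many lines, and by irreducibility of one.\<close>

lemma cone_without_zeros_is_line:
  assumes C: "C = zero_locus J" "J \<subseteq> Pol" "conical C" "irred C" and nt: "\<exists>v\<in>C. v \<noteq> 0"
    and f: "homogeneous scale d f" "d \<ge> 1" "\<And>v. v \<in> C \<Longrightarrow> f v = 0 \<Longrightarrow> v = 0"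
  shows "\<exists>v0. v0 \<noteq> 0 \<and> C = range (\<lambda>a. scale a v0)"
proof -
  define E where "E = {v \<in> C. f v = 1}"
  have fP: "f \<in> Pol" by (rule homog_poly[OF f(1)])
  have E0: "0 \<notin> E" using homogeneous_0[OF f(1)] f(2) by (auto simp: E_def)
  have normalise: "\<exists>a. a \<noteq> 0 \<and> scale a v \<in> E" if v: "v \<in> C" "v \<noteq> 0" for v
  proof -
    have fv: "f v \<noteq> 0" using f(3) v by blast
    obtain a where a: "a ^ d = inverse (f v)" using nth_root_exists[of d "inverse (f v)"] f(2) by auto
    have "a \<noteq> 0" using a fv f(2) by (auto simp: zero_power)
    moreover have "f (scale a v) = 1" using homogeneous_scale[OF f(1), of a v] a fv by simp
    ultimately show ?thesis using C(3) v by (auto simp: E_def conical_def)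
  qed
  have "\<exists>k h m. m < k \<and> homogeneous scale m h \<and> (\<forall>v\<in>E. coord b v ^ k = h v)" for b
  proof -
    have cP: "coord b \<in> Pol" by (rule poly_fun.linear[OF linear_coord])
    have z: "coord b v = 0" if "v \<in> C" "f v = 0" for v using f(3)[OF that] linear_formD(3)[OF linear_coord] by simp
    obtain k :: nat and h where h: "h \<in> Pol" "\<And>v. v \<in> C \<Longrightarrow> coord b v ^ k = h v * f v"
      by (rule Nullstellensatz_hypersurface[OF C(1,2) fP cP z]) (assumption | rule that)+
    \<comment> \<open>the additional factor makes the degree of the left side at least \<open>d\<close>, so that its cofactor has a component of degree \<open>k\<close>\<close>
    define h1 where "h1 v = h v * coord b v ^ d" for v
    have h1P: "h1 \<in> Pol" unfolding h1_def[abs_def] by (intro poly_fun_intros h(1) cP)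
    obtain H n where H: "graded h1 H n" using graded_exists[OF h1P] by blast
    have hk: "homogeneous scale (k + d) (\<lambda>v. coord b v ^ (k + d))"
      using homogeneous_power[OF homogeneous_intros(4)[OF linear_coord[of b]], of "k + d"] by simp
    have key: "coord b v ^ (k + d) = coeff (H v) k * f v" if v: "v \<in> C" for v
    proof -
      have "H v * monom (f v) d - monom (coord b v ^ (k + d)) (k + d) = 0"
      proof (rule poly_eq_0_infinite)
        fix t
        have "scale t v \<in> C" using C(3) v by (simp add: conical_def)
        then have "coord b (scale t v) ^ (k + d) = h1 (scale t v) * f (scale t v)"
          using h(2)[of "scale t v"] by (simp add: h1_def power_add)
        then have "t ^ (k + d) * coord b v ^ (k + d) = poly (H v) t * (t ^ d * f v)"
          by (simp only: graded_scale[OF H] homogeneous_scale[OF hk] homogeneous_scale[OF f(1)])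
        then show "poly (H v * monom (f v) d - monom (coord b v ^ (k + d)) (k + d)) t = 0" by (simp add: poly_monom ac_simps)
      qed
      then have "coeff (H v * monom (f v) d) (k + d) = coord b v ^ (k + d)" by simp
      then show ?thesis using coeff_monom_mult[of "f v" d "H v" "k + d"] by (simp add: mult.commute)
    qed
    have "homogeneous scale k (\<lambda>v. coeff (H v) k)" using H by (simp add: graded_def)
    then show ?thesis using key f(2) by (intro exI[of _ "k + d"] exI[of _ "\<lambda>v. coeff (H v) k"] exI[of _ k]) (auto simp: E_def)
  qed
  then have "\<forall>b. \<exists>k h m. m < k \<and> homogeneous scale m h \<and> (\<forall>v\<in>E. coord b v ^ k = h v)" by blast
  from choice[OF this] obtain n where n: "\<And>b. \<exists>h m. m < n b \<and> homogeneous scale m h \<and> (\<forall>v\<in>E. coord b v ^ n b = h v)" by blast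
  obtain T :: "('v \<Rightarrow> 'k) set" where T: "finite T" "\<And>d g. homogeneous scale d g \<Longrightarrow>
    (\<exists>g'. g' \<in> module.span (\<lambda>a g v. a * g v) T \<and> (\<forall>v\<in>E. g v = g' v))"
    using finite_dimensional_restriction[of n E] n by blast
  have fin: "finite (coord b ` E)" for b
  proof (rule finite_values[OF T(1)])
    fix i
    show "\<exists>g'. g' \<in> module.span (\<lambda>a g v. a * g v) T \<and> (\<forall>v\<in>E. coord b v ^ i = g' v)"
      using T(2)[OF homogeneous_power[OF homogeneous_intros(4)[OF linear_coord[of b]], of i]] .
  qed
  have finE: "finite E"
  proof (rule inj_on_finite)
    show "inj_on (\<lambda>v. restrict (\<lambda>b. coord b v) Basis) E"
    proof (rule inj_onI)
      fix v w assume eq: "restrict (\<lambda>b. coord b v) Basis = restrict (\<lambda>b. coord b w) Basis"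
      have "coord b v = coord b w" if "b \<in> Basis" for b using fun_cong[OF eq, of b] that by simp
      then have "(\<Sum>b\<in>Basis. scale (coord b v) b) = (\<Sum>b\<in>Basis. scale (coord b w) b)" by (intro sum.cong) auto
      then show "v = w" by (simp only: sum_coord)
    qed
    show "(\<lambda>v. restrict (\<lambda>b. coord b v) Basis) ` E \<subseteq> PiE Basis (\<lambda>b. coord b ` E)" by auto
    show "finite (PiE Basis (\<lambda>b. coord b ` E))" by (intro finite_PiE finite_Basis fin)
  qed
  obtain v1 where v1: "v1 \<in> C" "v1 \<noteq> 0" using nt by blast
  then obtain a1 where "scale a1 v1 \<in> E" using normalise by blast
  then obtain v0 where v0: "v0 \<in> E" by blast
  have v00: "v0 \<noteq> 0" "v0 \<in> C" using v0 E0 by (auto simp: E_def)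
  define Ln where "Ln = range (\<lambda>a. scale a v0)"
  have E_Ln: "w \<in> Ln" if w: "w \<in> E" for w
  proof (rule ccontr)
    assume n: "w \<notin> Ln"
    have "\<forall>u\<in>E - Ln. \<exists>l. linear_form scale l \<and> l u = 0 \<and> l v0 \<noteq> 0"
    proof
      fix u assume u: "u \<in> E - Ln"
      have u0: "u \<noteq> 0" using u E0 by auto
      have "v0 \<noteq> scale a u" for a
      proof
        assume a: "v0 = scale a u"
        then have "a \<noteq> 0" using v00 by auto
        then have "u = scale (inverse a) v0" using a by simp
        then show False using u by (auto simp: Ln_def)
      qed
      then show "\<exists>l. linear_form scale l \<and> l u = 0 \<and> l v0 \<noteq> 0" using separating_linear_form[OF u0] by metis
    qed
    from bchoice[OF this] obtain l where l: "\<And>u. u \<in> E - Ln \<Longrightarrow> linear_form scale (l u)" "\<And>u. u \<in> E - Ln \<Longrightarrow> l u u = 0"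
      "\<And>u. u \<in> E - Ln \<Longrightarrow> l u v0 \<noteq> 0" by blast
    have "w \<noteq> scale a v0" for a using n by (auto simp: Ln_def)
    then obtain h where h: "linear_form scale h" "h v0 = 0" "h w \<noteq> 0" using separating_linear_form[OF v00(1)] by metis
    define g where "g v = (\<Prod>u\<in>E - Ln. l u v)" for v
    have gh: "homogeneous scale (\<Sum>u\<in>E - Ln. 1) g"
      unfolding g_def[abs_def] by (rule homogeneous_prod) (use finE l(1) homogeneous_intros(4) in auto)
    have hh: "homogeneous scale 1 h" by (rule homogeneous_intros(4)[OF h(1)])
    have zE: "g v * h v = 0" if v: "v \<in> E" for v
    proof (cases "v \<in> Ln")
      case True
      then have "h v = 0" using h(2) linear_formD(2)[OF h(1)] by (auto simp: Ln_def)
      then show ?thesis by simp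
    next
      case False
      then have "g v = 0" unfolding g_def using v finE l(2) by (intro prod_zero) auto
      then show ?thesis by simp
    qed
    have "\<not> nonvanishing C (\<lambda>v. g v * h v)"
    proof -
      have "g v * h v = 0" if v: "v \<in> C" for v
      proof (cases "v = 0")
        case True
        then show ?thesis using linear_formD(3)[OF h(1)] by simp
      next
        case False
        then obtain a where a: "a \<noteq> 0" "scale a v \<in> E" using normalise[OF v] by blast
        show ?thesis using zE[OF a(2)] a(1) homogeneous_scale[OF gh, of a v] homogeneous_scale[OF hh, of a v] by simp
      qed
      then show ?thesis by (auto simp: nonvanishing_def)
    qed
    moreover have "nonvanishing C g" unfolding nonvanishing_def g_def using v00(2) finE l(3) by (intro bexI[of _ v0]) auto
    moreover have "nonvanishing C h" unfolding nonvanishing_def using w h(3) by (auto simp: E_def)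
    ultimately show False using irredD[OF C(4) homog_poly[OF gh] homog_poly[OF hh]] by blast
  qed
  have "C = Ln"
  proof
    show "Ln \<subseteq> C" using C(3) v00(2) by (auto simp: Ln_def conical_def)
    show "C \<subseteq> Ln"
    proof
      fix v assume v: "v \<in> C"
      show "v \<in> Ln"
      proof (cases "v = 0")
        case True
        then have "v = scale 0 v0" by simp
        then show ?thesis unfolding Ln_def by blast
      next
        case False
        then obtain a where a: "a \<noteq> 0" "scale a v \<in> E" using normalise[OF v] by blast
        obtain b where "scale a v = scale b v0" using E_Ln[OF a(2)] by (auto simp: Ln_def)
        then have "scale (inverse a) (scale a v) = scale (inverse a) (scale b v0)" by simp
        then have "v = scale (inverse a * b) v0" using a(1) by simp
        then show ?thesis unfolding Ln_def by blast
      qed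
    qed
  qed
  then show ?thesis using v00(1) by (auto simp: Ln_def)
qed

end

section \<open>The divisorial valuations of a Seshadri stratification\<close>

context divisor
begin

lemma restrict_rat_eq:
  assumes "a \<in> Pol" "s \<in> Pol" "nzD s"
  shows "restrict_rat scale C D (rat a s) = ratio scale D a s"
  unfolding restrict_rat_def
proof (rule the_equality)
  show "\<exists>a' s'. a' \<in> Pol \<and> s' \<in> Pol \<and> (\<exists>v\<in>D. s' v \<noteq> 0) \<and> rat a s = rat a' s' \<and> ratio scale D a s = ratio scale D a' s'"
    using assms by (auto simp: nonvanishing_def)
  interpret FD: function_field scale Basis D by unfold_locales (rule irred_D)
  fix k assume "\<exists>a' s'. a' \<in> Pol \<and> s' \<in> Pol \<and> (\<exists>v\<in>D. s' v \<noteq> 0) \<and> rat a s = rat a' s' \<and> k = ratio scale D a' s'"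
  then obtain a' s' where *: "a' \<in> Pol" "s' \<in> Pol" "nzD s'" "rat a s = rat a' s'" "k = ratio scale D a' s'"
    by (auto simp: nonvanishing_def)
  have "\<forall>v\<in>C. a v * s' v = a' v * s v" using *(4) rat_eq_iff[OF assms(1,2) *(1,2) nzD_nz[OF assms(3)] nzD_nz[OF *(3)]] by simp
  then have "a' v * s v = a v * s' v" if "v \<in> D" for v using D_sub that by (metis subsetD)
  then show "k = ratio scale D a s" unfolding *(5) by (rule FD.rat_eqI[OF *(1,2) assms(1,2) *(3) assms(3)])
qed

end

text \<open>The situation in which restriction to \<open>D\<close> is the residue map of a discrete valuation of the function field of
\<open>C\<close>.\<close>

locale divisorial_valuation = divisor scale Basis C D
  for scale :: "'k::alg_closed_field \<Rightarrow> 'v::ab_group_add \<Rightarrow> 'v" and Basis C D +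
  fixes t
  assumes dv: "discrete_valuation K B t"
begin

sublocale V: discrete_valuation K B t by (rule dv)
sublocale FD: function_field scale Basis D by unfold_locales (rule irred_D)

abbreviation "val \<equiv> divisor_val scale C D"

lemma val_eq: "val = dvr_val K B" by (simp add: divisor_val_def fun_eq_iff)

lemma val_nonneg_iff: "x \<in> carrier K \<Longrightarrow> x \<noteq> \<zero>\<^bsub>K\<^esub> \<Longrightarrow> val x \<ge> 0 \<longleftrightarrow> x \<in> B"
  using V.in_B_iff by (simp add: val_eq)

lemma val_rat_zero_iff:
  assumes "a \<in> Pol" "s \<in> Pol" "nzD s" "nz a"
  shows "val (rat a s) = 0 \<longleftrightarrow> nzD a"
proof -
  have x: "rat a s \<in> carrier K" "rat a s \<noteq> \<zero>\<^bsub>K\<^esub>" "rat a s \<in> B"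
    using rat_in_K[OF assms(1,2) nzD_nz[OF assms(3)]] rat_eq_zero_iff[OF assms(1,2) nzD_nz[OF assms(3)]] assms(4) B_I[OF assms(1-3)] by auto
  have "val (rat a s) = 0 \<longleftrightarrow> rat a s \<in> V.UB" using V.in_UB_iff[OF x(1,2)] by (simp add: val_eq)
  also have "\<dots> \<longleftrightarrow> nzD a" unfolding V.UB_def using x rat_unit_iff[OF assms] by simp
  finally show ?thesis .
qed

lemma nonneg_rat:
  assumes "x \<in> carrier K" "x \<noteq> \<zero>\<^bsub>K\<^esub>" "val x \<ge> 0"
  obtains a s where "a \<in> Pol" "s \<in> Pol" "nzD s" "nz s" "nz a" "x = rat a s" "nzD a \<longleftrightarrow> val x = 0"
proof -
  have "x \<in> B" using val_nonneg_iff assms by blast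
  then obtain a s where *: "a \<in> Pol" "s \<in> Pol" "nzD s" "nz s" "x = rat a s" by (rule B_E)
  moreover have "nz a" using rat_eq_zero_iff[OF *(1,2,4)] assms(2) *(5) by simp
  ultimately show thesis using that val_rat_zero_iff by metis
qed

abbreviation "\<rho> \<equiv> restrict_rat scale C D"

lemma residue_mult:
  assumes "x \<in> carrier K" "x \<noteq> \<zero>\<^bsub>K\<^esub>" "val x \<ge> 0" "y \<in> carrier K" "y \<noteq> \<zero>\<^bsub>K\<^esub>" "val y \<ge> 0"
  shows "\<rho> (x \<otimes>\<^bsub>K\<^esub> y) = \<rho> x \<otimes>\<^bsub>FD.K\<^esub> \<rho> y"
proof -
  obtain a s where a: "a \<in> Pol" "s \<in> Pol" "nzD s" "nz s" "nz a" "x = rat a s" using nonneg_rat[OF assms(1-3)] by metis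
  obtain b u where b: "b \<in> Pol" "u \<in> Pol" "nzD u" "nz u" "nz b" "y = rat b u" using nonneg_rat[OF assms(4-6)] by metis
  have p: "(\<lambda>v. a v * b v) \<in> Pol" "(\<lambda>v. s v * u v) \<in> Pol" "nzD (\<lambda>v. s v * u v)"
    using a b nzD_mult[OF a(2) b(2) a(3) b(3)] by (auto intro: poly_fun_intros)
  show ?thesis
    unfolding a(6) b(6) rat_mult[OF a(1,2) b(1,2) a(4) b(4)] restrict_rat_eq[OF p]
      restrict_rat_eq[OF a(1-3)] restrict_rat_eq[OF b(1-3)] FD.rat_mult[OF a(1,2) b(1,2) a(3) b(3)] ..
qed

lemma residue_unit:
  assumes "x \<in> carrier K" "x \<noteq> \<zero>\<^bsub>K\<^esub>" "val x = 0"
  shows "\<rho> x \<in> carrier FD.K" "\<rho> x \<noteq> \<zero>\<^bsub>FD.K\<^esub>"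
proof -
  obtain a s where a: "a \<in> Pol" "s \<in> Pol" "nzD s" "nz s" "nz a" "x = rat a s" "nzD a \<longleftrightarrow> val x = 0" using nonneg_rat[OF assms(1,2)] assms(3) by (metis order_refl)
  show "\<rho> x \<in> carrier FD.K" "\<rho> x \<noteq> \<zero>\<^bsub>FD.K\<^esub>"
    unfolding a(6) restrict_rat_eq[OF a(1-3)] using FD.rat_in_K[OF a(1-3)] FD.rat_eq_zero_iff[OF a(1-3)] a(7) assms(3) by auto
qed

lemma residue_one_add:
  assumes "x \<in> carrier K" "x \<noteq> \<zero>\<^bsub>K\<^esub>" "val x \<ge> 0"
  shows "\<rho> (\<one>\<^bsub>K\<^esub> \<oplus>\<^bsub>K\<^esub> x) = (if val x > 0 then \<one>\<^bsub>FD.K\<^esub> else \<one>\<^bsub>FD.K\<^esub> \<oplus>\<^bsub>FD.K\<^esub> \<rho> x)"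
proof -
  obtain a s where a: "a \<in> Pol" "s \<in> Pol" "nzD s" "nz s" "nz a" "x = rat a s" "nzD a \<longleftrightarrow> val x = 0" using nonneg_rat[OF assms] by metis
  have o: "(\<lambda>_. 1) \<in> Pol" by (rule poly_fun.const)
  have p: "(\<lambda>v. 1 * s v + a v * 1) \<in> Pol" "(\<lambda>v. 1 * s v) \<in> Pol" "nzD (\<lambda>v. 1 * s v)"
    using a by (auto intro: poly_fun_intros)
  have eq: "\<rho> (\<one>\<^bsub>K\<^esub> \<oplus>\<^bsub>K\<^esub> x) = ratio scale D (\<lambda>v. 1 * s v + a v * 1) (\<lambda>v. 1 * s v)"
    unfolding a(6) K_one rat_add[OF o o a(1,2) nz_one a(4)] by (rule restrict_rat_eq[OF p])
  show ?thesis
  proof (cases "val x > 0")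
    case True
    then have "\<not> nzD a" using a(7) by simp
    then have "ratio scale D (\<lambda>v. 1 * s v + a v * 1) (\<lambda>v. 1 * s v) = ratio scale D (\<lambda>_. 1) (\<lambda>_. 1)"
      using p o nzD_one by (intro FD.rat_eqI) (auto simp: nonvanishing_def)
    then show ?thesis using eq True FD.K_one by simp
  next
    case False
    then show ?thesis unfolding eq unfolding a(6) FD.K_one restrict_rat_eq[OF a(1-3)] FD.rat_add[OF o o a(1,2) nzD_one a(3)] by simp
  qed
qed

lemma residue_const: "\<rho> (rat (\<lambda>_. a) (\<lambda>_. 1)) = ratio scale D (\<lambda>_. a) (\<lambda>_. 1)"
  by (rule restrict_rat_eq) (auto intro: poly_fun_intros nzD_one)

lemma val_const: "a \<noteq> 0 \<Longrightarrow> val (rat (\<lambda>_. a) (\<lambda>_. 1)) = 0"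
  using val_rat_zero_iff[of "\<lambda>_. a" "\<lambda>_. 1"] irred_nonempty[OF irred_D] irred_nonempty[OF irred_C] nzD_one
  by (auto simp: nonvanishing_def intro: poly_fun_intros)

lemma val_vanishing:
  assumes "f \<in> Pol" "nz f" "\<not> nzD f"
  shows "val (rat f (\<lambda>_. 1)) > 0"
proof -
  have o: "(\<lambda>_. 1) \<in> Pol" by (rule poly_fun.const)
  have x: "rat f (\<lambda>_. 1) \<in> carrier K" "rat f (\<lambda>_. 1) \<noteq> \<zero>\<^bsub>K\<^esub>" "rat f (\<lambda>_. 1) \<in> B"
    using rat_in_K[OF assms(1) o nz_one] rat_eq_zero_iff[OF assms(1) o nz_one] assms(2) B_I[OF assms(1) o nzD_one] by auto
  have "val (rat f (\<lambda>_. 1)) \<ge> 0" using val_nonneg_iff[OF x(1,2)] x(3) by blast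
  moreover have "val (rat f (\<lambda>_. 1)) \<noteq> 0" using val_rat_zero_iff[OF assms(1) o nzD_one assms(2)] assms(3) by blast
  ultimately show ?thesis by simp
qed

end

sublocale seshadri_stratification \<subseteq> closed_field_space scale Basis
  by unfold_locales

context seshadri_stratification
begin

lemma stratum:
  assumes "p \<in> A"
  shows "proj_variety scale (Xs p)" "zariski_closed scale (Xs p)" "Xs p \<noteq> {}" "irred (cone (Xs p))" "conical (cone (Xs p))"
    "\<exists>v\<in>cone (Xs p). v \<noteq> 0"
proof -
  show *: "proj_variety scale (Xs p)" "zariski_closed scale (Xs p)" "Xs p \<noteq> {}"
    using variety_strata[OF assms] by (auto simp: proj_variety_def)
  show "irred (cone (Xs p))" by (rule irred_cone[OF *(1)])
  show "conical (cone (Xs p))" by (rule conical_cone[OF *(2)])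
  obtain L where "L \<in> Xs p" using *(3) by auto
  then show "\<exists>v\<in>cone (Xs p). v \<noteq> 0" using closed_points[OF *(2)] cone_mem[OF *(2)] by metis
qed

lemma stratum_zero_locus:
  assumes "p \<in> A" shows "\<exists>J. J \<subseteq> Pol \<and> (\<forall>h\<in>J. \<exists>d. homogeneous scale d h) \<and> cone (Xs p) = zero_locus J"
proof -
  obtain J where J: "\<And>h. h \<in> J \<Longrightarrow> \<exists>d. homogeneous scale d h" "cone (Xs p) = zero_locus J"
    using cone_zero_locus[OF stratum(2,3)[OF assms]] by blast
  have "J \<subseteq> Pol" using J(1) homog_poly by blast
  then show ?thesis using J by blast
qed

lemma cone_mono: "Xs q \<subseteq> Xs p \<Longrightarrow> cone (Xs q) \<subseteq> cone (Xs p)" by (auto simp: cone_def)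

lemma separating_function:
  assumes "p \<in> A" "q \<in> A" "\<not> Xs p \<subseteq> Xs q"
  shows "\<exists>h d. homogeneous scale d h \<and> nonvanishing (cone (Xs p)) h \<and> \<not> nonvanishing (cone (Xs q)) h"
proof -
  obtain J where J: "J \<subseteq> Pol" "\<And>h. h \<in> J \<Longrightarrow> \<exists>d. homogeneous scale d h" "cone (Xs q) = zero_locus J"
    using stratum_zero_locus[OF assms(2)] by blast
  obtain L where L: "L \<in> Xs p" "L \<notin> Xs q" using assms(3) by blast
  obtain v where v: "v \<noteq> 0" "L = point scale v" using closed_points[OF stratum(2)[OF assms(1)] L(1)] .
  have "v \<in> cone (Xs p)" "v \<notin> cone (Xs q)" using cone_mem[OF stratum(2) v(1)] L v(2) assms by auto
  then obtain h where "h \<in> J" "h v \<noteq> 0" using J(3) by (auto simp: zero_locus_def)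
  then show ?thesis using J(2)[of h] J(3) \<open>v \<in> cone (Xs p)\<close> unfolding nonvanishing_def zero_locus_def by blast
qed

text \<open>Condition (S3) on the level of cones, away from the origin.\<close>

lemma zeros_of_f:
  assumes p: "p \<in> A" and v: "v \<in> cone (Xs p)" "v \<noteq> 0"
  shows "f p v = 0 \<longleftrightarrow> (\<exists>q. covers p q \<and> v \<in> cone (Xs q))"
proof -
  obtain d where d: "homogeneous scale d (f p)" using homogeneous_f[OF p] by blast
  have vX: "point scale v \<in> Xs p" using cone_mem[OF stratum(2)[OF p] v(2)] v(1) by simp
  have "f p v = 0 \<longleftrightarrow> point scale v \<in> hypersurface scale (f p) \<inter> Xs p"
    using point_in_hypersurface[OF d v(2)] vX by simp
  also have "\<dots> \<longleftrightarrow> (\<exists>q. covers p q \<and> point scale v \<in> Xs q)"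
    unfolding S3[OF p] covers_def using p by blast
  also have "\<dots> \<longleftrightarrow> (\<exists>q. covers p q \<and> v \<in> cone (Xs q))"
    using cone_mem[OF stratum(2) v(2)] unfolding covers_def by blast
  finally show ?thesis .
qed

lemma f_zero: "p \<in> A \<Longrightarrow> f p 0 = 0"
  using homogeneous_f[of p] homogeneous_0 by fastforce

lemma f_Pol: "p \<in> A \<Longrightarrow> f p \<in> Pol"
  using homogeneous_f[of p] homog_poly by blast

text \<open>A product of forms, one for each member of \<open>Q\<close>, is still nonzero on the irreducible \<open>X\<^sub>s\<close>.\<close>

lemma separating_other_covers:
  assumes p: "p \<in> A" and Q: "Q \<subseteq> {q. covers p q}" and s: "s \<in> A" "\<And>q. q \<in> Q \<Longrightarrow> \<not> Xs s \<subseteq> Xs q"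
  shows "\<exists>b d. homogeneous scale d b \<and> nonvanishing (cone (Xs s)) b \<and> (\<forall>q\<in>Q. \<forall>v\<in>cone (Xs q). b v = 0)"
proof -
  have QA: "Q \<subseteq> A" using Q by (auto simp: covers_def)
  have finQ: "finite Q" using finite_subset[OF QA finite_A] .
  have "\<forall>q\<in>Q. \<exists>x. homogeneous scale (snd x) (fst x) \<and> nonvanishing (cone (Xs s)) (fst x) \<and> \<not> nonvanishing (cone (Xs q)) (fst x)"
    using separating_function[OF s(1)] s(2) QA by (metis subsetD fst_conv snd_conv)
  from bchoice[OF this] obtain x where x: "\<And>q. q \<in> Q \<Longrightarrow> homogeneous scale (snd (x q)) (fst (x q))"
    "\<And>q. q \<in> Q \<Longrightarrow> nonvanishing (cone (Xs s)) (fst (x q))" "\<And>q. q \<in> Q \<Longrightarrow> \<not> nonvanishing (cone (Xs q)) (fst (x q))" by blast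
  define b where "b v = (\<Prod>q\<in>Q. fst (x q) v)" for v
  have "homogeneous scale (\<Sum>q\<in>Q. snd (x q)) b" unfolding b_def[abs_def] by (rule homogeneous_prod[OF finQ x(1)])
  moreover have "nonvanishing (cone (Xs s)) b" unfolding b_def[abs_def]
    by (rule irred_prod[OF stratum(4)[OF s(1)] finQ homog_poly[OF x(1)] x(2)])
  moreover have "b v = 0" if "q \<in> Q" "v \<in> cone (Xs q)" for q v
    unfolding b_def using finQ that x(3)[OF that(1)] by (intro prod_zero) (auto simp: nonvanishing_def)
  ultimately show ?thesis by blast
qed

text \<open>If \<open>f\<^sub>p\<close> vanished on \<open>X\<^sub>p\<close>, then by (S3) the irreducible \<open>X\<^sub>p\<close> would be a finite union of proper closed
subsets.\<close>

lemma f_nonvanishing: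
  assumes p: "p \<in> A" shows "nonvanishing (cone (Xs p)) (f p)"
proof (rule ccontr)
  assume n: "\<not> ?thesis"
  have "\<not> Xs p \<subseteq> Xs q" if "q \<in> {q. covers p q}" for q using that by (auto simp: covers_def)
  then obtain b d where b: "homogeneous scale d b" "nonvanishing (cone (Xs p)) b" "\<And>q v. covers p q \<Longrightarrow> v \<in> cone (Xs q) \<Longrightarrow> b v = 0"
    using separating_other_covers[OF p order_refl p] by blast
  have z: "b v = 0" if "v \<in> cone (Xs p)" "v \<noteq> 0" for v
  proof -
    have "f p v = 0" using n that(1) by (auto simp: nonvanishing_def)
    then show ?thesis using zeros_of_f[OF p that] b(3) by blast
  qed
  obtain v where v: "v \<in> cone (Xs p)" "b v \<noteq> 0" using b(2) by (auto simp: nonvanishing_def)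
  then have "v = 0" using z by blast
  obtain w where w: "w \<in> cone (Xs p)" "w \<noteq> 0" using stratum(6)[OF p] by blast
  have "b w = 0" using z w by blast
  then have "b 0 = 0" using homogeneous_scale[OF b(1), of 0 w] by simp
  then show False using v \<open>v = 0\<close> by simp
qed

lemma Xhat_simps: "Xhat (Some p) = cone (Xs p)" "Xhat None = {0}" by (auto simp: Xhat_def)

lemma cover_divisor:
  assumes "covers p q" shows "divisor scale Basis (cone (Xs p)) (cone (Xs q))"
proof -
  have *: "p \<in> A" "q \<in> A" "Xs q \<subseteq> Xs p" using assms by (auto simp: covers_def)
  show ?thesis by unfold_locales (use stratum(4) * cone_mono in auto)
qed

text \<open>As \<open>X\<^sub>q\<close> has codimension one in \<open>X\<^sub>p\<close>, it is not contained in the singular locus, which has codimension at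
least two.\<close>

lemma regular_point:
  assumes "covers p q"
  obtains v where "v \<noteq> 0" "v \<in> cone (Xs q)" "regular_local_ring (local_ring_at scale (Xs p) (point scale v))"
proof -
  have *: "p \<in> A" "q \<in> A" "Xs q \<subset> Xs p" "\<not> (\<exists>s\<in>A. Xs q \<subset> Xs s \<and> Xs s \<subset> Xs p)" using assms by (auto simp: covers_def)
  have "\<not> Xs q \<subseteq> singular_locus scale (Xs p)"
  proof
    assume "Xs q \<subseteq> singular_locus scale (Xs p)"
    then have "codim scale (singular_locus scale (Xs p)) (Xs p) \<le> codim_irred scale (Xs q) (Xs p)"
      unfolding codim_def using stratum(1)[OF *(2)] by (intro INF_lower) auto
    also have "\<dots> = 1" by (rule S1_codim[OF *])
    finally have "codim scale (singular_locus scale (Xs p)) (Xs p) \<le> 1" .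
    moreover have "2 \<le> codim scale (singular_locus scale (Xs p)) (Xs p)"
      using S1_smooth[OF *(1)] by (simp add: smooth_in_codim_one_def)
    ultimately have "(2::enat) \<le> 1" by (rule order_trans[rotated])
    then show False by (simp add: one_enat_def numeral_eq_enat)
  qed
  then obtain L where L: "L \<in> Xs q" "L \<notin> singular_locus scale (Xs p)" by blast
  obtain v where v: "v \<noteq> 0" "L = point scale v" using closed_points[OF stratum(2)[OF *(2)] L(1)] .
  have "regular_local_ring (local_ring_at scale (Xs p) (point scale v))"
    using L *(3) v(2) by (auto simp: singular_locus_def)
  moreover have "v \<in> cone (Xs q)" using cone_mem[OF stratum(2)[OF *(2)] v(1)] L(1) v(2) by simp
  ultimately show thesis using that v(1) by blast
qed

lemma f_vanishes_on_cover:
  assumes "covers p q" shows "\<not> nonvanishing (cone (Xs q)) (f p)"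
proof -
  have *: "p \<in> A" "q \<in> A" "Xs q \<subseteq> Xs p" using assms by (auto simp: covers_def)
  have "f p v = 0" if v: "v \<in> cone (Xs q)" for v
    using f_zero[OF *(1)] zeros_of_f[OF *(1), of v] cone_mono[OF *(3)] v assms by (cases "v = 0") blast+
  then show ?thesis by (auto simp: nonvanishing_def)
qed

text \<open>The form \<open>f\<^sub>p\<close> vanishes on all covered strata; a form \<open>b\<close> that vanishes on the others but not on \<open>X\<^sub>q\<close> takes care
of them in \<open>discrete_valuation_at_regular_point\<close>.\<close>

lemma cover_valuation:
  assumes cov: "covers p q" shows "\<exists>t. divisorial_valuation scale Basis (cone (Xs p)) (cone (Xs q)) t"
proof -
  have *: "p \<in> A" "q \<in> A" "Xs q \<subset> Xs p" "\<not> (\<exists>s\<in>A. Xs q \<subset> Xs s \<and> Xs s \<subset> Xs p)" using cov by (auto simp: covers_def)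
  interpret dv: divisor scale Basis "cone (Xs p)" "cone (Xs q)" by (rule cover_divisor[OF cov])
  obtain J where J: "J \<subseteq> Pol" "\<And>h. h \<in> J \<Longrightarrow> \<exists>d. homogeneous scale d h" "cone (Xs p) = zero_locus J"
    using stratum_zero_locus[OF *(1)] by blast
  obtain \<delta> where \<delta>: "homogeneous scale \<delta> (f p)" using homogeneous_f[OF *(1)] by blast
  define Q where "Q = {s. covers p s} - {q}"
  have "\<not> Xs q \<subseteq> Xs s" if s: "s \<in> Q" for s
  proof
    have s': "s \<in> A" "s \<noteq> q" "Xs s \<subset> Xs p" using s by (auto simp: Q_def covers_def)
    assume "Xs q \<subseteq> Xs s"
    moreover have "Xs q \<noteq> Xs s" using inj_strata s' *(2) by (auto simp: inj_on_def)
    ultimately show False using *(4) s' by blast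
  qed
  then obtain b \<epsilon> where b: "homogeneous scale \<epsilon> b" "nonvanishing (cone (Xs q)) b" "\<And>s v. s \<in> Q \<Longrightarrow> v \<in> cone (Xs s) \<Longrightarrow> b v = 0"
    using separating_other_covers[OF *(1) _ *(2), of Q] unfolding Q_def by blast
  have bz: "v \<in> cone (Xs q) \<or> b v = 0" if v: "v \<in> cone (Xs p)" "f p v = 0" for v
  proof (cases "v = 0")
    case True
    then show ?thesis by (simp add: zero_in_cone)
  next
    case False
    then obtain s where "covers p s" "v \<in> cone (Xs s)" using zeros_of_f[OF *(1) v(1)] v(2) by blast
    then show ?thesis using b(3)[of s v] by (cases "s = q") (auto simp: Q_def)
  qed
  obtain v0 where v0: "v0 \<noteq> 0" "v0 \<in> cone (Xs q)" "regular_local_ring (local_ring_at scale (Xs p) (point scale v0))"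
    by (rule regular_point[OF cov])
  have "\<exists>t. discrete_valuation dv.K dv.B t"
    by (rule dv.discrete_valuation_at_regular_point[OF refl stratum(2)[OF *(1)] J(3,1) stratum(5)[OF *(2)] \<delta>
          f_vanishes_on_cover[OF cov] f_nonvanishing[OF *(1)] b(1,2) bz v0])
  then obtain t where "discrete_valuation dv.K dv.B t" ..
  then have "divisorial_valuation scale Basis (cone (Xs p)) (cone (Xs q)) t"
    by (intro divisorial_valuation.intro dv.divisor_axioms divisorial_valuation_axioms.intro)
  then show ?thesis ..
qed

text \<open>A minimal stratum has no covered strata, so by (S3) \<open>f\<^sub>p\<close> has no zero on it, and its cone is a line.\<close>

lemma minimal_stratum_valuation:
  assumes p: "p \<in> A" and min: "\<And>q. q \<in> A \<Longrightarrow> \<not> Xs q \<subset> Xs p"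
  shows "\<exists>t. divisorial_valuation scale Basis (cone (Xs p)) {0} t"
proof -
  obtain J where J: "J \<subseteq> Pol" "\<And>h. h \<in> J \<Longrightarrow> \<exists>d. homogeneous scale d h" "cone (Xs p) = zero_locus J"
    using stratum_zero_locus[OF p] by blast
  obtain d where d: "homogeneous scale d (f p)" "d \<ge> 1" using homogeneous_f[OF p] by blast
  have z: "v = 0" if "v \<in> cone (Xs p)" "f p v = 0" for v
    using zeros_of_f[OF p that(1)] that(2) min unfolding covers_def by blast
  obtain v0 where v0: "v0 \<noteq> 0" "cone (Xs p) = range (\<lambda>a. scale a v0)"
    using cone_without_zeros_is_line[OF J(3,1) stratum(5,4,6)[OF p] d z] by blast
  have "irred {0}" by (auto simp: irred_def)
  then interpret dv: divisor scale Basis "cone (Xs p)" "{0}"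
    by unfold_locales (use stratum(4)[OF p] zero_in_cone in auto)
  obtain t where "discrete_valuation dv.K dv.B t" using dv.discrete_valuation_line[OF v0(2,1) refl] by blast
  then have "divisorial_valuation scale Basis (cone (Xs p)) {0} t"
    by (intro divisorial_valuation.intro dv.divisor_axioms divisorial_valuation_axioms.intro)
  then show ?thesis ..
qed

lemma bond_pos: assumes "covers p q" shows "bond p (Some q) > 0"
proof -
  obtain t where "divisorial_valuation scale Basis (cone (Xs p)) (cone (Xs q)) t" using cover_valuation[OF assms] ..
  then interpret divisorial_valuation scale Basis "cone (Xs p)" "cone (Xs q)" t .
  have p: "p \<in> A" using assms by (simp add: covers_def)
  show ?thesis unfolding bond_def nu_def f_rat_def Xhat_simps
    by (rule val_vanishing[OF f_Pol[OF p] f_nonvanishing[OF p] f_vanishes_on_cover[OF assms]])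
qed

text \<open>Nonzero, as the least common multiple of finitely many positive numbers.\<close>

lemma bonds_N: "N > 0" "covers p q \<Longrightarrow> bond p (Some q) dvd int N"
proof -
  let ?S = "{nat (bond p (Some q)) | p q. covers p q}"
  have "?S \<subseteq> (\<lambda>(p, q). nat (bond p (Some q))) ` (A \<times> A)" by (auto simp: covers_def)
  then have fin: "finite ?S" by (rule finite_subset) (use finite_A in auto)
  have "0 \<notin> ?S" using bond_pos by fastforce
  then have "Lcm ?S \<noteq> 0" using Lcm_0_iff_nat[OF fin] by blast
  then show "N > 0" unfolding N_def by (rule iffD1[OF neq0_conv])
  assume c: "covers p q"
  then have "nat (bond p (Some q)) dvd N" unfolding N_def by (intro dvd_Lcm) auto
  then have "int (nat (bond p (Some q))) dvd int N" by (rule iffD2[OF int_dvd_int_iff])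
  then show "bond p (Some q) dvd int N" using bond_pos[OF c] by simp
qed

text \<open>An element that is comparable to every member of a maximal chain belongs to the chain. This excludes
elements strictly between neighbours and below the bottom, and shows that the chain ends with \<open>X\<close>.\<close>

lemma maximal_chain_facts:
  assumes "maximal_chain r c"
  shows "\<And>j. j \<le> r \<Longrightarrow> c j \<in> A" "\<And>j. j < r \<Longrightarrow> covers (c (Suc j)) (c j)" "\<And>q. q \<in> A \<Longrightarrow> \<not> Xs q \<subset> Xs (c 0)"
    "Xs (c r) = X" "inj_on c {..r}"
proof -
  let ?S = "c ` {..r}"
  let ?P = "\<lambda>p q. Xs p \<subset> Xs q"
  have step: "\<And>j. j < r \<Longrightarrow> Xs (c j) \<subset> Xs (c (Suc j))" and mc: "pred_on.maxchain A ?P ?S"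
    using assms by (auto simp: maximal_chain_def)
  have ch: "pred_on.chain A ?P ?S" and mx: "\<And>S. pred_on.chain A ?P S \<Longrightarrow> \<not> ?S \<subset> S"
    using mc by (auto simp: pred_on.maxchain_def)
  show cA: "c j \<in> A" if "j \<le> r" for j using ch that by (auto simp: pred_on.chain_def)
  have mono: "Xs (c i) \<subseteq> Xs (c j)" if "i \<le> j" "j \<le> r" for i j
    using that
  proof (induction j)
    case (Suc j)
    show ?case
    proof (cases "i = Suc j")
      case False
      then have "Xs (c i) \<subseteq> Xs (c j)" using Suc by simp
      also have "\<dots> \<subseteq> Xs (c (Suc j))" using step[of j] Suc.prems by (simp add: psubset_imp_subset)
      finally show ?thesis .
    qed simp
  qed simp
  have smono: "Xs (c i) \<subset> Xs (c j)" if "i < j" "j \<le> r" for i j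
    by (rule psubset_subset_trans[OF step mono]) (use that in simp_all)
  have in_chain: "p \<in> ?S" if p: "p \<in> A" "\<And>j. j \<le> r \<Longrightarrow> Xs p \<subset> Xs (c j) \<or> p = c j \<or> Xs (c j) \<subset> Xs p" for p
  proof (rule ccontr)
    assume "p \<notin> ?S"
    then have "?S \<subset> insert p ?S" by blast
    moreover have "pred_on.chain A ?P (insert p ?S)"
    proof -
      have cmp: "Xs p \<subset> Xs y \<or> p = y \<or> Xs y \<subset> Xs p" if "y \<in> ?S" for y using p(2) that by auto
      have S: "(x = y \<or> Xs x \<subset> Xs y) \<or> Xs y \<subset> Xs x" if "x \<in> ?S" "y \<in> ?S" for x y
        using pred_on.chain_total[OF ch that] cA by auto
      have comparable: "(x = y \<or> Xs x \<subset> Xs y) \<or> Xs y \<subset> Xs x" if xy: "x \<in> insert p ?S" "y \<in> insert p ?S" for x y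
      proof (cases "x = p \<or> y = p")
        case True
        then show ?thesis
        proof
          assume "x = p"
          have "Xs p \<subset> Xs y \<or> p = y \<or> Xs y \<subset> Xs p" using cmp[of y] xy(2) by (cases "y = p") simp_all
          then show ?thesis unfolding \<open>x = p\<close> by (elim disjE) simp_all
        next
          assume "y = p"
          have "Xs p \<subset> Xs x \<or> p = x \<or> Xs x \<subset> Xs p" using cmp[of x] xy(1) by (cases "x = p") simp_all
          then show ?thesis unfolding \<open>y = p\<close> by (elim disjE) simp_all
        qed
      next
        case False
        then have "x \<in> ?S" "y \<in> ?S" using xy by simp_all
        from S[OF this] show ?thesis .
      qed
      have "(?P)\<^sup>=\<^sup>= x y \<or> (?P)\<^sup>=\<^sup>= y x" if "x \<in> insert p ?S" "y \<in> insert p ?S" for x y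
        using comparable[OF that] by (elim disjE) simp_all
      moreover have "insert p ?S \<subseteq> A" using cA p(1) by auto
      ultimately show ?thesis unfolding pred_on.chain_def by (intro conjI ballI)
    qed
    ultimately show False using mx[of "insert p ?S"] by simp
  qed
  show "inj_on c {..r}"
  proof (rule inj_onI)
    fix i j assume ij: "i \<in> {..r}" "j \<in> {..r}" "c i = c j"
    show "i = j" by (rule ccontr) (use smono[of i j] smono[of j i] ij in \<open>auto simp: neq_iff\<close>)
  qed
  obtain pmax where pm: "pmax \<in> A" "Xs pmax = X" using maximal_stratum by auto
  have le: "Xs (c j) \<subset> Xs pmax \<or> pmax = c j" if "j \<le> r" for j
    using variety_strata[OF cA[OF that]] pm inj_strata cA[OF that] by (auto simp: inj_on_def)
  have "pmax \<in> ?S" by (rule in_chain[OF pm(1)]) (use le in blast)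
  then obtain j where "j \<le> r" "pmax = c j" by auto
  then show "Xs (c r) = X" using mono[of j r] pm(2) variety_strata[OF cA[of r]] by auto
  show "\<not> Xs q \<subset> Xs (c 0)" if q: "q \<in> A" for q
  proof
    assume s: "Xs q \<subset> Xs (c 0)"
    have "Xs q \<subset> Xs (c j)" if "j \<le> r" for j using s mono[of 0 j] that by auto
    then have "q \<in> ?S" using in_chain[OF q] by blast
    then obtain j where "j \<le> r" "q = c j" by auto
    then show False using s mono[of 0 j] by auto
  qed
  show "covers (c (Suc j)) (c j)" if j: "j < r" for j
    unfolding covers_def
  proof (intro conjI notI)
    show "c (Suc j) \<in> A" "c j \<in> A" "Xs (c j) \<subset> Xs (c (Suc j))" using cA j step by auto
    assume "\<exists>s\<in>A. Xs (c j) \<subset> Xs s \<and> Xs s \<subset> Xs (c (Suc j))"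
    then obtain s where s: "s \<in> A" "Xs (c j) \<subset> Xs s" "Xs s \<subset> Xs (c (Suc j))" by blast
    have cmp: "Xs (c i) \<subset> Xs s \<or> Xs s \<subset> Xs (c i)" if "i \<le> r" for i
    proof (cases "i \<le> j")
      case True
      then show ?thesis using mono[of i j] s(2) j by auto
    next
      case False
      then show ?thesis using mono[of "Suc j" i] s(3) that by auto
    qed
    then have "s \<in> ?S" using in_chain[OF s(1)] by blast
    then obtain i where "i \<le> r" "s = c i" by auto
    then show False using cmp[of i] by auto
  qed
qed

end

section \<open>The valuation of a maximal chain\<close>

context seshadri_stratification
begin

abbreviation cone_of :: "(nat \<Rightarrow> 'a) \<Rightarrow> nat \<Rightarrow> 'v set" where
  "cone_of c j \<equiv> Xhat (Some (c j))"

lemma chain_valuation: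
  assumes c: "maximal_chain r c" and j: "j \<le> r"
  shows "\<exists>t. divisorial_valuation scale Basis (cone_of c j) (Xhat (pred_elem c j)) t"
proof (cases j)
  case 0
  then show ?thesis
    using minimal_stratum_valuation[of "c 0"] maximal_chain_facts(1,3)[OF c] by (simp add: pred_elem_def Xhat_simps)
next
  case (Suc i)
  then show ?thesis
    using cover_valuation[OF maximal_chain_facts(2)[OF c, of i]] j by (simp add: pred_elem_def Xhat_simps)
qed

lemma chain_f:
  assumes c: "maximal_chain r c" and j: "j \<le> r"
  shows "f (c j) \<in> Pol" "nonvanishing (cone_of c j) (f (c j))" "\<not> nonvanishing (Xhat (pred_elem c j)) (f (c j))"
proof -
  have cA: "c j \<in> A" by (rule maximal_chain_facts(1)[OF c j])
  show "f (c j) \<in> Pol" "nonvanishing (cone_of c j) (f (c j))"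
    using f_Pol[OF cA] f_nonvanishing[OF cA] by (simp_all add: Xhat_simps)
  show "\<not> nonvanishing (Xhat (pred_elem c j)) (f (c j))"
  proof (cases j)
    case 0
    then show ?thesis using f_zero[OF cA] by (simp add: pred_elem_def Xhat_simps nonvanishing_def)
  next
    case (Suc i)
    then show ?thesis
      using f_vanishes_on_cover[OF maximal_chain_facts(2)[OF c, of i]] j by (simp add: pred_elem_def Xhat_simps)
  qed
qed

lemma pred_cone: "0 < j \<Longrightarrow> Xhat (pred_elem c j) = cone_of c (j - 1)"
  by (simp add: pred_elem_def)

text \<open>The bond at the bottom need not divide \<open>N\<close>, which runs over the coverings in \<open>A\<close> only; accordingly the tower asks for divisibility at
positive levels only.\<close>

lemma chain_tower:
  assumes c: "maximal_chain r c"
  shows "valued_field_tower (\<lambda>j. fun_field scale (cone_of c j)) (nu_chain c) (\<lambda>j. f_rat (c j))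
    (\<lambda>j. restrict_rat scale (cone_of c j) (Xhat (pred_elem c j))) N r (\<lambda>j a. ratio scale (cone_of c j) (\<lambda>_. a) (\<lambda>_. 1))"
proof -
  have nu: "nu_chain c j = divisor_val scale (cone_of c j) (Xhat (pred_elem c j))" for j
    by (simp add: nu_chain_def nu_def fun_eq_iff)
  show ?thesis
  proof (rule valued_field_tower.intro)
    fix j assume j: "j \<le> r"
    obtain t where "divisorial_valuation scale Basis (cone_of c j) (Xhat (pred_elem c j)) t" using chain_valuation[OF c j] ..
    then interpret D: divisorial_valuation scale Basis "cone_of c j" "Xhat (pred_elem c j)" t .
    note cf = chain_f[OF c j]
    have o: "(\<lambda>_. a) \<in> Pol" for a by (rule poly_fun.const)
    show "field D.K" by (rule D.field_K)
    show "nu_chain c j (x \<otimes>\<^bsub>D.K\<^esub> y) = nu_chain c j x + nu_chain c j y"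
      if "x \<in> carrier D.K" "x \<noteq> \<zero>\<^bsub>D.K\<^esub>" "y \<in> carrier D.K" "y \<noteq> \<zero>\<^bsub>D.K\<^esub>" for x y
      using D.V.ord_mult[OF that] by (simp add: nu D.val_eq)
    show "min (nu_chain c j x) (nu_chain c j y) \<le> nu_chain c j (x \<oplus>\<^bsub>D.K\<^esub> y)"
      if "x \<in> carrier D.K" "x \<noteq> \<zero>\<^bsub>D.K\<^esub>" "y \<in> carrier D.K" "y \<noteq> \<zero>\<^bsub>D.K\<^esub>" "x \<oplus>\<^bsub>D.K\<^esub> y \<noteq> \<zero>\<^bsub>D.K\<^esub>" for x y
      using D.V.ord_add[OF that] by (simp add: nu D.val_eq)
    show "f_rat (c j) \<in> carrier D.K" "f_rat (c j) \<noteq> \<zero>\<^bsub>D.K\<^esub>" "0 < nu_chain c j (f_rat (c j))"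
      unfolding f_rat_def nu using D.rat_in_K[OF cf(1) o D.nz_one] D.rat_eq_zero_iff[OF cf(1) o D.nz_one] cf(2) D.val_vanishing[OF cf] by auto
    show "ratio scale (cone_of c j) (\<lambda>_. a) (\<lambda>_. 1) \<in> carrier D.K \<and> ratio scale (cone_of c j) (\<lambda>_. a) (\<lambda>_. 1) \<noteq> \<zero>\<^bsub>D.K\<^esub> \<and>
       nu_chain c j (ratio scale (cone_of c j) (\<lambda>_. a) (\<lambda>_. 1)) = 0" if "a \<noteq> 0" for a
      using D.rat_in_K[OF o o D.nz_one, of a] D.rat_eq_zero_iff[OF o o D.nz_one, of a] D.val_const[OF that] that D.nz_one
      unfolding nu by (auto simp: nonvanishing_def)
    show "ratio scale (cone_of c j) (\<lambda>_. a) (\<lambda>_. 1) [^]\<^bsub>D.K\<^esub> n = ratio scale (cone_of c j) (\<lambda>_. a ^ n) (\<lambda>_. 1)" if "a \<noteq> 0" for a and n :: nat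
      using D.rat_pow[OF o o D.nz_one, of a n] by simp
    show "nu_chain c j (f_rat (c j)) dvd int N" if "0 < j"
    proof -
      obtain i where i: "j = Suc i" using \<open>0 < j\<close> by (cases j) auto
      have "covers (c (Suc i)) (c i)" using maximal_chain_facts(2)[OF c, of i] j i by simp
      from bonds_N(2)[OF this] show ?thesis by (simp add: i nu_chain_def bond_def pred_elem_def)
    qed
    assume j0: "0 < j"
    note pc = pred_cone[OF j0, of c, symmetric]
    show "restrict_rat scale (cone_of c j) (Xhat (pred_elem c j)) x \<in> carrier (fun_field scale (cone_of c (j - 1))) \<and>
        restrict_rat scale (cone_of c j) (Xhat (pred_elem c j)) x \<noteq> \<zero>\<^bsub>fun_field scale (cone_of c (j - 1))\<^esub>"
      if "x \<in> carrier D.K" "x \<noteq> \<zero>\<^bsub>D.K\<^esub>" "nu_chain c j x = 0" for x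
      unfolding pc using D.residue_unit[of x] that by (simp add: nu)
    show "restrict_rat scale (cone_of c j) (Xhat (pred_elem c j)) (x \<otimes>\<^bsub>D.K\<^esub> y) =
        restrict_rat scale (cone_of c j) (Xhat (pred_elem c j)) x \<otimes>\<^bsub>fun_field scale (cone_of c (j - 1))\<^esub> restrict_rat scale (cone_of c j) (Xhat (pred_elem c j)) y"
      if "x \<in> carrier D.K" "x \<noteq> \<zero>\<^bsub>D.K\<^esub>" "nu_chain c j x = 0" "y \<in> carrier D.K" "y \<noteq> \<zero>\<^bsub>D.K\<^esub>" "nu_chain c j y = 0" for x y
      unfolding pc using D.residue_mult[of x y] that by (simp add: nu)
    show "restrict_rat scale (cone_of c j) (Xhat (pred_elem c j)) (\<one>\<^bsub>D.K\<^esub> \<oplus>\<^bsub>D.K\<^esub> x) =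
        \<one>\<^bsub>fun_field scale (cone_of c (j - 1))\<^esub> \<oplus>\<^bsub>fun_field scale (cone_of c (j - 1))\<^esub> restrict_rat scale (cone_of c j) (Xhat (pred_elem c j)) x"
      if "x \<in> carrier D.K" "x \<noteq> \<zero>\<^bsub>D.K\<^esub>" "nu_chain c j x = 0" for x
      unfolding pc using D.residue_one_add[of x] that by (simp add: nu)
    show "restrict_rat scale (cone_of c j) (Xhat (pred_elem c j)) (\<one>\<^bsub>D.K\<^esub> \<oplus>\<^bsub>D.K\<^esub> x) = \<one>\<^bsub>fun_field scale (cone_of c (j - 1))\<^esub>"
      if "x \<in> carrier D.K" "x \<noteq> \<zero>\<^bsub>D.K\<^esub>" "0 < nu_chain c j x" for x
      unfolding pc using D.residue_one_add[of x] that by (simp add: nu)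
    show "restrict_rat scale (cone_of c j) (Xhat (pred_elem c j)) (ratio scale (cone_of c j) (\<lambda>_. a) (\<lambda>_. 1)) = ratio scale (cone_of c (j - 1)) (\<lambda>_. a) (\<lambda>_. 1)"
      if "a \<noteq> 0" for a
      unfolding pc by (rule D.residue_const)
  next
    show "N > 0" by (rule bonds_N(1))
  qed
qed

end

locale chain_valuation_setting = seshadri_stratification scale Basis X A Xs f
  for scale :: "'k::alg_closed_field \<Rightarrow> 'v::ab_group_add \<Rightarrow> 'v" and Basis X
    and A :: "'a set" and Xs :: "'a \<Rightarrow> 'v set set" and f :: "'a \<Rightarrow> 'v \<Rightarrow> 'k" +
  fixes r :: nat and c :: "nat \<Rightarrow> 'a"
  assumes chain: "maximal_chain r c"
begin

sublocale T: valued_field_tower "\<lambda>j. fun_field scale (cone_of c j)" "nu_chain c" "\<lambda>j. f_rat (c j)"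
  "\<lambda>j. restrict_rat scale (cone_of c j) (Xhat (pred_elem c j))" N r "\<lambda>j a. ratio scale (cone_of c j) (\<lambda>_. a) (\<lambda>_. 1)"
  by (rule chain_tower[OF chain])

abbreviation "CX \<equiv> cone X"

lemma cone_r: "cone_of c r = CX"
  using maximal_chain_facts(4)[OF chain] by (simp add: Xhat_simps)

sublocale FX: function_field scale Basis CX
  using stratum(4)[OF maximal_chain_facts(1)[OF chain order_refl]] maximal_chain_facts(4)[OF chain] by unfold_locales simp

lemma T_b: "T.b j = b_chain c j"
  by (simp add: T.b_def b_chain_def bond_def nu_chain_def)

lemma T_step: "T.step j h = g_step c j h"
  by (simp add: T.step_def g_step_def T_b Let_def)

lemma inj_c: "i \<le> r \<Longrightarrow> j \<le> r \<Longrightarrow> c i = c j \<longleftrightarrow> i = j"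
  using maximal_chain_facts(5)[OF chain] by (auto simp: inj_on_def)

text \<open>The vector of \<open>\<rat>\<^sup>\<CC>\<close> with entries \<open>w j\<close> in the coordinates \<open>e\<close> of the chain.\<close>

definition vec :: "(nat \<Rightarrow> rat) \<Rightarrow> 'a \<Rightarrow> rat" where
  "vec w x = (\<Sum>j\<le>r. w j * basis_vec (c j) x)"

lemma vec_c: "i \<le> r \<Longrightarrow> vec w (c i) = w i"
proof -
  assume i: "i \<le> r"
  have "vec w (c i) = (\<Sum>j\<le>r. if j = i then w j else 0)"
    unfolding vec_def basis_vec_def using i inj_c by (intro sum.cong) auto
  then show ?thesis using i by simp
qed

lemma vec_off: "x \<notin> c ` {..r} \<Longrightarrow> vec w x = 0"
  unfolding vec_def basis_vec_def by (intro sum.neutral) auto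

text \<open>The descent \<open>g_desc\<close> counts its steps from the top, \<open>W\<close> its level from the bottom.\<close>

lemma W_g_desc:
  assumes "k \<le> r" "i \<le> r - k"
  shows "T.W r (g_desc r c g 0) i = T.W (r - k) (g_desc r c g k) i / of_nat N ^ k"
  using assms
proof (induction k)
  case (Suc k)
  have rk: "r - k = Suc (r - Suc k)" using Suc.prems by simp
  have "T.W (r - k) (g_desc r c g k) i = T.W (r - Suc k) (g_desc r c g (Suc k)) i / of_nat N"
    using Suc.prems rk by (simp add: rk T_step)
  moreover have "T.W r (g_desc r c g 0) i = T.W (r - k) (g_desc r c g k) i / of_nat N ^ k" using Suc by simp
  ultimately show ?case by simp
qed simp

lemma W_diag: "T.W j h j = of_int (nu_chain c j h) / of_int (b_chain c j)"
  by (cases j) (simp_all add: T_b)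

lemma V_chain_eq: "V_chain r c g = vec (T.W r (g_desc r c g 0))"
proof
  fix x
  have "T.W r (g_desc r c g 0) j = of_int (nu_chain c j (g_desc r c g (r - j))) / (of_nat N ^ (r - j) * of_int (b_chain c j))"
    if j: "j \<le> r" for j
    using W_g_desc[of "r - j" j g] W_diag[of j "g_desc r c g (r - j)"] j by simp
  then show "V_chain r c g x = vec (T.W r (g_desc r c g 0)) x"
    unfolding V_chain_def vec_def by (intro sum.cong) auto
qed

lemma carrier_R:
  assumes "g \<in> carrier FX.R - {\<zero>\<^bsub>FX.R\<^esub>}"
  obtains a where "a \<in> Pol" "FX.nz a" "g = restrict a CX" "g_desc r c g 0 = FX.rat a (\<lambda>_. 1)"
proof -
  obtain a where a: "a \<in> Pol" "g = restrict a CX" using assms by (auto simp: coord_ring_simps)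
  have "FX.nz a" using assms a FX.restrict_nz[of a] by auto
  moreover have "g_desc r c g 0 = FX.rat a (\<lambda>_. 1)"
    unfolding g_desc.simps cone_r ratio_def a(2) restrict_restrict by simp
  ultimately show thesis using that a by blast
qed

text \<open>The vector \<open>T.W\<close> is defined and additive on all nonzero rational functions, so it already is the
extension of \<open>V_chain\<close> to the function field.\<close>

lemma V_difference:
  assumes g1: "g1 \<in> carrier FX.R - {\<zero>\<^bsub>FX.R\<^esub>}" and g2: "g2 \<in> carrier FX.R - {\<zero>\<^bsub>FX.R\<^esub>}"
  shows "(\<lambda>x. V_chain r c g1 x - V_chain r c g2 x) = vec (T.W r (fraction FX.R g1 g2))"
    and "fraction FX.R g1 g2 \<in> T.nonzero r"
proof -
  obtain a where a: "a \<in> Pol" "FX.nz a" "g1 = restrict a CX" "g_desc r c g1 0 = FX.rat a (\<lambda>_. 1)" using g1 by (rule carrier_R)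
  obtain b where b: "b \<in> Pol" "FX.nz b" "g2 = restrict b CX" "g_desc r c g2 0 = FX.rat b (\<lambda>_. 1)" using g2 by (rule carrier_R)
  have o: "(\<lambda>_. 1) \<in> Pol" by (rule poly_fun.const)
  have fr: "fraction FX.R g1 g2 = FX.rat a b" by (simp add: ratio_def a b)
  have nz: "x \<in> T.nonzero r \<longleftrightarrow> x \<in> carrier FX.K \<and> x \<noteq> \<zero>\<^bsub>FX.K\<^esub>" for x by (simp add: T.nonzero_def cone_r)
  show 1: "fraction FX.R g1 g2 \<in> T.nonzero r"
    unfolding nz fr using FX.rat_in_K[OF a(1) b(1,2)] FX.rat_eq_zero_iff[OF a(1) b(1,2)] a(2) by simp
  have 2: "FX.rat b (\<lambda>_. 1) \<in> T.nonzero r"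
    unfolding nz using FX.rat_in_K[OF b(1) o FX.nz_one] FX.rat_eq_zero_iff[OF b(1) o FX.nz_one] b(2) by simp
  have "FX.rat a b \<otimes>\<^bsub>FX.K\<^esub> FX.rat b (\<lambda>_. 1) = FX.rat a (\<lambda>_. 1)"
    unfolding FX.rat_mult[OF a(1) b(1) b(1) o b(2) FX.nz_one]
    by (rule FX.rat_eqI) (use a b FX.nz_one in \<open>auto intro: poly_fun_intros\<close>)
  then have "T.W r (FX.rat a (\<lambda>_. 1)) i = T.W r (FX.rat a b) i + T.W r (FX.rat b (\<lambda>_. 1)) i" for i
    using T.W_mult[OF order_refl 1 2, of i] by (simp add: fr cone_r)
  then show "(\<lambda>x. V_chain r c g1 x - V_chain r c g2 x) = vec (T.W r (fraction FX.R g1 g2))"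
    unfolding V_chain_eq a(4) b(4) fr vec_def by (simp add: algebra_simps sum.distrib fun_eq_iff)
qed

lemma V_ext_eq:
  assumes h: "h \<in> carrier FX.K" "h \<noteq> \<zero>\<^bsub>FX.K\<^esub>"
  shows "V_ext r c h = vec (T.W r h)"
  unfolding V_ext_def Let_def
proof (rule the_equality)
  obtain a b where ab: "a \<in> Pol" "b \<in> Pol" "FX.nz b" "h = FX.rat a b" using h(1) by (rule FX.K_cases)
  have na: "FX.nz a" using h(2) FX.rat_eq_zero_iff[OF ab(1,2,3)] unfolding ab(4) by simp
  have in_R: "restrict d CX \<in> carrier FX.R - {\<zero>\<^bsub>FX.R\<^esub>}" if "d \<in> Pol" "FX.nz d" for d
  proof
    show "restrict d CX \<in> carrier FX.R" unfolding coord_ring_simps(1) using that(1) by (rule imageI)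
    show "restrict d CX \<notin> {\<zero>\<^bsub>FX.R\<^esub>}" using iffD2[OF FX.restrict_nz that(2)] by simp
  qed
  note g = in_R[OF ab(1) na] in_R[OF ab(2,3)]
  have fr: "h = fraction FX.R (restrict a CX) (restrict b CX)" by (simp add: ab(4) ratio_def)
  show "\<exists>g1 g2. g1 \<in> carrier FX.R - {\<zero>\<^bsub>FX.R\<^esub>} \<and> g2 \<in> carrier FX.R - {\<zero>\<^bsub>FX.R\<^esub>} \<and> h = fraction FX.R g1 g2 \<and>
      vec (T.W r h) = (\<lambda>x. V_chain r c g1 x - V_chain r c g2 x)"
    by (rule exI, rule exI, intro conjI, rule g(1), rule g(2), rule fr)
      (simp only: V_difference(1)[OF g] fr)
  fix w assume "\<exists>g1 g2. g1 \<in> carrier FX.R - {\<zero>\<^bsub>FX.R\<^esub>} \<and> g2 \<in> carrier FX.R - {\<zero>\<^bsub>FX.R\<^esub>} \<and> h = fraction FX.R g1 g2 \<and>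
      w = (\<lambda>x. V_chain r c g1 x - V_chain r c g2 x)"
  then obtain g1 g2 where *: "g1 \<in> carrier FX.R - {\<zero>\<^bsub>FX.R\<^esub>}" "g2 \<in> carrier FX.R - {\<zero>\<^bsub>FX.R\<^esub>}" "h = fraction FX.R g1 g2"
      "w = (\<lambda>x. V_chain r c g1 x - V_chain r c g2 x)" by blast
  show "w = vec (T.W r h)" unfolding *(4) V_difference(1)[OF *(1,2)] *(3) ..
qed

lemma V_ext_fraction:
  assumes g1: "g1 \<in> carrier FX.R - {\<zero>\<^bsub>FX.R\<^esub>}" and g2: "g2 \<in> carrier FX.R - {\<zero>\<^bsub>FX.R\<^esub>}"
  shows "V_ext r c (fraction FX.R g1 g2) = (\<lambda>x. V_chain r c g1 x - V_chain r c g2 x)"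
proof -
  have "fraction FX.R g1 g2 \<in> carrier FX.K" "fraction FX.R g1 g2 \<noteq> \<zero>\<^bsub>FX.K\<^esub>"
    using V_difference(2)[OF assms] unfolding T.nonzero_def cone_r by simp_all
  from V_ext_eq[OF this] show ?thesis unfolding V_difference(1)[OF assms] .
qed

lemma V_ext_integral:
  assumes g: "g \<in> carrier FX.R - {\<zero>\<^bsub>FX.R\<^esub>}"
  shows "V_ext r c (fraction FX.R g \<one>\<^bsub>FX.R\<^esub>) = V_chain r c g"
proof -
  have one: "\<one>\<^bsub>FX.R\<^esub> = restrict (\<lambda>_. 1) CX" by (simp add: coord_ring_simps)
  have 1: "\<one>\<^bsub>FX.R\<^esub> \<in> carrier FX.R - {\<zero>\<^bsub>FX.R\<^esub>}"
  proof
    show "\<one>\<^bsub>FX.R\<^esub> \<in> carrier FX.R" unfolding one coord_ring_simps(1) by (rule imageI) (rule poly_fun.const)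
    show "\<one>\<^bsub>FX.R\<^esub> \<notin> {\<zero>\<^bsub>FX.R\<^esub>}" unfolding one using iffD2[OF FX.restrict_nz FX.nz_one] by simp
  qed
  then obtain a where a: "a \<in> Pol" "FX.nz a" "\<one>\<^bsub>FX.R\<^esub> = restrict a CX" "g_desc r c \<one>\<^bsub>FX.R\<^esub> 0 = FX.rat a (\<lambda>_. 1)" by (rule carrier_R)
  have "FX.rat a (\<lambda>_. 1) = \<one>\<^bsub>FX.K\<^esub>"
    unfolding ratio_def a(3)[symmetric] FX.K_one one ..
  then have "V_chain r c \<one>\<^bsub>FX.R\<^esub> x = 0" for x
    unfolding V_chain_eq a(4) vec_def using T.W_one[OF order_refl] by (simp add: cone_r)
  then show ?thesis using V_ext_fraction[OF g 1] by simp
qed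

lemma lex_le_iff: "lex_le r c l m \<longleftrightarrow> T.lexpos r (\<lambda>j. m (c j) - l (c j))"
  unfolding lex_le_def T.lexpos_def by (intro arg_cong2[of _ _ _ _ "(\<or>)"]) (auto simp: algebra_simps)

lemma lexpos_add: "T.lexpos j w \<Longrightarrow> T.lexpos j w' \<Longrightarrow> T.lexpos j (\<lambda>i. w i + w' i)"
proof (induction j)
  case 0
  then show ?case by (auto simp: T.lexpos_def)
next
  case (Suc j)
  then show ?case unfolding T.lexpos_Suc by auto
qed

lemma lexpos_total: "T.lexpos j w \<or> T.lexpos j (\<lambda>i. - w i)"
proof (induction j)
  case 0
  then show ?case by (auto simp: T.lexpos_def)
next
  case (Suc j)
  then show ?case unfolding T.lexpos_Suc by auto
qed

lemma lexpos_antisym: "T.lexpos j w \<Longrightarrow> T.lexpos j (\<lambda>i. - w i) \<Longrightarrow> i \<le> j \<Longrightarrow> w i = 0"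
proof (induction j)
  case 0
  then show ?case by (auto simp: T.lexpos_def)
next
  case (Suc j)
  then show ?case unfolding T.lexpos_Suc by (cases "i = Suc j") auto
qed

lemma lex_total: "lex_le r c l m \<or> lex_le r c m l"
  unfolding lex_le_iff using lexpos_total[of r "\<lambda>j. m (c j) - l (c j)"] by simp

lemma group_L: "comm_group (L_lattice r c)"
proof (rule comm_groupI)
  let ?L = "L_lattice r c"
  fix x y assume x: "x \<in> carrier ?L" and y: "y \<in> carrier ?L"
  then show "x \<otimes>\<^bsub>?L\<^esub> y \<in> carrier ?L"
    by (auto simp: L_lattice_def distrib_left)
  show "x \<otimes>\<^bsub>?L\<^esub> y = y \<otimes>\<^bsub>?L\<^esub> x" by (simp add: L_lattice_def add.commute)
next
  let ?L = "L_lattice r c"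
  show "\<one>\<^bsub>?L\<^esub> \<in> carrier ?L" by (simp add: L_lattice_def)
  fix x assume x: "x \<in> carrier ?L"
  have "(\<lambda>i. - x i) \<in> carrier ?L" using x by (auto simp: L_lattice_def)
  then show "\<exists>y\<in>carrier ?L. y \<otimes>\<^bsub>?L\<^esub> x = \<one>\<^bsub>?L\<^esub>"
    by (rule bexI[rotated]) (simp add: L_lattice_def)
qed (auto simp: L_lattice_def add.assoc)

lemma ordered_L: "totally_ordered_group (L_lattice r c) (lex_le r c)"
  unfolding totally_ordered_group_def
proof (intro conjI ballI impI group_L)
  let ?L = "L_lattice r c"
  let ?r = "{(a, b). a \<in> carrier ?L \<and> b \<in> carrier ?L \<and> lex_le r c a b}"
  have refl: "lex_le r c a a" for a by (simp add: lex_le_def)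
  have trans: "lex_le r c a d" if "lex_le r c a b" "lex_le r c b d" for a b d
    using lexpos_add[OF that[unfolded lex_le_iff]] unfolding lex_le_iff by simp
  have antisym: "a = b" if ab: "a \<in> carrier ?L" "b \<in> carrier ?L" "lex_le r c a b" "lex_le r c b a" for a b
  proof
    fix x
    show "a x = b x"
    proof (cases "x \<in> c ` {..r}")
      case True
      then obtain i where "i \<le> r" "x = c i" by auto
      moreover have "b (c i) - a (c i) = 0" if "i \<le> r" for i
        using lexpos_antisym[of r "\<lambda>j. b (c j) - a (c j)" i] ab(3,4) that unfolding lex_le_iff by simp
      ultimately show ?thesis by simp
    next
      case False
      then show ?thesis using ab(1,2) by (auto simp: L_lattice_def)
    qed
  qed
  have "refl_on (carrier ?L) ?r" by (auto simp: refl_on_def refl)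
  moreover have "trans ?r" by (rule transI) (auto intro: trans)
  moreover have "antisym ?r" by (rule antisymI) (auto intro: antisym)
  moreover have "total_on (carrier ?L) ?r" using lex_total by (auto simp: total_on_def)
  moreover have "?r \<subseteq> carrier ?L \<times> carrier ?L" by auto
  ultimately show "linear_order_on (carrier ?L) ?r"
    by (simp add: linear_order_on_def partial_order_on_def preorder_on_def)
  fix a b d assume "lex_le r c a b"
  then show "lex_le r c (a \<otimes>\<^bsub>?L\<^esub> d) (b \<otimes>\<^bsub>?L\<^esub> d)"
    unfolding lex_le_iff by (simp add: L_lattice_def)
qed

text \<open>For the sum, let \<open>x\<close> be the summand with the smaller value and write \<open>x + y = x (1 + y/x)\<close>; then \<open>y/x\<close> has
nonnegative value and \<open>one_add_nonneg\<close> applies.\<close>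

lemma valuation_V: "valuation FX.K (L_lattice r c) (lex_le r c) (V_ext r c)"
proof -
  have nz: "x \<in> T.nonzero r \<longleftrightarrow> x \<in> carrier FX.K - {\<zero>\<^bsub>FX.K\<^esub>}" for x by (simp add: T.nonzero_def cone_r)
  have V: "V_ext r c x = vec (T.W r x)" if "x \<in> carrier FX.K - {\<zero>\<^bsub>FX.K\<^esub>}" for x using V_ext_eq that by blast
  have W_mult: "T.W r (x \<otimes>\<^bsub>FX.K\<^esub> y) i = T.W r x i + T.W r y i"
    if "x \<in> carrier FX.K - {\<zero>\<^bsub>FX.K\<^esub>}" "y \<in> carrier FX.K - {\<zero>\<^bsub>FX.K\<^esub>}" for x y i
    using T.W_mult[OF order_refl, of x y i] that unfolding nz[symmetric] by (simp add: cone_r)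
  have leV: "lex_le r c (V_ext r c x) (V_ext r c y) \<longleftrightarrow> T.lexpos r (\<lambda>j. T.W r y j - T.W r x j)"
    if "x \<in> carrier FX.K - {\<zero>\<^bsub>FX.K\<^esub>}" "y \<in> carrier FX.K - {\<zero>\<^bsub>FX.K\<^esub>}" for x y
  proof -
    have "T.lexpos r (\<lambda>j. vec (T.W r y) (c j) - vec (T.W r x) (c j)) \<longleftrightarrow> T.lexpos r (\<lambda>j. T.W r y j - T.W r x j)"
      by (rule T.lexpos_scale[of 1]) (auto simp: vec_c)
    then show ?thesis unfolding lex_le_iff V[OF that(1)] V[OF that(2)] .
  qed
  have main: "lex_le r c (V_ext r c x) (V_ext r c (x \<oplus>\<^bsub>FX.K\<^esub> y))"
    if x: "x \<in> carrier FX.K - {\<zero>\<^bsub>FX.K\<^esub>}" and y: "y \<in> carrier FX.K - {\<zero>\<^bsub>FX.K\<^esub>}" and xy: "x \<oplus>\<^bsub>FX.K\<^esub> y \<noteq> \<zero>\<^bsub>FX.K\<^esub>"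
      and le: "lex_le r c (V_ext r c x) (V_ext r c y)" for x y
  proof -
    have xc: "x \<in> carrier FX.K" "x \<noteq> \<zero>\<^bsub>FX.K\<^esub>" "y \<in> carrier FX.K" "y \<noteq> \<zero>\<^bsub>FX.K\<^esub>" using x y by auto
    note ix = FX.K.inv_nonzero[OF xc(1,2)]
    define h where "h = inv\<^bsub>FX.K\<^esub> x \<otimes>\<^bsub>FX.K\<^esub> y"
    have hc: "h \<in> carrier FX.K" "h \<noteq> \<zero>\<^bsub>FX.K\<^esub>" using ix xc FX.K.integral_iff by (auto simp: h_def)
    have xh: "x \<otimes>\<^bsub>FX.K\<^esub> h = y" unfolding h_def using ix xc by (simp add: FX.K.m_assoc[symmetric])
    have x1h: "x \<otimes>\<^bsub>FX.K\<^esub> (\<one>\<^bsub>FX.K\<^esub> \<oplus>\<^bsub>FX.K\<^esub> h) = x \<oplus>\<^bsub>FX.K\<^esub> y" using xc hc xh by (simp add: FX.K.r_distr)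
    have h1: "\<one>\<^bsub>FX.K\<^esub> \<oplus>\<^bsub>FX.K\<^esub> h \<in> carrier FX.K - {\<zero>\<^bsub>FX.K\<^esub>}" using hc xy x1h xc by auto
    have "T.W r y j - T.W r x j = T.W r h j" for j using W_mult[OF x, of h j] hc xh by simp
    then have "T.lexpos r (T.W r h)" using le leV[OF x y] by simp
    then have "T.lexpos r (T.W r (\<one>\<^bsub>FX.K\<^esub> \<oplus>\<^bsub>FX.K\<^esub> h))"
      using T.one_add_nonneg[OF order_refl, of h] hc h1 unfolding nz by (simp add: cone_r)
    moreover have "T.W r (x \<oplus>\<^bsub>FX.K\<^esub> y) j - T.W r x j = T.W r (\<one>\<^bsub>FX.K\<^esub> \<oplus>\<^bsub>FX.K\<^esub> h) j" for j
      using W_mult[OF x h1, of j] x1h by simp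
    ultimately show ?thesis using leV[OF x, of "x \<oplus>\<^bsub>FX.K\<^esub> y"] xc xy by simp
  qed
  show ?thesis
    unfolding valuation_def
  proof (intro conjI ballI allI impI ordered_L)
    fix x assume x: "x \<in> carrier FX.K - {\<zero>\<^bsub>FX.K\<^esub>}"
    have "(\<Prod>i=j..r. of_int (b_chain c i)) * vec (T.W r x) (c j) \<in> \<int>" if "j \<le> r" for j
      using T.W_lattice[OF order_refl, of x j] x that unfolding nz by (simp add: vec_c T_b)
    then show "V_ext r c x \<in> carrier (L_lattice r c)"
      unfolding V[OF x] by (auto simp: L_lattice_def vec_off)
    fix y assume y: "y \<in> carrier FX.K - {\<zero>\<^bsub>FX.K\<^esub>}"
    show "lex_le r c (if lex_le r c (V_ext r c x) (V_ext r c y) then V_ext r c x else V_ext r c y) (V_ext r c (x \<oplus>\<^bsub>FX.K\<^esub> y))"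
      if xy: "x \<oplus>\<^bsub>FX.K\<^esub> y \<noteq> \<zero>\<^bsub>FX.K\<^esub>"
    proof (cases "lex_le r c (V_ext r c x) (V_ext r c y)")
      case True
      then show ?thesis using main[OF x y xy] by simp
    next
      case False
      then have "lex_le r c (V_ext r c y) (V_ext r c x)" using lex_total by blast
      moreover have "y \<oplus>\<^bsub>FX.K\<^esub> x = x \<oplus>\<^bsub>FX.K\<^esub> y" using x y FX.K.a_comm by auto
      ultimately show ?thesis using main[OF y x] xy False by simp
    qed
    show "V_ext r c (x \<otimes>\<^bsub>FX.K\<^esub> y) = V_ext r c x \<otimes>\<^bsub>L_lattice r c\<^esub> V_ext r c y"
    proof -
      have "x \<otimes>\<^bsub>FX.K\<^esub> y \<in> carrier FX.K - {\<zero>\<^bsub>FX.K\<^esub>}" using x y FX.K.integral_iff by auto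
      then show ?thesis unfolding V[OF x] V[OF y]
        by (simp add: V L_lattice_def vec_def W_mult[OF x y] fun_eq_iff algebra_simps sum.distrib)
    qed
  next
    fix t :: 'k and x assume t: "t \<noteq> 0" and x: "x \<in> carrier FX.K - {\<zero>\<^bsub>FX.K\<^esub>}"
    let ?t = "FX.rat (\<lambda>_. t) (\<lambda>_. 1)"
    have o: "(\<lambda>_. a) \<in> Pol" for a by (rule poly_fun.const)
    have tK: "?t \<in> carrier FX.K - {\<zero>\<^bsub>FX.K\<^esub>}" using T.const[OF order_refl t] by (simp add: cone_r)
    obtain a b where ab: "a \<in> Pol" "b \<in> Pol" "FX.nz b" "x = FX.rat a b" using x FX.K_cases by (metis DiffD1)
    have "t \<odot>\<^bsub>FX.K\<^esub> x = ?t \<otimes>\<^bsub>FX.K\<^esub> x"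
      unfolding ab(4) FX.rat_smult[OF ab(1-3)] FX.rat_mult[OF o o ab(1,2) FX.nz_one ab(3)] by simp
    moreover have "?t \<otimes>\<^bsub>FX.K\<^esub> x \<in> carrier FX.K - {\<zero>\<^bsub>FX.K\<^esub>}" using x tK FX.K.integral_iff by auto
    moreover have "T.W r ?t i = 0" for i using T.W_const[OF order_refl t, of i] by (simp add: cone_r)
    ultimately show "V_ext r c (t \<odot>\<^bsub>FX.K\<^esub> x) = V_ext r c x"
      using W_mult[OF tK x] V[OF x] V[of "?t \<otimes>\<^bsub>FX.K\<^esub> x"] by (simp add: fun_eq_iff vec_def)
  qed
qed

end

theorem proposition6p10:
  fixes scale :: "'k::alg_closed_field \<Rightarrow> 'v::ab_group_add \<Rightarrow> 'v"
    and Basis :: "'v set"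
    and X :: "'v set set"
    and A :: "'a set"
    and Xs :: "'a \<Rightarrow> 'v set set"
    and f :: "'a \<Rightarrow> 'v \<Rightarrow> 'k"
    and r :: nat
    and c :: "nat \<Rightarrow> 'a"
  assumes "seshadri_stratification scale Basis X A Xs f"
    and "seshadri_stratification.maximal_chain A Xs r c"
  shows "(\<forall>g1 \<in> carrier (coord_ring scale (cone X)) - {\<zero>\<^bsub>coord_ring scale (cone X)\<^esub>}.
          \<forall>g2 \<in> carrier (coord_ring scale (cone X)) - {\<zero>\<^bsub>coord_ring scale (cone X)\<^esub>}.
            seshadri_stratification.V_ext scale X A Xs f r c (fraction (coord_ring scale (cone X)) g1 g2) =
            (\<lambda>x. seshadri_stratification.V_chain scale A Xs f r c g1 x
                 - seshadri_stratification.V_chain scale A Xs f r c g2 x))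
       \<and> (\<forall>g \<in> carrier (coord_ring scale (cone X)) - {\<zero>\<^bsub>coord_ring scale (cone X)\<^esub>}.
            seshadri_stratification.V_ext scale X A Xs f r c
              (fraction (coord_ring scale (cone X)) g \<one>\<^bsub>coord_ring scale (cone X)\<^esub>) =
            seshadri_stratification.V_chain scale A Xs f r c g)
       \<and> valuation (fun_field scale (cone X))
            (seshadri_stratification.L_lattice scale Xs f r c)
            (seshadri_stratification.lex_le r c)
            (seshadri_stratification.V_ext scale X A Xs f r c)"
proof -
  interpret S: seshadri_stratification scale Basis X A Xs f by (rule assms(1))
  interpret chain_valuation_setting scale Basis X A Xs f r c by unfold_locales (rule assms(2))
  show ?thesis using V_ext_fraction V_ext_integral valuation_V by blast
qed

end
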